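(* Let $d\ge1$, $s\in\mathbb{R}$ with $s\ge0$, $\mathbb{F}\in\{\mathbb{R},\mathbb{C}\}$, and let $\Gamma=\prod_{i=1}^d\Gamma_i$ with each $\Gamma_i=\mathbb{R}$ or $\Gamma_i=L_i\mathbb{T}$, $L_i>0$. Let $R_\Gamma=\{i\in\{1,\dots,d\}:\Gamma_i=\mathbb{R}\}$. Then the following hold. 1. If $R_\Gamma=\varnothing$ or $R_\Gamma=\{1\}$, then $X^s(\Gamma;\mathbb{F})=H^s(\Gamma;\mathbb{F})$ and $\|\cdot\|_{X^s}$ and $\|\cdot\|_{H^s}$ are equivalent norms. In particular, if $s>d/2$, then $X^s(\Gamma;\mathbb{F})$ is an algebra. 2. If $1\in R_\Gamma$ and $|R_\Gamma|\ge2$, then $X^s(\Gamma;\mathbb{F})$ is not closed under rotations in the following sense: for any orthogonal matrix $Q\in O(|R_\Gamma|)$ such that $|Qe_1\cdot e_1|<1$, there exists a function $f\in X^s(\Gamma;\mathbb{F})\setminus L^2(\Gamma;\mathbb{F})$ such that $f\circ\tilde Q\notin X^s(\Gamma;\mathbb{F})$, where $\tilde Q:\Gamma\to\Gamma$ is the map acting by $Q$ on the real coordinates and leaving the toroidal coordinates fixed. In particular, $H^s(\Gamma;\mathbb{F})\subsetneq X^s(\Gamma;\mathbb{F})$. 3. If $1\notin R_\Gamma$ and $R_\Gamma\ne\varnothing$, then $H^s(\Gamma;\mathbb{F})\subsetneq X^s(\Gamma;\mathbb{F})$. Furthermore, for all $f\in X^s(\Gamma;\mathbb{F})$ we have $$\|f\|_{X^s}^2\asymp\int_{\hat\Gamma}|\xi|^2\langle\xi\rangle^{2(s-1)}|\hat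 f(\xi)|^2\,d\xi,$$ with implicit constants independent of $f$.
   Context: $L\mathbb{T}=\mathbb{R}/L\mathbb{Z}$. The dual group is $\hat\Gamma=\prod_{i=1}^d\hat\Gamma_i\subseteq\mathbb{R}^d$, $\hat\Gamma_i=\mathbb{R}$ if $\Gamma_i=\mathbb{R}$, $\hat\Gamma_i=L_i^{-1}\mathbb{Z}$ if $\Gamma_i=L_i\mathbb{T}$, with the product of Lebesgue and counting measures. $\hat f$ is the unitary Fourier transform, $\hat f(\xi)=(\prod_{i\notin R_\Gamma}L_i)^{-1/2}\int_\Gamma f(x)e^{-2\pi i\xi\cdot x}dx$ on Schwartz functions, extended to tempered distributions $\mathscr{S}'(\Gamma;\mathbb{C})$ (dual of the Schwartz class of smooth functions on $\Gamma$ with all derivatives rapidly decaying in the $\mathbb{R}$-variables). $\langle\xi\rangle=(1+|\xi|^2)^{1/2}$; $\mu(\xi)=\frac{|\xi_1|}{|\xi|}+|\xi|$ for $\xi\ne0$, $\mu(0)=1$. $X^s(\Gamma;\mathbb{C})=\{f\in\mathscr{S}'(\Gamma;\mathbb{C}):\hat f\in L^1_{\mathrm{loc}}(\hat\Gamma;\mathbb{C}),\ \|\mu\langle\cdot\rangle^{s-1}\hat f\|_{L^2}<\infty\}$, $X^s(\Gamma;\mathbb{R})$ is the subset with $f=\overline f$, and $\|f\|_{X^s}=\|\mu\langle\cdot\rangle^{s-1}\hat f\|_{L^2(\hat\Gamma)}$. $H^s(\Gamma;\mathbb{F})$ is the usual $L^2$-based Sobolev space. If $R_\Gamma=\{\mathfrak{r}_1<\dots<\mathfrak{r}_k\}$,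 "acting by $Q$ on the real coordinates" means $(x_{\mathfrak{r}_1},\dots,x_{\mathfrak{r}_k})\mapsto Q(x_{\mathfrak{r}_1},\dots,x_{\mathfrak{r}_k})$; $e_1$ in item 2 is the first standard basis vector of $\mathbb{R}^{|R_\Gamma|}$. "Algebra" means closed under pointwise products with $\|fg\|_{X^s}\lesssim\|f\|_{X^s}\|g\|_{X^s}$. *)

theory Defs
  imports "HOL-Analysis.Analysis"
begin

section \<open>The group and its dual\<close>

text \<open>
  The group is the product of the factors \<open>\<Gamma> i\<close>, where \<open>i\<close> runs through a finite linearly ordered
  index type (the role of \<open>{1..d}\<close>).  Functions on the group are functions on \<open>real ^ 'n\<close> that are
  periodic in the toroidal coordinates, and they are integrated over a fundamental domain.
\<close>

datatype factor = Line | Torus real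

definition real_coords :: "('n \<Rightarrow> factor) \<Rightarrow> 'n set" where
  "real_coords \<Gamma> = {i. \<Gamma> i = Line}"

definition first_index :: "'n::{finite,linorder}" where
  "first_index = Min UNIV"

definition periodic_on :: "('n::finite \<Rightarrow> factor) \<Rightarrow> (real ^ 'n \<Rightarrow> 'b) \<Rightarrow> bool" where
  "periodic_on \<Gamma> f \<longleftrightarrow> (\<forall>i L x. \<Gamma> i = Torus L \<longrightarrow> f (x + axis i L) = f x)"

definition group_measure :: "('n::finite \<Rightarrow> factor) \<Rightarrow> (real ^ 'n) measure" where
  "group_measure \<Gamma> =
     restrict_space lborel {x. \<forall>i L. \<Gamma> i = Torus L \<longrightarrow> 0 \<le> x $ i \<and> x $ i < L}"

text \<open>
  The product of Lebesgue measures (real coordinates) and counting measures on \<open>\<int> / L\<close> (toroidal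
  coordinates), regarded as a Borel measure on \<open>real ^ 'n\<close> that is concentrated on the dual group.
  Functions on the dual group are represented by functions on \<open>real ^ 'n\<close>; their values off the
  dual group never matter.
\<close>

definition dual_measure :: "('n::finite \<Rightarrow> factor) \<Rightarrow> (real ^ 'n) measure" where
  "dual_measure \<Gamma> =
     distr (\<Pi>\<^sub>M i\<in>UNIV. case \<Gamma> i of Line \<Rightarrow> lborel
                              | Torus L \<Rightarrow> count_space (range (\<lambda>m::int. of_int m / L)))
       borel vec_lambda"

definition real_part_norm :: "('n::finite \<Rightarrow> factor) \<Rightarrow> real ^ 'n \<Rightarrow> real" where
  "real_part_norm \<Gamma> x = norm (\<chi> i. if \<Gamma> i = Line then x $ i else 0)"

section \<open>Schwartz functions and tempered distributions\<close>

definition partial_deriv :: "'n::finite \<Rightarrow> (real ^ 'n \<Rightarrow> complex) \<Rightarrow> real ^ 'n \<Rightarrow> complex" where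
  "partial_deriv i f x = frechet_derivative f (at x) (axis i 1)"

fun iter_partial :: "'n::finite list \<Rightarrow> (real ^ 'n \<Rightarrow> complex) \<Rightarrow> real ^ 'n \<Rightarrow> complex" where
  "iter_partial [] f = f"
| "iter_partial (i # js) f = partial_deriv i (iter_partial js f)"

definition smooth_fun :: "(real ^ 'n::finite \<Rightarrow> complex) \<Rightarrow> bool" where
  "smooth_fun f \<longleftrightarrow> (\<forall>js x. iter_partial js f differentiable (at x))"

definition schwartz :: "('n::finite \<Rightarrow> factor) \<Rightarrow> (real ^ 'n \<Rightarrow> complex) set" where
  "schwartz \<Gamma> =
     {\<phi>. smooth_fun \<phi> \<and> periodic_on \<Gamma> \<phi> \<and>
        (\<forall>N js. bdd_above (range (\<lambda>x. (1 + real_part_norm \<Gamma> x) ^ N * cmod (iter_partial js \<phi> x))))}"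

definition schwartz_seminorm :: "('n::finite \<Rightarrow> factor) \<Rightarrow> nat \<Rightarrow> (real ^ 'n \<Rightarrow> complex) \<Rightarrow> real" where
  "schwartz_seminorm \<Gamma> N \<phi> =
     (SUP (js, x) \<in> {js. length js \<le> N} \<times> UNIV.
        (1 + real_part_norm \<Gamma> x) ^ N * cmod (iter_partial js \<phi> x))"

type_synonym 'n distribution = "(real ^ 'n \<Rightarrow> complex) \<Rightarrow> complex"

text \<open>
  The seminorms increase with \<open>N\<close> and generate the topology of the Schwartz class, so a linear
  functional is continuous iff it is bounded by a multiple of one of them.
\<close>

definition tempered_distributions :: "('n::finite \<Rightarrow> factor) \<Rightarrow> 'n distribution set" where
  "tempered_distributions \<Gamma> =
     {T. T \<in> extensional (schwartz \<Gamma>) \<and>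
        (\<forall>\<phi>\<in>schwartz \<Gamma>. \<forall>\<psi>\<in>schwartz \<Gamma>. T (\<lambda>x. \<phi> x + \<psi> x) = T \<phi> + T \<psi>) \<and>
        (\<forall>c. \<forall>\<phi>\<in>schwartz \<Gamma>. T (\<lambda>x. c * \<phi> x) = c * T \<phi>) \<and>
        (\<exists>N C. \<forall>\<phi>\<in>schwartz \<Gamma>. cmod (T \<phi>) \<le> C * schwartz_seminorm \<Gamma> N \<phi>)}"

definition conj_dist :: "('n::finite \<Rightarrow> factor) \<Rightarrow> 'n distribution \<Rightarrow> 'n distribution" where
  "conj_dist \<Gamma> T = (\<lambda>\<phi>\<in>schwartz \<Gamma>. cnj (T (\<lambda>x. cnj (\<phi> x))))"

text \<open>
  The scalar field is a set \<open>F\<close> of complex numbers, either \<open>\<real>\<close> or \<open>UNIV\<close>.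
  For \<open>F = \<real>\<close> a space of distributions is cut down to those that equal their conjugate.
\<close>

definition dist_over :: "complex set \<Rightarrow> ('n::finite \<Rightarrow> factor) \<Rightarrow> 'n distribution set" where
  "dist_over F \<Gamma> = {T \<in> tempered_distributions \<Gamma>. F = \<real> \<longrightarrow> conj_dist \<Gamma> T = T}"

text \<open>
  Functions on the group of at most polynomial growth in an integrated sense; integration against
  such a function is a tempered distribution.
\<close>

definition tempered_functions :: "complex set \<Rightarrow> ('n::finite \<Rightarrow> factor) \<Rightarrow> (real ^ 'n \<Rightarrow> complex) set" where
  "tempered_functions F \<Gamma> =
     {u. range u \<subseteq> F \<and> u \<in> borel_measurable borel \<and> periodic_on \<Gamma> u \<and>
        (\<exists>N::nat. integrable (group_measure \<Gamma>) (\<lambda>x. cmod (u x) / (1 + real_part_norm \<Gamma> x) ^ N))}"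

definition dist_of :: "('n::finite \<Rightarrow> factor) \<Rightarrow> (real ^ 'n \<Rightarrow> complex) \<Rightarrow> 'n distribution" where
  "dist_of \<Gamma> u = (\<lambda>\<phi>\<in>schwartz \<Gamma>. LINT x|group_measure \<Gamma>. u x * \<phi> x)"

definition L2_space :: "complex set \<Rightarrow> ('n::finite \<Rightarrow> factor) \<Rightarrow> 'n distribution set" where
  "L2_space F \<Gamma> =
     dist_of \<Gamma> ` {u. range u \<subseteq> F \<and> u \<in> borel_measurable borel \<and> periodic_on \<Gamma> u \<and>
                     integrable (group_measure \<Gamma>) (\<lambda>x. (cmod (u x))\<^sup>2)}"

section \<open>Fourier transform\<close>

text \<open>
  The unitary transform of a Schwartz function is
  \<open>(\<Prod>L\<^sub>i) powr (-1/2) * \<integral> f x * exp (- 2 \<pi> \<i> \<xi> \<bullet> x) dx\<close>.  Its transpose, which takes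
  functions on the dual group to functions on the group, has the same kernel; the transform of a
  tempered distribution \<open>T\<close> is the functional \<open>\<psi> \<mapsto> T (fourier_transpose \<Gamma> \<psi>)\<close>.
\<close>

definition torus_volume :: "('n::finite \<Rightarrow> factor) \<Rightarrow> real" where
  "torus_volume \<Gamma> = (\<Prod>i\<in>UNIV. case \<Gamma> i of Line \<Rightarrow> 1 | Torus L \<Rightarrow> L)"

definition fourier_transpose ::
    "('n::finite \<Rightarrow> factor) \<Rightarrow> (real ^ 'n \<Rightarrow> complex) \<Rightarrow> real ^ 'n \<Rightarrow> complex" where
  "fourier_transpose \<Gamma> \<psi> x =
     of_real (torus_volume \<Gamma> powr (- 1 / 2)) *
     (LINT \<xi>|dual_measure \<Gamma>. \<psi> \<xi> * exp (- 2 * of_real pi * \<i> * of_real (\<xi> \<bullet> x)))"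

definition fourier_dist :: "('n::finite \<Rightarrow> factor) \<Rightarrow> 'n distribution \<Rightarrow> 'n distribution" where
  "fourier_dist \<Gamma> T \<psi> = T (fourier_transpose \<Gamma> \<psi>)"

text \<open>
  The dual group is a closed submanifold of \<open>real ^ 'n\<close>, so its smooth compactly supported functions
  are exactly the restrictions of smooth compactly supported functions on \<open>real ^ 'n\<close>.
\<close>

definition dual_test_functions :: "(real ^ 'n::finite \<Rightarrow> complex) set" where
  "dual_test_functions = {\<psi>. smooth_fun \<psi> \<and> bounded {\<xi>. \<psi> \<xi> \<noteq> 0}}"

definition L1_loc_dual :: "('n::finite \<Rightarrow> factor) \<Rightarrow> (real ^ 'n \<Rightarrow> complex) set" where
  "L1_loc_dual \<Gamma> =
     {g \<in> borel_measurable borel. \<forall>K. compact K \<longrightarrow> set_integrable (dual_measure \<Gamma>) K g}"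

text \<open>
  \<open>g\<close> is a locally integrable function representing the Fourier transform of \<open>T\<close>; it is unique
  up to null sets.
\<close>

definition is_fourier :: "('n::finite \<Rightarrow> factor) \<Rightarrow> 'n distribution \<Rightarrow> (real ^ 'n \<Rightarrow> complex) \<Rightarrow> bool" where
  "is_fourier \<Gamma> T g \<longleftrightarrow>
     g \<in> L1_loc_dual \<Gamma> \<and>
     (\<forall>\<psi>\<in>dual_test_functions. fourier_dist \<Gamma> T \<psi> = (LINT \<xi>|dual_measure \<Gamma>. g \<xi> * \<psi> \<xi>))"

definition fourier_fun :: "('n::finite \<Rightarrow> factor) \<Rightarrow> 'n distribution \<Rightarrow> real ^ 'n \<Rightarrow> complex" where
  "fourier_fun \<Gamma> T = (SOME g. is_fourier \<Gamma> T g)"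

section \<open>The spaces\<close>

definition bracket :: "real ^ 'n::finite \<Rightarrow> real" where
  "bracket \<xi> = (1 + (norm \<xi>)\<^sup>2) powr (1 / 2)"

definition mu :: "real ^ 'n::{finite,linorder} \<Rightarrow> real" where
  "mu \<xi> = (if \<xi> = 0 then 1 else \<bar>\<xi> $ first_index\<bar> / norm \<xi> + norm \<xi>)"

definition weighted_space ::
    "(real ^ 'n::finite \<Rightarrow> real) \<Rightarrow> complex set \<Rightarrow> ('n \<Rightarrow> factor) \<Rightarrow> 'n distribution set" where
  "weighted_space w F \<Gamma> =
     {f \<in> dist_over F \<Gamma>. (\<exists>g. is_fourier \<Gamma> f g) \<and>
        integrable (dual_measure \<Gamma>) (\<lambda>\<xi>. (w \<xi> * cmod (fourier_fun \<Gamma> f \<xi>))\<^sup>2)}"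

definition weighted_norm ::
    "(real ^ 'n::finite \<Rightarrow> real) \<Rightarrow> ('n \<Rightarrow> factor) \<Rightarrow> 'n distribution \<Rightarrow> real" where
  "weighted_norm w \<Gamma> f =
     sqrt (LINT \<xi>|dual_measure \<Gamma>. (w \<xi> * cmod (fourier_fun \<Gamma> f \<xi>))\<^sup>2)"

definition X_space :: "real \<Rightarrow> complex set \<Rightarrow> ('n::{finite,linorder} \<Rightarrow> factor) \<Rightarrow> 'n distribution set" where
  "X_space s = weighted_space (\<lambda>\<xi>. mu \<xi> * bracket \<xi> powr (s - 1))"

definition X_norm :: "real \<Rightarrow> ('n::{finite,linorder} \<Rightarrow> factor) \<Rightarrow> 'n distribution \<Rightarrow> real" where
  "X_norm s = weighted_norm (\<lambda>\<xi>. mu \<xi> * bracket \<xi> powr (s - 1))"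

definition H_space :: "real \<Rightarrow> complex set \<Rightarrow> ('n::finite \<Rightarrow> factor) \<Rightarrow> 'n distribution set" where
  "H_space s = weighted_space (\<lambda>\<xi>. bracket \<xi> powr s)"

definition H_norm :: "real \<Rightarrow> ('n::finite \<Rightarrow> factor) \<Rightarrow> 'n distribution \<Rightarrow> real" where
  "H_norm s = weighted_norm (\<lambda>\<xi>. bracket \<xi> powr s)"

text \<open>
  A set \<open>A\<close> of distributions is an algebra under pointwise multiplication: its elements are
  functions, so that pointwise products make sense, and \<open>A\<close> is closed under these products with a
  norm bound.
\<close>

definition pointwise_algebra ::
    "complex set \<Rightarrow> ('n::finite \<Rightarrow> factor) \<Rightarrow> 'n distribution set \<Rightarrow> ('n distribution \<Rightarrow> real) \<Rightarrow> bool" where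
  "pointwise_algebra F \<Gamma> A nrm \<longleftrightarrow>
     A \<subseteq> dist_of \<Gamma> ` tempered_functions F \<Gamma> \<and>
     (\<exists>C. \<forall>u\<in>tempered_functions F \<Gamma>. \<forall>v\<in>tempered_functions F \<Gamma>.
        dist_of \<Gamma> u \<in> A \<longrightarrow> dist_of \<Gamma> v \<in> A \<longrightarrow>
          (\<lambda>x. u x * v x) \<in> tempered_functions F \<Gamma> \<and>
          dist_of \<Gamma> (\<lambda>x. u x * v x) \<in> A \<and>
          nrm (dist_of \<Gamma> (\<lambda>x. u x * v x)) \<le> C * nrm (dist_of \<Gamma> u) * nrm (dist_of \<Gamma> v))"

section \<open>Orthogonal maps on the real coordinates\<close>

text \<open>
  The increasing enumeration of the real coordinates by an index type \<open>'k\<close>; it is used only when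
  \<open>CARD('k) = card (real_coords \<Gamma>)\<close>, where it exists and is unique.
\<close>

definition enum_real_coords :: "('n::{finite,linorder} \<Rightarrow> factor) \<Rightarrow> 'k::{finite,linorder} \<Rightarrow> 'n" where
  "enum_real_coords \<Gamma> = (THE e. strict_mono e \<and> range e = real_coords \<Gamma>)"

definition act_real ::
    "('n::{finite,linorder} \<Rightarrow> factor) \<Rightarrow> real ^ ('k::{finite,linorder}) ^ ('k::{finite,linorder}) \<Rightarrow>
       real ^ ('n::{finite,linorder}) \<Rightarrow> real ^ ('n::{finite,linorder})" where
  "act_real \<Gamma> Q x =
     (\<chi> i. if i \<in> real_coords \<Gamma>
           then (Q *v (\<chi> a. x $ enum_real_coords \<Gamma> a)) $ (inv (enum_real_coords \<Gamma>) i)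
           else x $ i)"

end

theory Submission
 imports Defs "HOL-Probability.Probability"
begin

text \<open>
 All spaces are weighted \<open>L\<^sup>2\<close> spaces on the dual group, so the theorem compares the weights
 \<open>mu * bracket powr (s - 1)\<close> and \<open>bracket powr s\<close>.  Always \<open>mu <= 2 * bracket\<close>, whence \<open>H \<subseteq> X\<close>.  The
 two weights differ only near the frequency zero, where \<open>mu\<close> is of the order of \<open>|xi\<^sub>1| / |xi| + |xi|\<close>.
 If no coordinate is real, nonzero frequencies are bounded away from zero, and if only the first
 one is real, small frequencies are multiples of the first basis vector; so \<open>mu\<close> is bounded below
 (\<open>bracket_le_mu\<close>).  If the first coordinate is toroidal but another one is real, then small
 frequencies have \<open>xi\<^sub>1 = 0\<close> and \<open>mu\<close> is comparable to \<open>|xi|\<close> almost everywhere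
 (\<open>X_norm_homogeneous\<close>).

 Strictness and the failure of rotation invariance come from one construction
 (\<open>low_frequency_example\<close>).  For a unit vector \<open>w\<close> in the real coordinates, orthogonal to the first
 basis vector \<open>e\<close>, put bumps of radius \<open>c * 4\<^sup>-\<^sup>j\<close> at \<open>\<plusminus>2\<^sup>-\<^sup>j * w\<close>, each normalised in \<open>L\<^sup>2\<close>.  The sum \<open>g\<close> is
 integrable but not square integrable, while \<open>|xi| * g\<close> is square integrable; on the support
 \<open>|xi\<^sub>1| / |xi|\<close> is \<open>O(|xi|)\<close>, so the inverse transform of \<open>g\<close> lies in \<open>X\<close> and is a bounded function
 outside \<open>L\<^sup>2\<close>.  Choosing \<open>w\<close> along the component of \<open>Q e\<close> orthogonal to \<open>e\<close>, the rotated function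
 has its frequencies where \<open>|xi\<^sub>1| / |xi|\<close> is bounded below, so it leaves \<open>X\<close> (\<open>rotation_example\<close>).

 The algebra property holds for \<open>H\<close> when \<open>2 s > n\<close>: transforms are then integrable, products of
 functions correspond to convolutions, and a weighted Cauchy-Schwarz inequality bounds these
 (\<open>weighted_convolution\<close>).  It also requires that a tempered distribution with integrable transform
 be a function.  This amounts to the density of the transforms of test functions in the Schwartz
 class (\<open>transform_density\<close>), obtained from summability kernels with compactly supported
 transforms: dilates of a fixed kernel on lines and powers of the cosine on circles.

 The underlying Fourier analysis is built on product measures: rapid decay and smoothness
 of transforms by integration by parts, inversion on the dual group by Gaussian regularisation
 (\<open>dual_inversion\<close>), and the fact that a distribution determines its transform and a tempered
 function is determined by its distribution (\<open>fourier_unique\<close>, \<open>dist_of_inj\<close>).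
\<close>

section \<open>Smooth functions and the Schwartz class\<close>

lemmas integrable_bound = Bochner_Integration.integrable_bound

abbreviation growth :: "('n::finite => factor) => real ^ 'n => real" where
 "growth \<Gamma> x \<equiv> 1 + real_part_norm \<Gamma> x"

abbreviation Borel :: "('a::topological_space => 'b::topological_space) set" where
 "Borel \<equiv> borel_measurable borel"

lemma iter_partial_append: "iter_partial (is @ js) f = iter_partial is (iter_partial js f)"
 by (induction "is") auto

lemma partial_deriv_eqI:
 assumes "(f has_derivative D) (at x)"
 shows "partial_deriv i f x = D (axis i 1)"
 unfolding partial_deriv_def using frechet_derivative_at[OF assms] by simp

lemma has_derivative_frechet:
 "f differentiable (at x) ==> (f has_derivative frechet_derivative f (at x)) (at x)"
 by (simp add: frechet_derivative_works)

lemma partial_deriv_add: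
 assumes "f differentiable (at x)" "g differentiable (at x)"
 shows "partial_deriv i (\<lambda>x. f x + g x) x = partial_deriv i f x + partial_deriv i g x"
 by (subst partial_deriv_eqI[OF has_derivative_add[OF assms[THEN has_derivative_frechet]]])
  (simp add: partial_deriv_def)

lemma partial_deriv_mult:
 assumes "f differentiable (at x)" "g differentiable (at x)"
 shows "partial_deriv i (\<lambda>x. f x * g x) x = f x * partial_deriv i g x + partial_deriv i f x * g x"
 by (subst partial_deriv_eqI[OF has_derivative_mult[OF assms[THEN has_derivative_frechet]]])
  (simp add: partial_deriv_def)

lemma partial_deriv_scale:
 assumes "f differentiable (at x)"
 shows "partial_deriv i (\<lambda>x. c * f x) x = c * partial_deriv i f x"
 by (subst partial_deriv_eqI[OF has_derivative_mult_right[OF has_derivative_frechet[OF assms]]])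
  (simp add: partial_deriv_def)

lemma cnj_has_derivative: "(f has_derivative D) F ==> ((\<lambda>x. cnj (f x)) has_derivative (\<lambda>x. cnj (D x))) F"
 by (rule bounded_linear.has_derivative[OF bounded_linear_cnj])

lemma partial_deriv_cnj:
 assumes "f differentiable (at x)"
 shows "partial_deriv i (\<lambda>x. cnj (f x)) x = cnj (partial_deriv i f x)"
 by (subst partial_deriv_eqI[OF cnj_has_derivative[OF has_derivative_frechet[OF assms]]])
  (simp add: partial_deriv_def)

lemma smooth_fun_differentiable: "smooth_fun f ==> f differentiable (at x)"
 unfolding smooth_fun_def by (metis iter_partial.simps(1))

lemma smooth_fun_iter_partial: "smooth_fun f ==> smooth_fun (iter_partial js f)"
 unfolding smooth_fun_def by (metis iter_partial_append)

lemma smooth_fun_partial_deriv: "smooth_fun f ==> smooth_fun (partial_deriv i f)"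
 using smooth_fun_iter_partial[of f "[i]"] by simp

lemma smooth_fun_continuous: "smooth_fun f ==> continuous_on S f"
 by (meson continuous_at_imp_continuous_on differentiable_imp_continuous_within smooth_fun_differentiable)

lemma smooth_fun_coinduct:
 assumes "f \<in> C"
  and "!!g x. g \<in> C ==> g differentiable (at x)"
  and "!!g i. g \<in> C ==> partial_deriv i g \<in> C"
 shows "smooth_fun f"
proof -
 have "iter_partial js f \<in> C" for js
  using assms by (induction js) auto
 then show ?thesis
  using assms(2) by (auto simp: smooth_fun_def)
qed

lemma partial_deriv_const: "partial_deriv i (\<lambda>x. c) = (\<lambda>x. 0)"
 by (rule ext, subst partial_deriv_eqI[OF has_derivative_const]) simp

lemma smooth_fun_const: "smooth_fun (\<lambda>x. c)"
 by (rule smooth_fun_coinduct[where C = "range (%c x. c)"]) (auto simp: partial_deriv_const)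

lemma smooth_fun_inner: "smooth_fun (\<lambda>x. complex_of_real (a \<bullet> x))"
proof (rule smooth_fun_coinduct[where C = "range (%a x. complex_of_real (a \<bullet> x)) \<union> range (%c x. c)"])
 have d: "((%x. complex_of_real (b \<bullet> x)) has_derivative (%x. complex_of_real (b \<bullet> x))) (at x)" for b x :: "real ^ 'a"
  by (rule bounded_linear_imp_has_derivative)
   (intro bounded_linear_compose[OF bounded_linear_of_real] bounded_linear_inner_right)
 fix g :: "real ^ 'a => complex" and x i
 assume "g \<in> range (%a x. complex_of_real (a \<bullet> x)) \<union> range (%c x. c)"
 then show "g differentiable (at x)" "partial_deriv i g \<in> range (%a x. complex_of_real (a \<bullet> x)) \<union> range (%c x. c)"
  using d by (auto simp: partial_deriv_const partial_deriv_eqI[OF d] fun_eq_iff intro: differentiableI)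
qed auto

lemma smooth_fun_nth: "smooth_fun (\<lambda>x. complex_of_real (x $ i))"
 using smooth_fun_inner[of "axis i 1"] by (simp add: inner_axis' )

text \<open>
 Smoothness is a coinductive property: all iterated partial derivatives are differentiable. Its
 closure under products and compositions follows once this hull of the smooth functions is seen to
 be closed under partial derivatives. In the last clause \<open>h\<close> lists the successive derivatives of the
 outer function.
\<close>

inductive_set smooth_hull :: "(real ^ 'n::finite => complex) set" where
 base: "smooth_fun f ==> f \<in> smooth_hull"
| add: "f \<in> smooth_hull ==> g \<in> smooth_hull ==> (\<lambda>x. f x + g x) \<in> smooth_hull"
| mult: "f \<in> smooth_hull ==> g \<in> smooth_hull ==> (\<lambda>x. f x * g x) \<in> smooth_hull"
| comp: "[|!!k t. (h k has_vector_derivative h (Suc k) t) (at t);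
     (\<lambda>x. complex_of_real (q x)) \<in> smooth_hull|] ==> (\<lambda>x. h k (q x)) \<in> smooth_hull"

lemma smooth_hull_closed:
 "f \<in> smooth_hull ==> (\<forall>x. f differentiable (at x)) \<and> (\<forall>i. partial_deriv i f \<in> smooth_hull)"
proof (induction rule: smooth_hull.induct)
 case (base f)
 then show ?case
  by (auto intro: smooth_fun_differentiable smooth_hull.base smooth_fun_partial_deriv)
next
 case (add f g)
 have "partial_deriv i (%x. f x + g x) = (%x. partial_deriv i f x + partial_deriv i g x)" for i
  using add by (auto simp: partial_deriv_add fun_eq_iff)
 with add show ?case by (auto intro: smooth_hull.add)
next
 case (mult f g)
 have "partial_deriv i (%x. f x * g x) = (%x. f x * partial_deriv i g x + partial_deriv i f x * g x)" for i
  using mult by (auto simp: partial_deriv_mult fun_eq_iff)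
 moreover have "(%x. f x * partial_deriv i g x + partial_deriv i f x * g x) \<in> smooth_hull" for i
  by (rule smooth_hull.add; rule smooth_hull.mult) (use mult in auto)
 ultimately show ?case using mult by auto
next
 case (comp h q k)
 let ?Q = "%x. complex_of_real (q x)"
 have D: "((%x. h k (q x)) has_derivative (%v. h (Suc k) (q x) * frechet_derivative ?Q (at x) v)) (at x)" for k x
 proof -
  have dQ: "(?Q has_derivative frechet_derivative ?Q (at x)) (at x)"
   using comp by (auto intro: has_derivative_frechet)
  have "((%x. Re (?Q x)) has_derivative (%v. Re (frechet_derivative ?Q (at x) v))) (at x)"
   using bounded_linear.has_derivative[OF bounded_linear_Re dQ] by simp
  then have dq: "(q has_derivative (%v. Re (frechet_derivative ?Q (at x) v))) (at x)"
   by simp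
  have "(?Q has_derivative (%v. of_real (Re (frechet_derivative ?Q (at x) v)))) (at x)"
   using bounded_linear.has_derivative[OF bounded_linear_of_real dq] .
  then have eq: "frechet_derivative ?Q (at x) = (%v. of_real (Re (frechet_derivative ?Q (at x) v)))"
   using dQ has_derivative_unique by blast
  have "(h k has_derivative (%t. t *\<^sub>R h (Suc k) (q x))) (at (q x))"
   using comp(1) by (simp add: has_vector_derivative_def)
  from has_derivative_compose[OF dq this]
  show ?thesis
   by (subst eq) (simp add: scaleR_conv_of_real mult.commute)
 qed
 have "partial_deriv i (%x. h k (q x)) = (%x. h (Suc k) (q x) * partial_deriv i ?Q x)" for i
  using partial_deriv_eqI[OF D] by (auto simp: partial_deriv_def fun_eq_iff)
 moreover have "(%x. h (Suc k) (q x)) \<in> smooth_hull"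
  by (rule smooth_hull.comp[of h q, OF comp(1,2)])
 ultimately show ?case
  using comp(3) differentiableI[OF D] by (simp add: smooth_hull.mult)
qed

lemma smooth_hull_smooth: "f \<in> smooth_hull ==> smooth_fun f"
 by (rule smooth_fun_coinduct[where C = smooth_hull]) (use smooth_hull_closed in auto)

lemma smooth_fun_add: "smooth_fun f ==> smooth_fun g ==> smooth_fun (\<lambda>x. f x + g x)"
 and smooth_fun_mult: "smooth_fun f ==> smooth_fun g ==> smooth_fun (\<lambda>x. f x * g x)"
 and smooth_fun_comp: "[|!!k t. (h k has_vector_derivative h (Suc k) t) (at t);
   smooth_fun (\<lambda>x. complex_of_real (q x))|] ==> smooth_fun (\<lambda>x. h k (q x))"
 by (auto intro!: smooth_hull_smooth intro: smooth_hull.intros)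

lemma smooth_fun_sum: "finite I ==> (!!i. i \<in> I ==> smooth_fun (f i)) ==> smooth_fun (\<lambda>x. \<Sum>i\<in>I. f i x)"
 by (induction I rule: finite_induct) (auto intro: smooth_fun_add smooth_fun_const)

lemma smooth_fun_prod: "finite I ==> (!!i. i \<in> I ==> smooth_fun (f i)) ==> smooth_fun (\<lambda>x. \<Prod>i\<in>I. f i x)"
 by (induction I rule: finite_induct) (auto intro: smooth_fun_mult smooth_fun_const)

lemma smooth_fun_cis:
 assumes "smooth_fun (\<lambda>x. complex_of_real (q x))"
 shows "smooth_fun (\<lambda>x. cis (q x))"
proof -
 have "((%t. \<i> ^ k * cis t) has_vector_derivative \<i> ^ Suc k * cis t) (at t)" for k t
  unfolding cis_conv_exp
  by (auto intro!: derivative_eq_intros has_vector_derivative_real_field)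
 from smooth_fun_comp[of "%k t. \<i> ^ k * cis t", OF this assms, of 0]
 show ?thesis by simp
qed

lemma iter_partial_cnj:
 assumes "smooth_fun f"
 shows "iter_partial js (\<lambda>x. cnj (f x)) = (\<lambda>x. cnj (iter_partial js f x))"
proof (induction js)
 case (Cons j js)
 have "partial_deriv j (%x. cnj (iter_partial js f x)) = (%x. cnj (partial_deriv j (iter_partial js f) x))"
  using assms by (auto simp: partial_deriv_cnj fun_eq_iff smooth_fun_def)
 then show ?case using Cons by simp
qed simp

lemma smooth_fun_cnj:
 assumes "smooth_fun f" shows "smooth_fun (\<lambda>x. cnj (f x))"
 unfolding smooth_fun_def iter_partial_cnj[OF assms]
proof (intro allI)
 fix js x
 have "iter_partial js f differentiable at x" using assms by (simp add: smooth_fun_def)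
 from cnj_has_derivative[OF has_derivative_frechet[OF this]]
 show "(%x. cnj (iter_partial js f x)) differentiable (at x)" by (rule differentiableI)
qed

lemma iter_partial_add:
 assumes "smooth_fun f" "smooth_fun g"
 shows "iter_partial js (\<lambda>x. f x + g x) = (\<lambda>x. iter_partial js f x + iter_partial js g x)"
proof (induction js)
 case (Cons j js)
 have "partial_deriv j (%x. iter_partial js f x + iter_partial js g x)
   = (%x. partial_deriv j (iter_partial js f) x + partial_deriv j (iter_partial js g) x)"
  using assms by (auto simp: partial_deriv_add fun_eq_iff smooth_fun_def)
 then show ?case using Cons by simp
qed simp

lemma iter_partial_scale:
 assumes "smooth_fun f"
 shows "iter_partial js (\<lambda>x. c * f x) = (\<lambda>x. c * iter_partial js f x)"
proof (induction js)
 case (Cons j js)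
 have "partial_deriv j (%x. c * iter_partial js f x) = (%x. c * partial_deriv j (iter_partial js f) x)"
  using assms by (auto simp: partial_deriv_scale fun_eq_iff smooth_fun_def)
 then show ?case using Cons by simp
qed simp

lemma partial_deriv_shift:
 assumes "!!y. f (y + a) = f y" "f differentiable (at x)"
 shows "partial_deriv i f (x + a) = partial_deriv i f x"
proof -
 have eq: "f \<circ> (%y. y - a) = f"
  using assms(1)[of "_ - a"] by (auto simp: fun_eq_iff)
 have "((%y. y - a) has_derivative (%v. v)) (at (x + a))"
  by (auto intro!: derivative_eq_intros)
 moreover have "(f has_derivative frechet_derivative f (at x)) (at ((%y. y - a) (x + a)))"
  using has_derivative_frechet[OF assms(2)] by simp
 ultimately have "(f \<circ> (%y. y - a) has_derivative frechet_derivative f (at x) \<circ> (%v. v)) (at (x + a))"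
  by (rule diff_chain_at)
 then have "(f has_derivative frechet_derivative f (at x)) (at (x + a))"
  unfolding eq by (simp add: comp_def)
 from partial_deriv_eqI[OF this] show ?thesis
  by (simp add: partial_deriv_def)
qed

lemma iter_partial_periodic:
 assumes "smooth_fun f" "periodic_on \<Gamma> f"
 shows "periodic_on \<Gamma> (iter_partial js f)"
proof (induction js)
 case (Cons j js)
 then show ?case
  using assms(1) unfolding periodic_on_def smooth_fun_def
  by (auto intro!: partial_deriv_shift)
qed (use assms in simp)

lemma iter_partial_zero_on:
 assumes "open U" "!!x. x \<in> U ==> f x = 0"
 shows "x \<in> U ==> iter_partial js f x = 0"
proof (induction js arbitrary: x)
 case (Cons j js)
 have "(iter_partial js f has_derivative (%_. 0)) (at x)"
  by (rule has_derivative_transform_within_open[OF has_derivative_const[of 0] assms(1) Cons.prems])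
   (use Cons.IH in auto)
 then show ?case by (simp add: partial_deriv_eqI)
qed (use assms in simp)

lemma periodic_shift_multi:
 assumes "periodic_on \<Gamma> f"
 shows "f (x + (\<chi> i. case \<Gamma> i of Line => 0 | Torus L => of_int (k i) * L)) = f x"
proof -
 have nat: "f (x + axis i (of_nat m * L)) = f x" if "\<Gamma> i = Torus L" for i L x and m :: nat
 proof (induction m arbitrary: x)
  case (Suc m)
  have "axis i (real (Suc m) * L) = axis i (real m * L) + axis i L"
   by (simp add: axis_def vec_eq_iff algebra_simps)
  then show ?case
   using Suc assms that unfolding periodic_on_def by (metis add.assoc)
 qed (simp add: axis_def vec_eq_iff zero_vec_def[symmetric] vec_lambda_unique)
 have int: "f (x + axis i (of_int m * L)) = f x" if "\<Gamma> i = Torus L" for i L x and m :: int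
 proof (cases "m >= 0")
  case True
  then show ?thesis using nat[OF that, of x "nat m"] by simp
 next
  case False
  have "x + axis i (of_int m * L) + axis i (real (nat (-m)) * L) = x"
   using False by (simp add: axis_def vec_eq_iff)
  then show ?thesis using nat[OF that, of "x + axis i (of_int m * L)" "nat (-m)"] by metis
 qed
 have *: "f (x + (\<Sum>i\<in>I. axis i (case \<Gamma> i of Line => 0 | Torus L => of_int (k i) * L))) = f x"
  if "finite I" for I
  using that
 proof (induction I arbitrary: x rule: finite_induct)
  case (insert i I)
  let ?a = "%i. axis i (case \<Gamma> i of Line => 0 | Torus L => of_int (k i) * L)"
  have "f (x + (\<Sum>i\<in>insert i I. ?a i)) = f ((x + ?a i) + (\<Sum>i\<in>I. ?a i))"
   using insert by (simp add: add.assoc)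
  also have "... = f (x + ?a i)" by (rule insert.IH)
  also have "... = f x"
  proof (cases "\<Gamma> i")
   case Line
   then show ?thesis by (simp add: axis_def zero_vec_def[symmetric] vec_eq_iff vec_lambda_unique)
  next
   case (Torus L)
   then show ?thesis using int by simp
  qed
  finally show ?case .
 qed simp
 have "(\<chi> i. case \<Gamma> i of Line => 0 | Torus L => of_int (k i) * L)
   = (\<Sum>i\<in>UNIV. axis i (case \<Gamma> i of Line => 0 | Torus L => of_int (k i) * L))"
  by (simp add: vec_eq_iff axis_def if_distrib[where f="%x. x $ _"] cong: if_cong)
 then show ?thesis using *[of UNIV] by simp
qed

lemma real_part_norm_shift:
 "real_part_norm \<Gamma> (x + (\<chi> i. case \<Gamma> i of Line => 0 | Torus L => c i L)) = real_part_norm \<Gamma> x"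
 unfolding real_part_norm_def by (rule arg_cong[where f=norm]) (simp add: vec_eq_iff)

lemma real_part_norm_nonneg [simp]: "0 <= real_part_norm \<Gamma> x"
 by (simp add: real_part_norm_def)

lemma real_part_norm_ge: "\<Gamma> i = Line ==> \<bar>x $ i\<bar> <= real_part_norm \<Gamma> x"
 unfolding real_part_norm_def
 using component_le_norm_cart[of "\<chi> i. if \<Gamma> i = Line then x $ i else 0" i] by simp

lemma real_part_norm_lines [simp]: "real_part_norm (\<lambda>_. Line) x = norm x"
 by (simp add: real_part_norm_def)

lemma continuous_real_part_norm: "continuous_on S (real_part_norm \<Gamma>)"
proof -
 have "continuous_on S (%x. if \<Gamma> i = Line then x $ i else 0 :: real)" for i
  by (cases "\<Gamma> i = Line") (auto intro!: continuous_intros)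
 then show ?thesis
  unfolding real_part_norm_def by (auto intro!: continuous_intros)
qed

lemma schwartzI:
 assumes "smooth_fun phi" "periodic_on \<Gamma> phi"
  and "!!N js. \<exists>B. \<forall>x. growth \<Gamma> x ^ N * cmod (iter_partial js phi x) <= B"
 shows "phi \<in> schwartz \<Gamma>"
 using assms unfolding schwartz_def bdd_above_def by fastforce

lemma schwartz_smooth: "phi \<in> schwartz \<Gamma> ==> smooth_fun phi"
 and schwartz_periodic: "phi \<in> schwartz \<Gamma> ==> periodic_on \<Gamma> phi"
 by (auto simp: schwartz_def)

lemma schwartz_bound:
 assumes "phi \<in> schwartz \<Gamma>"
 obtains B where "B > 0" "!!x. growth \<Gamma> x ^ N * cmod (iter_partial js phi x) <= B"
proof -
 from assms obtain B where "!!x. growth \<Gamma> x ^ N * cmod (iter_partial js phi x) <= B"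
  unfolding schwartz_def bdd_above_def by fastforce
 then have "!!x. growth \<Gamma> x ^ N * cmod (iter_partial js phi x) <= max B 1"
  by (metis max.coboundedI1)
 then show ?thesis using that[of "max B 1"] by fastforce
qed

lemma schwartz_iter_partial:
 assumes "phi \<in> schwartz \<Gamma>" shows "iter_partial js phi \<in> schwartz \<Gamma>"
 using assms smooth_fun_iter_partial iter_partial_periodic
 by (auto simp: schwartz_def iter_partial_append[symmetric])

lemma schwartz_partial_deriv:
 assumes "phi \<in> schwartz \<Gamma>" shows "partial_deriv j phi \<in> schwartz \<Gamma>"
 using schwartz_iter_partial[OF assms, of "[j]"] by simp

lemma schwartz_add:
 assumes "phi \<in> schwartz \<Gamma>" "psi \<in> schwartz \<Gamma>"
 shows "(\<lambda>x. phi x + psi x) \<in> schwartz \<Gamma>"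
proof (rule schwartzI)
 note sm = assms[THEN schwartz_smooth]
 show "smooth_fun (%x. phi x + psi x)" using sm by (rule smooth_fun_add)
 show "periodic_on \<Gamma> (%x. phi x + psi x)"
  using assms[THEN schwartz_periodic] by (simp add: periodic_on_def)
 fix N js
 obtain A B where AB: "!!x. growth \<Gamma> x ^ N * cmod (iter_partial js phi x) <= A"
  "!!x. growth \<Gamma> x ^ N * cmod (iter_partial js psi x) <= B"
  using schwartz_bound assms by metis
 have "growth \<Gamma> x ^ N * cmod (iter_partial js phi x + iter_partial js psi x) <= A + B" for x
 proof -
  have "growth \<Gamma> x ^ N * cmod (iter_partial js phi x + iter_partial js psi x)
   <= growth \<Gamma> x ^ N * (cmod (iter_partial js phi x) + cmod (iter_partial js psi x))"
   by (intro mult_left_mono norm_triangle_ineq zero_le_power) (simp add: add_nonneg_nonneg)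
  also have "... <= A + B" using add_mono[OF AB] by (simp add: distrib_left)
  finally show ?thesis .
 qed
 then show "\<exists>B. \<forall>x. growth \<Gamma> x ^ N * cmod (iter_partial js (%x. phi x + psi x) x) <= B"
  unfolding iter_partial_add[OF sm] by blast
qed

lemma schwartz_scale:
 assumes "phi \<in> schwartz \<Gamma>"
 shows "(\<lambda>x. c * phi x) \<in> schwartz \<Gamma>"
proof (rule schwartzI)
 note sm = assms[THEN schwartz_smooth]
 show "smooth_fun (%x. c * phi x)" using sm by (intro smooth_fun_mult smooth_fun_const)
 show "periodic_on \<Gamma> (%x. c * phi x)"
  using assms[THEN schwartz_periodic] by (simp add: periodic_on_def)
 fix N js
 obtain A where A: "!!x. growth \<Gamma> x ^ N * cmod (iter_partial js phi x) <= A"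
  using schwartz_bound assms by metis
 have "growth \<Gamma> x ^ N * cmod (c * iter_partial js phi x) <= cmod c * A" for x
  using mult_left_mono[OF A[of x], of "cmod c"] by (simp add: norm_mult algebra_simps)
 then show "\<exists>B. \<forall>x. growth \<Gamma> x ^ N * cmod (iter_partial js (%x. c * phi x) x) <= B"
  unfolding iter_partial_scale[OF sm] by blast
qed

lemma schwartz_cnj:
 assumes "phi \<in> schwartz \<Gamma>"
 shows "(\<lambda>x. cnj (phi x)) \<in> schwartz \<Gamma>"
 using assms by (auto simp: schwartz_def periodic_on_def smooth_fun_cnj iter_partial_cnj)

text \<open>
 By periodicity every derivative takes all its values on a compact set, so it is bounded, and the
 polynomial weight is bounded on the support.
\<close>

lemma schwartz_if_real_support_bounded:
 assumes pos: "!!i L. \<Gamma> i = Torus L ==> L > 0"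
  and sm: "smooth_fun phi" and per: "periodic_on \<Gamma> phi"
  and supp: "!!x. phi x ~= 0 ==> real_part_norm \<Gamma> x <= B"
 shows "phi \<in> schwartz \<Gamma>"
proof (rule schwartzI[OF sm per])
 fix N js
 define K where "K = {x. \<forall>i. x $ i \<in> (case \<Gamma> i of Line => {-B..B} | Torus L => {0..L})}"
 have K: "compact K"
 proof -
  have "K = cbox (\<chi> i. case \<Gamma> i of Line => -B | Torus L => 0) (\<chi> i. case \<Gamma> i of Line => B | Torus L => L)"
   unfolding K_def
   by (rule set_eqI) (auto simp: mem_box_cart split: factor.splits; metis factor.exhaust)
  then show ?thesis by simp
 qed
 let ?h = "%x. growth \<Gamma> x ^ N * cmod (iter_partial js phi x)"
 have "continuous_on K ?h"
  by (intro continuous_intros continuous_real_part_norm smooth_fun_continuous smooth_fun_iter_partial sm)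
 then have "bdd_above (?h ` K)"
  using K by (intro bounded_imp_bdd_above compact_imp_bounded compact_continuous_image)
 then obtain M where M: "!!x. x \<in> K ==> ?h x <= M" by (auto simp: bdd_above_def)
 have "?h x <= max M 0" for x
 proof (cases "real_part_norm \<Gamma> x <= B")
  case True
  define k where "k i = (case \<Gamma> i of Line => 0 | Torus L => - \<lfloor>x $ i / L\<rfloor>)" for i
  let ?s = "\<chi> i. case \<Gamma> i of Line => 0 | Torus L => of_int (k i) * L"
  have "(x + ?s) $ i \<in> (case \<Gamma> i of Line => {-B..B} | Torus L => {0..L})" for i
  proof (cases "\<Gamma> i")
   case Line
   with real_part_norm_ge[of \<Gamma> i x] True show ?thesis by (simp add: abs_le_iff)
  next
   case (Torus L)
   have L: "L > 0" using pos Torus by blast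
   have "of_int \<lfloor>x $ i / L\<rfloor> <= x $ i / L" "x $ i / L <= of_int \<lfloor>x $ i / L\<rfloor> + 1"
    by linarith+
   then have "of_int \<lfloor>x $ i / L\<rfloor> * L <= x $ i" "x $ i <= (of_int \<lfloor>x $ i / L\<rfloor> + 1) * L"
    using L by (simp_all only: pos_le_divide_eq pos_divide_le_eq)
   then show ?thesis using Torus by (simp add: k_def algebra_simps)
  qed
  then have "x + ?s \<in> K" by (simp add: K_def)
  moreover have "?h (x + ?s) = ?h x"
   using periodic_shift_multi[OF iter_partial_periodic[OF sm per], where k=k]
   by (simp add: real_part_norm_shift)
  ultimately show ?thesis using M[of "x + ?s"] by simp
 next
  case False
  have "open {x. real_part_norm \<Gamma> x > B}"
   by (intro open_Collect_less continuous_intros continuous_real_part_norm)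
  from iter_partial_zero_on[OF this, of phi x js] have "iter_partial js phi x = 0"
   using False supp by force
  then show ?thesis by simp
 qed
 then show "\<exists>B. \<forall>x. ?h x <= B" by blast
qed

lemma dual_test_schwartz: "psi \<in> dual_test_functions ==> psi \<in> schwartz (\<lambda>_. Line)"
 unfolding dual_test_functions_def bounded_iff
 by (auto intro!: schwartz_if_real_support_bounded simp: periodic_on_def)

section \<open>A smooth function that is flat at the origin\<close>

text \<open>
 The derivatives of \<open>exp (- 1 / t)\<close> are \<open>p (1 / t) * exp (- 1 / t)\<close> with polynomials \<open>p\<close>. This family is
 closed under differentiation, which makes \<open>flat\<close> smooth.
\<close>

definition flat_poly :: "real poly => real => real" where
 "flat_poly p t = (if t > 0 then poly p (1 / t) * exp (- (1 / t)) else 0)"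

definition flat :: "real => real" where
 "flat = flat_poly 1"

lemma flat_poly_tendsto_0: "((\<lambda>t. flat_poly p t / t) \<longlongrightarrow> 0) (at 0)"
proof -
 have mono: "((%x::real. x ^ k * exp (- x)) \<longlongrightarrow> 0) at_top" for k
  using tendsto_power_div_exp_0[of k] by (simp add: exp_minus field_simps)
 have "((%x::real. poly q x * exp (- x)) \<longlongrightarrow> 0) at_top" for q
  unfolding poly_altdef sum_distrib_right mult.assoc
  using tendsto_sum[of "{..degree q}" "%i x. coeff q i * (x ^ i * exp (- x))" "%_. 0" at_top]
   tendsto_mult[OF tendsto_const mono, of "coeff q _"] by simp
 from this[of "pCons 0 p"] have "((%x::real. x * poly p x * exp (- x)) \<longlongrightarrow> 0) at_top" by simp
 from filterlim_compose[OF this filterlim_inverse_at_top_right]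
 have r: "((%t::real. inverse t * poly p (inverse t) * exp (- inverse t)) \<longlongrightarrow> 0) (at_right 0)" .
 have "((%t. flat_poly p t / t) \<longlongrightarrow> 0) (at_right 0)"
  by (rule Lim_transform_eventually[OF r])
   (auto simp: eventually_at_right_less flat_poly_def field_simps
    intro!: eventually_mono[OF eventually_at_right_less])
 moreover have "((%t. flat_poly p t / t) \<longlongrightarrow> 0) (at_left 0)"
  by (rule Lim_transform_eventually[OF tendsto_const])
   (auto simp: flat_poly_def eventually_at_filter)
 ultimately show ?thesis by (simp add: filterlim_split_at)
qed

lemma flat_poly_deriv:
 "(flat_poly p has_real_derivative flat_poly ([:0, 0, 1:] * (p - pderiv p)) t) (at t)"
proof (cases t "0 :: real" rule: linorder_cases)
 case equal
 then show ?thesis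
  using flat_poly_tendsto_0[of p] by (simp add: has_field_derivative_iff flat_poly_def)
next
 case less
 have "((%_. 0) has_real_derivative 0) (at t)" by simp
 then have "(flat_poly p has_real_derivative 0) (at t)"
  by (rule DERIV_cong_ev[THEN iffD1, rotated 3])
   (use less in \<open>auto simp: flat_poly_def intro!: eventually_mono[OF eventually_nhds_in_open[of "{..<0}"]]\<close>)
 then show ?thesis using less by (simp add: flat_poly_def)
next
 case greater
 have "((%t. poly p (1 / t) * exp (- (1 / t))) has_real_derivative
  (poly p (1/t) - poly (pderiv p) (1/t)) * (1/t)^2 * exp (- (1/t))) (at t)"
  using greater
  by (auto intro!: derivative_eq_intros DERIV_chain'[OF _ poly_DERIV] simp: field_simps power2_eq_square)
 then have "(flat_poly p has_real_derivative
  (poly p (1/t) - poly (pderiv p) (1/t)) * (1/t)^2 * exp (- (1/t))) (at t)"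
  by (rule DERIV_cong_ev[THEN iffD1, rotated 3])
   (use greater in \<open>auto simp: flat_poly_def intro!: eventually_mono[OF eventually_nhds_in_open[of "{0<..}"]]\<close>)
 then show ?thesis using greater by (simp add: flat_poly_def algebra_simps power2_eq_square)
qed

lemma smooth_fun_flat:
 assumes "smooth_fun (\<lambda>x. complex_of_real (q x))"
 shows "smooth_fun (\<lambda>x. complex_of_real (flat (q x)))"
proof -
 define h where "h k t = complex_of_real (flat_poly (((%p. [:0, 0, 1:] * (p - pderiv p)) ^^ k) 1) t)" for k t
 have "(h k has_vector_derivative h (Suc k) t) (at t)" for k t
  unfolding h_def funpow.simps comp_def
  by (intro has_vector_derivative_of_real)
   (simp only: has_real_derivative_iff_has_vector_derivative[symmetric] flat_poly_deriv)
 from smooth_fun_comp[of h, OF this assms, of 0]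
 show ?thesis by (simp add: h_def flat_def)
qed

lemma flat_simps: "t > 0 ==> flat t = exp (- (1 / t))" "t <= 0 ==> flat t = 0"
 by (auto simp: flat_def flat_poly_def)

lemma flat_nonneg: "0 <= flat t" and flat_le_1: "flat t <= 1" and flat_pos_iff: "flat t ~= 0 \<longleftrightarrow> t > 0"
 by (auto simp: flat_def flat_poly_def)

lemma flat_step_tendsto: "(\<lambda>n. flat (real n * t)) \<longlonglongrightarrow> indicator {0<..} t"
proof (cases "t > 0")
 case True
 have "(%n. exp (- (1 / (real n * t)))) \<longlonglongrightarrow> exp (- 0)"
 proof (intro tendsto_intros)
  have "(%n. inverse t * inverse (real n)) \<longlonglongrightarrow> inverse t * 0"
   by (intro tendsto_intros lim_inverse_n)
  then show "(%n. 1 / (real n * t)) \<longlonglongrightarrow> 0" by (simp add: field_simps)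
 qed
 moreover have "\<forall>\<^sub>F n in sequentially. exp (- (1 / (real n * t))) = flat (real n * t)"
  using eventually_gt_at_top[of 0] by eventually_elim (use True in \<open>simp add: flat_simps\<close>)
 ultimately show ?thesis using True by (simp add: Lim_transform_eventually)
next
 case False
 then have "flat (real n * t) = 0" for n by (simp add: flat_simps mult_nonneg_nonpos)
 then show ?thesis using False by simp
qed

section \<open>Product measures on Euclidean space\<close>

lemma measurable_vec_nth [measurable]: "(\<lambda>x::real^'n. x $ i) \<in> Borel"
 by (intro borel_measurable_continuous_onI continuous_intros)

lemma measurable_vec_lambda_fun:
 fixes f :: "'a => 'n::finite => real"
 assumes "!!i. (\<lambda>x. f x i) \<in> borel_measurable M"
 shows "(\<lambda>x. \<chi> i. f x i) \<in> borel_measurable M"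
 using assms by (subst borel_measurable_euclidean_space) (auto simp: Basis_vec_def inner_axis)

lemma measurable_box [measurable]:
 fixes A :: "'n::finite => real set"
 assumes "!!i. A i \<in> sets borel"
 shows "{x. \<forall>i. x $ i \<in> A i} \<in> sets borel"
proof -
 have "{x. \<forall>i. x $ i \<in> A i} = (\<Inter>i. (%x. x $ i) -` A i)" by auto
 also have "(%x. x $ i) -` A i \<in> sets borel" for i
  using measurable_sets[OF measurable_vec_nth assms] by simp
 then have "(\<Inter>i. (%x. x $ i) -` A i) \<in> sets borel"
  by (intro sets.finite_INT) auto
 finally show ?thesis .
qed

text \<open>
 The group measure and the dual measure are products of one-dimensional measures. Transporting
 the product measure to vectors lets one-dimensional facts be used coordinate by coordinate.
\<close>

definition vprod :: "('n::finite => real measure) => (real ^ 'n) measure" where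
 "vprod M = distr (\<Pi>\<^sub>M i\<in>UNIV. M i) borel vec_lambda"

lemma sets_vprod [simp, measurable_cong]: "sets (vprod M) = sets borel"
 and space_vprod [simp]: "space (vprod M) = UNIV"
 by (auto simp: vprod_def)

locale real_measures = product_sigma_finite M for M :: "'n::finite => real measure" +
 assumes sets_M [simp, measurable_cong]: "!!i. sets (M i) = sets borel"
begin

lemma space_M [simp]: "space (M i) = UNIV"
 using sets_eq_imp_space_eq[OF sets_M[of i]] by simp

lemma vec_lambda_measurable: "vec_lambda \<in> borel_measurable (PiM UNIV M)"
proof -
 have "(%f. \<chi> i. f i) \<in> borel_measurable (PiM UNIV M)"
  by (rule measurable_vec_lambda_fun) (simp add: measurable_cong_sets[OF refl sets_M, symmetric])
 then show ?thesis by simp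
qed

lemma vec_nth_measurable: "vec_nth \<in> borel \<rightarrow>\<^sub>M PiM UNIV M"
 by (rule measurable_PiM_single')
  (auto simp: measurable_cong_sets[OF refl sets_M] measurable_vec_nth space_PiM)

lemma PiM_eq_distr: "PiM UNIV M = distr (vprod M) (PiM UNIV M) vec_nth"
 unfolding vprod_def
 by (subst distr_distr[OF vec_nth_measurable vec_lambda_measurable]) (simp add: comp_def vec_lambda_inverse)

lemma emeasure_vprod:
 assumes "!!i. A i \<in> sets borel"
 shows "emeasure (vprod M) {x. \<forall>i. x $ i \<in> A i} = (\<Prod>i\<in>UNIV. emeasure (M i) (A i))"
proof -
 have "emeasure (vprod M) {x. \<forall>i. x $ i \<in> A i} = emeasure (PiM UNIV M) (PiE UNIV A)"
  unfolding vprod_def using assms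
  by (subst emeasure_distr[OF vec_lambda_measurable]) (auto simp: space_PiM intro!: arg_cong2[where f=emeasure])
 also have "... = (\<Prod>i\<in>UNIV. emeasure (M i) (A i))"
  using assms by (subst emeasure_PiM) auto
 finally show ?thesis .
qed

lemma vprod_eqI:
 assumes sets: "sets N = sets borel"
  and eq: "!!A. (!!i. A i \<in> sets borel) ==>
   emeasure N {x. \<forall>i. x $ i \<in> A i} = (\<Prod>i\<in>UNIV. emeasure (M i) (A i))"
 shows "N = vprod M"
proof -
 have m: "vec_nth \<in> N \<rightarrow>\<^sub>M PiM UNIV M"
  using vec_nth_measurable sets by (simp cong: measurable_cong_sets)
 have sp: "space N = UNIV" using sets_eq_imp_space_eq[OF sets] by simp
 have "distr N (PiM UNIV M) vec_nth = PiM UNIV M"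
 proof (rule PiM_eqI)
  fix A assume A: "!!i. i \<in> UNIV ==> A i \<in> sets (M i)"
  have "emeasure (distr N (PiM UNIV M) vec_nth) (PiE UNIV A) = emeasure N {x. \<forall>i. x $ i \<in> A i}"
   using A m by (subst emeasure_distr) (auto simp: sp intro!: arg_cong2[where f=emeasure] sets_PiM_I_finite)
  then show "emeasure (distr N (PiM UNIV M) vec_nth) (PiE UNIV A) = (\<Prod>i\<in>UNIV. emeasure (M i) (A i))"
   using eq[of A] A by simp
 qed auto
 then have "vprod M = distr (distr N (PiM UNIV M) vec_nth) borel vec_lambda"
  by (simp add: vprod_def)
 also have "... = distr N borel (%x. x)"
  by (subst distr_distr[OF vec_lambda_measurable m]) (simp add: comp_def)
 also have "... = N" by (rule distr_id2[OF sets[symmetric]])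
 finally show ?thesis by simp
qed

lemma sigma_finite_vprod: "sigma_finite_measure (vprod M)"
proof (rule sigma_finite_measure_distr[where f = vec_nth and N = "PiM UNIV M"])
 show "sigma_finite_measure (distr (vprod M) (PiM UNIV M) vec_nth)"
  unfolding PiM_eq_distr[symmetric] by (rule sigma_finite) simp
qed (use vec_nth_measurable in \<open>simp cong: measurable_cong_sets\<close>)

lemma nn_integral_vprod_prod:
 assumes "!!i. f i \<in> Borel"
 shows "(\<integral>\<^sup>+x. (\<Prod>i\<in>UNIV. f i (x $ i)) \<partial>vprod M) = (\<Prod>i\<in>UNIV. \<integral>\<^sup>+t. f i t \<partial>M i)"
proof -
 have m: "(%x. \<Prod>i\<in>UNIV. f i (x $ i)) \<in> Borel"
  using assms by measurable
 show ?thesis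
  unfolding vprod_def using assms
  by (subst nn_integral_distr[OF vec_lambda_measurable]) (use m in \<open>simp_all add: product_nn_integral_prod\<close>)
qed

lemma
 fixes f :: "'n => real => _::{real_normed_field,banach,second_countable_topology}"
 assumes "!!i. integrable (M i) (f i)"
 shows integrable_vprod_prod: "integrable (vprod M) (\<lambda>x. \<Prod>i\<in>UNIV. f i (x $ i))" (is ?th1)
  and integral_vprod_prod: "(LINT x|vprod M. (\<Prod>i\<in>UNIV. f i (x $ i))) = (\<Prod>i\<in>UNIV. LINT t|M i. f i t)" (is ?th2)
proof -
 have [measurable]: "f i \<in> Borel" for i
  using borel_measurable_integrable[OF assms[of i]] by (simp cong: measurable_cong_sets)
 have m: "(%x. \<Prod>i\<in>UNIV. f i (x $ i)) \<in> Borel" by measurable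
 show ?th1 unfolding vprod_def
  by (subst integrable_distr_eq[OF vec_lambda_measurable m]) (use assms in \<open>simp add: product_integrable_prod\<close>)
 show ?th2 unfolding vprod_def
  by (subst integral_distr[OF vec_lambda_measurable m]) (use assms in \<open>simp add: product_integral_prod\<close>)
qed

lemma AE_vprod_component:
 assumes "AE t in M i. P t"
 shows "AE x in vprod M. P (x $ i)"
proof -
 obtain N where N': "{t \<in> space (M i). \<not> P t} \<subseteq> N" "emeasure (M i) N = 0" "N \<in> sets (M i)"
  using AE_E[OF assms] by metis
 then have N: "{t. \<not> P t} \<subseteq> N" "N \<in> sets borel" "emeasure (M i) N = 0"
  by simp_all
 have "emeasure (vprod M) {x. \<forall>j. x $ j \<in> (if j = i then N else UNIV)} = 0"
 proof (subst emeasure_vprod)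
  show "(\<Prod>j\<in>UNIV. emeasure (M j) (if j = i then N else UNIV)) = 0"
   by (rule prod_zero) (use N(3) in \<open>auto intro!: bexI[of _ i]\<close>)
 qed (use N(2) in simp)
 moreover have "{x. \<forall>j. x $ j \<in> (if j = i then N else UNIV)} = {x. x $ i \<in> N}" by auto
 ultimately have "emeasure (vprod M) {x. x $ i \<in> N} = 0" by simp
 then show ?thesis
  by (rule AE_I[rotated]) (use N measurable_sets[OF measurable_vec_nth[of i] N(2)] in \<open>auto simp: vimage_def\<close>)
qed

lemma AE_vprod:
 assumes "!!i. AE t in M i. P i t"
 shows "AE x in vprod M. \<forall>i. P i (x $ i)"
 using AE_vprod_component[OF assms] by (subst AE_all_countable) auto

end

lemma distr_vprod:
 assumes "real_measures M" "real_measures N"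
  and h [measurable]: "!!i. h i \<in> Borel"
  and eq: "!!i. distr (M i) borel (h i) = N i"
 shows "distr (vprod M) borel (\<lambda>x. \<chi> i. h i (x $ i)) = vprod N"
proof -
 interpret M: real_measures M by fact
 interpret N: real_measures N by fact
 have m: "(%x. \<chi> i. h i (x $ i)) \<in> borel \<rightarrow>\<^sub>M borel"
  by (intro measurable_vec_lambda_fun) measurable
 show ?thesis
 proof (rule N.vprod_eqI)
  fix A :: "'a => real set" assume A: "!!i. A i \<in> sets borel"
  have "emeasure (distr (vprod M) borel (%x. \<chi> i. h i (x $ i))) {x. \<forall>i. x $ i \<in> A i}
   = emeasure (vprod M) {x. \<forall>i. x $ i \<in> h i -` A i}"
   using A m by (subst emeasure_distr) (auto intro!: arg_cong2[where f=emeasure])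
  also have "... = (\<Prod>i\<in>UNIV. emeasure (M i) (h i -` A i))"
   using measurable_sets[OF h A] by (subst M.emeasure_vprod) auto
  also have "... = (\<Prod>i\<in>UNIV. emeasure (N i) (A i))"
   using A by (intro prod.cong refl)
    (simp add: eq[symmetric] emeasure_distr measurable_cong_sets[OF M.sets_M refl])
  finally show "emeasure (distr (vprod M) borel (%x. \<chi> i. h i (x $ i))) {x. \<forall>i. x $ i \<in> A i} = ..." .
 qed simp
qed

lemma real_measures_lborel: "real_measures (\<lambda>_. lborel)"
 by (unfold_locales) auto

lemma lborel_eq_vprod: "(lborel :: (real ^ 'n::finite) measure) = vprod (\<lambda>_. lborel)"
proof (rule lborel_eqI)
 interpret L: real_measures "%_ :: 'n. lborel" by (rule real_measures_lborel)
 fix l u :: "real ^ 'n" assume lu: "!!b. b \<in> Basis ==> l \<bullet> b <= u \<bullet> b"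
 then have le: "l $ i <= u $ i" for i
 proof -
  have "axis i (1::real) \<in> Basis" by (auto simp: Basis_vec_def)
  from lu[OF this] show ?thesis by (simp add: inner_axis)
 qed
 have "box l u = {x. \<forall>i. x $ i \<in> {l $ i<..<u $ i}}"
  by (auto simp: mem_box_cart)
 then have "emeasure (vprod (%_. lborel)) (box l u) = (\<Prod>i\<in>UNIV. emeasure lborel {l $ i<..<u $ i})"
  by (simp only:) (rule L.emeasure_vprod, simp)
 also have "... = ennreal (\<Prod>i\<in>UNIV. (u - l) $ i)"
  using le by (simp add: prod_ennreal)
 also have "(\<Prod>i\<in>UNIV. (u - l) $ i) = (\<Prod>b\<in>Basis. (u - l) \<bullet> b)"
 proof -
  have "inj (%i::'n. axis i (1::real))" by (simp add: inj_on_def axis_eq_axis)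
  moreover have "(Basis :: (real^'n) set) = range (%i. axis i 1)" by (auto simp: Basis_vec_def)
  ultimately show ?thesis using prod.reindex[of "%i::'n. axis i (1::real)" UNIV "%b. (u - l) \<bullet> b"]
   by (simp add: inner_axis comp_def)
 qed
 finally show "emeasure (vprod (%_. lborel)) (box l u) = ennreal (\<Prod>b\<in>Basis. (u - l) \<bullet> b)" .
qed simp

lemma vprod_density:
 assumes "!!i. f i \<in> Borel" "real_measures M" "real_measures (\<lambda>i. density (M i) (f i))"
 shows "vprod (\<lambda>i. density (M i) (f i)) = density (vprod M) (\<lambda>x. \<Prod>i\<in>UNIV. f i (x $ i))"
proof -
 interpret M: real_measures M by fact
 interpret N: real_measures "%i. density (M i) (f i)" by fact
 note [measurable] = assms(1)
 show ?thesis
 proof (rule N.vprod_eqI[symmetric])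
  fix A :: "'a => real set" assume A [measurable]: "!!i. A i \<in> sets borel"
  have ind: "(\<Prod>i\<in>UNIV. indicator (A i) (x $ i)) = (indicator {x. \<forall>i. x $ i \<in> A i} x :: ennreal)" for x
   by (auto simp: indicator_def)
  have "emeasure (density (vprod M) (%x. \<Prod>i\<in>UNIV. f i (x $ i))) {x. \<forall>i. x $ i \<in> A i}
   = (\<integral>\<^sup>+x. (\<Prod>i\<in>UNIV. f i (x $ i)) * indicator {x. \<forall>i. x $ i \<in> A i} x \<partial>vprod M)"
   by (rule emeasure_density) (use A in simp_all)
  also have "... = (\<integral>\<^sup>+x. (\<Prod>i\<in>UNIV. f i (x $ i) * indicator (A i) (x $ i)) \<partial>vprod M)"
   by (simp add: ind prod.distrib)
  also have "... = (\<Prod>i\<in>UNIV. \<integral>\<^sup>+t. f i t * indicator (A i) t \<partial>M i)"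
   by (subst M.nn_integral_vprod_prod) simp_all
  also have "... = (\<Prod>i\<in>UNIV. emeasure (density (M i) (f i)) (A i))"
   by (intro prod.cong refl) (simp add: emeasure_density)
  finally show "emeasure (density (vprod M) (%x. \<Prod>i\<in>UNIV. f i (x $ i))) {x. \<forall>i. x $ i \<in> A i} = ..." .
 qed simp
qed

section \<open>The factors of the group and of its dual\<close>

definition group_factor :: "factor => real measure" where
 "group_factor f = (case f of Line => lborel | Torus L => density lborel (indicator {0..<L}))"

definition lattice :: "real => real set" where
 "lattice L = range (\<lambda>m::int. of_int m / L)"

text \<open>
 The counting measure on the lattice is carried to the Borel sets of the reals, so that all factors
 share one sigma-algebra.
\<close>

definition dual_factor :: "factor => real measure" where
 "dual_factor f = (case f of Line => lborel | Torus L => distr (count_space (lattice L)) borel (\<lambda>x. x))"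

definition round_dual :: "factor => real => real" where
 "round_dual f x = (case f of Line => x | Torus L => of_int \<lfloor>x\<rfloor> / L)"

lemma factor_simps [simp]:
 "group_factor Line = lborel" "dual_factor Line = lborel" "round_dual Line x = x"
 "group_factor (Torus L) = density lborel (indicator {0..<L})"
 "dual_factor (Torus L) = distr (count_space (lattice L)) borel (\<lambda>x. x)"
 "round_dual (Torus L) x = of_int \<lfloor>x\<rfloor> / L"
 by (auto simp: group_factor_def dual_factor_def round_dual_def)

lemma countable_lattice [simp]: "countable (lattice L)"
 by (simp add: lattice_def)

lemma emeasure_dual_torus:
 assumes "A \<in> sets borel"
 shows "emeasure (dual_factor (Torus L)) A = emeasure (count_space UNIV) (A \<inter> lattice L)"
 using assms by (simp add: emeasure_distr) (simp add: emeasure_count_space)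

lemma sets_factor [simp, measurable_cong]: "sets (group_factor f) = sets borel" "sets (dual_factor f) = sets borel"
 by (cases f; simp)+

lemma round_dual_measurable [measurable]: "round_dual f \<in> Borel"
 unfolding round_dual_def by (cases f) (simp_all, measurable)

lemma dual_torus_eq_distr:
 assumes L: "L > 0"
 shows "dual_factor (Torus L) = distr lborel borel (round_dual (Torus L))"
proof (rule measure_eqI)
 fix A assume "A \<in> sets (dual_factor (Torus L))"
 then have A [measurable]: "A \<in> sets borel" by simp
 define I where "I = {m::int. of_int m / L \<in> A}"
 define X where "X m = {real_of_int m ..< of_int m + 1}" for m :: int
 have X: "x \<in> X m \<longleftrightarrow> \<lfloor>x\<rfloor> = m" for x m
  by (auto simp: X_def floor_eq_iff)
 have un: "round_dual (Torus L) -` A = \<Union> (X ` I)"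
  by (auto simp: I_def X)
 have "emeasure lborel (\<Union> (X ` I)) = (\<integral>\<^sup>+m. emeasure lborel (X m) \<partial>count_space I)"
  by (rule emeasure_UN_countable) (auto simp: X_def[abs_def] disjoint_family_on_def X[unfolded X_def, simplified])
 also have "... = emeasure (count_space I) I" by (simp add: X_def)
 finally have "emeasure (distr lborel borel (round_dual (Torus L))) A = emeasure (count_space I) I"
  by (subst emeasure_distr) (use un in auto)
 also have "... = emeasure (count_space UNIV) (A \<inter> lattice L)"
 proof -
  have img: "A \<inter> lattice L = (%m. of_int m / L) ` I" by (auto simp: I_def lattice_def)
  have inj: "inj_on (%m. of_int m / L) I" using L by (auto simp: inj_on_def)
  show ?thesis unfolding img using inj
   by (cases "finite I") (auto simp: emeasure_count_space card_image finite_image_iff)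
 qed
 finally show "emeasure (dual_factor (Torus L)) A = emeasure (distr lborel borel (round_dual (Torus L))) A"
  using emeasure_dual_torus[OF A] by simp
qed simp

lemma sigma_finite_dual_factor: "sigma_finite_measure (dual_factor f)"
proof (cases f)
 case Line
 then show ?thesis by (simp add: sigma_finite_lborel)
next
 case (Torus L)
 show ?thesis
 proof
  let ?A = "insert (- lattice L) ((%x. {x}) ` lattice L)"
  have b: "- lattice L \<in> sets borel"
   using sets.countable[OF _ countable_lattice, of L borel] by (intro borel_comp) simp
  have sp: "space (dual_factor (Torus L)) = UNIV" by simp
  show "\<exists>A. countable A \<and> A \<subseteq> sets (dual_factor f) \<and> \<Union> A = space (dual_factor f) \<and>
   (\<forall>a\<in>A. emeasure (dual_factor f) a ~= \<infinity>)"
   unfolding Torus using b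
   by (intro exI[of _ ?A]) (auto simp: emeasure_dual_torus emeasure_count_space sp simp del: factor_simps)
 qed
qed

lemma sigma_finite_group_factor: "sigma_finite_measure (group_factor f)"
proof (cases f)
 case (Torus L)
 have "finite_measure (density lborel (indicator {0..<L}) :: real measure)"
  by (rule finite_measureI) (cases "0 <= L"; simp add: emeasure_density)
 then show ?thesis unfolding Torus by (simp add: finite_measure.axioms(1))
qed (simp add: sigma_finite_lborel)

lemma AE_dual_factor_lattice: "AE x in dual_factor f. \<forall>L. f = Torus L \<longrightarrow> x \<in> lattice L"
proof (cases f)
 case (Torus L)
 have "{x. x \<in> lattice L} \<in> sets borel" using sets.countable[OF _ countable_lattice, of L borel] by simp
 then have "AE x in distr (count_space (lattice L)) borel (%x. x). x \<in> lattice L"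
  by (subst AE_distr_iff) (auto simp: AE_count_space)
 then show ?thesis unfolding Torus factor_simps by simp
qed simp

lemma integral_dual_torus_finite:
 fixes f :: "real => complex"
 assumes f [measurable]: "f \<in> Borel" and S: "finite S" "S \<subseteq> lattice L"
  and z: "!!x. x \<in> lattice L ==> x \<notin> S ==> f x = 0"
 shows "integrable (dual_factor (Torus L)) f" "(LINT x|dual_factor (Torus L). f x) = (\<Sum>x\<in>S. f x)"
proof -
 have fin: "finite {x \<in> lattice L. f x ~= 0}"
  by (rule finite_subset[OF _ S(1)]) (use z in auto)
 show "integrable (dual_factor (Torus L)) f"
 proof -
  have "integrable (count_space (lattice L)) f"
   unfolding integrable_iff_bounded using fin
   by (auto simp: nn_integral_count_space)
  then show ?thesis by (simp add: integrable_distr_eq)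
 qed
 have "(LINT x|dual_factor (Torus L). f x) = (\<Sum>x\<in>{x \<in> lattice L. f x ~= 0}. f x)"
  by (simp add: integral_distr) (rule lebesgue_integral_count_space_finite_support[OF fin])
 also have "... = (\<Sum>x\<in>S. f x)"
  by (rule sum.mono_neutral_left) (use S z in auto)
 finally show "(LINT x|dual_factor (Torus L). f x) = (\<Sum>x\<in>S. f x)" .
qed

section \<open>Polynomial weights\<close>

lemma integrable_weight_lborel:
 assumes p: "p > 1 / 2"
 shows "integrable lborel (\<lambda>t::real. (1 + t\<^sup>2) powr (- p))"
proof -
 have half: "set_integrable lborel {1..} (%t::real. t powr (- (2 * p)))"
 proof -
  have "((%x. x powr (- (2 * p))) has_integral -(1 powr (- (2 * p) + 1)) / (- (2 * p) + 1)) {1::real..}"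
   using p by (intro has_integral_powr_to_inf) auto
  then have "(%x. x powr (- (2 * p))) integrable_on {1::real..}" by blast
  then have "(%x. x powr (- (2 * p))) absolutely_integrable_on {1::real..}"
   by (rule nonnegative_absolutely_integrable_1) simp
  then show ?thesis
   unfolding set_integrable_def by (subst (asm) integrable_completion) auto
 qed
 let ?g = "%t::real. indicator {1..} t *\<^sub>R t powr (- (2 * p))"
 have g: "integrable lborel ?g" using half by (simp add: set_integrable_def)
 have g': "integrable lborel (%t. ?g (- t))"
  using lborel_integrable_real_affine[OF g, of "-1" 0] by simp
 have "integrable lborel (%t. indicator {-1..1} t + (?g t + ?g (- t)))"
  by (intro Bochner_Integration.integrable_add g g') simp
 then show ?thesis
 proof (rule integrable_bound)
  have "(1 + t\<^sup>2) powr (- p) <= indicator {-1..1} t + (?g t + ?g (- t))" for t :: real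
  proof (cases "\<bar>t\<bar> <= 1")
   case True
   have "(1 + t\<^sup>2) powr (- p) <= 1"
    using p by (simp add: powr_minus divide_simps ge_one_powr_ge_zero)
   with True show ?thesis by (auto simp: abs_le_iff indicator_def)
  next
   case False
   have "(1 + t\<^sup>2) powr (- p) <= (t\<^sup>2) powr (- p)"
    using p False by (intro powr_mono2') auto
   also have "(t\<^sup>2) powr (- p) = \<bar>t\<bar> powr (- (2 * p))"
    using False powr_powr[of "\<bar>t\<bar>" 2 "-p"] by simp
   finally show ?thesis using False by (auto simp: indicator_def abs_if split: if_splits)
  qed
  then show "AE t in lborel. norm ((1 + t\<^sup>2) powr (- p)) <= norm (indicator {-1..1} t + (?g t + ?g (- t)) :: real)"
   by (auto intro!: AE_I2 order_trans[OF _ abs_ge_self])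
 qed measurable
qed

lemma integrable_weight_dual_factor:
 assumes p: "p > 1 / 2" and pos: "!!L. f = Torus L ==> L > 0"
 shows "integrable (dual_factor f) (\<lambda>t::real. (1 + t\<^sup>2) powr (- p))"
proof (cases f)
 case (Torus L)
 have L: "L > 0" using pos Torus by simp
 let ?C = "(3 + 2 * L\<^sup>2) powr p"
 have "integrable lborel (%t::real. ?C * (1 + t\<^sup>2) powr (- p))"
  by (intro integrable_mult_right integrable_weight_lborel p)
 then have "integrable lborel (%t::real. (1 + (round_dual f t)\<^sup>2) powr (- p))"
 proof (rule integrable_bound)
  have "(1 + (round_dual f t)\<^sup>2) powr (- p) <= ?C * (1 + t\<^sup>2) powr (- p)" for t :: real
  proof -
   let ?r = "round_dual f t"
   define e where "e = t - of_int \<lfloor>t\<rfloor>"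
   have e: "0 <= e" "e <= 1" unfolding e_def by linarith+
   have t: "t = L * ?r + e" using L by (simp add: Torus e_def)
   have sq: "(a + b)\<^sup>2 <= 2 * a\<^sup>2 + 2 * b\<^sup>2" for a b :: real
    using sum_squares_bound[of a b] by (simp add: power2_sum)
   have "t\<^sup>2 <= 2 * (L * ?r)\<^sup>2 + 2 * e\<^sup>2"
    using sq[of "L * ?r" e] t by metis
   moreover have "e\<^sup>2 <= 1" using e by (simp add: power_le_one)
   ultimately have "1 + t\<^sup>2 <= 3 + 2 * (L\<^sup>2 * ?r\<^sup>2)" by (simp add: power_mult_distrib)
   also have "... <= (3 + 2 * L\<^sup>2) * (1 + ?r\<^sup>2)" by (simp add: algebra_simps)
   finally have "(1 + t\<^sup>2) powr p <= ((3 + 2 * L\<^sup>2) * (1 + ?r\<^sup>2)) powr p"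
    using p by (intro powr_mono2) (auto intro: add_nonneg_nonneg)
   also have "... = ?C * (1 + ?r\<^sup>2) powr p"
    by (rule powr_mult)
   finally have *: "(1 + t\<^sup>2) powr p <= ?C * (1 + ?r\<^sup>2) powr p" .
   have "1 + ?r\<^sup>2 > 0" "1 + t\<^sup>2 > 0" by (simp_all add: add_pos_nonneg)
   then show ?thesis using * by (simp add: powr_minus field_simps)
  qed
  then show "AE t in lborel. norm ((1 + (round_dual f t)\<^sup>2) powr (- p)) <= norm (?C * (1 + t\<^sup>2) powr (- p))"
   by (auto intro!: AE_I2)
 qed measurable
 then show ?thesis
  unfolding Torus dual_torus_eq_distr[OF L] by (simp add: integrable_distr_eq del: factor_simps)
qed (use integrable_weight_lborel[OF p] in simp)

text \<open>
 A radial weight is dominated by a product weight, since \<open>1 + x\<^sub>i\<^sup>2 <= 1 + |x|\<^sup>2\<close>; the latter can be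
 integrated one coordinate at a time.
\<close>

lemma weight_prod_bound:
 fixes x :: "real ^ 'n::finite"
 assumes "p >= 0"
 shows "(1 + (norm x)\<^sup>2) powr (- (p * real CARD('n))) <= (\<Prod>i\<in>UNIV. (1 + (x $ i)\<^sup>2) powr (- p))"
proof -
 have pos: "0 < 1 + (norm x)\<^sup>2" by (simp add: add_pos_nonneg)
 have "(\<Prod>i\<in>(UNIV::'n set). (1 + (norm x)\<^sup>2) powr (- p)) <= (\<Prod>i\<in>UNIV. (1 + (x $ i)\<^sup>2) powr (- p))"
 proof (intro prod_mono conjI powr_mono2')
  fix i
  have "\<bar>x $ i\<bar> <= norm x" by (rule component_le_norm_cart)
  then show "1 + (x $ i)\<^sup>2 <= 1 + (norm x)\<^sup>2" using power_mono[of "\<bar>x $ i\<bar>" "norm x" 2] by simp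
 qed (use assms in \<open>auto simp: add_pos_nonneg\<close>)
 also have "(\<Prod>i\<in>(UNIV::'n set). (1 + (norm x)\<^sup>2) powr (- p)) = (1 + (norm x)\<^sup>2) powr (- (p * real CARD('n)))"
  using pos by (simp add: powr_powr[symmetric] powr_realpow[symmetric] powr_powr)
 finally show ?thesis .
qed

lemma integrable_if_decay:
 fixes f :: "'a => 'b::{banach,second_countable_topology}"
 assumes w: "integrable M (\<lambda>x. 1 / (1 + w x) ^ N)" "!!x. 0 <= w x"
  and f: "f \<in> borel_measurable M" and B: "!!x. (1 + w x) ^ N * norm (f x) <= B"
 shows "integrable M f"
proof (rule integrable_bound)
 show "integrable M (%x. B * (1 / (1 + w x) ^ N))" by (intro integrable_mult_right w(1))
 have "norm (f x) <= B * (1 / (1 + w x) ^ N)" for x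
 proof -
  have "0 < (1 + w x) ^ N" using w(2)[of x] by (simp add: add_pos_nonneg)
  then show ?thesis using B[of x] by (simp add: field_simps)
 qed
 then show "AE x in M. norm (f x) <= norm (B * (1 / (1 + w x) ^ N))"
  by (intro AE_I2) (metis real_norm_def abs_ge_self order_trans)
qed (use f in simp)

section \<open>The group and its dual\<close>

locale lca =
 fixes \<Gamma> :: "'n::finite => factor"
 assumes pos: "!!i L. \<Gamma> i = Torus L ==> L > 0"

sublocale lca \<subseteq> D: real_measures "\<lambda>i. dual_factor (\<Gamma> i)"
 by (intro real_measures.intro product_sigma_finite.intro real_measures_axioms.intro)
  (rule sigma_finite_dual_factor sets_factor)+

sublocale lca \<subseteq> G: real_measures "\<lambda>i. group_factor (\<Gamma> i)"
 by (intro real_measures.intro product_sigma_finite.intro real_measures_axioms.intro)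
  (rule sigma_finite_group_factor sets_factor)+

context lca
begin

abbreviation dm :: "(real ^ 'n) measure" where "dm \<equiv> dual_measure \<Gamma>"
definition gm :: "(real ^ 'n) measure" where "gm = vprod (\<lambda>i. group_factor (\<Gamma> i))"

lemma sets_gm [simp, measurable_cong]: "sets gm = sets borel"
 and space_gm [simp]: "space gm = UNIV"
 by (simp_all add: gm_def)

lemma dual_measure_eq: "dm = vprod (\<lambda>i. dual_factor (\<Gamma> i))"
proof (rule D.vprod_eqI)
 define M' where "M' i = (case \<Gamma> i of Line => lborel | Torus L => count_space (lattice L))" for i
 have dm: "dm = distr (PiM UNIV M') borel vec_lambda"
  unfolding dual_measure_def M'_def[abs_def] lattice_def ..
 have sf: "sigma_finite_measure (M' i)" for i
  unfolding M'_def using sigma_finite_lborel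
  by (cases "\<Gamma> i") (simp_all add: sigma_finite_measure_count_space_countable)
 interpret M': product_sigma_finite M' by (intro product_sigma_finite.intro sf)
 have id: "(%t. t) \<in> M' i \<rightarrow>\<^sub>M borel" for i
  unfolding M'_def by (cases "\<Gamma> i") simp_all
 have comp: "(%x. x i) \<in> borel_measurable (PiM UNIV M')" for i
  by (rule measurable_compose[where g = "%t. t" and N = "M' i", OF _ id])
   (rule measurable_component_singleton, simp)
 have vl: "vec_lambda \<in> borel_measurable (PiM UNIV M')"
  using measurable_vec_lambda_fun[of "%x i. x i", OF comp] by simp
 show "sets dm = sets borel" by (simp add: dm)
 fix A :: "'n => real set" assume A: "!!i. A i \<in> sets borel"
 have fac: "A i \<inter> space (M' i) \<in> sets (M' i)"
  "emeasure (M' i) (A i \<inter> space (M' i)) = emeasure (dual_factor (\<Gamma> i)) (A i)" for i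
 proof -
  have "A i \<inter> space (M' i) \<in> sets (M' i) \<and>
   emeasure (M' i) (A i \<inter> space (M' i)) = emeasure (dual_factor (\<Gamma> i)) (A i)"
  proof (cases "\<Gamma> i")
   case (Torus L)
   then have "M' i = count_space (lattice L)" by (simp add: M'_def)
   then show ?thesis
    unfolding Torus emeasure_dual_torus[OF A] by (simp add: emeasure_count_space)
  qed (use A in \<open>simp add: M'_def\<close>)
  then show "A i \<inter> space (M' i) \<in> sets (M' i)"
   "emeasure (M' i) (A i \<inter> space (M' i)) = emeasure (dual_factor (\<Gamma> i)) (A i)" by auto
 qed
 have "emeasure dm {x. \<forall>i. x $ i \<in> A i} = emeasure (PiM UNIV M') (PiE UNIV (%i. A i \<inter> space (M' i)))"
  unfolding dm using A
  by (subst emeasure_distr[OF vl]) (auto simp: space_PiM intro!: arg_cong2[where f=emeasure])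
 also have "... = (\<Prod>i\<in>UNIV. emeasure (dual_factor (\<Gamma> i)) (A i))"
  using fac by (subst M'.emeasure_PiM) auto
 finally show "emeasure dm {x. \<forall>i. x $ i \<in> A i} = (\<Prod>i\<in>UNIV. emeasure (dual_factor (\<Gamma> i)) (A i))" .
qed

lemma sets_dm [simp, measurable_cong]: "sets dm = sets borel"
 and space_dm [simp]: "space dm = UNIV"
 by (simp_all add: dual_measure_eq)

lemma sigma_finite_dm: "sigma_finite_measure dm"
 unfolding dual_measure_eq by (rule D.sigma_finite_vprod)

lemma sigma_finite_gm: "sigma_finite_measure gm"
 unfolding gm_def by (rule G.sigma_finite_vprod)

lemma AE_dm_lattice: "AE xi in dm. \<forall>i L. \<Gamma> i = Torus L \<longrightarrow> xi $ i \<in> lattice L"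
 using D.AE_vprod[OF AE_dual_factor_lattice] unfolding dual_measure_eq by auto

lemma AE_gm_domain: "AE x in gm. \<forall>i L. \<Gamma> i = Torus L \<longrightarrow> 0 < x $ i \<and> x $ i < L"
proof -
 have "AE t in group_factor f. \<forall>L. f = Torus L \<longrightarrow> 0 < t \<and> t < L" for f
 proof (cases f)
  case (Torus L)
  have "AE t in lborel. t ~= (0::real)" by (rule AE_lborel_singleton)
  then have "AE t in density lborel (indicator {0..<L}). 0 < t \<and> t < L"
   by (subst AE_density) (auto simp: indicator_def elim: AE_mp)
  then show ?thesis unfolding Torus factor_simps by simp
 qed simp
 from G.AE_vprod[OF this] show ?thesis unfolding gm_def by auto
qed

definition fund :: "(real ^ 'n) set" where
 "fund = {x. \<forall>i L. \<Gamma> i = Torus L \<longrightarrow> 0 <= x $ i \<and> x $ i < L}"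

lemma fund_alt: "fund = {x. \<forall>i. x $ i \<in> (case \<Gamma> i of Line => UNIV | Torus L => {0..<L})}"
 by (auto simp: fund_def split: factor.splits; metis factor.exhaust)

lemma fund_measurable [measurable]: "fund \<in> sets borel"
 unfolding fund_alt by (rule measurable_box) (simp split: factor.split)

lemma gm_eq_density: "gm = density lborel (indicator fund)"
proof -
 define f :: "'n => real => ennreal" where "f i = (case \<Gamma> i of Line => (%_. 1) | Torus L => indicator {0..<L})" for i
 have gf: "group_factor (\<Gamma> i) = density lborel (f i)" for i
  by (cases "\<Gamma> i") (simp_all add: f_def density_1)
 have f: "f i \<in> Borel" for i
  unfolding f_def by (cases "\<Gamma> i") simp_all
 have ind: "(\<Prod>i\<in>UNIV. f i (x $ i)) = indicator fund x" for x
 proof -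
  have "f i (x $ i) = indicator (case \<Gamma> i of Line => UNIV | Torus L => {0..<L}) (x $ i)" for i
   by (simp add: f_def split: factor.split)
  then show ?thesis
   by (auto simp: fund_alt indicator_def)
 qed
 have "gm = vprod (%i. density lborel (f i))" by (simp add: gm_def gf)
 also have "... = density (vprod (%_. lborel)) (%x. \<Prod>i\<in>UNIV. f i (x $ i))"
  by (rule vprod_density[OF f real_measures_lborel]) (simp add: gf[symmetric] G.real_measures_axioms)
 finally show ?thesis by (simp add: ind lborel_eq_vprod[symmetric])
qed

lemma
 fixes f :: "real ^ 'n => 'b::{banach, second_countable_topology}"
 assumes f: "f \<in> Borel"
 shows integrable_gm_lborel: "integrable gm f \<longleftrightarrow> integrable lborel (\<lambda>x. indicator fund x *\<^sub>R f x)"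
  and integral_gm_lborel: "integral\<^sup>L gm f = (LINT x|lborel. indicator fund x *\<^sub>R f x)"
proof -
 have "gm = density lborel (%x. ennreal (indicator fund x))"
  unfolding gm_eq_density by (simp add: ennreal_indicator)
 then show "integrable gm f \<longleftrightarrow> integrable lborel (%x. indicator fund x *\<^sub>R f x)"
  "integral\<^sup>L gm f = (LINT x|lborel. indicator fund x *\<^sub>R f x)"
  using f by (simp_all add: integrable_density integral_density)
qed

lemma
 fixes f :: "real ^ 'n => 'b::{banach, second_countable_topology}"
 assumes f: "f \<in> Borel"
 shows integrable_group: "integrable (group_measure \<Gamma>) f \<longleftrightarrow> integrable gm f"
  and integral_group: "integral\<^sup>L (group_measure \<Gamma>) f = integral\<^sup>L gm f"
 unfolding integrable_gm_lborel[OF f] integral_gm_lborel[OF f]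
 unfolding group_measure_def fund_def[symmetric]
 by (simp_all add: integrable_restrict_space integral_restrict_space)

section \<open>Integrability of weights\<close>

lemma integrable_dm_weight:
 assumes "2 * s > real CARD('n)"
 shows "integrable dm (\<lambda>xi. (1 + (norm xi)\<^sup>2) powr (- s))"
proof -
 define p where "p = s / real CARD('n)"
 have p: "p > 1 / 2" using assms by (simp add: p_def field_simps)
 have s: "s = p * real CARD('n)" by (simp add: p_def)
 have "integrable (vprod (%i. dual_factor (\<Gamma> i))) (%xi. \<Prod>i\<in>UNIV. (1 + (xi $ i)\<^sup>2) powr (- p))"
  by (rule D.integrable_vprod_prod[where f = "%_ t. (1 + t\<^sup>2) powr (- p)"])
   (rule integrable_weight_dual_factor[OF p pos])
 then show ?thesis
  unfolding dual_measure_eq[symmetric]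
 proof (rule integrable_bound)
  show "AE xi in dm. norm ((1 + (norm xi)\<^sup>2) powr (- s)) <= norm (\<Prod>i\<in>UNIV. (1 + (xi $ i)\<^sup>2) powr (- p))"
   using weight_prod_bound[of p] p by (auto simp: s prod_nonneg)
 qed measurable
qed

lemma integrable_dm_weight_nat: "integrable dm (\<lambda>xi. 1 / (1 + norm xi) ^ (2 * CARD('n)))"
proof -
 have "integrable dm (%xi. (1 + (norm xi)\<^sup>2) powr (- real CARD('n)))"
  by (rule integrable_dm_weight) simp
 then show ?thesis
 proof (rule integrable_bound)
  have "1 / (1 + norm xi) ^ (2 * CARD('n)) <= (1 + (norm xi)\<^sup>2) powr (- real CARD('n))" for xi :: "real^'n"
  proof -
   have pos: "0 < 1 + (norm xi)\<^sup>2" by (simp add: add_pos_nonneg)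
   have "(1 + (norm xi)\<^sup>2) ^ CARD('n) <= ((1 + norm xi)\<^sup>2) ^ CARD('n)"
    by (intro power_mono) (auto simp: power2_sum)
   then have "1 / ((1 + norm xi)\<^sup>2) ^ CARD('n) <= 1 / (1 + (norm xi)\<^sup>2) ^ CARD('n)"
    using pos by (intro divide_left_mono) (auto intro!: mult_pos_pos add_pos_nonneg zero_less_power)
   also have "1 / (1 + (norm xi)\<^sup>2) ^ CARD('n) = (1 + (norm xi)\<^sup>2) powr (- real CARD('n))"
    using pos by (simp add: powr_minus powr_realpow inverse_eq_divide)
   finally show ?thesis by (simp add: power_mult)
  qed
  then show "AE xi in dm. norm (1 / (1 + norm xi) ^ (2 * CARD('n))) <= norm ((1 + (norm xi)\<^sup>2) powr (- real CARD('n)))"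
   by auto
 qed measurable
qed

lemma real_part_norm_measurable [measurable]: "real_part_norm \<Gamma> \<in> Borel"
 by (intro borel_measurable_continuous_onI continuous_real_part_norm)

lemma integrable_gm_weight_nat: "integrable gm (\<lambda>x. 1 / growth \<Gamma> x ^ (2 * CARD('n)))"
proof -
 define q :: "'n => real => real" where "q i t = (case \<Gamma> i of Line => (1 + t\<^sup>2) powr (- 1) | Torus L => 1)" for i t
 have "integrable (group_factor (\<Gamma> i)) (q i)" for i
 proof (cases "\<Gamma> i")
  case Line
  then show ?thesis using integrable_weight_lborel[of 1] by (simp add: q_def[abs_def])
 next
  case (Torus L)
  then have "emeasure (group_factor (\<Gamma> i)) (space (group_factor (\<Gamma> i))) < \<infinity>"
   using pos by (cases "0 <= L") (simp_all add: emeasure_density)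
  then have "finite_measure (group_factor (\<Gamma> i))" by (intro finite_measureI) auto
  then have "integrable (group_factor (\<Gamma> i)) (%_. 1::real)"
   by (rule finite_measure.integrable_const)
  then show ?thesis by (simp add: q_def[abs_def] Torus)
 qed
 then have "integrable gm (%x. \<Prod>i\<in>UNIV. q i (x $ i))"
  unfolding gm_def by (rule G.integrable_vprod_prod)
 then show ?thesis
 proof (rule integrable_bound)
  have "1 / growth \<Gamma> x ^ (2 * CARD('n)) <= (\<Prod>i\<in>UNIV. q i (x $ i))" for x :: "real^'n"
  proof -
   let ?r = "real_part_norm \<Gamma> x"
   have "(\<Prod>i\<in>(UNIV::'n set). 1 / (1 + ?r)\<^sup>2) <= (\<Prod>i\<in>UNIV. q i (x $ i))"
   proof (intro prod_mono conjI)
    fix i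
    show "0 <= 1 / (1 + ?r)\<^sup>2" by simp
    have r: "0 <= ?r" by simp
    show "1 / (1 + ?r)\<^sup>2 <= q i (x $ i)"
    proof (cases "\<Gamma> i")
     case Line
     have "\<bar>x $ i\<bar> <= ?r" using Line by (intro real_part_norm_ge)
     then have "(x $ i)\<^sup>2 <= ?r\<^sup>2" using power_mono[of "\<bar>x $ i\<bar>" ?r 2] by simp
     then have "1 + (x $ i)\<^sup>2 <= (1 + ?r)\<^sup>2" unfolding power2_sum using real_part_norm_nonneg[of \<Gamma> x] by (simp del: real_part_norm_nonneg)
     moreover have "0 < 1 + (x $ i)\<^sup>2" by (simp add: add_pos_nonneg)
     ultimately have "1 / (1 + ?r)\<^sup>2 <= 1 / (1 + (x $ i)\<^sup>2)"
      by (intro divide_left_mono mult_pos_pos) auto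
     then show ?thesis by (simp add: q_def Line powr_minus_divide \<open>0 < 1 + (x $ i)\<^sup>2\<close>)
    next
     case (Torus L)
     have "1 <= (1 + ?r)\<^sup>2" using r by (simp add: one_le_power)
     then have "1 / (1 + ?r)\<^sup>2 <= 1" by (metis divide_le_eq_1 not_one_le_zero order_less_le_trans zero_less_one)
     then show ?thesis by (simp add: q_def Torus)
    qed
   qed
   then show ?thesis by (simp add: power_mult power_one_over)
  qed
  then show "AE x in gm. norm (1 / growth \<Gamma> x ^ (2 * CARD('n))) <= norm (\<Prod>i\<in>UNIV. q i (x $ i))"
   by (auto intro!: order_trans[OF _ abs_ge_self])
 qed measurable
qed

lemma integrable_gm_schwartz:
 assumes "phi \<in> schwartz \<Gamma>"
 shows "integrable gm (\<lambda>x. of_real (growth \<Gamma> x ^ k) * phi x)"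
proof -
 obtain B where B: "!!x. growth \<Gamma> x ^ (2 * CARD('n) + k) * cmod (iter_partial [] phi x) <= B"
  using schwartz_bound[OF assms] by metis
 have 1: "growth \<Gamma> x ^ (2 * CARD('n)) * cmod (of_real (growth \<Gamma> x ^ k) * phi x) <= B" for x
  using B[of x]
  by (simp add: norm_mult power_add mult.assoc norm_power add_nonneg_nonneg del: of_real_power of_real_add)
 have "phi \<in> Borel"
  by (intro borel_measurable_continuous_onI smooth_fun_continuous schwartz_smooth[OF assms])
 then have 2: "(%x. of_real (growth \<Gamma> x ^ k) * phi x) \<in> borel_measurable gm"
  by measurable
 show ?thesis
  by (rule integrable_if_decay[OF integrable_gm_weight_nat _ 2 1]) simp
qed

lemma integrable_dm_schwartz:
 assumes "phi \<in> schwartz (\<lambda>_. Line)"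
 shows "integrable dm (\<lambda>x. of_real ((1 + norm x) ^ k) * phi x)"
proof -
 obtain B where B: "!!x. growth (%_. Line) x ^ (2 * CARD('n) + k) * cmod (iter_partial [] phi x) <= B"
  using schwartz_bound[OF assms] by metis
 have 1: "(1 + norm x) ^ (2 * CARD('n)) * cmod (of_real ((1 + norm x) ^ k) * phi x) <= B" for x
  using B[of x]
  by (simp add: norm_mult power_add mult.assoc norm_power add_nonneg_nonneg del: of_real_power of_real_add)
 have "phi \<in> Borel"
  by (intro borel_measurable_continuous_onI smooth_fun_continuous schwartz_smooth[OF assms])
 then have 2: "(%x. of_real ((1 + norm x) ^ k) * phi x) \<in> borel_measurable dm"
  by measurable
 show ?thesis
  by (rule integrable_if_decay[OF integrable_dm_weight_nat _ 2 1]) simp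
qed

lemma integrable_dm_bounded_support:
 fixes f :: "real ^ 'n => 'b::{banach,second_countable_topology}"
 assumes f: "f \<in> Borel" and B: "!!x. norm (f x) <= B" and R: "!!x. f x ~= 0 ==> norm x <= R"
 shows "integrable dm f"
proof (rule integrable_if_decay[OF integrable_dm_weight_nat])
 have B0: "0 <= B" using B[of 0] norm_ge_zero order_trans by blast
 show "(1 + norm x) ^ (2 * CARD('n)) * norm (f x) <= (1 + \<bar>R\<bar>) ^ (2 * CARD('n)) * B" for x
 proof (cases "f x = 0")
  case False
  then have "norm x <= \<bar>R\<bar>" using R[of x] by simp
  then show ?thesis using B[of x] by (intro mult_mono power_mono) auto
 qed (use B0 in simp)
qed (use f in auto)

section \<open>Invariance of the dual measure\<close>

lemma dual_factor_bij_invariant: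
 assumes h: "h \<in> Borel" "bij h" "h ` lattice L = lattice L"
 shows "distr (dual_factor (Torus L)) borel h = dual_factor (Torus L)"
proof (rule measure_eqI)
 fix A assume "A \<in> sets (distr (dual_factor (Torus L)) borel h)"
 then have A: "A \<in> sets borel" by simp
 have im: "h ` (h -` A \<inter> lattice L) = A \<inter> lattice L"
 proof (intro equalityI subsetI)
  fix x assume x: "x \<in> A \<inter> lattice L"
  then obtain y where "y \<in> lattice L" "x = h y" using h(3) by blast
  with x show "x \<in> h ` (h -` A \<inter> lattice L)" by blast
 qed (use h(3) in blast)
 have inj: "inj_on h (h -` A \<inter> lattice L)" using h by (meson bij_is_inj inj_on_subset subset_UNIV)
 have "emeasure (distr (dual_factor (Torus L)) borel h) A = emeasure (count_space UNIV) (h -` A \<inter> lattice L)"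
  using A measurable_sets[OF h(1) A] h(1)
  by (subst emeasure_distr) (simp_all add: emeasure_dual_torus del: factor_simps)
 also have "... = emeasure (count_space UNIV) (h ` (h -` A \<inter> lattice L))"
  using inj by (simp add: emeasure_count_space card_image finite_image_iff)
 finally show "emeasure (distr (dual_factor (Torus L)) borel h) A = emeasure (dual_factor (Torus L)) A"
  using A by (simp add: im emeasure_dual_torus del: factor_simps)
qed simp

lemma lattice_add: "x \<in> lattice L ==> y \<in> lattice L ==> x + y \<in> lattice L"
 unfolding lattice_def by (auto simp: add_divide_distrib[symmetric] of_int_add[symmetric] simp del: of_int_add)

lemma lattice_uminus: "x \<in> lattice L ==> - x \<in> lattice L"
 unfolding lattice_def by (auto simp: minus_divide_left of_int_minus[symmetric] simp del: of_int_minus)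

lemma dm_translate:
 assumes "!!i L. \<Gamma> i = Torus L ==> a $ i \<in> lattice L"
 shows "distr dm borel (\<lambda>xi. xi + a) = dm"
proof -
 have "distr (dual_factor (\<Gamma> i)) borel (%t. t + a $ i) = dual_factor (\<Gamma> i)" for i
 proof (cases "\<Gamma> i")
  case Line
  have "(%t. t + a $ i) = (+) (a $ i)" by auto
  then show ?thesis by (simp add: Line lborel_distr_plus)
 next
  case (Torus L)
  have "bij (%t. t + a $ i)" by (rule o_bij[of "%t. t - a $ i"]) auto
  moreover have "(%t. t + a $ i) ` lattice L = lattice L"
  proof -
   have "x \<in> (%t. t + a $ i) ` lattice L" if "x \<in> lattice L" for x
    using lattice_add[OF that lattice_uminus[OF assms[OF Torus]]] by force
   then show ?thesis using assms[OF Torus] by (auto intro: lattice_add)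
  qed
  ultimately show ?thesis unfolding Torus by (intro dual_factor_bij_invariant) auto
 qed
 then have "distr (vprod (%i. dual_factor (\<Gamma> i))) borel (%x. \<chi> i. x $ i + a $ i) = vprod (%i. dual_factor (\<Gamma> i))"
  by (intro distr_vprod D.real_measures_axioms) auto
 moreover have "(%x. \<chi> i. x $ i + a $ i) = (%x. x + a)" by (auto simp: vec_eq_iff)
 ultimately show ?thesis by (simp add: dual_measure_eq)
qed

lemma dm_reflect: "distr dm borel uminus = dm"
proof -
 have "distr (dual_factor (\<Gamma> i)) borel uminus = dual_factor (\<Gamma> i)" for i
 proof (cases "\<Gamma> i")
  case Line
  then show ?thesis by (simp add: lborel_distr_uminus)
 next
  case (Torus L)
  have "bij (uminus :: real => real)" by (rule o_bij[of uminus]) auto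
  moreover have "uminus ` lattice L = lattice L"
   using lattice_uminus by (force simp: image_iff)
  ultimately show ?thesis unfolding Torus by (intro dual_factor_bij_invariant) auto
 qed
 then have "distr (vprod (%i. dual_factor (\<Gamma> i))) borel (%x. \<chi> i. - (x $ i)) = vprod (%i. dual_factor (\<Gamma> i))"
  by (intro distr_vprod D.real_measures_axioms) auto
 moreover have "(%x. \<chi> i. - (x $ i)) = (uminus :: real^'n => real^'n)" by (auto simp: vec_eq_iff)
 ultimately show ?thesis by (simp add: dual_measure_eq)
qed

definition round_vec :: "real ^ 'n => real ^ 'n" where
 "round_vec x = (\<chi> i. round_dual (\<Gamma> i) (x $ i))"

text \<open>
 A lattice point has a unit interval of preimages under rounding, so counting measure is an image of
 Lebesgue measure. Hence a map that preserves Lebesgue measure and commutes with the rounding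
 preserves the dual measure; rotations of the real coordinates are of this kind.
\<close>

lemma dm_eq_distr_lborel: "dm = distr lborel borel round_vec"
proof -
 have "distr lborel borel (round_dual (\<Gamma> i)) = dual_factor (\<Gamma> i)" for i
 proof (cases "\<Gamma> i")
  case Line
  have "round_dual Line = (%x. x)" by (auto simp: fun_eq_iff)
  then show ?thesis using Line distr_id2[of borel lborel] by simp
 next
  case (Torus L)
  with dual_torus_eq_distr[OF pos[OF Torus]] show ?thesis by (simp del: factor_simps)
 qed
 then show ?thesis
  unfolding dual_measure_eq lborel_eq_vprod round_vec_def[abs_def]
  by (intro distr_vprod[symmetric] D.real_measures_axioms real_measures_lborel) auto
qed

end

lemma orthogonal_measurable:
 fixes A :: "'a::euclidean_space => 'a"
 assumes A: "orthogonal_transformation A"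
 shows "A \<in> Borel"
 using A orthogonal_transformation_linear linear_continuous_on linear_conv_bounded_linear
 by (intro borel_measurable_continuous_onI) blast

text \<open>
 By the Vitali covering theorem an open set is a countable disjoint union of balls up to a null set.
 An orthogonal map takes a ball to a ball of the same radius, and balls of equal radius have equal
 measure.
\<close>

lemma emeasure_orthogonal_le:
 fixes A :: "'a::euclidean_space => 'a"
 assumes A: "orthogonal_transformation A" and U: "open U"
 shows "emeasure lborel U <= emeasure lborel (A ` U)"
proof -
 have balls: "emeasure lborel (ball (A x) r) = emeasure lborel (ball x r)" for x r
 proof -
  have "emeasure lborel (ball (A x) r) = emeasure (distr lborel borel ((+) (A x - x))) (ball (A x) r)"
   by (simp add: lborel_distr_plus)
  also have "... = emeasure lborel ((+) (A x - x) -` ball (A x) r)"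
   by (subst emeasure_distr) auto
  also have "(+) (A x - x) -` ball (A x) r = ball x r"
   by (auto simp: dist_norm algebra_simps)
  finally show ?thesis .
 qed
 define K where "K = {(x, r). ball x r \<subseteq> U}"
 have vit: "\<exists>i. i \<in> K \<and> x \<in> ball (fst i) (snd i) \<and> snd i < d" if x: "x \<in> U" and d: "d > 0" for x and d :: real
 proof -
  obtain e where "e > 0" "ball x e \<subseteq> U" using U x openE by blast
  then show ?thesis using d by (intro exI[of _ "(x, min e (d / 2))"]) (auto simp: K_def)
 qed
 obtain C where C: "countable C" "C \<subseteq> K"
  and dis: "pairwise (%i j. disjnt (ball (fst i) (snd i)) (ball (fst j) (snd j))) C"
  and neg: "negligible (U - (\<Union>i\<in>C. ball (fst i) (snd i)))"
  by (rule Vitali_covering_theorem_balls[of U K fst snd, OF vit])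
 let ?B = "%i. ball (fst i) (snd i)"
 have dB: "disjoint_family_on ?B C"
  using dis unfolding disjoint_family_on_def pairwise_def disjnt_def by blast
 have Um: "(\<Union>i\<in>C. ?B i) \<in> sets borel" by (intro borel_open open_UN) simp
 have inj: "inj A" using A orthogonal_transformation_inj by blast
 have AB: "A ` ?B i = ball (A (fst i)) (snd i)" for i
  by (rule image_orthogonal_transformation_ball[OF A])
 have dAB: "disjoint_family_on (%i. A ` ?B i) C"
  using dB inj unfolding disjoint_family_on_def by (metis image_Int image_empty)
 have AUo: "open (A ` U)"
  using U orthogonal_transformation_surj[OF A] orthogonal_transformation_linear[OF A]
  by (intro open_surjective_linear_image) auto
 have "U - (\<Union>i\<in>C. ?B i) \<in> null_sets lborel"
  using neg U Um unfolding negligible_iff_null_sets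
  by (subst (asm) null_sets_completion_iff) (simp_all add: sets.Diff)
 then have nul: "emeasure lborel (U - (\<Union>i\<in>C. ?B i)) = 0" by (rule null_setsD1)
 have Ub: "U \<in> sets lborel" "U - (\<Union>i\<in>C. ?B i) \<in> sets lborel" "(\<Union>i\<in>C. ?B i) \<in> sets lborel"
  using U Um by auto
 have "emeasure lborel U <= emeasure lborel ((\<Union>i\<in>C. ?B i) \<union> (U - (\<Union>i\<in>C. ?B i)))"
  by (rule emeasure_mono) (use Ub in blast)+
 also have "... <= emeasure lborel (\<Union>i\<in>C. ?B i) + emeasure lborel (U - (\<Union>i\<in>C. ?B i))"
  by (rule emeasure_subadditive) (fact Ub)+
 also have "... = emeasure lborel (\<Union>i\<in>C. ?B i)" by (simp only: nul add_0_right)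
 also have "... = (\<integral>\<^sup>+i. emeasure lborel (?B i) \<partial>count_space C)"
  using C dB by (subst emeasure_UN_countable) auto
 also have "... = (\<integral>\<^sup>+i. emeasure lborel (A ` ?B i) \<partial>count_space C)"
  by (simp only: AB balls)
 also have "... = emeasure lborel (\<Union>i\<in>C. A ` ?B i)"
  using C dAB by (subst emeasure_UN_countable) (auto simp: AB)
 also have "... <= emeasure lborel (A ` U)"
 proof (rule emeasure_mono)
  have "?B i \<subseteq> U" if "i \<in> C" for i using C(2) that by (force simp: K_def)
  then show "(\<Union>i\<in>C. A ` ?B i) \<subseteq> A ` U" by blast
 qed (use AUo in simp)
 finally show ?thesis .
qed

lemma lborel_orthogonal:
 fixes A :: "'a::euclidean_space => 'a"
 assumes A: "orthogonal_transformation A"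
 shows "distr lborel borel A = lborel"
proof (rule lborel_eqI[symmetric])
 note Am = orthogonal_measurable[OF A]
 fix l u :: 'a assume lu: "!!b. b \<in> Basis ==> l \<bullet> b <= u \<bullet> b"
 have bij: "bij A" by (rule orthogonal_transformation_bij[OF A])
 have inv: "orthogonal_transformation (inv A)" by (rule orthogonal_transformation_inv[OF A])
 have vi: "A -` box l u = inv A ` box l u"
  by (rule bij_vimage_eq_inv_image[OF bij])
 have ii: "A ` (inv A ` box l u) = box l u"
  using bij by (simp add: image_f_inv_f bij_is_surj)
 have op: "open (inv A ` box l u)"
  using orthogonal_transformation_surj[OF inv] orthogonal_transformation_linear[OF inv]
  by (intro open_surjective_linear_image) auto
 have "emeasure lborel (A -` box l u) = emeasure lborel (box l u)"
  using emeasure_orthogonal_le[OF A op] emeasure_orthogonal_le[OF inv open_box, of l u]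
  unfolding vi ii by (rule antisym)
 then show "emeasure (distr lborel borel A) (box l u) = ennreal (\<Prod>b\<in>Basis. (u - l) \<bullet> b)"
  using Am lu by (simp add: emeasure_distr)
qed simp

lemma (in lca) dm_orthogonal:
 assumes A: "orthogonal_transformation A" and comm: "!!x. A (round_vec x) = round_vec (A x)"
 shows "distr dm borel A = dm"
proof -
 note Am = orthogonal_measurable[OF A]
 have rm: "round_vec \<in> Borel"
  unfolding round_vec_def[abs_def] by (intro measurable_vec_lambda_fun) measurable
 have "distr dm borel A = distr lborel borel (A \<circ> round_vec)"
  unfolding dm_eq_distr_lborel using Am rm by (subst distr_distr) auto
 also have "A \<circ> round_vec = round_vec \<circ> A" using comm by auto
 also have "distr lborel borel (round_vec \<circ> A) = distr (distr lborel borel A) borel round_vec"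
  using Am rm by (subst distr_distr) auto
 finally show ?thesis by (simp add: lborel_orthogonal[OF A] dm_eq_distr_lborel)
qed

section \<open>Oscillatory integrals\<close>

text \<open>
 With the dual or the group measure and \<open>c = \<plusminus>2 * pi\<close> this is, up to normalisation, the transform,
 its inverse or its transpose, so that one theory of differentiation under the integral serves all.
\<close>

definition osc :: "(real ^ 'n::finite) measure => real => (real ^ 'n => complex) => real ^ 'n => complex" where
 "osc M c psi x = (LINT xi|M. psi xi * cis (c * (xi \<bullet> x)))"

text \<open>
 What is needed to differentiate an oscillatory integral arbitrarily often.
\<close>

definition rapid :: "(real ^ 'n::finite) measure => (real ^ 'n => complex) => bool" where
 "rapid M psi \<longleftrightarrow> psi \<in> borel_measurable M \<and> (\<forall>k. integrable M (\<lambda>xi. of_real ((1 + norm xi) ^ k) * psi xi))"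

lemma rapid_integrable: "rapid M psi ==> integrable M psi"
 unfolding rapid_def by (metis (no_types, lifting) Bochner_Integration.integrable_cong mult_1 of_real_1 power_0)

lemma cis_measurable_osc [measurable]: "(\<lambda>xi::real^'n::finite. cis (c * (xi \<bullet> x))) \<in> Borel"
 unfolding cis_conv_exp by (intro borel_measurable_continuous_onI continuous_intros)

lemma integrable_osc:
 fixes M :: "(real ^ 'n::finite) measure"
 assumes "integrable M psi" "sets M = sets borel"
 shows "integrable M (\<lambda>xi. psi xi * cis (c * (xi \<bullet> x)))"
proof (rule integrable_bound[OF assms(1)])
 have [measurable]: "(%xi. cis (c * (xi \<bullet> x))) \<in> borel_measurable M"
  by (subst measurable_cong_sets[OF assms(2) refl]) (rule cis_measurable_osc)
 show "(%xi. psi xi * cis (c * (xi \<bullet> x))) \<in> borel_measurable M"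
  using borel_measurable_integrable[OF assms(1)] by measurable
qed (simp add: norm_mult)

lemma rapid_mult:
 assumes r: "rapid M psi" and s: "sets M = sets borel"
  and g: "g \<in> Borel" and b: "!!xi. cmod (g xi) <= C * (1 + norm xi) ^ m"
 shows "rapid M (\<lambda>xi. g xi * psi xi)"
 unfolding rapid_def
proof (intro conjI allI)
 have [measurable]: "psi \<in> borel_measurable M" using r by (simp add: rapid_def)
 have [measurable]: "g \<in> borel_measurable M" using g s by (simp cong: measurable_cong_sets)
 have [measurable]: "norm \<in> borel_measurable M"
  by (subst measurable_cong_sets[OF s refl]) simp
 show "(%xi. g xi * psi xi) \<in> borel_measurable M" by measurable
 fix k
 have "integrable M (%xi. C * (of_real ((1 + norm xi) ^ (m + k)) * psi xi))"
  using r unfolding rapid_def by (intro integrable_mult_right) blast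
 then show "integrable M (%xi. of_real ((1 + norm xi) ^ k) * (g xi * psi xi))"
 proof (rule integrable_bound)
  have "cmod (of_real ((1 + norm xi) ^ k) * (g xi * psi xi)) <= cmod (C * (of_real ((1 + norm xi) ^ (m + k)) * psi xi))" for xi
  proof -
   have "cmod (g xi) <= \<bar>C\<bar> * (1 + norm xi) ^ m"
    using b[of xi] by (meson abs_ge_self mult_right_mono norm_ge_zero order_trans zero_le_power add_nonneg_nonneg zero_le_one)
   then have "(1 + norm xi) ^ k * (cmod (g xi) * cmod (psi xi)) <= (1 + norm xi) ^ k * ((\<bar>C\<bar> * (1 + norm xi) ^ m) * cmod (psi xi))"
    by (intro mult_left_mono mult_right_mono) (auto intro: zero_le_power add_nonneg_nonneg)
   then show ?thesis
    by (simp add: norm_mult norm_power power_add algebra_simps del: of_real_power of_real_add)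
  qed
  then show "AE xi in M. cmod (of_real ((1 + norm xi) ^ k) * (g xi * psi xi)) <= cmod (C * (of_real ((1 + norm xi) ^ (m + k)) * psi xi))"
   by simp
 qed measurable
qed

lemma rapid_mult_nth:
 assumes "rapid M psi" "sets M = sets borel"
 shows "rapid M (\<lambda>xi. (a * of_real (xi $ i)) * psi xi)"
proof (rule rapid_mult[OF assms, where m = 1 and C = "cmod a"])
 fix xi :: "real ^ 'a"
 show "cmod (a * of_real (xi $ i)) <= cmod a * (1 + norm xi) ^ 1"
  using component_le_norm_cart[of xi i] by (simp add: norm_mult mult_left_mono)
qed measurable

lemma cis_taylor2: "cmod (cis (theta + delta) - cis theta - \<i> * delta * cis theta) <= delta\<^sup>2 / 2"
proof -
 have "cmod (iexp delta - (\<Sum>k \<le> 1. (\<i> * delta)^k / fact k)) <= \<bar>delta\<bar>^(Suc 1) / fact (Suc 1)"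
  by (rule iexp_approx1)
 then have "cmod (cis delta - 1 - \<i> * delta) <= delta\<^sup>2 / 2"
  by (simp add: cis_conv_exp power2_eq_square diff_diff_eq)
 moreover have "cis (theta + delta) - cis theta - \<i> * delta * cis theta = cis theta * (cis delta - 1 - \<i> * delta)"
  by (simp add: cis_mult[symmetric] algebra_simps)
 ultimately show ?thesis by (simp add: norm_mult)
qed

lemma osc_has_derivative:
 assumes r: "rapid M psi" and s: "sets M = sets borel"
 shows "(osc M c psi has_derivative
  (\<lambda>v. \<Sum>i\<in>UNIV. of_real (v $ i) * osc M c (\<lambda>xi. (\<i> * c * of_real (xi $ i)) * psi xi) x)) (at x)"
  (is "(_ has_derivative ?D) _")
 unfolding has_derivative_at
proof
 show "bounded_linear ?D"
 proof (rule bounded_linear_sum)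
  fix i
  have "bounded_linear (%v::real^'a. (v $ i) *\<^sub>R osc M c (%xi. (\<i> * c * of_real (xi $ i)) * psi xi) x)"
   by (rule bounded_linear_compose[OF bounded_linear_scaleR_left bounded_linear_vec_nth])
  then show "bounded_linear (%v. of_real (v $ i) * osc M c (%xi. (\<i> * c * of_real (xi $ i)) * psi xi) x)"
   by (simp add: scaleR_conv_of_real)
 qed
 have [measurable]: "psi \<in> borel_measurable M" using r by (simp add: rapid_def)
 have nm [measurable]: "norm \<in> borel_measurable M"
  by (subst measurable_cong_sets[OF s refl]) simp
 define K where "K = (LINT xi|M. cmod (of_real ((1 + norm xi) ^ 2) * psi xi))"
 have K: "integrable M (%xi. cmod (of_real ((1 + norm xi) ^ 2) * psi xi))"
  by (rule integrable_norm) (use r in \<open>simp add: rapid_def\<close>)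
 have K0: "K >= 0" unfolding K_def by (rule integral_nonneg_AE) simp
 have bound: "cmod (osc M c psi (x + h) - osc M c psi x - ?D h) <= c\<^sup>2 * K * (norm h)\<^sup>2" for h
 proof -
  have int: "integrable M (%xi. psi xi * cis (c * (xi \<bullet> y)))" for y
   by (rule integrable_osc[OF rapid_integrable[OF r] s])
  have inti: "integrable M (%xi. of_real (h $ i) * ((\<i> * c * of_real (xi $ i)) * psi xi * cis (c * (xi \<bullet> x))))" for i
   by (intro integrable_mult_right integrable_osc rapid_integrable rapid_mult_nth r s)
  have "?D h = (LINT xi|M. (\<Sum>i\<in>UNIV. of_real (h $ i) * ((\<i> * c * of_real (xi $ i)) * psi xi * cis (c * (xi \<bullet> x)))))"
   unfolding osc_def using inti
   by (subst Bochner_Integration.integral_sum) (auto intro!: sum.cong integral_mult_right_zero[symmetric] simp del: integral_mult_right)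
  also have "... = (LINT xi|M. psi xi * (\<i> * (c * (xi \<bullet> h)) * cis (c * (xi \<bullet> x))))"
   by (intro Bochner_Integration.integral_cong refl)
    (simp add: inner_vec_def sum_distrib_left sum_distrib_right algebra_simps)
  finally have D: "?D h = (LINT xi|M. psi xi * (\<i> * (c * (xi \<bullet> h)) * cis (c * (xi \<bullet> x))))" .
  have intD: "integrable M (%xi. psi xi * (\<i> * (c * (xi \<bullet> h)) * cis (c * (xi \<bullet> x))))"
  proof -
   have "integrable M (%xi. \<Sum>i\<in>UNIV. of_real (h $ i) * ((\<i> * c * of_real (xi $ i)) * psi xi * cis (c * (xi \<bullet> x))))"
    by (rule Bochner_Integration.integrable_sum) (rule inti)
   then show ?thesis
    by (simp add: inner_vec_def sum_distrib_left sum_distrib_right algebra_simps)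
  qed
  have "osc M c psi (x + h) - osc M c psi x - ?D h
    = (LINT xi|M. psi xi * (cis (c * (xi \<bullet> x) + c * (xi \<bullet> h)) - cis (c * (xi \<bullet> x)) - \<i> * (c * (xi \<bullet> h)) * cis (c * (xi \<bullet> x))))"
   unfolding D unfolding osc_def using int[of x] int[of "x + h"] intD
   by (simp add: right_diff_distrib inner_add_right distrib_left)
  also have "cmod ... <= (LINT xi|M. (c\<^sup>2 * (norm h)\<^sup>2) * cmod (of_real ((1 + norm xi) ^ 2) * psi xi))"
  proof (rule Bochner_Integration.integral_norm_bound_integral)
   show "integrable M (%xi. psi xi * (cis (c * (xi \<bullet> x) + c * (xi \<bullet> h)) - cis (c * (xi \<bullet> x)) - \<i> * (c * (xi \<bullet> h)) * cis (c * (xi \<bullet> x))))"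
    using int[of x] int[of "x + h"] intD
    by (simp add: right_diff_distrib inner_add_right distrib_left)
   show "integrable M (%xi. (c\<^sup>2 * (norm h)\<^sup>2) * cmod (of_real ((1 + norm xi) ^ 2) * psi xi))"
    by (intro integrable_mult_right K)
   fix xi
   have "cmod (cis (c * (xi \<bullet> x) + c * (xi \<bullet> h)) - cis (c * (xi \<bullet> x)) - \<i> * (c * (xi \<bullet> h)) * cis (c * (xi \<bullet> x))) <= (c * (xi \<bullet> h))\<^sup>2 / 2"
    using cis_taylor2[of "c * (xi \<bullet> x)" "c * (xi \<bullet> h)"] by simp
   also have "... <= (c * (xi \<bullet> h))\<^sup>2" by simp
   also have "... = c\<^sup>2 * \<bar>xi \<bullet> h\<bar>\<^sup>2" by (simp add: power_mult_distrib)
   also have "... <= c\<^sup>2 * (norm xi * norm h)\<^sup>2"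
    by (intro mult_left_mono power_mono Cauchy_Schwarz_ineq2) auto
   also have "... <= c\<^sup>2 * ((1 + norm xi) * norm h)\<^sup>2"
    by (intro mult_left_mono power_mono mult_right_mono) auto
   finally have "cmod (psi xi) * cmod (cis (c * (xi \<bullet> x) + c * (xi \<bullet> h)) - cis (c * (xi \<bullet> x)) - \<i> * (c * (xi \<bullet> h)) * cis (c * (xi \<bullet> x)))
    <= cmod (psi xi) * (c\<^sup>2 * ((1 + norm xi) * norm h)\<^sup>2)"
    by (intro mult_left_mono) auto
   moreover have "cmod (psi xi) * (c\<^sup>2 * ((1 + norm xi) * norm h)\<^sup>2) = (c\<^sup>2 * (norm h)\<^sup>2) * cmod (of_real ((1 + norm xi) ^ 2) * psi xi)"
    by (simp add: norm_mult norm_power power_mult_distrib mult_ac del: of_real_power of_real_add)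
   ultimately show "cmod (psi xi * (cis (c * (xi \<bullet> x) + c * (xi \<bullet> h)) - cis (c * (xi \<bullet> x)) - \<i> * (c * (xi \<bullet> h)) * cis (c * (xi \<bullet> x))))
    <= (c\<^sup>2 * (norm h)\<^sup>2) * cmod (of_real ((1 + norm xi) ^ 2) * psi xi)"
    by (simp only: norm_mult)
  qed
  also have "... = c\<^sup>2 * K * (norm h)\<^sup>2" by (simp add: K_def)
  finally show ?thesis .
 qed
 show "(%h. cmod (osc M c psi (x + h) - osc M c psi x - ?D h) / norm h) \<midarrow>0\<rightarrow> 0"
 proof (rule Lim_null_comparison)
  have "cmod (osc M c psi (x + h) - osc M c psi x - ?D h) / norm h <= c\<^sup>2 * K * norm h" if "h ~= 0" for h
   using bound[of h] that by (simp add: divide_le_eq power2_eq_square mult.assoc)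
  then show "\<forall>\<^sub>F h in at 0. norm (cmod (osc M c psi (x + h) - osc M c psi x - ?D h) / norm h) <= c\<^sup>2 * K * norm h"
   by (auto simp: eventually_at_filter intro!: always_eventually)
  show "((%h::real^'a. c\<^sup>2 * K * norm h) \<longlongrightarrow> 0) (at 0)"
   by (auto intro!: tendsto_eq_intros)
 qed
qed

lemma partial_deriv_osc:
 assumes "rapid M psi" "sets M = sets borel"
 shows "partial_deriv j (osc M c psi) = osc M c (\<lambda>xi. (\<i> * c * of_real (xi $ j)) * psi xi)"
proof
 fix x
 have "(\<Sum>i\<in>UNIV. of_real (axis j 1 $ i) * a i) = a j" for a :: "'a => complex"
  by (subst sum.remove[of _ j]) (auto simp: axis_def intro!: sum.neutral)
 then show "partial_deriv j (osc M c psi) x = osc M c (%xi. (\<i> * c * of_real (xi $ j)) * psi xi) x"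
  using partial_deriv_eqI[OF osc_has_derivative[OF assms], of j c x] by simp
qed

text \<open>
 The symbol of the differential operator \<open>iter_partial js\<close>.
\<close>

definition freq_monomial :: "real => 'n::finite list => real ^ 'n => complex" where
 "freq_monomial c js xi = prod_list (map (\<lambda>j. \<i> * c * of_real (xi $ j)) js)"

lemma rapid_freq_monomial:
 assumes "rapid M psi" "sets M = sets borel"
 shows "rapid M (\<lambda>xi. freq_monomial c js xi * psi xi)"
proof (induction js)
 case Nil then show ?case using assms by (simp add: freq_monomial_def)
next
 case (Cons j js)
 from rapid_mult_nth[OF this assms(2), of "\<i> * c" j] show ?case by (simp add: freq_monomial_def mult.assoc)
qed

lemma iter_partial_osc:
 assumes "rapid M psi" "sets M = sets borel"
 shows "iter_partial js (osc M c psi) = osc M c (\<lambda>xi. freq_monomial c js xi * psi xi)"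
proof (induction js)
 case Nil then show ?case by (simp add: freq_monomial_def)
next
 case (Cons j js)
 show ?case
  by (simp add: Cons partial_deriv_osc[OF rapid_freq_monomial[OF assms] assms(2)])
   (simp add: freq_monomial_def mult.assoc)
qed

lemma smooth_fun_osc:
 assumes "rapid M psi" "sets M = sets borel"
 shows "smooth_fun (osc M c psi)"
 unfolding smooth_fun_def iter_partial_osc[OF assms]
 using osc_has_derivative[OF rapid_freq_monomial[OF assms] assms(2)] differentiableI by blast

section \<open>Operations on Schwartz functions\<close>

lemma smooth_fun_cis_inner: "smooth_fun (\<lambda>x::real^'n::finite. cis (c * (a \<bullet> x)))"
 using smooth_fun_cis[of "%x. c * (a \<bullet> x)"] smooth_fun_inner[of "c *\<^sub>R a"] by simp

lemma partial_deriv_cis_inner: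
 "partial_deriv j (\<lambda>x::real^'n::finite. cis (c * (a \<bullet> x))) = (\<lambda>x. (\<i> * c * of_real (a $ j)) * cis (c * (a \<bullet> x)))"
proof
 fix x :: "real ^ 'n"
 have "((%x. c * (a \<bullet> x)) has_derivative (%v. c * (a \<bullet> v))) (at x)"
  by (auto intro!: derivative_eq_intros)
 moreover have "(cis has_derivative (%t. t *\<^sub>R (\<i> * cis (c * (a \<bullet> x))))) (at (c * (a \<bullet> x)))"
  unfolding has_vector_derivative_def[symmetric] cis_conv_exp
  by (auto intro!: derivative_eq_intros has_vector_derivative_real_field)
 ultimately have "((%x. cis (c * (a \<bullet> x))) has_derivative (%v. (c * (a \<bullet> v)) *\<^sub>R (\<i> * cis (c * (a \<bullet> x))))) (at x)"
  by (rule has_derivative_compose)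
 from partial_deriv_eqI[OF this, of j]
 show "partial_deriv j (%x. cis (c * (a \<bullet> x))) x = (\<i> * c * of_real (a $ j)) * cis (c * (a \<bullet> x))"
  by (simp add: inner_axis scaleR_conv_of_real mult_ac)
qed

lemma iter_partial_snoc: "iter_partial (js @ [j]) f = iter_partial js (partial_deriv j f)"
 by (simp add: iter_partial_append)

lemma schwartz_mult_cis:
 assumes phi: "phi \<in> schwartz \<Gamma>" and per: "periodic_on \<Gamma> (\<lambda>x. cis (c * (a \<bullet> x)))"
 shows "(\<lambda>x. phi x * cis (c * (a \<bullet> x))) \<in> schwartz \<Gamma>"
proof (rule schwartzI)
 show "smooth_fun (%x. phi x * cis (c * (a \<bullet> x)))"
  by (intro smooth_fun_mult schwartz_smooth[OF phi] smooth_fun_cis_inner)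
 show "periodic_on \<Gamma> (%x. phi x * cis (c * (a \<bullet> x)))"
  using schwartz_periodic[OF phi] per by (simp add: periodic_on_def)
 fix N js
 have "\<forall>phi \<in> schwartz \<Gamma>. \<exists>B. \<forall>x. growth \<Gamma> x ^ N * cmod (iter_partial js (%x. phi x * cis (c * (a \<bullet> x))) x) <= B"
 proof (induction js rule: rev_induct)
  case Nil
  show ?case
  proof
   fix phi assume "phi \<in> schwartz \<Gamma>"
   then obtain B where "!!x. growth \<Gamma> x ^ N * cmod (iter_partial [] phi x) <= B"
    using schwartz_bound by metis
   then show "\<exists>B. \<forall>x. growth \<Gamma> x ^ N * cmod (iter_partial [] (%x. phi x * cis (c * (a \<bullet> x))) x) <= B"
    by (auto simp: norm_mult)
  qed
 next
  case (snoc j js)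
  show ?case
  proof
   fix phi assume phi: "phi \<in> schwartz \<Gamma>"
   let ?psi = "%x. partial_deriv j phi x + (\<i> * c * of_real (a $ j)) * phi x"
   have psi: "?psi \<in> schwartz \<Gamma>"
    by (intro schwartz_add schwartz_scale schwartz_partial_deriv phi)
   have "partial_deriv j (%x. phi x * cis (c * (a \<bullet> x))) = (%x. ?psi x * cis (c * (a \<bullet> x)))"
   proof
    fix x
    show "partial_deriv j (%x. phi x * cis (c * (a \<bullet> x))) x = ?psi x * cis (c * (a \<bullet> x))"
     by (subst partial_deriv_mult)
      (simp_all add: smooth_fun_differentiable schwartz_smooth[OF phi] smooth_fun_cis_inner
       partial_deriv_cis_inner algebra_simps)
   qed
   then show "\<exists>B. \<forall>x. growth \<Gamma> x ^ N * cmod (iter_partial (js @ [j]) (%x. phi x * cis (c * (a \<bullet> x))) x) <= B"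
    using snoc psi by (simp only: iter_partial_snoc)
  qed
 qed
 then show "\<exists>B. \<forall>x. growth \<Gamma> x ^ N * cmod (iter_partial js (%x. phi x * cis (c * (a \<bullet> x))) x) <= B"
  using phi by blast
qed

lemma partial_deriv_nth: "partial_deriv j (\<lambda>x::real^'n::finite. complex_of_real (x $ i)) = (\<lambda>x. if i = j then 1 else 0)"
proof
 fix x :: "real ^ 'n"
 have "((%x::real^'n. complex_of_real (x $ i)) has_derivative (%v. complex_of_real (v $ i))) (at x)"
  by (rule bounded_linear_imp_has_derivative)
   (rule bounded_linear_compose[OF bounded_linear_of_real bounded_linear_vec_nth])
 from partial_deriv_eqI[OF this, of j]
 show "partial_deriv j (%x. complex_of_real (x $ i)) x = (if i = j then 1 else 0)"
  by (auto simp: axis_def)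
qed

lemma schwartz_lines_mult_nth:
 fixes phi :: "real ^ 'n::finite => complex"
 assumes phi: "phi \<in> schwartz (\<lambda>_. Line)"
 shows "(\<lambda>x. of_real (x $ i) * phi x) \<in> schwartz (\<lambda>_. Line)"
proof (rule schwartzI)
 show "smooth_fun (%x. of_real (x $ i) * phi x)"
  by (intro smooth_fun_mult schwartz_smooth[OF phi] smooth_fun_nth)
 show "periodic_on (%_. Line) (%x. of_real (x $ i) * phi x)" by (simp add: periodic_on_def)
 fix N and js :: "'n list"
 have "\<forall>phi \<in> schwartz (%_::'n. Line). \<exists>B. \<forall>x. (1 + norm x) ^ N * cmod (iter_partial js (%x. of_real (x $ i) * phi x) x) <= B"
 proof (induction js rule: rev_induct)
  case Nil
  show ?case
  proof
   fix phi :: "real ^ 'n => complex" assume "phi \<in> schwartz (%_::'n. Line)"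
   then obtain B where B: "!!x. (1 + norm x) ^ Suc N * cmod (phi x) <= B"
    using schwartz_bound[of phi "%_. Line" "Suc N" "[]"] by auto
   have "(1 + norm x) ^ N * (\<bar>x $ i\<bar> * cmod (phi x)) <= B" for x
   proof -
    have "(1 + norm x) ^ N * (\<bar>x $ i\<bar> * cmod (phi x)) <= (1 + norm x) ^ N * ((1 + norm x) * cmod (phi x))"
     using component_le_norm_cart[of x i] by (intro mult_left_mono mult_right_mono) auto
    also have "... <= B" using B[of x] by (simp add: mult_ac)
    finally show ?thesis .
   qed
   then show "\<exists>B. \<forall>x. (1 + norm x) ^ N * cmod (iter_partial [] (%x. of_real (x $ i) * phi x) x) <= B"
    by (auto simp: norm_mult)
  qed
 next
  case (snoc j js)
  show ?case
  proof
   fix phi :: "real ^ 'n => complex" assume phi: "phi \<in> schwartz (%_. Line)"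
   let ?d = "if i = j then 1 else 0 :: complex"
   have s: "smooth_fun (%x. ?d * phi x)" "smooth_fun (%x. of_real (x $ i) * partial_deriv j phi x)"
    by (intro smooth_fun_mult smooth_fun_const smooth_fun_nth smooth_fun_partial_deriv schwartz_smooth[OF phi])+
   have "partial_deriv j (%x. of_real (x $ i) * phi x) = (%x. ?d * phi x + of_real (x $ i) * partial_deriv j phi x)"
   proof
    fix x
    show "partial_deriv j (%x. of_real (x $ i) * phi x) x = ?d * phi x + of_real (x $ i) * partial_deriv j phi x"
     by (subst partial_deriv_mult)
      (simp_all add: smooth_fun_differentiable schwartz_smooth[OF phi] smooth_fun_nth partial_deriv_nth)
   qed
   then have eq: "iter_partial (js @ [j]) (%x. of_real (x $ i) * phi x)
    = (%x. ?d * iter_partial js phi x + iter_partial js (%x. of_real (x $ i) * partial_deriv j phi x) x)"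
    using iter_partial_add[OF s] iter_partial_scale[OF schwartz_smooth[OF phi]] by (simp only: iter_partial_snoc)
   obtain B where B: "!!x. (1 + norm x) ^ N * cmod (iter_partial js (%x. of_real (x $ i) * partial_deriv j phi x) x) <= B"
    using snoc schwartz_partial_deriv[OF phi, of j] by blast
   obtain A where A: "!!x. (1 + norm x) ^ N * cmod (iter_partial js phi x) <= A"
    using schwartz_bound[OF phi, of N js] unfolding real_part_norm_lines by metis
   have "(1 + norm x) ^ N * cmod (?d * iter_partial js phi x + iter_partial js (%x. of_real (x $ i) * partial_deriv j phi x) x) <= A + B" for x
   proof -
    have "cmod (?d * iter_partial js phi x + iter_partial js (%x. of_real (x $ i) * partial_deriv j phi x) x)
     <= cmod (iter_partial js phi x) + cmod (iter_partial js (%x. of_real (x $ i) * partial_deriv j phi x) x)"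
     by (rule order_trans[OF norm_triangle_ineq]) auto
    then have "(1 + norm x) ^ N * cmod (?d * iter_partial js phi x + iter_partial js (%x. of_real (x $ i) * partial_deriv j phi x) x)
     <= (1 + norm x) ^ N * (cmod (iter_partial js phi x) + cmod (iter_partial js (%x. of_real (x $ i) * partial_deriv j phi x) x))"
     by (intro mult_left_mono) auto
    also have "... <= A + B" using add_mono[OF A B] by (simp add: distrib_left)
    finally show ?thesis .
   qed
   then show "\<exists>B. \<forall>x. (1 + norm x) ^ N * cmod (iter_partial (js @ [j]) (%x. of_real (x $ i) * phi x) x) <= B"
    unfolding eq by blast
  qed
 qed
 then show "\<exists>B. \<forall>x. growth (%_. Line) x ^ N * cmod (iter_partial js (%x. of_real (x $ i) * phi x) x) <= B"
  using phi by simp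
qed

lemma schwartz_lines_freq_monomial:
 assumes "psi \<in> schwartz (\<lambda>_. Line)"
 shows "(\<lambda>xi. freq_monomial c js xi * psi xi) \<in> schwartz (\<lambda>_. Line)"
proof (induction js)
 case (Cons j js)
 from schwartz_scale[OF schwartz_lines_mult_nth[OF this, of j], of "\<i> * c"]
 show ?case by (simp add: freq_monomial_def mult.assoc)
qed (use assms in \<open>simp add: freq_monomial_def\<close>)

section \<open>Integration by parts\<close>

lemma mvt_bound:
 fixes r :: "real => complex"
 assumes "t >= 0" and d: "!!theta. 0 <= theta ==> theta <= t ==> (r has_vector_derivative r' theta) (at theta)"
  and b: "!!theta. 0 <= theta ==> theta <= t ==> cmod (r' theta) <= S"
 shows "cmod (r t - r 0) <= t * S"
proof (cases "t = 0")
 case False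
 then have t: "0 < t" using assms by simp
 have "continuous_on {0..t} r"
  using d by (intro continuous_at_imp_continuous_on ballI) (auto intro: has_vector_derivative_continuous)
 then have "\<exists>x\<in>{0<..<t}. cmod (r t - r 0) <= cmod ((t - 0) *\<^sub>R r' x)"
  using d t by (intro mvt_general[where f' = "%x v. v *\<^sub>R r' x"]) (auto simp: has_vector_derivative_def)
 then obtain x where x: "0 < x" "x < t" and "cmod (r t - r 0) <= t * cmod (r' x)" using t by auto
 then have "cmod (r t - r 0) <= t * cmod (r' x)" by simp
 also have "t * cmod (r' x) <= t * S" using x t b[of x] by (intro mult_left_mono) auto
 finally show ?thesis .
qed simp

lemma smooth_line_derivative:
 assumes "smooth_fun h"
 shows "((\<lambda>theta. h (z + theta *\<^sub>R axis j 1)) has_vector_derivative partial_deriv j h (z + theta *\<^sub>R axis j 1)) (at theta)"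
proof -
 let ?D = "frechet_derivative h (at (z + theta *\<^sub>R axis j 1))"
 have h: "(h has_derivative ?D) (at (z + theta *\<^sub>R axis j 1))"
  by (rule has_derivative_frechet[OF smooth_fun_differentiable[OF assms]])
 have "((%theta. z + theta *\<^sub>R axis j 1) has_derivative (%t. t *\<^sub>R axis j 1)) (at theta)"
  by (auto intro!: derivative_eq_intros)
 from has_derivative_compose[OF this h]
 have "((%theta. h (z + theta *\<^sub>R axis j 1)) has_derivative (%t. ?D (t *\<^sub>R axis j 1))) (at theta)" .
 moreover have "?D (t *\<^sub>R axis j 1) = t *\<^sub>R ?D (axis j 1)" for t
  by (rule linear_scale[OF has_derivative_linear[OF h]])
 ultimately show ?thesis by (simp add: has_vector_derivative_def partial_deriv_def)
qed

lemma smooth_taylor: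
 assumes h: "smooth_fun h" and t: "0 <= t"
  and S: "!!theta. 0 <= theta ==> theta <= t ==> cmod (partial_deriv j (partial_deriv j h) (z + theta *\<^sub>R axis j 1)) <= S"
 shows "cmod (h (z + t *\<^sub>R axis j 1) - h z - t *\<^sub>R partial_deriv j h z) <= t\<^sup>2 * S"
proof -
 let ?p = "partial_deriv j h"
 have S0: "0 <= S" using S[of 0] t norm_ge_zero order_trans by blast
 have 1: "cmod (?p (z + theta *\<^sub>R axis j 1) - ?p z) <= t * S" if theta: "0 <= theta" "theta <= t" for theta
 proof -
  have "cmod (?p (z + theta *\<^sub>R axis j 1) - ?p (z + 0 *\<^sub>R axis j 1)) <= theta * S"
   by (rule mvt_bound[OF theta(1) smooth_line_derivative[OF smooth_fun_partial_deriv[OF h]]]) (use S theta in auto)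
  also have "... <= t * S" using theta S0 by (intro mult_right_mono)
  finally show ?thesis by simp
 qed
 have "cmod ((h (z + t *\<^sub>R axis j 1) - t *\<^sub>R ?p z) - (h (z + 0 *\<^sub>R axis j 1) - 0 *\<^sub>R ?p z)) <= t * (t * S)"
 proof (rule mvt_bound[OF t])
  show "((%theta. h (z + theta *\<^sub>R axis j 1) - theta *\<^sub>R ?p z) has_vector_derivative
   (?p (z + theta *\<^sub>R axis j 1) - ?p z)) (at theta)" for theta
   by (intro has_vector_derivative_diff smooth_line_derivative h) (auto intro!: derivative_eq_intros)
 qed (use 1 in auto)
 then show ?thesis by (simp add: algebra_simps power2_eq_square)
qed

lemma smooth_mvt:
 fixes h :: "real ^ 'n::finite => complex"
 assumes h: "smooth_fun h" and S: "!!theta i. 0 <= theta ==> theta <= 1 ==> cmod (partial_deriv i h (x + theta *\<^sub>R v)) <= S"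
 shows "cmod (h (x + v) - h x) <= S * (\<Sum>i\<in>UNIV. \<bar>v $ i\<bar>)"
proof -
 have lin: "frechet_derivative h (at y) v = (\<Sum>i\<in>UNIV. (v $ i) *\<^sub>R partial_deriv i h y)" for y
 proof -
  have "linear (frechet_derivative h (at y))"
   using smooth_fun_differentiable[OF h] by (rule linear_frechet_derivative)
  then have "frechet_derivative h (at y) (\<Sum>i\<in>UNIV. (v $ i) *\<^sub>R (axis i 1)) = (\<Sum>i\<in>UNIV. (v $ i) *\<^sub>R partial_deriv i h y)"
   by (simp add: linear_sum linear_scale partial_deriv_def)
  moreover have "(\<Sum>i\<in>UNIV. (v $ i) *\<^sub>R (axis i 1)) = v" by (simp add: vec_eq_iff axis_def if_distrib cong: if_cong)
  ultimately show ?thesis by simp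
 qed
 have d: "((%theta. h (x + theta *\<^sub>R v)) has_vector_derivative (\<Sum>i\<in>UNIV. (v $ i) *\<^sub>R partial_deriv i h (x + theta *\<^sub>R v))) (at theta)" for theta
 proof -
  have "(h has_derivative frechet_derivative h (at (x + theta *\<^sub>R v))) (at (x + theta *\<^sub>R v))"
   using smooth_fun_differentiable[OF h] by (simp add: frechet_derivative_works)
  moreover have "((%theta. x + theta *\<^sub>R v) has_derivative (%r. r *\<^sub>R v)) (at theta)" by (auto intro!: derivative_eq_intros)
  ultimately have "((%theta. h (x + theta *\<^sub>R v)) has_derivative (%r. frechet_derivative h (at (x + theta *\<^sub>R v)) (r *\<^sub>R v))) (at theta)"
   using has_derivative_compose by fastforce
  then show ?thesis
   unfolding has_vector_derivative_def lin[symmetric]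
   using linear_scale[OF linear_frechet_derivative[OF smooth_fun_differentiable[OF h]]] by (simp add: fun_eq_iff)
 qed
 have "cmod (h (x + 1 *\<^sub>R v) - h (x + 0 *\<^sub>R v)) <= 1 * (S * (\<Sum>i\<in>UNIV. \<bar>v $ i\<bar>))"
 proof (rule mvt_bound[OF zero_le_one d])
  fix theta :: real assume theta: "0 <= theta" "theta <= 1"
  have "cmod (\<Sum>i\<in>UNIV. (v $ i) *\<^sub>R partial_deriv i h (x + theta *\<^sub>R v)) <= (\<Sum>i\<in>UNIV. \<bar>v $ i\<bar> * S)"
   by (rule sum_norm_le) (use S[OF theta] in \<open>auto intro: mult_left_mono\<close>)
  then show "cmod (\<Sum>i\<in>UNIV. (v $ i) *\<^sub>R partial_deriv i h (x + theta *\<^sub>R v)) <= S * (\<Sum>i\<in>UNIV. \<bar>v $ i\<bar>)"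
   by (simp add: sum_distrib_left mult.commute)
 qed
 then show ?thesis by simp
qed

lemma real_part_norm_triangle: "real_part_norm \<Gamma> (x + y) <= real_part_norm \<Gamma> x + real_part_norm \<Gamma> y"
proof -
 have "(\<chi> i. if \<Gamma> i = Line then (x + y) $ i else 0) = (\<chi> i. if \<Gamma> i = Line then x $ i else 0) + (\<chi> i. if \<Gamma> i = Line then y $ i else 0)"
  by (simp add: vec_eq_iff)
 then show ?thesis unfolding real_part_norm_def by (simp only: norm_triangle_ineq)
qed

lemma real_part_norm_le_norm: "real_part_norm \<Gamma> x <= norm x"
 unfolding real_part_norm_def by (rule norm_le_componentwise_cart) auto

lemma real_part_norm_uminus: "real_part_norm \<Gamma> (- x) = real_part_norm \<Gamma> x"
proof -
 have "(\<chi> i. if \<Gamma> i = Line then (- x) $ i else 0) = - (\<chi> i. if \<Gamma> i = Line then x $ i else 0)"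
  by (simp add: vec_eq_iff)
 then show ?thesis unfolding real_part_norm_def by (simp only: norm_minus_cancel)
qed

text \<open>
 Translation invariance makes the integral of a difference quotient vanish. The second order Taylor
 estimate with an integrable bound for the remainder then lets the step tend to zero.
\<close>

lemma integral_partial_deriv_eq_0:
 fixes h :: "real ^ 'n::finite => complex"
 assumes h: "h \<in> schwartz \<Gamma>" and s: "sets M = sets borel"
  and w: "integrable M (\<lambda>x. 1 / growth \<Gamma> x ^ N)"
  and t0: "t0 > 0" and inv: "!!t. 0 < t ==> t < t0 ==> (LINT z|M. h (z + t *\<^sub>R axis j 1)) = (LINT z|M. h z)"
 shows "(LINT z|M. partial_deriv j h z) = 0"
proof -
 let ?r = "real_part_norm \<Gamma>" and ?e = "axis j 1 :: real ^ 'n"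
 have meas: "phi \<in> borel_measurable M" if "phi \<in> schwartz \<Gamma>" for phi
  using borel_measurable_continuous_onI[OF smooth_fun_continuous[OF schwartz_smooth[OF that]]] s
  by (simp cong: measurable_cong_sets)
 have cmp: "1 + ?r z <= 2 * (1 + ?r (z + theta *\<^sub>R ?e))" if "0 <= theta" "theta <= 1" for z theta
 proof -
  have "?r z = ?r ((z + theta *\<^sub>R ?e) + - (theta *\<^sub>R ?e))" by simp
  also have "... <= ?r (z + theta *\<^sub>R ?e) + ?r (theta *\<^sub>R ?e)"
   using real_part_norm_triangle real_part_norm_uminus by metis
  finally have "?r z <= ?r (z + theta *\<^sub>R ?e) + ?r (theta *\<^sub>R ?e)" .
  moreover have "?r (theta *\<^sub>R ?e) <= 1"
   using order_trans[OF real_part_norm_le_norm, of "theta *\<^sub>R ?e" 1 \<Gamma>] that by simp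
  moreover have "a <= b + c ==> c <= 1 ==> 0 <= b ==> 1 + a <= 2 * (1 + b)" for a b c :: real by simp
  ultimately show ?thesis using real_part_norm_nonneg by blast
 qed
 have dec: "\<exists>B. \<forall>z theta. 0 <= theta \<longrightarrow> theta <= 1 \<longrightarrow> (1 + ?r z) ^ N * cmod (iter_partial js h (z + theta *\<^sub>R ?e)) <= B" for js
 proof -
  obtain B where B: "!!x. (1 + ?r x) ^ N * cmod (iter_partial js h x) <= B"
   using schwartz_bound[OF h] by metis
  have "(1 + ?r z) ^ N * cmod (iter_partial js h (z + theta *\<^sub>R ?e)) <= 2 ^ N * B" if "0 <= theta" "theta <= 1" for z theta
  proof -
   have "(1 + ?r z) ^ N * cmod (iter_partial js h (z + theta *\<^sub>R ?e))
     <= (2 * (1 + ?r (z + theta *\<^sub>R ?e))) ^ N * cmod (iter_partial js h (z + theta *\<^sub>R ?e))"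
    by (intro mult_right_mono power_mono cmp that) (auto simp: add_nonneg_nonneg)
   also have "... <= 2 ^ N * B"
    unfolding power_mult_distrib mult.assoc by (intro mult_left_mono B) simp
   finally show ?thesis .
  qed
  then show ?thesis by blast
 qed
 have int: "integrable M (%z. h (z + t *\<^sub>R ?e))" if "0 <= t" "t <= 1" for t
 proof -
  obtain B where "!!z theta. 0 <= theta ==> theta <= 1 ==> (1 + ?r z) ^ N * cmod (iter_partial [] h (z + theta *\<^sub>R ?e)) <= B"
   using dec by metis
  then have B: "(1 + ?r z) ^ N * cmod (h (z + t *\<^sub>R ?e)) <= B" for z using that by simp
  have "(%z. h (z + t *\<^sub>R ?e)) \<in> Borel"
   by (intro borel_measurable_continuous_onI continuous_on_compose2[OF smooth_fun_continuous[OF schwartz_smooth[OF h], of UNIV]] continuous_intros) auto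
  then have m: "(%z. h (z + t *\<^sub>R ?e)) \<in> borel_measurable M" using s by (simp cong: measurable_cong_sets)
  show ?thesis by (rule integrable_if_decay[OF w _ m B]) simp
 qed
 have intp: "integrable M (partial_deriv j h)"
 proof -
  obtain B where B: "!!x. (1 + ?r x) ^ N * cmod (partial_deriv j h x) <= B"
   using schwartz_bound[OF h, of N "[j]"] by auto
  show ?thesis by (rule integrable_if_decay[OF w _ meas[OF schwartz_partial_deriv[OF h]] B]) simp
 qed
 obtain B where B: "!!z theta. 0 <= theta ==> theta <= 1 ==> (1 + ?r z) ^ N * cmod (partial_deriv j (partial_deriv j h) (z + theta *\<^sub>R ?e)) <= B"
  using dec[of "[j, j]"] by auto
 define C where "C = (LINT z|M. B * (1 / (1 + ?r z) ^ N))"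
 have small: "cmod (LINT z|M. partial_deriv j h z) <= t * C" if t: "0 < t" "t < t0" "t <= 1" for t
 proof -
  have "t *\<^sub>R (LINT z|M. partial_deriv j h z) = - (LINT z|M. h (z + t *\<^sub>R ?e) - h z - t *\<^sub>R partial_deriv j h z)"
   using int[of t] int[of 0] intp inv[OF t(1,2)] t by simp
  then have "cmod (t *\<^sub>R (LINT z|M. partial_deriv j h z)) = cmod (LINT z|M. h (z + t *\<^sub>R ?e) - h z - t *\<^sub>R partial_deriv j h z)"
   by (simp only: norm_minus_cancel)
  then have "t * cmod (LINT z|M. partial_deriv j h z) = cmod (LINT z|M. h (z + t *\<^sub>R ?e) - h z - t *\<^sub>R partial_deriv j h z)"
   using t by (simp only: norm_scaleR abs_of_pos)
  also have "... <= (LINT z|M. t\<^sup>2 * (B * (1 / (1 + ?r z) ^ N)))"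
  proof (rule Bochner_Integration.integral_norm_bound_integral)
   show "integrable M (%z. h (z + t *\<^sub>R ?e) - h z - t *\<^sub>R partial_deriv j h z)"
    using int[of t] int[of 0] intp t by (intro Bochner_Integration.integrable_diff integrable_scaleR_right) auto
   show "integrable M (%z. t\<^sup>2 * (B * (1 / (1 + ?r z) ^ N)))" by (intro integrable_mult_right w)
   fix z
   have p: "0 < (1 + ?r z) ^ N" by (simp add: add_pos_nonneg)
   show "cmod (h (z + t *\<^sub>R ?e) - h z - t *\<^sub>R partial_deriv j h z) <= t\<^sup>2 * (B * (1 / (1 + ?r z) ^ N))"
   proof (rule smooth_taylor[OF schwartz_smooth[OF h]])
    fix theta assume "0 <= theta" "theta <= t"
    then show "cmod (partial_deriv j (partial_deriv j h) (z + theta *\<^sub>R ?e)) <= B * (1 / (1 + ?r z) ^ N)"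
     using B[of theta z] t p by (simp add: field_simps)
   qed (use t in simp)
  qed
  also have "... = t * (t * C)"
   by (simp only: C_def power2_eq_square mult.assoc integral_mult_right_zero)
  finally show ?thesis using t by simp
 qed
 have "cmod (LINT z|M. partial_deriv j h z) <= 0"
 proof (rule tendsto_lowerbound)
  show "((%t. t * C) \<longlongrightarrow> 0) (at_right 0)" by (auto intro!: tendsto_eq_intros)
  show "\<forall>\<^sub>F t in at_right 0. cmod (LINT z|M. partial_deriv j h z) <= t * C"
   unfolding eventually_at_right_field
   by (rule exI[of _ "min 1 t0"]) (use t0 small in auto)
 qed simp
 then show ?thesis by simp
qed

section \<open>Fourier transforms of Schwartz functions\<close>

lemma cis_measurable [measurable]: "cis \<in> Borel"
 unfolding cis_conv_exp[abs_def] by (intro borel_measurable_continuous_onI continuous_intros)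

lemma cis_2pi_lattice:
 assumes "L > 0" "t \<in> lattice L"
 shows "cis (2 * pi * of_int k * (t * L)) = 1"
proof -
 obtain m where m: "t = of_int m / L" using assms(2) by (auto simp: lattice_def)
 have "2 * pi * of_int k * (t * L) = 2 * pi * of_int (k * m)" using assms(1) m by simp
 also have "cis ... = 1" by (rule cis_multiple_2pi) auto
 finally show ?thesis .
qed

text \<open>
 Translation of the circle, read on the fundamental domain.
\<close>

lemma torus_wrap:
 assumes t: "0 < t" "t < L"
 shows "distr (density lborel (indicator {0..<L})) borel (\<lambda>x. if x < L - t then x + t else x + t - L)
  = (density lborel (indicator {0..<L}) :: real measure)" (is "distr ?D borel ?h = _")
proof (rule measure_eqI)
 fix A assume "A \<in> sets (distr ?D borel ?h)"
 then have A: "A \<in> sets borel" by simp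
 have h: "?h \<in> Borel" by measurable
 have tr: "emeasure lborel ((+) c -` B) = emeasure lborel B" if "B \<in> sets borel" for c :: real and B
  using that arg_cong[OF lborel_distr_plus[of c], of "%M. emeasure M B"]
  by (simp add: emeasure_distr)
 have "emeasure (distr ?D borel ?h) A = emeasure lborel ({0..<L} \<inter> ?h -` A)"
  using A h measurable_sets[OF h A]
  by (simp add: emeasure_distr emeasure_density nn_integral_indicator Int_def indicator_inter_arith[symmetric])
 also have "{0..<L} \<inter> ?h -` A = ((+) t -` (A \<inter> {t..<L})) \<union> ((+) (t - L) -` (A \<inter> {0..<t}))"
  using t by (auto simp: algebra_simps split: if_splits)
 also have "emeasure lborel ... = emeasure lborel ((+) t -` (A \<inter> {t..<L})) + emeasure lborel ((+) (t - L) -` (A \<inter> {0..<t}))"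
 proof (rule plus_emeasure[symmetric])
  have "(+) c \<in> Borel" for c :: real by measurable
  then show "(+) t -` (A \<inter> {t..<L}) \<in> sets lborel" "(+) (t - L) -` (A \<inter> {0..<t}) \<in> sets lborel"
   using A by (auto dest: measurable_sets[of _ borel borel])
 qed (use t in auto)
 also have "... = emeasure lborel (A \<inter> {t..<L}) + emeasure lborel (A \<inter> {0..<t})"
  using A by (subst (1 2) tr) auto
 also have "... = emeasure lborel ((A \<inter> {t..<L}) \<union> (A \<inter> {0..<t}))"
  using A by (intro plus_emeasure) auto
 also have "(A \<inter> {t..<L}) \<union> (A \<inter> {0..<t}) = {0..<L} \<inter> A" using t by auto
 also have "emeasure lborel ({0..<L} \<inter> A) = emeasure ?D A"
  using A by (simp add: emeasure_density indicator_inter_arith[symmetric])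
 finally show "emeasure (distr ?D borel ?h) A = emeasure ?D A" .
qed simp

context lca
begin

lemma gm_translate:
 fixes h :: "real ^ 'n => complex"
 assumes h [measurable]: "h \<in> Borel" and per: "periodic_on \<Gamma> h"
  and t: "0 < t" "!!L. \<Gamma> j = Torus L ==> t < L"
 shows "(LINT z|gm. h (z + t *\<^sub>R axis j 1)) = (LINT z|gm. h z)"
proof -
 define w :: "'n => real => real" where "w i = (if i ~= j then (%x. x) else (case \<Gamma> j of Line => (+) t
  | Torus L => (%x. if x < L - t then x + t else x + t - L)))" for i
 let ?w = "%z. \<chi> i. w i (z $ i)"
 have wm [measurable]: "w i \<in> Borel" for i
  by (cases "\<Gamma> j") (simp_all add: w_def)
 have "distr (group_factor (\<Gamma> i)) borel (w i) = group_factor (\<Gamma> i)" for i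
 proof (cases "i = j")
  case True
  show ?thesis
  proof (cases "\<Gamma> j")
   case Line
   then show ?thesis by (simp add: True w_def lborel_distr_plus)
  next
   case (Torus L)
   then show ?thesis using torus_wrap[of t L] t by (simp add: True w_def)
  qed
 next
  case False
  then show ?thesis using distr_id2[of borel "group_factor (\<Gamma> i)"] by (simp add: w_def)
 qed
 then have inv: "distr gm borel ?w = gm"
  unfolding gm_def by (intro distr_vprod G.real_measures_axioms) auto
 have wmv: "?w \<in> gm \<rightarrow>\<^sub>M borel"
  using measurable_vec_lambda_fun[of "%z i. w i (z $ i)" borel] by simp
 have eq: "h (?w z) = h (z + t *\<^sub>R axis j 1)" for z
 proof (cases "\<Gamma> j")
  case Line
  then have "?w z = z + t *\<^sub>R axis j 1" by (simp add: vec_eq_iff w_def axis_def)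
  then show ?thesis by simp
 next
  case (Torus L)
  then have "?w z = z + t *\<^sub>R axis j 1 \<or> ?w z + axis j L = z + t *\<^sub>R axis j 1"
   by (cases "z $ j < L - t") (auto simp: vec_eq_iff w_def axis_def)
  then show ?thesis using per Torus unfolding periodic_on_def by metis
 qed
 have "(LINT z|gm. h z) = (LINT z|distr gm borel ?w. h z)" by (simp only: inv)
 also have "... = (LINT z|gm. h (?w z))" by (rule integral_distr[OF wmv h])
 finally show ?thesis by (simp add: eq)
qed

lemma integral_gm_partial_deriv:
 assumes h: "h \<in> schwartz \<Gamma>"
 shows "(LINT z|gm. partial_deriv j h z) = 0"
proof (rule integral_partial_deriv_eq_0[OF h sets_gm integrable_gm_weight_nat])
 show "0 < (case \<Gamma> j of Line => 1 | Torus L => L)" using pos by (cases "\<Gamma> j") auto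
 fix t assume "0 < t" "t < (case \<Gamma> j of Line => 1 | Torus L => L)"
 then show "(LINT z|gm. h (z + t *\<^sub>R axis j 1)) = (LINT z|gm. h z)"
  by (intro gm_translate schwartz_periodic[OF h] borel_measurable_continuous_onI
    smooth_fun_continuous[OF schwartz_smooth[OF h]]) auto
qed

lemma integral_dm_partial_deriv:
 assumes h: "h \<in> schwartz (\<lambda>_. Line)" and j: "\<Gamma> j = Line"
 shows "(LINT z|dm. partial_deriv j h z) = 0"
proof (rule integral_partial_deriv_eq_0[OF h sets_dm])
 show "0 < (1::real)" by simp
 show "integrable dm (%x. 1 / growth (%_. Line) x ^ (2 * CARD('n)))"
  using integrable_dm_weight_nat by simp
 fix t :: real
 have hm: "h \<in> Borel"
  by (intro borel_measurable_continuous_onI smooth_fun_continuous[OF schwartz_smooth[OF h]])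
 have "(LINT z|dm. h z) = (LINT z|distr dm borel (%xi. xi + t *\<^sub>R axis j 1). h z)"
 proof (subst dm_translate)
  fix i L assume "\<Gamma> i = Torus L"
  then have "(t *\<^sub>R axis j 1 :: real^'n) $ i = of_int 0 / L" using j by (auto simp: axis_def)
  then show "(t *\<^sub>R axis j 1 :: real^'n) $ i \<in> lattice L" unfolding lattice_def by blast
 qed simp
 also have "... = (LINT z|dm. h (z + t *\<^sub>R axis j 1))"
  by (rule integral_distr) (use hm in auto)
 finally show "(LINT z|dm. h (z + t *\<^sub>R axis j 1)) = (LINT z|dm. h z)" ..
qed

definition dual_lattice :: "(real ^ 'n) set" where
 "dual_lattice = {xi. \<forall>i L. \<Gamma> i = Torus L \<longrightarrow> xi $ i \<in> lattice L}"

lemma AE_dual_lattice: "AE xi in dm. xi \<in> dual_lattice"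
 using AE_dm_lattice by (simp add: dual_lattice_def)

lemma character_periodic:
 assumes "xi \<in> dual_lattice"
 shows "periodic_on \<Gamma> (\<lambda>x. cis (2 * pi * of_int k * (xi \<bullet> x)))"
 unfolding periodic_on_def
proof (intro allI impI)
 fix i L x assume L: "\<Gamma> i = Torus L"
 then have "cis (2 * pi * of_int k * (xi $ i * L)) = 1"
  using assms pos by (intro cis_2pi_lattice) (auto simp: dual_lattice_def)
 then show "cis (2 * pi * of_int k * (xi \<bullet> (x + axis i L))) = cis (2 * pi * of_int k * (xi \<bullet> x))"
  by (simp add: inner_add_right inner_axis distrib_left cis_mult[symmetric])
qed

lemma rapid_gm:
 assumes phi: "phi \<in> schwartz \<Gamma>"
 shows "rapid gm phi"
 unfolding rapid_def
proof (intro conjI allI)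
 have m [measurable]: "phi \<in> Borel"
  by (intro borel_measurable_continuous_onI smooth_fun_continuous[OF schwartz_smooth[OF phi]])
 then show "phi \<in> borel_measurable gm" by measurable
 fix k
 define S where "S = (\<Sum>i\<in>UNIV. case \<Gamma> i of Line => 0 | Torus L => L)"
 have S0: "S >= 0" unfolding S_def using pos by (intro sum_nonneg) (auto split: factor.splits intro: less_imp_le)
 have nb: "1 + norm x <= (1 + S) * (1 + real_part_norm \<Gamma> x)" if "\<forall>i L. \<Gamma> i = Torus L \<longrightarrow> 0 < x $ i \<and> x $ i < L" for x
 proof -
  let ?a = "\<chi> i. if \<Gamma> i = Line then x $ i else 0" and ?b = "\<chi> i. if \<Gamma> i = Line then 0 else x $ i"
  have "x = ?a + ?b" by (simp add: vec_eq_iff)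
  then have "norm x <= norm ?a + norm ?b" by (metis norm_triangle_ineq)
  moreover have "norm ?b <= (\<Sum>i\<in>UNIV. \<bar>?b $ i\<bar>)" by (rule norm_le_l1_cart)
  moreover have "(\<Sum>i\<in>UNIV. \<bar>?b $ i\<bar>) <= S"
   unfolding S_def
  proof (rule sum_mono)
   fix i show "\<bar>?b $ i\<bar> <= (case \<Gamma> i of Line => 0 | Torus L => L)"
   proof (cases "\<Gamma> i")
    case (Torus L)
    then have "0 < x $ i \<and> x $ i < L" using that by blast
    with Torus show ?thesis by simp
   qed simp
  qed
  ultimately have "norm x <= real_part_norm \<Gamma> x + S" by (simp add: real_part_norm_def)
  moreover have "0 <= S * real_part_norm \<Gamma> x" using S0 by simp
  ultimately show ?thesis by (simp add: algebra_simps)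
 qed
 have "integrable gm (%x. of_real ((1 + S) ^ k) * (of_real (growth \<Gamma> x ^ k) * phi x))"
  by (intro integrable_mult_right integrable_gm_schwartz phi)
 then show "integrable gm (%x. of_real ((1 + norm x) ^ k) * phi x)"
 proof (rule integrable_bound)
  show "AE x in gm. cmod (of_real ((1 + norm x) ^ k) * phi x) <= cmod (of_real ((1 + S) ^ k) * (of_real (growth \<Gamma> x ^ k) * phi x))"
   using AE_gm_domain
  proof eventually_elim
   case (elim x)
   have "(1 + norm x) ^ k <= ((1 + S) * (1 + real_part_norm \<Gamma> x)) ^ k"
    using nb[OF elim] by (intro power_mono) auto
   then have "(1 + norm x) ^ k * cmod (phi x) <= ((1 + S) * (1 + real_part_norm \<Gamma> x)) ^ k * cmod (phi x)"
    by (rule mult_right_mono) simp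
   then show ?case using S0
    by (simp add: norm_mult norm_power power_mult_distrib mult.assoc add_nonneg_nonneg del: of_real_power of_real_add)
  qed
 qed measurable
qed

lemma rapid_dm:
 assumes psi: "psi \<in> schwartz (\<lambda>_. Line)"
 shows "rapid dm psi"
 unfolding rapid_def
proof (intro conjI allI integrable_dm_schwartz psi)
 show "psi \<in> borel_measurable dm"
  using borel_measurable_continuous_onI[OF smooth_fun_continuous[OF schwartz_smooth[OF psi]]] by simp
qed

text \<open>
 Integration by parts; there are no boundary terms because characters with frequency in the dual
 lattice are periodic.
\<close>

lemma osc_gm_partial_deriv:
 assumes phi: "phi \<in> schwartz \<Gamma>" and xi: "xi \<in> dual_lattice"
 shows "osc gm (2 * pi * of_int k) (partial_deriv j phi) xi = - (\<i> * of_real (2 * pi * of_int k) * of_real (xi $ j)) * osc gm (2 * pi * of_int k) phi xi"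
proof -
 let ?c = "2 * pi * of_int k :: real"
 let ?h = "%x. phi x * cis (?c * (xi \<bullet> x))"
 have i1: "integrable gm phi" and i2: "integrable gm (partial_deriv j phi)"
  by (intro rapid_integrable rapid_gm schwartz_partial_deriv phi)+
 have h: "?h \<in> schwartz \<Gamma>" by (rule schwartz_mult_cis[OF phi character_periodic[OF xi]])
 have "partial_deriv j ?h x = partial_deriv j phi x * cis (?c * (x \<bullet> xi)) + (\<i> * of_real ?c * of_real (xi $ j)) * (phi x * cis (?c * (x \<bullet> xi)))" for x
  by (subst partial_deriv_mult)
   (simp_all add: smooth_fun_differentiable schwartz_smooth[OF phi] smooth_fun_cis_inner
       partial_deriv_cis_inner inner_commute[of x xi] del: of_real_mult)
 then have "0 = (LINT x|gm. partial_deriv j phi x * cis (?c * (x \<bullet> xi)) + (\<i> * of_real ?c * of_real (xi $ j)) * (phi x * cis (?c * (x \<bullet> xi))))"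
  using integral_gm_partial_deriv[OF h, of j] by (simp del: of_real_mult)
 also have "... = osc gm ?c (partial_deriv j phi) xi + (\<i> * of_real ?c * of_real (xi $ j)) * osc gm ?c phi xi"
  unfolding osc_def
  by (subst Bochner_Integration.integral_add)
   (auto intro!: integrable_mult_right integrable_osc i1 i2)
 finally show ?thesis by (simp add: eq_neg_iff_add_eq_0 del: of_real_mult)
qed

lemma osc_dm_partial_deriv:
 assumes psi: "psi \<in> schwartz (\<lambda>_. Line)" and j: "\<Gamma> j = Line"
 shows "osc dm c (partial_deriv j psi) x = - (\<i> * of_real c * of_real (x $ j)) * osc dm c psi x"
proof -
 let ?h = "%xi. psi xi * cis (c * (x \<bullet> xi))"
 have i1: "integrable dm psi" and i2: "integrable dm (partial_deriv j psi)"
  by (intro rapid_integrable rapid_dm schwartz_partial_deriv psi)+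
 have h: "?h \<in> schwartz (%_. Line)" by (rule schwartz_mult_cis[OF psi]) (simp add: periodic_on_def)
 have "partial_deriv j ?h xi = partial_deriv j psi xi * cis (c * (xi \<bullet> x)) + (\<i> * of_real c * of_real (x $ j)) * (psi xi * cis (c * (xi \<bullet> x)))" for xi
  by (subst partial_deriv_mult)
   (simp_all add: smooth_fun_differentiable schwartz_smooth[OF psi] smooth_fun_cis_inner
       partial_deriv_cis_inner inner_commute[of xi x])
 then have "0 = (LINT xi|dm. partial_deriv j psi xi * cis (c * (xi \<bullet> x)) + (\<i> * of_real c * of_real (x $ j)) * (psi xi * cis (c * (xi \<bullet> x))))"
  using integral_dm_partial_deriv[OF h j] by simp
 also have "... = osc dm c (partial_deriv j psi) x + (\<i> * of_real c * of_real (x $ j)) * osc dm c psi x"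
  unfolding osc_def
  by (subst Bochner_Integration.integral_add)
   (auto intro!: integrable_mult_right integrable_osc i1 i2)
 finally show ?thesis by (simp add: eq_neg_iff_add_eq_0)
qed

lemma osc_periodic:
 "periodic_on \<Gamma> (osc dm (2 * pi * of_int k) g)"
 unfolding periodic_on_def osc_def
proof (intro allI impI)
 fix i L x assume L: "\<Gamma> i = Torus L"
 show "(LINT xi|dm. g xi * cis (2 * pi * of_int k * (xi \<bullet> (x + axis i L)))) = (LINT xi|dm. g xi * cis (2 * pi * of_int k * (xi \<bullet> x)))"
 proof (cases "g \<in> Borel")
  case True
  note [measurable] = True
  have [measurable]: "(%xi. cis (c * (xi \<bullet> y))) \<in> Borel" for c and y :: "real^'n"
   by (rule cis_measurable_osc)
  show ?thesis
  proof (rule integral_cong_AE)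
   show "AE xi in dm. g xi * cis (2 * pi * of_int k * (xi \<bullet> (x + axis i L))) = g xi * cis (2 * pi * of_int k * (xi \<bullet> x))"
    using AE_dual_lattice
   proof eventually_elim
    case (elim xi)
    then show ?case using character_periodic[OF elim, of k] L by (simp add: periodic_on_def)
   qed
  qed measurable
 next
  case False
  have "\<not> integrable dm (%xi. g xi * cis (c * (xi \<bullet> y)))" for c y
  proof
   assume "integrable dm (%xi. g xi * cis (c * (xi \<bullet> y)))"
   from borel_measurable_integrable[OF this]
   have "(%xi. g xi * cis (c * (xi \<bullet> y))) \<in> Borel"
    by (simp only: measurable_cong_sets[OF sets_dm refl])
   from borel_measurable_times[OF this cis_measurable_osc[of "- c" y]]
   have "(%xi. g xi * cis (c * (xi \<bullet> y)) * cis (- c * (xi \<bullet> y))) \<in> Borel" .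
   moreover have "(%xi. g xi * cis (c * (xi \<bullet> y)) * cis (- c * (xi \<bullet> y))) = g"
    by (simp add: mult.assoc cis_mult)
   ultimately show False using False by simp
  qed
  then show ?thesis by (simp add: not_integrable_integral_eq)
 qed
qed

lemma osc_dm_bounded:
 assumes "integrable dm g"
 shows "cmod (osc dm c g x) <= (LINT xi|dm. cmod (g xi))"
 unfolding osc_def
 using integral_norm_bound[of dm "%xi. g xi * cis (c * (xi \<bullet> x))"] by (simp add: norm_mult)

text \<open>
 Decay in a real variable comes from integration by parts in the corresponding real frequency.
\<close>

lemma osc_dm_decay:
 assumes "psi \<in> schwartz (\<lambda>_. Line)" "\<Gamma> j = Line" "c ~= 0"
 shows "\<exists>B. \<forall>x. \<bar>x $ j\<bar> ^ N * cmod (osc dm c psi x) <= B"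
 using assms(1)
proof (induction N arbitrary: psi)
 case 0
 then show ?case using osc_dm_bounded[OF rapid_integrable[OF rapid_dm]] by auto
next
 case (Suc N)
 obtain B where B: "!!x. \<bar>x $ j\<bar> ^ N * cmod (osc dm c (partial_deriv j psi) x) <= B"
  using Suc.IH[OF schwartz_partial_deriv[OF Suc.prems]] by blast
 have "\<bar>x $ j\<bar> ^ Suc N * cmod (osc dm c psi x) <= B / \<bar>c\<bar>" for x
  using B[of x] assms(3) unfolding osc_dm_partial_deriv[OF Suc.prems assms(2)]
  by (simp add: norm_mult field_simps)
 then show ?case by blast
qed

lemma real_part_norm_power_le:
 "growth \<Gamma> x ^ N <= (real CARD('n) + 1) ^ N * (1 + (\<Sum>j | \<Gamma> j = Line. \<bar>x $ j\<bar> ^ N))"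
proof -
 define m where "m = Max (insert 1 ((%j. \<bar>x $ j\<bar>) ` {j. \<Gamma> j = Line}))"
 have m1: "1 <= m" and mj: "!!j. \<Gamma> j = Line ==> \<bar>x $ j\<bar> <= m"
  unfolding m_def by (auto intro!: Max_ge)
 have min: "m \<in> insert 1 ((%j. \<bar>x $ j\<bar>) ` {j. \<Gamma> j = Line})"
  unfolding m_def by (rule Max_in) auto
 have "real_part_norm \<Gamma> x <= (\<Sum>i\<in>UNIV. \<bar>(\<chi> i. if \<Gamma> i = Line then x $ i else 0) $ i\<bar>)"
  unfolding real_part_norm_def by (rule norm_le_l1_cart)
 also have "... <= (\<Sum>i\<in>(UNIV::'n set). m)"
  using mj m1 by (intro sum_mono) auto
 finally have "1 + real_part_norm \<Gamma> x <= (real CARD('n) + 1) * m" using m1 by (simp add: algebra_simps)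
 then have "growth \<Gamma> x ^ N <= ((real CARD('n) + 1) * m) ^ N"
  by (intro power_mono) (auto simp: add_nonneg_nonneg)
 also have "... = (real CARD('n) + 1) ^ N * m ^ N" by (rule power_mult_distrib)
 also have "m ^ N <= 1 + (\<Sum>j | \<Gamma> j = Line. \<bar>x $ j\<bar> ^ N)"
 proof (cases "m = 1")
  case False
  with min obtain j where "\<Gamma> j = Line" "m = \<bar>x $ j\<bar>" by auto
  then show ?thesis
   using member_le_sum[of j "{j. \<Gamma> j = Line}" "%j. \<bar>x $ j\<bar> ^ N"] by simp
 qed (simp add: sum_nonneg)
 finally show ?thesis by (simp add: mult_left_mono)
qed

lemma schwartz_osc_dm:
 assumes psi: "psi \<in> schwartz (\<lambda>_. Line)" and k: "k ~= 0"
 shows "osc dm (2 * pi * of_int k) psi \<in> schwartz \<Gamma>"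
proof (rule schwartzI)
 let ?c = "2 * pi * of_int k :: real"
 show "smooth_fun (osc dm ?c psi)" by (rule smooth_fun_osc[OF rapid_dm[OF psi] sets_dm])
 show "periodic_on \<Gamma> (osc dm ?c psi)" by (rule osc_periodic)
 fix N js
 define psi' where "psi' = (%xi. freq_monomial ?c js xi * psi xi)"
 have psi': "psi' \<in> schwartz (%_. Line)"
  unfolding psi'_def by (rule schwartz_lines_freq_monomial[OF psi])
 have eq: "iter_partial js (osc dm ?c psi) = osc dm ?c psi'"
  unfolding psi'_def by (rule iter_partial_osc[OF rapid_dm[OF psi] sets_dm])
 have "\<exists>B. \<forall>x. \<bar>x $ j\<bar> ^ N * cmod (osc dm ?c psi' x) <= B" if "\<Gamma> j = Line" for j
  by (rule osc_dm_decay[OF psi' that]) (use k in simp)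
 then obtain B where B: "!!j x. \<Gamma> j = Line ==> \<bar>x $ j\<bar> ^ N * cmod (osc dm ?c psi' x) <= B j" by metis
 define A where "A = (LINT xi|dm. cmod (psi' xi))"
 have A: "cmod (osc dm ?c psi' x) <= A" for x
  unfolding A_def by (rule osc_dm_bounded[OF rapid_integrable[OF rapid_dm[OF psi']]])
 have "growth \<Gamma> x ^ N * cmod (osc dm ?c psi' x) <= (real CARD('n) + 1) ^ N * (A + (\<Sum>j | \<Gamma> j = Line. B j))" for x
 proof -
  have "growth \<Gamma> x ^ N * cmod (osc dm ?c psi' x)
   <= ((real CARD('n) + 1) ^ N * (1 + (\<Sum>j | \<Gamma> j = Line. \<bar>x $ j\<bar> ^ N))) * cmod (osc dm ?c psi' x)"
   by (intro mult_right_mono real_part_norm_power_le) simp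
  also have "... = (real CARD('n) + 1) ^ N * (cmod (osc dm ?c psi' x) + (\<Sum>j | \<Gamma> j = Line. \<bar>x $ j\<bar> ^ N * cmod (osc dm ?c psi' x)))"
   by (simp add: sum_distrib_right distrib_right distrib_left mult.assoc)
  also have "... <= (real CARD('n) + 1) ^ N * (A + (\<Sum>j | \<Gamma> j = Line. B j))"
   by (intro mult_left_mono add_mono A sum_mono) (auto intro: B)
  finally show ?thesis .
 qed
 then show "\<exists>B. \<forall>x. growth \<Gamma> x ^ N * cmod (iter_partial js (osc dm ?c psi) x) <= B"
  unfolding eq by blast
qed

lemma fourier_transpose_eq:
 "fourier_transpose \<Gamma> psi = (\<lambda>x. of_real (torus_volume \<Gamma> powr (- 1 / 2)) * osc dm (2 * pi * of_int (-1)) psi x)"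
 unfolding fourier_transpose_def osc_def
 by (rule ext) (simp add: cis_conv_exp mult_ac)

lemma fourier_transpose_schwartz:
 assumes "psi \<in> schwartz (\<lambda>_. Line)"
 shows "fourier_transpose \<Gamma> psi \<in> schwartz \<Gamma>"
 unfolding fourier_transpose_eq by (rule schwartz_scale[OF schwartz_osc_dm[OF assms]]) simp

end

section \<open>Kernels\<close>

lemma integral_norm_bound_integral_AE:
 fixes f :: "'a => 'b::{banach, second_countable_topology}"
 assumes "integrable M f" "integrable M g" "AE x in M. norm (f x) <= g x"
 shows "norm (integral\<^sup>L M f) <= integral\<^sup>L M g"
 using order_trans[OF integral_norm_bound integral_mono_AE[OF integrable_norm[OF assms(1)] assms(2,3)]] .

context real_measures
begin

text \<open>
 An approximate identity that is a product of one-dimensional kernels reproduces a value up to the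
 first absolute moments of its factors. The weights \<open>w\<close> admit moduli of continuity that grow.
\<close>

lemma product_kernel_estimate:
 fixes k :: "'n => real => complex" and w d :: "'n => real => real" and f :: "real ^ 'n => complex"
 assumes k: "!!i. integrable (M i) (k i)" "!!i. (LINT t|M i. k i t) = m i"
  and w: "!!i. integrable (M i) (\<lambda>t. cmod (k i t) * w i t)" "!!i t. 0 <= w i t"
  and wd: "!!i. integrable (M i) (\<lambda>t. cmod (k i t) * (w i t * d i t))" "!!i t. 0 <= d i t"
  and int: "integrable (vprod M) (\<lambda>xi. f xi * (\<Prod>i\<in>UNIV. k i (xi $ i)))"
  and bound: "AE xi in vprod M. cmod (f xi - f0) * (\<Prod>i\<in>UNIV. cmod (k i (xi $ i)))
   <= (B * (\<Prod>i\<in>UNIV. w i (xi $ i)) * (\<Sum>i\<in>UNIV. d i (xi $ i))) * (\<Prod>i\<in>UNIV. cmod (k i (xi $ i)))"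
 shows "cmod ((LINT xi|vprod M. f xi * (\<Prod>i\<in>UNIV. k i (xi $ i))) - f0 * (\<Prod>i\<in>UNIV. m i))
  <= B * (\<Sum>i\<in>UNIV. (LINT t|M i. cmod (k i t) * (w i t * d i t)) * (\<Prod>j\<in>UNIV - {i}. LINT t|M j. cmod (k j t) * w j t))"
proof -
 define K where "K xi = (\<Prod>i\<in>UNIV. k i (xi $ i))" for xi
 have K: "integrable (vprod M) K" "(LINT xi|vprod M. K xi) = (\<Prod>i\<in>UNIV. m i)"
  unfolding K_def using integrable_vprod_prod[OF k(1)] integral_vprod_prod[OF k(1)] k(2) by simp_all
 define g where "g i j t = (if j = i then cmod (k j t) * (w j t * d j t) else cmod (k j t) * w j t)" for i j t
 have gi: "integrable (M j) (g i j)" for i j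
  unfolding g_def using w(1)[of j] wd(1)[of j] by (cases "i = j") auto
 have G: "integrable (vprod M) (%xi. \<Prod>j\<in>UNIV. g i j (xi $ j))" for i
  by (rule integrable_vprod_prod[OF gi])
 have Gv: "(LINT xi|vprod M. (\<Prod>j\<in>UNIV. g i j (xi $ j))) = (LINT t|M i. cmod (k i t) * (w i t * d i t)) * (\<Prod>j\<in>UNIV - {i}. LINT t|M j. cmod (k j t) * w j t)" for i
  by (subst integral_vprod_prod[OF gi], subst prod.remove[of _ i])
   (auto simp: g_def[abs_def] intro!: arg_cong2[where f="(*)"] prod.cong)
 have gp: "(\<Prod>j\<in>UNIV. g i j (xi $ j)) = (\<Prod>i\<in>UNIV. w i (xi $ i)) * d i (xi $ i) * (\<Prod>i\<in>UNIV. cmod (k i (xi $ i)))" for i xi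
 proof -
  have "(\<Prod>j\<in>UNIV. g i j (xi $ j)) = (\<Prod>j\<in>UNIV. (cmod (k j (xi $ j)) * w j (xi $ j)) * (if j = i then d j (xi $ j) else 1))"
   by (intro prod.cong refl) (simp add: g_def)
  also have "... = (\<Prod>j\<in>UNIV. cmod (k j (xi $ j))) * (\<Prod>j\<in>UNIV. w j (xi $ j)) * d i (xi $ i)"
   by (simp add: prod.distrib)
  finally show ?thesis by (simp add: mult_ac)
 qed
 have "(LINT xi|vprod M. f xi * K xi) - f0 * (\<Prod>i\<in>UNIV. m i) = (LINT xi|vprod M. f xi * K xi - f0 * K xi)"
  using int K by (simp add: K_def[symmetric])
 also have "cmod ... <= (LINT xi|vprod M. B * (\<Sum>i\<in>UNIV. \<Prod>j\<in>UNIV. g i j (xi $ j)))"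
 proof (rule integral_norm_bound_integral_AE)
  show "integrable (vprod M) (%xi. f xi * K xi - f0 * K xi)"
   using int K by (simp add: K_def[symmetric])
  show "integrable (vprod M) (%xi. B * (\<Sum>i\<in>UNIV. \<Prod>j\<in>UNIV. g i j (xi $ j)))"
   by (intro integrable_mult_right Bochner_Integration.integrable_sum G)
  show "AE xi in vprod M. cmod (f xi * K xi - f0 * K xi) <= B * (\<Sum>i\<in>UNIV. \<Prod>j\<in>UNIV. g i j (xi $ j))"
   using bound
  proof eventually_elim
   case (elim xi)
   have "cmod (f xi * K xi - f0 * K xi) = cmod (f xi - f0) * (\<Prod>i\<in>UNIV. cmod (k i (xi $ i)))"
    by (simp add: left_diff_distrib[symmetric] norm_mult K_def prod_norm)
   also note elim
   also have "(B * (\<Prod>i\<in>UNIV. w i (xi $ i)) * (\<Sum>i\<in>UNIV. d i (xi $ i))) * (\<Prod>i\<in>UNIV. cmod (k i (xi $ i)))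
    = B * (\<Sum>i\<in>UNIV. \<Prod>j\<in>UNIV. g i j (xi $ j))"
    by (simp add: gp sum_distrib_left sum_distrib_right mult_ac)
   finally show ?case .
  qed
 qed
 also have "... = B * (\<Sum>i\<in>UNIV. (LINT t|M i. cmod (k i t) * (w i t * d i t)) * (\<Prod>j\<in>UNIV - {i}. LINT t|M j. cmod (k j t) * w j t))"
  using G by (simp add: Gv)
 finally show ?thesis by (simp add: K_def)
qed

end

lemma fubini_bounded_kernel:
 fixes a :: "'a => complex" and b :: "'b => complex" and k :: "'a => 'b => complex"
 assumes "sigma_finite_measure A" "sigma_finite_measure B"
  and a: "integrable A a" and b: "integrable B b"
  and k: "case_prod k \<in> borel_measurable (A \<Otimes>\<^sub>M B)" "!!x y. cmod (k x y) <= C"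
 shows "(LINT x|A. a x * (LINT y|B. b y * k x y)) = (LINT y|B. b y * (LINT x|A. a x * k x y))"
  and "integrable A (\<lambda>x. a x * (LINT y|B. b y * k x y))"
  and "integrable B (\<lambda>y. b y * (LINT x|A. a x * k x y))"
proof -
 interpret A: sigma_finite_measure A by fact
 interpret B: sigma_finite_measure B by fact
 interpret pair_sigma_finite A B ..
 note [measurable] = borel_measurable_integrable[OF a] borel_measurable_integrable[OF b] k(1)
 have C: "0 <= C" using order_trans[OF norm_ge_zero k(2)] .
 let ?f = "%(x, y). a x * b y * k x y"
 have bk: "integrable B (%y. b y * k x y)" if "x \<in> space A" for x
 proof (rule integrable_bound[OF integrable_mult_right[OF b, of "of_real C"]])
  show "(%y. b y * k x y) \<in> borel_measurable B"
   using measurable_Pair2[OF k(1) that] by simp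
  have "cmod (b y) * cmod (k x y) <= cmod (b y) * C" for y by (intro mult_left_mono k(2)) simp
  then show "AE y in B. cmod (b y * k x y) <= cmod (of_real C * b y)"
   using C by (simp add: norm_mult mult.commute)
 qed
 have ak: "integrable A (%x. a x * k x y)" if "y \<in> space B" for y
 proof (rule integrable_bound[OF integrable_mult_right[OF a, of "of_real C"]])
  show "(%x. a x * k x y) \<in> borel_measurable A"
   using measurable_Pair1[OF k(1) that] by simp
  have "cmod (a x) * cmod (k x y) <= cmod (a x) * C" for x by (intro mult_left_mono k(2)) simp
  then show "AE x in A. cmod (a x * k x y) <= cmod (of_real C * a x)"
   using C by (simp add: norm_mult mult.commute)
 qed
 have f: "integrable (A \<Otimes>\<^sub>M B) ?f"
 proof (rule Fubini_integrable)
  show "integrable A (%x. LINT y|B. cmod (case (x, y) of (x, y) => a x * b y * k x y))"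
  proof (rule integrable_bound[OF integrable_mult_right[OF integrable_norm[OF a], of "C * (LINT y|B. cmod (b y))"]])
   show "AE x in A. norm (LINT y|B. cmod (case (x, y) of (x, y) => a x * b y * k x y)) <= norm (C * (LINT y|B. cmod (b y)) * cmod (a x))"
   proof (rule AE_I2)
    fix x assume x: "x \<in> space A"
    have "(LINT y|B. cmod (case (x, y) of (x, y) => a x * b y * k x y)) = cmod (a x) * (LINT y|B. cmod (b y * k x y))"
     by (simp add: norm_mult mult.assoc)
    also have "... <= cmod (a x) * (LINT y|B. C * cmod (b y))"
    proof (intro mult_left_mono integral_mono)
     show "integrable B (%y. C * cmod (b y))" using b by (intro integrable_mult_right integrable_norm)
     have "cmod (b y) * cmod (k x y) <= cmod (b y) * C" for y by (intro mult_left_mono k(2)) simp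
     then show "cmod (b y * k x y) <= C * cmod (b y)" for y by (simp add: norm_mult mult.commute)
    qed (use bk[OF x] in auto)
    finally show "norm (LINT y|B. cmod (case (x, y) of (x, y) => a x * b y * k x y)) <= norm (C * (LINT y|B. cmod (b y)) * cmod (a x))"
     using C by (simp add: mult_ac abs_of_nonneg)
   qed
  qed measurable
  show "AE x in A. integrable B (%y. case (x, y) of (x, y) => a x * b y * k x y)"
   using bk by (intro AE_I2) (simp add: mult.assoc)
 qed measurable
 have 1: "(LINT y|B. ?f (x, y)) = a x * (LINT y|B. b y * k x y)" for x
  by (simp add: mult.assoc)
 have 2: "(LINT x|A. ?f (x, y)) = b y * (LINT x|A. a x * k x y)" for y
 proof -
  have "(LINT x|A. ?f (x, y)) = (LINT x|A. b y * (a x * k x y))" by (simp add: mult_ac)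
  then show ?thesis by simp
 qed
 show "(LINT x|A. a x * (LINT y|B. b y * k x y)) = (LINT y|B. b y * (LINT x|A. a x * k x y))"
  using Fubini_integral[of "%x y. ?f (x, y)"] f 1 2 by (simp add: case_prod_beta')
 show "integrable A (%x. a x * (LINT y|B. b y * k x y))"
  using integrable_fst[of "%x y. ?f (x, y)"] f 1 by (simp add: case_prod_beta')
 show "integrable B (%y. b y * (LINT x|A. a x * k x y))"
  using integrable_snd[of "%x y. ?f (x, y)"] f 2 by (simp add: case_prod_beta')
qed

lemma gaussian_fourier:
 assumes e: "e > 0"
 shows "(LINT x|lborel. of_real (exp (- (e * x)\<^sup>2 / 2)) * cis (2 * pi * (u - t) * x))
  = of_real (normal_density u (e / (2 * pi)) t)"
  and "integrable lborel (\<lambda>x::real. complex_of_real (exp (- (e * x)\<^sup>2 / 2)))"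
proof -
 have sd: "std_normal_density x = exp (- x\<^sup>2 / 2) / sqrt (2 * pi)" for x :: real
  by (simp add: std_normal_density_def)
 have i0: "integrable lborel (%x. std_normal_density x)" by simp
 have i1: "integrable lborel (%x::real. exp (- (e * x)\<^sup>2 / 2))"
  using integrable_mult_right[OF lborel_integrable_real_affine[OF i0, of e 0], of "sqrt (2 * pi)"] e
  by (simp add: sd)
 then show "integrable lborel (%x::real. complex_of_real (exp (- (e * x)\<^sup>2 / 2)))"
  by (rule integrable_of_real)
 define v where "v = 2 * pi * (u - t) / e"
 have "char std_normal_distribution v = (LINT x|lborel. std_normal_density x *\<^sub>R cis (v * x))"
  unfolding char_def by (subst integral_density) (auto simp: cis_conv_exp)
 then have ch: "(LINT x|lborel. std_normal_density x *\<^sub>R cis (v * x)) = of_real (exp (- v\<^sup>2 / 2))"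
  by (simp add: char_std_normal_distribution)
 have "(LINT x|lborel. of_real (exp (- (e * x)\<^sup>2 / 2)) * cis (2 * pi * (u - t) * x))
  = (LINT x|lborel. (%y. of_real (exp (- y\<^sup>2 / 2)) * cis (v * y)) (0 + e * x))"
 proof -
  have "v * (0 + e * x) = 2 * pi * (u - t) * x" for x using e by (simp add: v_def)
  then show ?thesis by (simp only: add_0_left)
 qed
 also have "... = (1 / e) *\<^sub>R (LINT y|lborel. of_real (exp (- y\<^sup>2 / 2)) * cis (v * y))"
  using lborel_integral_real_affine[of e "%y. of_real (exp (- y\<^sup>2 / 2)) * cis (v * y)" 0] e by simp
 also have "(LINT y|lborel. of_real (exp (- y\<^sup>2 / 2)) * cis (v * y)) = (LINT y|lborel. of_real (sqrt (2 * pi)) * (std_normal_density y *\<^sub>R cis (v * y)))"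
  by (simp add: sd scaleR_conv_of_real)
 also have "... = of_real (sqrt (2 * pi)) * of_real (exp (- v\<^sup>2 / 2))"
  by (simp only: integral_mult_right_zero ch)
 finally have "(LINT x|lborel. of_real (exp (- (e * x)\<^sup>2 / 2)) * cis (2 * pi * (u - t) * x))
  = of_real (1 / e * (sqrt (2 * pi) * exp (- v\<^sup>2 / 2)))"
  by (simp add: scaleR_conv_of_real)
 also have "1 / e * (sqrt (2 * pi) * exp (- v\<^sup>2 / 2)) = normal_density u (e / (2 * pi)) t"
 proof -
  define q where "q = sqrt (2 * pi)"
  have q: "q > 0" and qq: "q * q = 2 * pi" by (simp_all add: q_def)
  have "sqrt (2 * pi * (e / (2 * pi))\<^sup>2) = q * (e / (2 * pi))"
   using e by (simp add: real_sqrt_mult q_def)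
  also have "... = q * (e / (q * q))" by (simp only: qq)
  also have "... = e / q" using q by simp
  finally have "1 / sqrt (2 * pi * (e / (2 * pi))\<^sup>2) = sqrt (2 * pi) / e"
   by (simp add: q_def)
  moreover have "- (t - u)\<^sup>2 / (2 * (e / (2 * pi))\<^sup>2) = - v\<^sup>2 / 2"
   using e by (simp add: v_def field_simps power2_eq_square)
  ultimately show ?thesis by (simp add: normal_density_def)
 qed
 finally show "(LINT x|lborel. of_real (exp (- (e * x)\<^sup>2 / 2)) * cis (2 * pi * (u - t) * x))
  = of_real (normal_density u (e / (2 * pi)) t)" .
qed

lemma torus_character_integral:
 assumes L: "L > 0" and uv: "u \<in> lattice L" "v \<in> lattice L"
 shows "(LINT x|density lborel (indicator {0..<L}). cis (2 * pi * (u - v) * x)) = (if u = v then of_real L else 0)"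
proof -
 have meas: "(%x. cis (2 * pi * (u - v) * x)) \<in> Borel" by measurable
 have dens: "density lborel (indicator {0..<L}) = density lborel (%x::real. ennreal (indicator {0..<L} x))"
  by (simp add: ennreal_indicator)
 have "(LINT x|density lborel (indicator {0..<L}). cis (2 * pi * (u - v) * x))
  = (LINT x|lborel. indicator {0..<L} x *\<^sub>R cis (2 * pi * (u - v) * x))"
  unfolding dens by (subst integral_density) (use meas in auto)
 also have "... = (LINT x|lborel. indicator {0..L} x *\<^sub>R cis (2 * pi * (u - v) * x))"
 proof (rule integral_cong_AE)
  show "AE x in lborel. indicator {0..<L} x *\<^sub>R cis (2 * pi * (u - v) * x) = indicator {0..L} x *\<^sub>R cis (2 * pi * (u - v) * x)"
   using AE_lborel_singleton[of L] by eventually_elim (auto simp: indicator_def)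
 qed measurable
 also have "... = (if u = v then of_real L else 0)"
 proof (cases "u = v")
  case True
  then show ?thesis using L by (simp add: scaleR_conv_of_real measure_def)
 next
  case False
  let ?c = "2 * pi * (u - v)"
  have c: "?c ~= 0" using False by simp
  let ?F = "%x. cis (?c * x) / (\<i> * ?c)"
  have "(LINT x|lborel. indicator {0..L} x *\<^sub>R cis (?c * x)) = ?F L - ?F 0"
  proof (rule integral_FTC_atLeastAtMost)
   show "0 <= L" using L by simp
   show "continuous_on {0..L} (%x. cis (?c * x))"
    unfolding cis_conv_exp by (intro continuous_intros)
   fix x assume "0 <= x" "x <= L"
   have "((%x. exp (\<i> * (of_real ?c * of_real x)) / (\<i> * ?c)) has_vector_derivative exp (\<i> * (of_real ?c * of_real x))) (at x within {0..L})"
    using c by (auto intro!: derivative_eq_intros has_vector_derivative_real_field)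
   then show "(?F has_vector_derivative cis (?c * x)) (at x within {0..L})"
    by (simp add: cis_conv_exp)
  qed
  moreover have "u - v \<in> lattice L"
   using uv by (auto simp: lattice_def diff_divide_distrib[symmetric] of_int_diff[symmetric] simp del: of_int_diff)
  then have "cis (2 * pi * of_int 1 * ((u - v) * L)) = 1" by (rule cis_2pi_lattice[OF L])
  ultimately show ?thesis using False by (simp add: mult_ac)
 qed
 finally show ?thesis .
qed

section \<open>Fourier inversion on the dual group\<close>

context lca
begin

lemma continuous_pair_measurable:
 fixes f :: "real ^ 'n => real ^ 'n => complex"
 assumes "continuous_on UNIV (case_prod f)" "sets M = sets borel" "sets N = sets borel"
 shows "case_prod f \<in> borel_measurable (M \<Otimes>\<^sub>M N)"
proof -
 have "sets (M \<Otimes>\<^sub>M N) = sets borel"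
  using sets_pair_measure_cong[OF assms(2,3)] by (simp only: borel_prod)
 from borel_measurable_continuous_onI[OF assms(1)] show ?thesis
  by (simp only: measurable_cong_sets[OF \<open>sets (M \<Otimes>\<^sub>M N) = sets borel\<close> refl])
qed

lemma cis_pair_measurable:
 "(\<lambda>(x, xi). cis (c * (xi \<bullet> x))) \<in> borel_measurable (gm \<Otimes>\<^sub>M dm)"
 by (rule continuous_pair_measurable)
  (auto simp: case_prod_beta' cis_conv_exp intro!: continuous_intros)

lemma torus_volume_pos: "torus_volume \<Gamma> > 0"
 unfolding torus_volume_def using pos by (intro prod_pos) (auto split: factor.splits)

definition gauss_factor :: "real => 'n => real => complex" where
 "gauss_factor e i x = (case \<Gamma> i of Line => of_real (exp (- (e * x)\<^sup>2 / 2)) | Torus L => 1)"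

text \<open>
 The transform of the Gaussian factors: a narrow Gaussian in a real frequency and a point mass in a
 lattice frequency, where the factor is constant.
\<close>

definition gauss_kernel :: "real => real ^ 'n => 'n => real => complex" where
 "gauss_kernel e eta i t = (case \<Gamma> i of Line => of_real (normal_density (eta $ i) (e / (2 * pi)) t)
  | Torus L => if t = eta $ i then of_real L else 0)"

lemma integrable_gauss_factor: "e > 0 ==> integrable (group_factor (\<Gamma> i)) (gauss_factor e i)"
proof (cases "\<Gamma> i")
 case Line
 then show "e > 0 ==> ?thesis" using gaussian_fourier(2)[of e] by (simp add: gauss_factor_def[abs_def])
next
 case (Torus L)
 have "finite_measure (density lborel (indicator {0..<L}) :: real measure)"
  by (rule finite_measureI) (cases "0 <= L"; simp add: emeasure_density)
 then show ?thesis using Torus by (simp add: gauss_factor_def[abs_def] finite_measure.integrable_const)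
qed

lemma gauss_factor_fourier:
 assumes "e > 0" "eta \<in> dual_lattice" "!!L. \<Gamma> i = Torus L ==> t \<in> lattice L"
 shows "(LINT x|group_factor (\<Gamma> i). gauss_factor e i x * cis (2 * pi * (eta $ i - t) * x)) = gauss_kernel e eta i t"
proof (cases "\<Gamma> i")
 case Line
 then show ?thesis using gaussian_fourier(1)[OF assms(1), of "eta $ i" t]
  by (simp add: gauss_factor_def gauss_kernel_def)
next
 case (Torus L)
 then show ?thesis using torus_character_integral[OF pos[OF Torus], of "eta $ i" t] assms
  by (auto simp: gauss_factor_def gauss_kernel_def dual_lattice_def)
qed

lemma gauss_kernel_integral:
 assumes e: "e > 0" and eta: "eta \<in> dual_lattice"
 shows "integrable (dual_factor (\<Gamma> i)) (gauss_kernel e eta i)"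
  and "(LINT t|dual_factor (\<Gamma> i). gauss_kernel e eta i t) = of_real (case \<Gamma> i of Line => 1 | Torus L => L)"
  and "integrable (dual_factor (\<Gamma> i)) (\<lambda>t. cmod (gauss_kernel e eta i t) * \<bar>t - eta $ i\<bar>)"
  and "(LINT t|dual_factor (\<Gamma> i). cmod (gauss_kernel e eta i t) * \<bar>t - eta $ i\<bar>) <= e"
  and "(LINT t|dual_factor (\<Gamma> i). cmod (gauss_kernel e eta i t)) = (case \<Gamma> i of Line => 1 | Torus L => L)"
proof -
 have "integrable (dual_factor (\<Gamma> i)) (gauss_kernel e eta i) \<and>
  (LINT t|dual_factor (\<Gamma> i). gauss_kernel e eta i t) = of_real (case \<Gamma> i of Line => 1 | Torus L => L) \<and>
  integrable (dual_factor (\<Gamma> i)) (%t. cmod (gauss_kernel e eta i t) * \<bar>t - eta $ i\<bar>) \<and>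
  (LINT t|dual_factor (\<Gamma> i). cmod (gauss_kernel e eta i t) * \<bar>t - eta $ i\<bar>) <= e \<and>
  (LINT t|dual_factor (\<Gamma> i). cmod (gauss_kernel e eta i t)) = (case \<Gamma> i of Line => 1 | Torus L => L)"
 proof (cases "\<Gamma> i")
  case Line
  let ?s = "e / (2 * pi)"
  have s: "?s > 0" using e by simp
  have k: "gauss_kernel e eta i = (%t. complex_of_real (normal_density (eta $ i) ?s t))"
   using Line by (simp add: gauss_kernel_def[abs_def])
  have n: "cmod (gauss_kernel e eta i t) = normal_density (eta $ i) ?s t" for t
   unfolding k by simp
  have m: "has_bochner_integral lborel (%t. normal_density (eta $ i) ?s t * \<bar>t - eta $ i\<bar>) (?s * sqrt (2 / pi))"
   using normal_moment_abs_odd[OF s, of "eta $ i" 0] by simp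
  have "sqrt (2 / pi) <= 1" using pi_ge_two by (simp add: real_sqrt_le_1_iff)
  then have "?s * sqrt (2 / pi) <= ?s * 1" using s by (intro mult_left_mono) auto
  also have "... <= e" using pi_ge_two e by (simp add: divide_le_eq)
  finally have le: "?s * sqrt (2 / pi) <= e" .
  have i1: "integrable lborel (normal_density (eta $ i) ?s)" using s by simp
  have i2: "(LINT t|lborel. normal_density (eta $ i) ?s t) = 1" using s by simp
  show ?thesis
   unfolding n unfolding k using Line m le i1 i2
   by (auto simp: has_bochner_integral_iff simp del: integral_normal_density)
 next
  case (Torus L)
  have L: "L > 0" using pos Torus by simp
  have el: "eta $ i \<in> lattice L" using eta Torus by (simp add: dual_lattice_def)
  have m: "gauss_kernel e eta i \<in> Borel"
   unfolding gauss_kernel_def[abs_def] Torus by simp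
  have "integrable (dual_factor (Torus L)) (gauss_kernel e eta i)"
   by (rule integral_dual_torus_finite(1)[OF m, of "{eta $ i}"]) (use el Torus in \<open>auto simp: gauss_kernel_def\<close>)
  moreover have "(LINT t|dual_factor (Torus L). gauss_kernel e eta i t) = (\<Sum>t\<in>{eta $ i}. gauss_kernel e eta i t)"
   by (rule integral_dual_torus_finite(2)[OF m]) (use el Torus in \<open>auto simp: gauss_kernel_def\<close>)
  moreover have "gauss_kernel e eta i (eta $ i) = of_real L" by (simp add: gauss_kernel_def Torus)
  moreover have z: "(%t. cmod (gauss_kernel e eta i t) * \<bar>t - eta $ i\<bar>) = (%t. 0)"
   by (auto simp: gauss_kernel_def Torus)
  moreover have "cmod (gauss_kernel e eta i t) = Re (gauss_kernel e eta i t)" for t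
   using L by (simp add: gauss_kernel_def Torus)
  ultimately show ?thesis using e unfolding z by (simp add: Torus del: factor_simps)
 qed
 then show "integrable (dual_factor (\<Gamma> i)) (gauss_kernel e eta i)"
  "(LINT t|dual_factor (\<Gamma> i). gauss_kernel e eta i t) = of_real (case \<Gamma> i of Line => 1 | Torus L => L)"
  "integrable (dual_factor (\<Gamma> i)) (%t. cmod (gauss_kernel e eta i t) * \<bar>t - eta $ i\<bar>)"
  "(LINT t|dual_factor (\<Gamma> i). cmod (gauss_kernel e eta i t) * \<bar>t - eta $ i\<bar>) <= e"
  "(LINT t|dual_factor (\<Gamma> i). cmod (gauss_kernel e eta i t)) = (case \<Gamma> i of Line => 1 | Torus L => L)"
  by blast+
qed

lemma cis_prod: "cis (c * (a \<bullet> x)) = (\<Prod>i\<in>UNIV. cis (c * (a $ i) * (x $ i)))"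
 by (simp add: cis_conv_exp inner_vec_def sum_distrib_left exp_sum[symmetric] mult.assoc)

lemma gauss_integrable:
 assumes "e > 0"
 shows "integrable gm (\<lambda>x. \<Prod>i\<in>UNIV. gauss_factor e i (x $ i))"
 unfolding gm_def by (rule G.integrable_vprod_prod[OF integrable_gauss_factor[OF assms]])

lemma gauss_fourier:
 assumes e: "e > 0" and eta: "eta \<in> dual_lattice" and xi: "xi \<in> dual_lattice"
 shows "(LINT x|gm. (\<Prod>i\<in>UNIV. gauss_factor e i (x $ i)) * cis (2 * pi * ((eta - xi) \<bullet> x))) = (\<Prod>i\<in>UNIV. gauss_kernel e eta i (xi $ i))"
proof -
 have "integrable (group_factor (\<Gamma> i)) (%x. gauss_factor e i x * cis (2 * pi * (eta $ i - xi $ i) * x))" for i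
 proof (rule integrable_bound[OF integrable_gauss_factor[OF e]])
  have "gauss_factor e i \<in> Borel"
   using borel_measurable_integrable[OF integrable_gauss_factor[OF e, of i]] by simp
  then show "(%x. gauss_factor e i x * cis (2 * pi * (eta $ i - xi $ i) * x)) \<in> borel_measurable (group_factor (\<Gamma> i))"
   by measurable
 qed (simp add: norm_mult)
 from G.integral_vprod_prod[OF this]
 have "(LINT x|gm. (\<Prod>i\<in>UNIV. gauss_factor e i (x $ i) * cis (2 * pi * (eta $ i - xi $ i) * x $ i)))
  = (\<Prod>i\<in>UNIV. LINT x|group_factor (\<Gamma> i). gauss_factor e i x * cis (2 * pi * (eta $ i - xi $ i) * x))"
  by (simp add: gm_def)
 also have "... = (\<Prod>i\<in>UNIV. gauss_kernel e eta i (xi $ i))"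
  using gauss_factor_fourier[OF e eta] xi by (simp add: dual_lattice_def)
 finally show ?thesis by (simp add: cis_prod prod.distrib)
qed

lemma schwartz_lines_lipschitz:
 assumes psi: "psi \<in> schwartz (\<lambda>_::'n. Line)"
 obtains B where "B >= 0" "!!xi eta. cmod (psi xi - psi eta) <= B * (\<Sum>i\<in>UNIV. \<bar>xi $ i - eta $ i\<bar>)"
proof -
 have "\<exists>B>0. \<forall>x. cmod (partial_deriv i psi x) <= B" for i
  using schwartz_bound[OF psi, of 0 "[i]"] by simp metis
 then obtain B where B: "!!i. B i > 0" "!!i x. cmod (partial_deriv i psi x) <= B i" by metis
 define C where "C = (\<Sum>i\<in>UNIV. B i)"
 have C: "B i <= C" for i unfolding C_def using B(1) by (intro member_le_sum) (auto intro: less_imp_le)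
 have C0: "0 <= C" using C B(1) less_imp_le order_trans by blast
 have "cmod (psi (eta + (xi - eta)) - psi eta) <= C * (\<Sum>i\<in>UNIV. \<bar>(xi - eta) $ i\<bar>)" for xi eta
  by (rule smooth_mvt[OF schwartz_smooth[OF psi]]) (use B(2) C order_trans in blast)
 then have "cmod (psi xi - psi eta) <= C * (\<Sum>i\<in>UNIV. \<bar>xi $ i - eta $ i\<bar>)" for xi eta by simp
 with C0 show thesis by (rule that)
qed

lemma schwartz_measurable: "phi \<in> schwartz \<Gamma>' ==> phi \<in> Borel"
 by (intro borel_measurable_continuous_onI smooth_fun_continuous schwartz_smooth)

text \<open>
 The integral is regularised by a Gaussian in the real coordinates. After an exchange of the order of
 integration it is an average of \<open>psi\<close> against a product kernel concentrating at \<open>eta\<close>; on the other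
 side the Gaussian tends to one and dominated convergence applies, since the transform of \<open>psi\<close> is a
 Schwartz function.
\<close>

lemma dual_inversion:
 assumes psi: "psi \<in> schwartz (\<lambda>_::'n. Line)" and eta: "eta \<in> dual_lattice"
 shows "(LINT x|gm. osc dm (2 * pi * of_int (-1)) psi x * cis (2 * pi * (eta \<bullet> x))) = of_real (torus_volume \<Gamma>) * psi eta"
proof -
 let ?F = "osc dm (2 * pi * of_int (-1)) psi"
 define E where "E n x = (\<Prod>i\<in>UNIV. gauss_factor (1 / real (Suc n)) i (x $ i))" for n x
 define K where "K n xi = (\<Prod>i\<in>UNIV. gauss_kernel (1 / real (Suc n)) eta i (xi $ i))" for n xi
 define J where "J n = (LINT x|gm. E n x * (?F x * cis (2 * pi * (eta \<bullet> x))))" for n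
 have e: "1 / real (Suc n) > 0" for n by simp
 have Fs: "?F \<in> schwartz \<Gamma>" by (rule schwartz_osc_dm[OF psi]) simp
 have psii: "integrable dm psi" by (rule rapid_integrable[OF rapid_dm[OF psi]])
 have Fi: "integrable gm (%x. ?F x * cis (2 * pi * (eta \<bullet> x)))"
  using integrable_osc[OF rapid_integrable[OF rapid_gm[OF Fs]] sets_gm, of "2 * pi" eta] by (simp add: inner_commute)
 have Ei: "integrable gm (E n)" for n
  unfolding E_def by (rule gauss_integrable[OF e])
 have "J \<longlonglongrightarrow> (LINT x|gm. ?F x * cis (2 * pi * (eta \<bullet> x)))"
  unfolding J_def
 proof (rule integral_dominated_convergence[where w = "%x. cmod (?F x * cis (2 * pi * (eta \<bullet> x)))"])
  show "(%x. ?F x * cis (2 * pi * (eta \<bullet> x))) \<in> borel_measurable gm" using Fi by auto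
  then show "(%x. E n x * (?F x * cis (2 * pi * (eta \<bullet> x)))) \<in> borel_measurable gm" for n
   using borel_measurable_integrable[OF Ei] by measurable
  show "integrable gm (%x. cmod (?F x * cis (2 * pi * (eta \<bullet> x))))" using Fi by (rule integrable_norm)
  show "AE x in gm. (%n. E n x * (?F x * cis (2 * pi * (eta \<bullet> x)))) \<longlonglongrightarrow> ?F x * cis (2 * pi * (eta \<bullet> x))"
  proof (rule AE_I2)
   fix x :: "real ^ 'n"
   have "(%n. gauss_factor (1 / real (Suc n)) i (x $ i)) \<longlonglongrightarrow> 1" for i
   proof (cases "\<Gamma> i")
    case Line
    have "(%n. exp (- (1 / real (Suc n) * x $ i)\<^sup>2 / 2)) \<longlonglongrightarrow> exp (- (0 * x $ i)\<^sup>2 / 2)"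
     by (intro tendsto_intros LIMSEQ_Suc[OF lim_1_over_n]) simp
    then have "(%n. complex_of_real (exp (- (1 / real (Suc n) * x $ i)\<^sup>2 / 2))) \<longlonglongrightarrow> of_real 1"
     by (intro tendsto_of_real) simp
    then show ?thesis by (simp add: gauss_factor_def Line)
   qed (simp add: gauss_factor_def)
   then have "(%n. E n x) \<longlonglongrightarrow> (\<Prod>i\<in>(UNIV::'n set). 1)"
    unfolding E_def by (rule tendsto_prod)
   then show "(%n. E n x * (?F x * cis (2 * pi * (eta \<bullet> x)))) \<longlonglongrightarrow> ?F x * cis (2 * pi * (eta \<bullet> x))"
    using tendsto_mult[OF _ tendsto_const, of "%n. E n x" 1 sequentially] by simp
  qed
  have "cmod (gauss_factor e i t) <= 1" for e i t
   by (cases "\<Gamma> i") (simp_all add: gauss_factor_def)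
  then have "cmod (E n x) <= 1" for n x
   unfolding E_def prod_norm[symmetric] by (intro prod_le_1) auto
  then have "cmod (E n x) * cmod (?F x * cis (2 * pi * (eta \<bullet> x))) <= 1 * cmod (?F x * cis (2 * pi * (eta \<bullet> x)))" for n x
   by (intro mult_right_mono) auto
  then show "AE x in gm. cmod (E n x * (?F x * cis (2 * pi * (eta \<bullet> x)))) <= cmod (?F x * cis (2 * pi * (eta \<bullet> x)))" for n
   by (simp add: norm_mult)
 qed
 moreover have "J \<longlonglongrightarrow> of_real (torus_volume \<Gamma>) * psi eta"
 proof -
  have ke: "(%(x, xi). cis (2 * pi * ((eta - xi) \<bullet> x))) \<in> borel_measurable (gm \<Otimes>\<^sub>M dm)"
   by (rule continuous_pair_measurable)
    (auto simp: case_prod_beta' cis_conv_exp intro!: continuous_intros)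
  have JK: "J n = (LINT xi|dm. psi xi * K n xi)" and Ki: "integrable dm (%xi. psi xi * K n xi)" for n
  proof -
   note fub = fubini_bounded_kernel[OF sigma_finite_gm sigma_finite_dm Ei psii ke, of 1 n]
   have "?F x * cis (2 * pi * (eta \<bullet> x)) = (LINT xi|dm. psi xi * cis (2 * pi * ((eta - xi) \<bullet> x)))" for x
   proof -
    have "cis (2 * pi * of_int (-1) * (xi \<bullet> x)) * cis (2 * pi * (eta \<bullet> x)) = cis (2 * pi * ((eta - xi) \<bullet> x))" for xi
     by (simp add: cis_mult inner_diff_left algebra_simps)
    then show ?thesis unfolding osc_def
     by (subst integral_mult_left_zero[symmetric]) (simp only: mult.assoc)
   qed
   then have "J n = (LINT x|gm. E n x * (LINT xi|dm. psi xi * cis (2 * pi * ((eta - xi) \<bullet> x))))"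
    by (simp only: J_def)
   also have "... = (LINT xi|dm. psi xi * (LINT x|gm. E n x * cis (2 * pi * ((eta - xi) \<bullet> x))))"
    by (rule fub(1)) simp
   finally have 1: "J n = ..." .
   have i: "integrable dm (%xi. psi xi * (LINT x|gm. E n x * cis (2 * pi * ((eta - xi) \<bullet> x))))"
    by (rule fub(3)) simp
   have ae: "AE xi in dm. psi xi * (LINT x|gm. E n x * cis (2 * pi * ((eta - xi) \<bullet> x))) = psi xi * K n xi"
    using AE_dual_lattice
    by eventually_elim (simp only: E_def K_def gauss_fourier[OF e eta])
   have Km: "K n \<in> Borel"
   proof -
    have "gauss_kernel (1 / real (Suc n)) eta i \<in> Borel" for i
     using borel_measurable_integrable[OF gauss_kernel_integral(1)[OF e eta], of n i] by simp
    then show ?thesis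
     unfolding K_def by (intro borel_measurable_prod measurable_compose[OF measurable_vec_nth])
   qed
   have m: "(%xi. psi xi * K n xi) \<in> borel_measurable dm"
    using Km schwartz_measurable[OF psi] by measurable
   show "integrable dm (%xi. psi xi * K n xi)"
    by (rule integrable_cong_AE_imp[OF i m ae])
   show "J n = (LINT xi|dm. psi xi * K n xi)"
    unfolding 1 by (rule integral_cong_AE[OF borel_measurable_integrable[OF i] m ae])
  qed
  obtain B where B: "B >= 0" "!!xi eta. cmod (psi xi - psi eta) <= B * (\<Sum>i\<in>UNIV. \<bar>xi $ i - eta $ i\<bar>)"
   by (rule schwartz_lines_lipschitz[OF psi]) (rule that)
  define l where "l i = (case \<Gamma> i of Line => 1 | Torus L => L)" for i
  have l0: "l i >= 0" for i using pos[of i] by (cases "\<Gamma> i") (auto simp: l_def intro: less_imp_le)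
  define P where "P = (\<Sum>i\<in>UNIV. (\<Prod>j\<in>UNIV - {i}. l j))"
  have est: "cmod (J n - of_real (torus_volume \<Gamma>) * psi eta) <= B * P * (1 / real (Suc n))" for n
  proof -
   let ?e = "1 / real (Suc n)"
   have "cmod ((LINT xi|vprod (%i. dual_factor (\<Gamma> i)). psi xi * (\<Prod>i\<in>UNIV. gauss_kernel ?e eta i (xi $ i))) - psi eta * (\<Prod>i\<in>UNIV. of_real (l i)))
    <= B * (\<Sum>i\<in>UNIV. (LINT t|dual_factor (\<Gamma> i). cmod (gauss_kernel ?e eta i t) * (1 * \<bar>t - eta $ i\<bar>)) * (\<Prod>j\<in>UNIV - {i}. LINT t|dual_factor (\<Gamma> j). cmod (gauss_kernel ?e eta j t) * 1))"
   proof (rule D.product_kernel_estimate[where w = "%_ _. 1" and d = "%i t. \<bar>t - eta $ i\<bar>"])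
    show "integrable (vprod (%i. dual_factor (\<Gamma> i))) (%xi. psi xi * (\<Prod>i\<in>UNIV. gauss_kernel ?e eta i (xi $ i)))"
     using Ki[of n] by (simp add: K_def dual_measure_eq)
    show "AE xi in vprod (%i. dual_factor (\<Gamma> i)). cmod (psi xi - psi eta) * (\<Prod>i\<in>UNIV. cmod (gauss_kernel ?e eta i (xi $ i)))
     <= B * (\<Prod>i\<in>(UNIV::'n set). 1) * (\<Sum>i\<in>UNIV. \<bar>xi $ i - eta $ i\<bar>) * (\<Prod>i\<in>UNIV. cmod (gauss_kernel ?e eta i (xi $ i)))"
     using B(2) by (intro AE_I2 mult_right_mono prod_nonneg) auto
    show "integrable (dual_factor (\<Gamma> i)) (gauss_kernel ?e eta i)" for i by (rule gauss_kernel_integral[OF e eta])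
    show "(LINT t|dual_factor (\<Gamma> i). gauss_kernel ?e eta i t) = of_real (l i)" for i
     unfolding l_def by (rule gauss_kernel_integral[OF e eta])
    show "integrable (dual_factor (\<Gamma> i)) (%t. cmod (gauss_kernel ?e eta i t) * 1)" for i
     using integrable_norm[OF gauss_kernel_integral(1)[OF e eta]] by simp
    show "integrable (dual_factor (\<Gamma> i)) (%t. cmod (gauss_kernel ?e eta i t) * (1 * \<bar>t - eta $ i\<bar>))" for i
     using gauss_kernel_integral(3)[OF e eta] by simp
   qed auto
   also have "... <= B * (\<Sum>i\<in>UNIV. ?e * (\<Prod>j\<in>UNIV - {i}. l j))"
   proof (intro mult_left_mono B sum_mono mult_mono)
    fix i
    show "(LINT t|dual_factor (\<Gamma> i). cmod (gauss_kernel ?e eta i t) * (1 * \<bar>t - eta $ i\<bar>)) <= ?e"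
     using gauss_kernel_integral(4)[OF e eta] by simp
    have "(LINT t|dual_factor (\<Gamma> j). cmod (gauss_kernel ?e eta j t) * 1) = l j" for j
     using gauss_kernel_integral(5)[OF e eta] by (simp add: l_def)
    then show "(\<Prod>j\<in>UNIV - {i}. LINT t|dual_factor (\<Gamma> j). cmod (gauss_kernel ?e eta j t) * 1) <= (\<Prod>j\<in>UNIV - {i}. l j)"
     "0 <= (\<Prod>j\<in>UNIV - {i}. LINT t|dual_factor (\<Gamma> j). cmod (gauss_kernel ?e eta j t) * 1)"
     using l0 by (simp_all add: prod_nonneg)
   qed simp
   also have "... = B * P * ?e" by (simp add: P_def sum_distrib_left[symmetric] sum_divide_distrib[symmetric])
   finally show ?thesis
    unfolding JK K_def dual_measure_eq torus_volume_def l_def[symmetric] by (simp add: mult.commute)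
  qed
  have "(%n. J n - of_real (torus_volume \<Gamma>) * psi eta) \<longlonglongrightarrow> 0"
  proof (rule Lim_null_comparison)
   show "\<forall>\<^sub>F n in sequentially. cmod (J n - of_real (torus_volume \<Gamma>) * psi eta) <= B * P * (1 / real (Suc n))"
    using est by simp
   have "(%n. B * P * (1 / real (Suc n))) \<longlonglongrightarrow> B * P * 0"
    by (intro tendsto_intros LIMSEQ_Suc[OF lim_1_over_n])
   then show "(%n. B * P * (1 / real (Suc n))) \<longlonglongrightarrow> 0" by simp
  qed
  then show ?thesis by (simp add: LIM_zero_iff)
 qed
 ultimately show ?thesis by (rule LIMSEQ_unique)
qed

definition inv_fourier :: "(real ^ 'n => complex) => real ^ 'n => complex" where
 "inv_fourier g x = of_real (torus_volume \<Gamma> powr (- 1 / 2)) * osc dm (2 * pi) g x"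

lemma volume_powr: "complex_of_real (torus_volume \<Gamma> powr (- 1 / 2)) * (of_real (torus_volume \<Gamma> powr (- 1 / 2)) * of_real (torus_volume \<Gamma>)) = 1"
proof -
 have "torus_volume \<Gamma> powr (- 1 / 2) * torus_volume \<Gamma> powr (- 1 / 2) = inverse (torus_volume \<Gamma>)"
 proof -
  have "(- 1 / 2) + (- 1 / 2) = (- 1 :: real)" by simp
  then show ?thesis using torus_volume_pos by (simp only: powr_add[symmetric]) (simp add: powr_minus)
 qed
 then have "torus_volume \<Gamma> powr (- 1 / 2) * (torus_volume \<Gamma> powr (- 1 / 2) * torus_volume \<Gamma>) = 1"
  using torus_volume_pos by (simp add: mult.assoc[symmetric])
 then show ?thesis by (metis of_real_1 of_real_mult)
qed

text \<open>
 Fubini reduces this to inversion for \<open>psi\<close>. The formula says that \<open>g\<close> is the distributional transform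
 of its inverse transform.
\<close>

lemma multiplication_formula:
 assumes g: "integrable dm g" and psi: "psi \<in> schwartz (\<lambda>_::'n. Line)"
 shows "(LINT x|gm. inv_fourier g x * fourier_transpose \<Gamma> psi x) = (LINT xi|dm. g xi * psi xi)"
proof -
 let ?v = "complex_of_real (torus_volume \<Gamma> powr (- 1 / 2))"
 let ?F = "osc dm (2 * pi * of_int (-1)) psi"
 have Fs: "?F \<in> schwartz \<Gamma>" by (rule schwartz_osc_dm[OF psi]) simp
 have Fi: "integrable gm ?F" by (rule rapid_integrable[OF rapid_gm[OF Fs]])
 note fub = fubini_bounded_kernel[OF sigma_finite_gm sigma_finite_dm Fi g, of "%x xi. cis (2 * pi * (xi \<bullet> x))" 1]
 have "(LINT x|gm. inv_fourier g x * fourier_transpose \<Gamma> psi x) = (LINT x|gm. (?v * ?v) * (?F x * osc dm (2 * pi) g x))"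
  unfolding inv_fourier_def fourier_transpose_eq by (simp only: mult_ac)
 also have "... = (?v * ?v) * (LINT x|gm. ?F x * (LINT xi|dm. g xi * cis (2 * pi * (xi \<bullet> x))))"
  by (simp only: integral_mult_right_zero osc_def[of dm "2 * pi" g])
 also have "(LINT x|gm. ?F x * (LINT xi|dm. g xi * cis (2 * pi * (xi \<bullet> x)))) = (LINT xi|dm. g xi * (LINT x|gm. ?F x * cis (2 * pi * (xi \<bullet> x))))"
  by (rule fub(1)) (simp_all add: cis_pair_measurable)
 also have "... = (LINT xi|dm. of_real (torus_volume \<Gamma>) * (g xi * psi xi))"
 proof (rule integral_cong_AE)
  show "(%xi. g xi * (LINT x|gm. ?F x * cis (2 * pi * (xi \<bullet> x)))) \<in> borel_measurable dm"
   by (rule borel_measurable_integrable, rule fub(3)) (simp_all add: cis_pair_measurable)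
  show "(%xi. of_real (torus_volume \<Gamma>) * (g xi * psi xi)) \<in> borel_measurable dm"
   using borel_measurable_integrable[OF g] schwartz_measurable[OF psi] by measurable
  show "AE xi in dm. g xi * (LINT x|gm. ?F x * cis (2 * pi * (xi \<bullet> x))) = of_real (torus_volume \<Gamma>) * (g xi * psi xi)"
   using AE_dual_lattice by eventually_elim (subst dual_inversion[OF psi], assumption, simp only: mult_ac)
 qed
 also have "(?v * ?v) * ... = (LINT xi|dm. g xi * psi xi)"
 proof -
  have "(?v * ?v) * (of_real (torus_volume \<Gamma>) * X) = X" for X
   using arg_cong[OF volume_powr, of "%z. z * X"] by (simp only: mult.assoc mult_1_left)
  then show ?thesis by (simp only: integral_mult_right_zero)
 qed
 finally show ?thesis .
qed

end

section \<open>Fundamental lemma of the calculus of variations\<close>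

text \<open>
 Boxes form an intersection-stable generator of the Borel sets, so the integrals over all Borel
 subsets of a large box vanish as well.
\<close>

lemma AE_zero_if_box_integrals_zero:
 fixes d :: "real ^ 'n::finite => complex"
 assumes s: "sets M = sets borel"
  and int: "!!a b. integrable M (\<lambda>x. indicator (box a b) x *\<^sub>R d x)"
  and zero: "!!a b. (LINT x|M. indicator (box a b) x *\<^sub>R d x) = 0"
 shows "AE x in M. d x = 0"
proof -
 define Q :: "nat => (real ^ 'n) set" where "Q m = box (\<chi> i. - real m) (\<chi> i. real m)" for m
 define f where "f m x = indicator (Q m) x *\<^sub>R d x" for m x
 have f: "integrable M (f m)" for m unfolding f_def Q_def by (rule int)
 have bs: "box a b \<in> sets M" for a b using s by simp
 have setint: "set_integrable M A (f m)" if "A \<in> sets M" for A m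
  unfolding set_integrable_def using integrable_mult_indicator[OF that f] .
 have A: "(LINT x:A|M. f m x) = 0" if "A \<in> sets borel" for A m
 proof -
  let ?G = "range (%(a, b). box a b :: (real^'n) set)"
  have sb: "sets borel = sigma_sets UNIV ?G"
   by (subst borel_eq_box) (simp add: sets_measure_of)
  have ii: "\<exists>c e. box a b \<inter> box a' b' = (box c e :: (real^'n) set)" for a b a' b'
   unfolding box_Int_box by blast
  have Ain: "A \<in> sigma_sets UNIV ?G" using that sb by simp
  have "Int_stable ?G"
  proof (rule Int_stableI)
   fix S T assume "S \<in> ?G" "T \<in> ?G"
   then obtain a b a' b' where "S = box a b" "T = box a' b'" by auto
   moreover obtain c e where "box a b \<inter> box a' b' = box c e" using ii by blast
   ultimately show "S \<inter> T \<in> ?G" by auto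
  qed
  moreover have "?G \<subseteq> Pow UNIV" by simp
  ultimately show ?thesis using Ain
  proof (induction rule: sigma_sets_induct_disjoint)
   case (basic A)
   then obtain a b where A: "A = box a b" by auto
   obtain c e where ce: "box a b \<inter> Q m = box c e" using ii unfolding Q_def by blast
   have "(LINT x:A|M. f m x) = (LINT x|M. indicator (box c e) x *\<^sub>R d x)"
    unfolding set_lebesgue_integral_def f_def A ce[symmetric]
    by (simp add: indicator_inter_arith)
   then show ?case by (simp add: zero)
  next
   case empty
   then show ?case by (simp add: set_lebesgue_integral_def)
  next
   case (compl A)
   have As: "A \<in> sets M" using compl(1) sb s by simp
   have "(LINT x|M. f m x) = 0" unfolding f_def Q_def by (rule zero)
   moreover have "indicator (UNIV - A) x *\<^sub>R f m x = f m x - indicator A x *\<^sub>R f m x" for x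
    by (auto simp: indicator_def)
   ultimately show ?case
    using compl(2) f setint[OF As, of m] unfolding set_lebesgue_integral_def set_integrable_def by simp
  next
   case (union A)
   have As: "A i \<in> sets M" for i using union(2) sb s by auto
   have "(LINT x:(\<Union>i. A i)|M. f m x) = (\<Sum>i. (LINT x:(A i)|M. f m x))"
    using union(1) As by (intro lebesgue_integral_countable_add setint) (auto simp: disjoint_family_on_def)
   then show ?case using union by simp
  qed
 qed
 have "AE x in M. f m x = 0" for m
 proof -
  have "AE x in M. Re (c * f m x) = 0" for c
  proof (rule density_unique_real)
   fix A assume "A \<in> sets M"
   then have "(LINT x:A|M. f m x) = 0" and "set_integrable M A (f m)" using A s setint by auto
   then have "(LINT x|M. Re (c * (indicator A x *\<^sub>R f m x))) = 0"
    by (simp only: set_lebesgue_integral_def set_integrable_def integral_Re integrable_mult_right integral_mult_right_zero mult_zero_right zero_complex.sel)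
   then show "(LINT x:A|M. Re (c * f m x)) = (LINT x:A|M. 0)"
    by (simp add: set_lebesgue_integral_def)
  qed (use f in auto)
  from this[of 1] this[of "- \<i>"] show ?thesis by eventually_elim (simp add: complex_eq_iff)
 qed
 then have "AE x in M. \<forall>m. f m x = 0" by (subst AE_all_countable) auto
 then show ?thesis
 proof eventually_elim
  case (elim x)
  obtain m :: nat where m: "norm x < real m" using reals_Archimedean2 by blast
  have "\<bar>x $ i\<bar> < real m" for i using component_le_norm_cart[of x i] m by linarith
  then have "x \<in> Q m" unfolding Q_def mem_box_cart by (auto simp: abs_less_iff) (metis minus_less_iff)
  then show ?case using elim[rule_format, of m] by (simp add: f_def)
 qed
qed

text \<open>
 Products of approximations of interval indicators converge to the indicator of a box. The family
 \<open>\<Theta>\<close> is a parameter because the tests are compactly supported on the dual group but periodic on the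
 circles of the group.
\<close>

lemma (in real_measures) AE_zero_if_product_integrals_zero:
 fixes d :: "real ^ 'n => complex" and \<Theta> :: "'n => (real => real) set"
 assumes int: "!!a b. integrable (vprod M) (\<lambda>x. indicator (box a b) x *\<^sub>R d x)"
  and d: "d \<in> Borel"
  and \<Theta>: "!!i theta. theta \<in> \<Theta> i ==> theta \<in> Borel"
  and approx: "!!i a b. a < b ==> \<exists>theta. (\<forall>n. theta n \<in> \<Theta> i) \<and>
    (AE t in M i. \<forall>n. 0 <= theta n t \<and> theta n t <= indicator {a<..<b} t) \<and>
    (AE t in M i. (\<lambda>n. theta n t) \<longlonglongrightarrow> indicator {a<..<b} t)"
  and zero: "!!theta. (!!i. theta i \<in> \<Theta> i) ==> (LINT x|vprod M. d x * of_real (\<Prod>i\<in>UNIV. theta i (x $ i))) = 0"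
 shows "AE x in vprod M. d x = 0"
proof (rule AE_zero_if_box_integrals_zero[OF sets_vprod int])
 fix a b :: "real ^ 'n"
 show "(LINT x|vprod M. indicator (box a b) x *\<^sub>R d x) = 0"
 proof (cases "\<forall>i. a $ i < b $ i")
  case False
  then obtain i where "b $ i <= a $ i" by (auto simp: not_less)
  then have "\<not> (a $ i < x $ i \<and> x $ i < b $ i)" for x :: "real^'n" by linarith
  then have "x \<notin> box a b" for x by (auto simp: mem_box_cart)
  then have "box a b = {}" by blast
  then show ?thesis by simp
 next
  case True
  then have "\<forall>i. \<exists>theta. (\<forall>n. theta n \<in> \<Theta> i) \<and>
    (AE t in M i. \<forall>n. 0 <= theta n t \<and> theta n t <= indicator {a $ i<..<b $ i} t) \<and>
    (AE t in M i. (%n. theta n t) \<longlonglongrightarrow> indicator {a $ i<..<b $ i} t)"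
   using approx by blast
  from choice[OF this] obtain theta where "\<forall>i. (\<forall>n. theta i n \<in> \<Theta> i) \<and>
    (AE t in M i. \<forall>n. 0 <= theta i n t \<and> theta i n t <= indicator {a $ i<..<b $ i} t) \<and>
    (AE t in M i. (%n. theta i n t) \<longlonglongrightarrow> indicator {a $ i<..<b $ i} t)" ..
  then have theta: "!!i n. theta i n \<in> \<Theta> i"
   "!!i. AE t in M i. \<forall>n. 0 <= theta i n t \<and> theta i n t <= indicator {a $ i<..<b $ i} t"
   "!!i. AE t in M i. (%n. theta i n t) \<longlonglongrightarrow> indicator {a $ i<..<b $ i} t"
   by (simp_all only:)
  note [measurable] = d \<Theta>[OF theta(1)]
  have ind: "(\<Prod>i\<in>UNIV. indicator {a $ i<..<b $ i} (x $ i)) = (indicator (box a b) x :: real)" for x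
   by (auto simp: indicator_def mem_box_cart)
  have b: "AE x in vprod M. \<forall>i n. 0 <= theta i n (x $ i) \<and> theta i n (x $ i) <= indicator {a $ i<..<b $ i} (x $ i)"
   by (rule AE_vprod[OF theta(2)])
  have l: "AE x in vprod M. \<forall>i. (%n. theta i n (x $ i)) \<longlonglongrightarrow> indicator {a $ i<..<b $ i} (x $ i)"
   by (rule AE_vprod[OF theta(3)])
  have "(%n. LINT x|vprod M. d x * of_real (\<Prod>i\<in>UNIV. theta i n (x $ i))) \<longlonglongrightarrow> (LINT x|vprod M. indicator (box a b) x *\<^sub>R d x)"
  proof (rule integral_dominated_convergence[where w = "%x. norm (indicator (box a b) x *\<^sub>R d x)"])
   show "(%x. indicator (box a b) x *\<^sub>R d x) \<in> borel_measurable (vprod M)"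
    by (rule borel_measurable_integrable[OF int])
   show "(%x. d x * of_real (\<Prod>i\<in>UNIV. theta i n (x $ i))) \<in> borel_measurable (vprod M)" for n
    by measurable
   show "integrable (vprod M) (%x. norm (indicator (box a b) x *\<^sub>R d x))"
    by (rule integrable_norm[OF int])
   show "AE x in vprod M. (%n. d x * of_real (\<Prod>i\<in>UNIV. theta i n (x $ i))) \<longlonglongrightarrow> indicator (box a b) x *\<^sub>R d x"
    using l
   proof eventually_elim
    case (elim x)
    have "(%n. \<Prod>i\<in>UNIV. theta i n (x $ i)) \<longlonglongrightarrow> (\<Prod>i\<in>UNIV. indicator {a $ i<..<b $ i} (x $ i))"
     using elim by (intro tendsto_prod) auto
    then have "(%n. d x * of_real (\<Prod>i\<in>UNIV. theta i n (x $ i))) \<longlonglongrightarrow> d x * of_real (indicator (box a b) x)"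
     unfolding ind by (intro tendsto_intros)
    then show ?case by (simp only: scaleR_conv_of_real mult.commute)
   qed
   show "AE x in vprod M. norm (d x * of_real (\<Prod>i\<in>UNIV. theta i n (x $ i))) <= norm (indicator (box a b) x *\<^sub>R d x)" for n
    using b
   proof eventually_elim
    case (elim x)
    have "0 <= (\<Prod>i\<in>UNIV. theta i n (x $ i))" using elim by (intro prod_nonneg) auto
    moreover have "(\<Prod>i\<in>UNIV. theta i n (x $ i)) <= (\<Prod>i\<in>UNIV. indicator {a $ i<..<b $ i} (x $ i))"
     using elim by (intro prod_mono) auto
    ultimately have "norm (d x) * \<bar>\<Prod>i\<in>UNIV. theta i n (x $ i)\<bar> <= norm (d x) * indicator (box a b) x"
     unfolding ind by (intro mult_left_mono) auto
    then show ?case by (simp only: norm_mult norm_of_real norm_scaleR abs_of_nonneg indicator_pos_le mult.commute)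
   qed
  qed
  moreover have "(LINT x|vprod M. d x * of_real (\<Prod>i\<in>UNIV. theta i n (x $ i))) = 0" for n
   by (rule zero) (rule theta(1))
  ultimately show ?thesis using LIMSEQ_unique[OF tendsto_const] by fastforce
 qed
qed

definition test_factor :: "factor => 'n::finite => (real => real) set" where
 "test_factor f i = {theta. theta \<in> Borel \<and> smooth_fun (\<lambda>x::real^'n. complex_of_real (theta (x $ i))) \<and>
  (case f of Line => \<exists>B. \<forall>t. theta t ~= 0 \<longrightarrow> \<bar>t\<bar> <= B | Torus L => \<forall>t. theta (t + L) = theta t)}"

lemma flat_measurable [measurable]: "flat \<in> Borel"
proof -
 have "isCont flat t" for t
  unfolding flat_def using flat_poly_deriv DERIV_isCont by blast
 then show ?thesis
  by (intro borel_measurable_continuous_onI continuous_at_imp_continuous_on) auto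
qed

lemma flat_scaled_indicator:
 assumes "!!t. q t > 0 \<longleftrightarrow> t \<in> A"
 shows "(\<lambda>n. flat (real n * q t)) \<longlonglongrightarrow> indicator A t"
  and "0 <= flat (real n * q t)" and "flat (real n * q t) <= indicator A t"
proof -
 show "(%n. flat (real n * q t)) \<longlonglongrightarrow> indicator A t"
  using flat_step_tendsto[of "q t"] assms[of t] by (simp add: indicator_def)
 show "0 <= flat (real n * q t)" by (rule flat_nonneg)
 show "flat (real n * q t) <= indicator A t"
 proof (cases "t \<in> A")
  case False
  then have "real n * q t <= 0" using assms[of t] by (simp add: mult_nonneg_nonpos)
  then show ?thesis using False by (simp add: flat_simps)
 qed (simp add: flat_le_1)
qed

lemma line_test_factor_approx:
 fixes i :: "'n::finite"
 assumes "a < b"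
 shows "\<exists>theta. (\<forall>n. theta n \<in> test_factor Line i) \<and> (\<forall>t n. 0 <= theta n t \<and> theta n t <= indicator {a<..<b} t) \<and>
    (\<forall>t. (\<lambda>n. theta n t) \<longlonglongrightarrow> indicator {a<..<b} t)"
proof -
 let ?q = "%t. (t - a) * (b - t)"
 have q: "?q t > 0 \<longleftrightarrow> t \<in> {a<..<b}" for t
  using assms by (auto simp: zero_less_mult_iff)
 define theta where "theta n t = flat (real n * ?q t)" for n t
 have "smooth_fun (%x::real^'n. complex_of_real (theta n (x $ i)))" for n
 proof -
  have "smooth_fun (%x::real^'n. of_real (real n) * ((of_real (x $ i) + of_real (- a)) * (of_real b + of_real (- 1) * of_real (x $ i))))"
   by (intro smooth_fun_mult smooth_fun_add smooth_fun_const smooth_fun_nth)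
  then have "smooth_fun (%x::real^'n. complex_of_real (real n * ?q (x $ i)))" by simp
  then show ?thesis unfolding theta_def by (rule smooth_fun_flat)
 qed
 moreover have "theta n \<in> Borel" for n unfolding theta_def by measurable
 moreover have "\<exists>B. \<forall>t. theta n t ~= 0 \<longrightarrow> \<bar>t\<bar> <= B" for n
 proof -
  have "\<bar>t\<bar> <= \<bar>a\<bar> + \<bar>b\<bar>" if "theta n t ~= 0" for t
  proof -
   have "t \<in> {a<..<b}"
   proof (rule ccontr)
    assume "t \<notin> {a<..<b}"
    then have "theta n t <= 0"
     using flat_scaled_indicator(3)[of ?q "{a<..<b}" n t, OF q] by (simp add: theta_def)
    then show False using that flat_nonneg[of "real n * ?q t"] by (simp add: theta_def)
   qed
   then show ?thesis by auto
  qed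
  then show ?thesis by blast
 qed
 ultimately have "theta n \<in> test_factor Line i" for n by (simp add: test_factor_def)
 then show ?thesis
  using flat_scaled_indicator[of ?q "{a<..<b}", OF q] unfolding theta_def
  by (intro exI[of _ "%n t. flat (real n * ?q t)"]) simp
qed

text \<open>
 A periodic replacement for \<open>(t - a) * (b - t)\<close>: the difference of cosines is twice the product of
 \<open>sin (pi * (t - a) / L)\<close> and \<open>sin (pi * (b - t) / L)\<close>, whose signs are those of \<open>t - a\<close> and \<open>b - t\<close>.
\<close>

lemma torus_bump_pos_iff:
 assumes L: "L > 0" and ab: "0 <= a" "a < b" "b <= L" and t: "0 < t" "t < L"
 shows "cos (2 * pi * (t - (a + b) / 2) / L) - cos (pi * (b - a) / L) > 0 \<longleftrightarrow> t \<in> {a<..<b}"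
proof -
 have sgn: "0 < sin (pi * u / L) \<longleftrightarrow> 0 < u" "sin (pi * u / L) < 0 \<longleftrightarrow> u < 0" if u: "\<bar>u\<bar> < L" for u
 proof -
  have gt: "0 < sin (pi * r / L)" if "0 < r" "r < L" for r
   using that L by (intro sin_gt_zero) (simp_all add: divide_less_eq)
  have lt: "sin (pi * r / L) < 0" if "r < 0" "- L < r" for r
   using gt[of "- r"] that by simp
  show "0 < sin (pi * u / L) \<longleftrightarrow> 0 < u" "sin (pi * u / L) < 0 \<longleftrightarrow> u < 0"
   using gt[of u] lt[of u] u by (cases "u = 0"; cases "u < 0"; force)+
 qed
 have "cos (2 * pi * (t - (a + b) / 2) / L) - cos (pi * (b - a) / L) = 2 * (sin (pi * (t - a) / L) * sin (pi * (b - t) / L))"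
  unfolding cos_diff_cos mult.assoc
  by (intro arg_cong2[of _ _ _ _ "%x y. 2 * (sin x * sin y)"]) (use L in \<open>simp_all add: field_simps\<close>)
 moreover have "\<bar>t - a\<bar> < L" "\<bar>b - t\<bar> < L" using ab t by auto
 ultimately show ?thesis using sgn[of "t - a"] sgn[of "b - t"] ab by (auto simp: zero_less_mult_iff)
qed

lemma smooth_fun_cos_nth: "smooth_fun (\<lambda>x::real^'n::finite. complex_of_real (cos (c * (x $ i) + e)))"
proof -
 have "smooth_fun (%x::real^'n. complex_of_real (c * (x $ i) + e))"
  using smooth_fun_add[OF smooth_fun_mult[OF smooth_fun_const[of "of_real c"] smooth_fun_nth[of i]] smooth_fun_const[of "of_real e"]]
  by simp
 then have s: "smooth_fun (%x::real^'n. cis (c * (x $ i) + e))" by (rule smooth_fun_cis)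
 have "smooth_fun (%x::real^'n. (1 / 2) * (cis (c * (x $ i) + e) + cnj (cis (c * (x $ i) + e))))"
  by (intro smooth_fun_mult smooth_fun_add smooth_fun_const smooth_fun_cnj s)
 moreover have "(1 / 2) * (cis z + cnj (cis z)) = complex_of_real (cos z)" for z
  by (simp add: complex_eq_iff)
 ultimately show ?thesis by simp
qed

lemma torus_test_factor_approx:
 fixes i :: "'n::finite"
 assumes L: "L > 0" and ab: "a < b"
 shows "\<exists>theta. (\<forall>n. theta n \<in> test_factor (Torus L) i) \<and> (\<forall>t n. 0 < t \<and> t < L \<longrightarrow> 0 <= theta n t \<and> theta n t <= indicator {a<..<b} t) \<and>
    (\<forall>t. 0 < t \<and> t < L \<longrightarrow> (\<lambda>n. theta n t) \<longlonglongrightarrow> indicator {a<..<b} t)"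
proof -
 define a' where "a' = max a 0"
 define b' where "b' = min b L"
 have ind: "(indicator {a<..<b} t :: real) = indicator {a'<..<b'} t" if "0 < t" "t < L" for t
  using that by (auto simp: a'_def b'_def indicator_def)
 show ?thesis
 proof (cases "a' < b'")
  case False
  have "(%_. 0) \<in> test_factor (Torus L) i"
   using smooth_fun_const[of 0] by (simp add: test_factor_def)
  moreover have "{a'<..<b'} = {}" using False by auto
  ultimately show ?thesis using ind by (intro exI[of _ "%n t. 0"] conjI allI impI) simp_all
 next
  case True
  let ?q = "%t. cos (2 * pi * (t - (a' + b') / 2) / L) - cos (pi * (b' - a') / L)"
  define r where "r t = (if 0 < t \<and> t < L then ?q t else 0)" for t
  have q: "r t > 0 \<longleftrightarrow> t \<in> {a'<..<b'}" for t
  proof (cases "0 < t \<and> t < L")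
   case True
   then show ?thesis using torus_bump_pos_iff[OF L, of a' b' t] \<open>a' < b'\<close> by (simp add: r_def a'_def b'_def)
  qed (auto simp: r_def a'_def b'_def)
  define theta where "theta n t = flat (real n * ?q t)" for n t
  have "smooth_fun (%x::real^'n. complex_of_real (theta n (x $ i)))" for n
  proof -
   have "smooth_fun (%x::real^'n. of_real (real n) * (of_real (cos ((2 * pi / L) * (x $ i) + (- (2 * pi * ((a' + b') / 2) / L)))) + of_real (- cos (pi * (b' - a') / L))))"
    by (intro smooth_fun_mult smooth_fun_add smooth_fun_const smooth_fun_cos_nth)
   moreover have "2 * pi / L * t + (- (2 * pi * ((a' + b') / 2) / L)) = 2 * pi * (t - (a' + b') / 2) / L" for t
    by (simp add: diff_divide_distrib right_diff_distrib)
   ultimately have "smooth_fun (%x::real^'n. complex_of_real (real n * ?q (x $ i)))" by simp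
   then show ?thesis unfolding theta_def by (rule smooth_fun_flat)
  qed
  moreover have "theta n \<in> Borel" for n unfolding theta_def by measurable
  moreover have "theta n (t + L) = theta n t" for n t
  proof -
   have "2 * pi * (t + L - (a' + b') / 2) / L = 2 * pi * (t - (a' + b') / 2) / L + 2 * pi"
    using L by (simp add: field_simps)
   then show ?thesis by (simp add: theta_def)
  qed
  ultimately have "theta n \<in> test_factor (Torus L) i" for n by (simp add: test_factor_def)
  moreover have "theta n t = flat (real n * r t)" if "0 < t" "t < L" for n t
   using that by (simp add: theta_def r_def)
  ultimately show ?thesis
   using flat_scaled_indicator[of r "{a'<..<b'}", OF q] ind by (intro exI[of _ theta]) auto
 qed
qed

lemma product_test_schwartz:
 assumes pos: "!!i L. \<Gamma> i = Torus L ==> L > 0" and theta: "!!i. theta i \<in> test_factor (\<Gamma> i) i"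
 shows "smooth_fun (\<lambda>x::real^'n::finite. complex_of_real (\<Prod>i\<in>UNIV. theta i (x $ i)))"
  and "\<exists>B. \<forall>x. (\<Prod>i\<in>UNIV. theta i (x $ i)) ~= 0 \<longrightarrow> real_part_norm \<Gamma> x <= B"
  and "(\<lambda>x. complex_of_real (\<Prod>i\<in>UNIV. theta i (x $ i))) \<in> schwartz \<Gamma>"
proof -
 have "smooth_fun (%x::real^'n. \<Prod>i\<in>UNIV. complex_of_real (theta i (x $ i)))"
  using theta by (intro smooth_fun_prod) (auto simp: test_factor_def)
 then show sm: "smooth_fun (%x::real^'n. complex_of_real (\<Prod>i\<in>UNIV. theta i (x $ i)))" by simp
 have "\<exists>B. \<forall>t. \<Gamma> i = Line \<longrightarrow> theta i t ~= 0 \<longrightarrow> \<bar>t\<bar> <= B" for i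
  using theta[of i] by (cases "\<Gamma> i") (auto simp: test_factor_def)
 then obtain B where B: "!!i t. \<Gamma> i = Line ==> theta i t ~= 0 ==> \<bar>t\<bar> <= B i" by metis
 have rb: "real_part_norm \<Gamma> x <= (\<Sum>i\<in>UNIV. \<bar>B i\<bar>)" if "(\<Prod>i\<in>UNIV. theta i (x $ i)) ~= 0" for x
 proof -
  have nz: "theta i (x $ i) ~= 0" for i using that by auto
  have "real_part_norm \<Gamma> x <= (\<Sum>i\<in>UNIV. \<bar>(\<chi> i. if \<Gamma> i = Line then x $ i else 0) $ i\<bar>)"
   unfolding real_part_norm_def by (rule norm_le_l1_cart)
  also have "... <= (\<Sum>i\<in>UNIV. \<bar>B i\<bar>)"
  proof (rule sum_mono)
   fix i show "\<bar>(\<chi> i. if \<Gamma> i = Line then x $ i else 0) $ i\<bar> <= \<bar>B i\<bar>"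
    using B[of i "x $ i"] nz[of i] by auto
  qed
  finally show ?thesis .
 qed
 then show "\<exists>B. \<forall>x. (\<Prod>i\<in>UNIV. theta i (x $ i)) ~= 0 \<longrightarrow> real_part_norm \<Gamma> x <= B" by blast
 show "(%x. complex_of_real (\<Prod>i\<in>UNIV. theta i (x $ i))) \<in> schwartz \<Gamma>"
 proof (rule schwartz_if_real_support_bounded[OF pos sm])
  show "periodic_on \<Gamma> (%x. complex_of_real (\<Prod>i\<in>UNIV. theta i (x $ i)))"
   unfolding periodic_on_def
  proof (intro allI impI)
   fix i L x assume L: "\<Gamma> i = Torus L"
   have "theta j ((x + axis i L) $ j) = theta j (x $ j)" for j
    using theta[of j] L by (cases "j = i") (auto simp: test_factor_def axis_def)
   then show "complex_of_real (\<Prod>j\<in>UNIV. theta j ((x + axis i L) $ j)) = complex_of_real (\<Prod>j\<in>UNIV. theta j (x $ j))"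
    by simp
  qed
 qed (use rb in auto)
qed

context lca
begin

lemma dual_AE_zero:
 assumes d: "d \<in> Borel" and int: "!!K. compact K ==> set_integrable dm K d"
  and zero: "!!psi. psi \<in> dual_test_functions ==> (LINT xi|dm. d xi * psi xi) = 0"
 shows "AE xi in dm. d xi = 0"
 unfolding dual_measure_eq
proof (rule D.AE_zero_if_product_integrals_zero[OF _ d, where \<Theta> = "test_factor Line"])
 show "integrable (vprod (%i. dual_factor (\<Gamma> i))) (%x. indicator (box a b) x *\<^sub>R d x)" for a b
  unfolding dual_measure_eq[symmetric] set_integrable_def[symmetric]
  by (rule set_integrable_subset[OF int[OF compact_cbox[of a b]]]) (auto simp: box_subset_cbox)
 show "theta \<in> test_factor Line i ==> theta \<in> Borel" for theta and i :: 'n by (simp add: test_factor_def)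
next
 fix i :: 'n and a b :: real assume "a < b"
 from line_test_factor_approx[OF this, of i]
 show "\<exists>theta. (\<forall>n. theta n \<in> test_factor Line i) \<and>
    (AE t in dual_factor (\<Gamma> i). \<forall>n. 0 <= theta n t \<and> theta n t <= indicator {a<..<b} t) \<and>
    (AE t in dual_factor (\<Gamma> i). (%n. theta n t) \<longlonglongrightarrow> indicator {a<..<b} t)"
  by (elim exE conjE) (rule_tac x = theta in exI, auto intro!: AE_I2)
next
 fix theta assume theta: "!!i::'n. theta i \<in> test_factor Line i"
 let ?psi = "%x. complex_of_real (\<Prod>i\<in>UNIV. theta i (x $ i))"
 note p = product_test_schwartz[of "%_. Line" theta, OF _ theta, simplified]
 have "?psi \<in> dual_test_functions"
  using p(1,2) unfolding dual_test_functions_def bounded_iff by auto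
 then show "(LINT x|vprod (%i. dual_factor (\<Gamma> i)). d x * ?psi x) = 0"
  using zero by (simp add: dual_measure_eq)
qed

lemma group_AE_zero:
 assumes d: "d \<in> Borel"
  and int: "integrable gm (\<lambda>x. cmod (d x) / growth \<Gamma> x ^ N)"
  and zero: "!!phi. phi \<in> schwartz \<Gamma> ==> (LINT x|gm. d x * phi x) = 0"
 shows "AE x in gm. d x = 0"
 unfolding gm_def
proof (rule G.AE_zero_if_product_integrals_zero[OF _ d, where \<Theta> = "%i. test_factor (\<Gamma> i) i"])
 fix a b :: "real ^ 'n"
 show "integrable (vprod (%i. group_factor (\<Gamma> i))) (%x. indicator (box a b) x *\<^sub>R d x)"
  unfolding gm_def[symmetric]
 proof -
  obtain B where B: "!!x. x \<in> box a b ==> norm x <= B"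
   using bounded_box[of a b] by (auto simp: bounded_iff)
  show "integrable gm (%x. indicator (box a b) x *\<^sub>R d x)"
  proof (rule integrable_bound[OF integrable_mult_right[OF int, of "(1 + \<bar>B\<bar>) ^ N"]])
   have "norm (indicator (box a b) x *\<^sub>R d x) <= (1 + \<bar>B\<bar>) ^ N * (cmod (d x) / growth \<Gamma> x ^ N)" for x
   proof (cases "x \<in> box a b")
    case True
    have "real_part_norm \<Gamma> x <= \<bar>B\<bar>" using real_part_norm_le_norm[of \<Gamma> x] B[OF True] by linarith
    then have "growth \<Gamma> x ^ N <= (1 + \<bar>B\<bar>) ^ N" by (intro power_mono) (auto simp: add_nonneg_nonneg)
    moreover have p: "0 < growth \<Gamma> x ^ N" by (simp add: add_pos_nonneg)
    ultimately have "cmod (d x) * growth \<Gamma> x ^ N <= cmod (d x) * (1 + \<bar>B\<bar>) ^ N"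
     by (intro mult_left_mono) auto
    then show ?thesis using True p by (simp add: field_simps)
   qed (simp add: add_nonneg_nonneg)
   then show "AE x in gm. norm (indicator (box a b) x *\<^sub>R d x) <= norm ((1 + \<bar>B\<bar>) ^ N * (cmod (d x) / growth \<Gamma> x ^ N))"
    by (intro AE_I2) (metis abs_ge_self order_trans real_norm_def)
   show "(%x. indicator (box a b) x *\<^sub>R d x) \<in> borel_measurable gm"
    using d by measurable
  qed
 qed
 show "theta \<in> test_factor (\<Gamma> i) i ==> theta \<in> Borel" for theta i by (simp add: test_factor_def)
next
 fix i and a b :: real assume ab: "a < b"
 show "\<exists>theta. (\<forall>n. theta n \<in> test_factor (\<Gamma> i) i) \<and>
    (AE t in group_factor (\<Gamma> i). \<forall>n. 0 <= theta n t \<and> theta n t <= indicator {a<..<b} t) \<and>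
    (AE t in group_factor (\<Gamma> i). (%n. theta n t) \<longlonglongrightarrow> indicator {a<..<b} t)"
 proof (cases "\<Gamma> i")
  case Line
  from line_test_factor_approx[OF ab, of i] show ?thesis
   unfolding Line by (elim exE conjE) (rule_tac x = theta in exI, auto intro!: AE_I2)
 next
  case (Torus L)
  obtain theta where theta: "!!n. theta n \<in> test_factor (Torus L) i" "!!t n. 0 < t ==> t < L ==> 0 <= theta n t \<and> theta n t <= indicator {a<..<b} t"
   "!!t. 0 < t ==> t < L ==> (%n. theta n t) \<longlonglongrightarrow> indicator {a<..<b} t"
   using torus_test_factor_approx[OF pos[OF Torus] ab, of i] by blast
  have "AE t in density lborel (indicator {0..<L}). 0 < t \<and> t < L"
   using AE_lborel_singleton[of "0::real"] by (subst AE_density) (auto simp: indicator_def elim: AE_mp)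
  then have ae: "AE t in group_factor (\<Gamma> i). 0 < t \<and> t < L" unfolding Torus factor_simps .
  show ?thesis
  proof (intro exI[of _ theta] conjI)
   show "AE t in group_factor (\<Gamma> i). \<forall>n. 0 <= theta n t \<and> theta n t <= indicator {a<..<b} t"
    using ae by eventually_elim (use theta in blast)
   show "AE t in group_factor (\<Gamma> i). (%n. theta n t) \<longlonglongrightarrow> indicator {a<..<b} t"
    using ae by eventually_elim (use theta in blast)
  qed (use theta Torus in auto)
 qed
next
 fix theta assume "!!i. theta i \<in> test_factor (\<Gamma> i) i"
 from zero[OF product_test_schwartz(3)[OF pos this]]
 show "(LINT x|vprod (%i. group_factor (\<Gamma> i)). d x * complex_of_real (\<Prod>i\<in>UNIV. theta i (x $ i))) = 0"
  by (simp add: gm_def)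
qed

end

section \<open>Functions as distributions\<close>

context lca
begin

lemma finite_lists_length_le: "finite {js :: 'n list. length js <= N}"
 using finite_lists_length_le[of "UNIV :: 'n set" N] by simp

lemma schwartz_seminorm_bdd:
 assumes "phi \<in> schwartz \<Gamma>"
 shows "bdd_above ((\<lambda>(js, x). growth \<Gamma> x ^ N * cmod (iter_partial js phi x)) ` ({js. length js <= N} \<times> UNIV))"
proof -
 have "\<exists>B. \<forall>x. growth \<Gamma> x ^ N * cmod (iter_partial js phi x) <= B" for js
  using schwartz_bound[OF assms, of N js] by metis
 then obtain B where B: "!!js x. growth \<Gamma> x ^ N * cmod (iter_partial js phi x) <= B js" by metis
 have "growth \<Gamma> x ^ N * cmod (iter_partial js phi x) <= (\<Sum>js | length js <= N. \<bar>B js\<bar>)" if "length js <= N" for js x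
 proof -
  have "B js <= \<bar>B js\<bar>" by simp
  also have "... <= (\<Sum>js | length js <= N. \<bar>B js\<bar>)"
   using finite_lists_length_le[of N] that by (intro member_le_sum) auto
  finally show ?thesis using B[of x js] by linarith
 qed
 then show ?thesis by (intro bdd_aboveI) auto
qed

lemma schwartz_seminorm_ge:
 assumes "phi \<in> schwartz \<Gamma>" "length js <= N"
 shows "growth \<Gamma> x ^ N * cmod (iter_partial js phi x) <= schwartz_seminorm \<Gamma> N phi"
 unfolding schwartz_seminorm_def
 using cSUP_upper[OF _ schwartz_seminorm_bdd[OF assms(1)], of "(js, x)" N] assms(2) by simp

lemma schwartz_seminorm_le:
 assumes "!!js x. length js <= N ==> growth \<Gamma> x ^ N * cmod (iter_partial js phi x) <= B"
 shows "schwartz_seminorm \<Gamma> N phi <= B"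
 unfolding schwartz_seminorm_def by (rule cSUP_least) (use assms in \<open>auto intro: exI[of _ "[]"]\<close>)

text \<open>
 The growth condition of \<open>tempered_functions\<close> with its exponent exposed.
\<close>

definition moderate :: "(real ^ 'n => complex) => nat => bool" where
 "moderate u N \<longleftrightarrow> u \<in> Borel \<and> integrable gm (\<lambda>x. cmod (u x) / growth \<Gamma> x ^ N)"

lemma tempered_functions_iff:
 "u \<in> tempered_functions F \<Gamma> \<longleftrightarrow> range u \<subseteq> F \<and> u \<in> Borel \<and> periodic_on \<Gamma> u \<and> (\<exists>N. moderate u N)"
proof -
 have "integrable (group_measure \<Gamma>) (%x. cmod (u x) / growth \<Gamma> x ^ N) \<longleftrightarrow>
  integrable gm (%x. cmod (u x) / growth \<Gamma> x ^ N)" if "u \<in> Borel" for N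
 proof -
  note [measurable] = that real_part_norm_measurable
  show ?thesis by (rule integrable_group) measurable
 qed
 then show ?thesis unfolding tempered_functions_def moderate_def by blast
qed

lemma moderate_integrable:
 assumes u: "moderate u N" and phi: "phi \<in> schwartz \<Gamma>"
 shows "integrable gm (\<lambda>x. u x * phi x)"
  and "cmod (LINT x|gm. u x * phi x) <= (LINT x|gm. cmod (u x) / growth \<Gamma> x ^ N) * schwartz_seminorm \<Gamma> N phi"
proof -
 note [measurable] = u[unfolded moderate_def, THEN conjunct1] schwartz_measurable[OF phi]
 have int: "integrable gm (%x. cmod (u x) / growth \<Gamma> x ^ N)" using u by (simp add: moderate_def)
 have b: "cmod (u x * phi x) <= cmod (u x) / growth \<Gamma> x ^ N * schwartz_seminorm \<Gamma> N phi" for x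
 proof -
  have p: "0 < growth \<Gamma> x ^ N" by (simp add: add_pos_nonneg)
  have "growth \<Gamma> x ^ N * cmod (phi x) <= schwartz_seminorm \<Gamma> N phi"
   using schwartz_seminorm_ge[OF phi, of "[]" N x] by simp
  then have "cmod (u x) * (growth \<Gamma> x ^ N * cmod (phi x)) <= cmod (u x) * schwartz_seminorm \<Gamma> N phi"
   by (rule mult_left_mono) simp
  then show ?thesis using p by (simp add: norm_mult field_simps)
 qed
 show i: "integrable gm (%x. u x * phi x)"
 proof (rule integrable_bound[OF integrable_mult_left[OF int, of "schwartz_seminorm \<Gamma> N phi"]])
  show "AE x in gm. cmod (u x * phi x) <= norm (cmod (u x) / growth \<Gamma> x ^ N * schwartz_seminorm \<Gamma> N phi)"
   using b by (intro AE_I2) (metis abs_ge_self order_trans real_norm_def)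
 qed measurable
 have "cmod (LINT x|gm. u x * phi x) <= (LINT x|gm. cmod (u x) / growth \<Gamma> x ^ N * schwartz_seminorm \<Gamma> N phi)"
  by (rule integral_norm_bound_integral_AE[OF i integrable_mult_left[OF int]]) (use b in auto)
 then show "cmod (LINT x|gm. u x * phi x) <= (LINT x|gm. cmod (u x) / growth \<Gamma> x ^ N) * schwartz_seminorm \<Gamma> N phi"
  by (simp only: integral_mult_left_zero)
qed

lemma dist_of_eq:
 assumes "u \<in> Borel" "phi \<in> schwartz \<Gamma>"
 shows "dist_of \<Gamma> u phi = (LINT x|gm. u x * phi x)"
proof -
 note [measurable] = assms(1) schwartz_measurable[OF assms(2)]
 show ?thesis using assms(2) by (simp add: dist_of_def) (rule integral_group, measurable)
qed

lemma dist_of_tempered: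
 assumes u: "u \<in> tempered_functions F \<Gamma>"
 shows "dist_of \<Gamma> u \<in> tempered_distributions \<Gamma>"
proof -
 obtain N where um: "u \<in> Borel" and N: "moderate u N"
  using u by (auto simp: tempered_functions_iff)
 have "\<forall>phi\<in>schwartz \<Gamma>. cmod (dist_of \<Gamma> u phi) <= (LINT x|gm. cmod (u x) / growth \<Gamma> x ^ N) * schwartz_seminorm \<Gamma> N phi"
  using moderate_integrable(2)[OF N] by (simp add: dist_of_eq[OF um])
 moreover have "dist_of \<Gamma> u (%x. phi x + psi x) = dist_of \<Gamma> u phi + dist_of \<Gamma> u psi"
  if "phi \<in> schwartz \<Gamma>" "psi \<in> schwartz \<Gamma>" for phi psi
  using moderate_integrable(1)[OF N] that schwartz_add[OF that] by (simp add: dist_of_eq[OF um] distrib_left)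
 moreover have "dist_of \<Gamma> u (%x. c * phi x) = c * dist_of \<Gamma> u phi" if "phi \<in> schwartz \<Gamma>" for c phi
 proof -
  have "dist_of \<Gamma> u (%x. c * phi x) = (LINT x|gm. c * (u x * phi x))"
   using schwartz_scale[OF that] by (simp add: dist_of_eq[OF um] mult_ac)
  then show ?thesis using that by (simp add: dist_of_eq[OF um])
 qed
 moreover have "dist_of \<Gamma> u \<in> extensional (schwartz \<Gamma>)" by (simp add: dist_of_def)
 ultimately show ?thesis unfolding tempered_distributions_def by blast
qed

lemma conj_dist_of:
 assumes u: "u \<in> Borel"
 shows "conj_dist \<Gamma> (dist_of \<Gamma> u) = dist_of \<Gamma> (\<lambda>x. cnj (u x))"
proof
 fix phi
 have cm: "(%x. cnj (u x)) \<in> Borel"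
  by (rule measurable_compose[OF u]) (intro borel_measurable_continuous_onI continuous_intros)
 show "conj_dist \<Gamma> (dist_of \<Gamma> u) phi = dist_of \<Gamma> (%x. cnj (u x)) phi"
 proof (cases "phi \<in> schwartz \<Gamma>")
  case True
  have "cnj (LINT x|gm. u x * cnj (phi x)) = (LINT x|gm. cnj (u x * cnj (phi x)))"
   by (rule integral_bounded_linear'[OF bounded_linear_cnj bounded_linear_cnj, symmetric]) simp
  then show ?thesis
   using True by (simp add: conj_dist_def dist_of_eq[OF u] dist_of_eq[OF cm] schwartz_cnj)
 qed (simp add: conj_dist_def dist_of_def)
qed

lemma dist_of_over:
 assumes u: "u \<in> tempered_functions F \<Gamma>"
 shows "dist_of \<Gamma> u \<in> dist_over F \<Gamma>"
proof -
 have um: "u \<in> Borel" using u by (simp add: tempered_functions_iff)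
 have "conj_dist \<Gamma> (dist_of \<Gamma> u) = dist_of \<Gamma> u" if "F = \<real>"
 proof -
  have "cnj (u x) = u x" for x
   using u that by (auto simp: tempered_functions_iff subset_iff Reals_cnj_iff)
  then show ?thesis by (simp add: conj_dist_of[OF um])
 qed
 then show ?thesis using dist_of_tempered[OF u] by (simp add: dist_over_def)
qed

lemma dist_of_cong_AE:
 assumes "u \<in> Borel" "v \<in> Borel" "AE x in gm. u x = v x"
 shows "dist_of \<Gamma> u = dist_of \<Gamma> v"
proof
 fix phi
 show "dist_of \<Gamma> u phi = dist_of \<Gamma> v phi"
 proof (cases "phi \<in> schwartz \<Gamma>")
  case True
  note [measurable] = assms(1,2) schwartz_measurable[OF True]
  have "(LINT x|gm. u x * phi x) = (LINT x|gm. v x * phi x)"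
   by (rule integral_cong_AE) (use assms(3) in \<open>auto elim: AE_mp\<close>)
  then show ?thesis using True assms by (simp add: dist_of_eq)
 qed (simp add: dist_of_def)
qed

lemma moderate_mono:
 assumes "moderate u N" "N <= N'"
 shows "moderate u N'"
 unfolding moderate_def
proof (intro conjI)
 show m [measurable]: "u \<in> Borel" using assms by (simp add: moderate_def)
 have "integrable gm (%x. cmod (u x) / growth \<Gamma> x ^ N)" using assms by (simp add: moderate_def)
 then show "integrable gm (%x. cmod (u x) / growth \<Gamma> x ^ N')"
 proof (rule integrable_bound)
  have "cmod (u x) / growth \<Gamma> x ^ N' <= cmod (u x) / growth \<Gamma> x ^ N" for x
  proof -
   have "growth \<Gamma> x ^ N <= growth \<Gamma> x ^ N'"
    by (rule power_increasing[OF assms(2)]) simp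
   then show ?thesis by (intro divide_left_mono) (auto intro!: mult_pos_pos zero_less_power add_pos_nonneg)
  qed
  then show "AE x in gm. norm (cmod (u x) / growth \<Gamma> x ^ N') <= norm (cmod (u x) / growth \<Gamma> x ^ N)"
   by (auto simp: abs_of_nonneg add_nonneg_nonneg)
 qed measurable
qed

lemma dist_of_inj:
 assumes u: "u \<in> tempered_functions F \<Gamma>" and v: "v \<in> tempered_functions F' \<Gamma>" and eq: "dist_of \<Gamma> u = dist_of \<Gamma> v"
 shows "AE x in gm. u x = v x"
proof -
 obtain N1 N2 where N: "moderate u N1" "moderate v N2" and m [measurable]: "u \<in> Borel" "v \<in> Borel"
  using u v by (auto simp: tempered_functions_iff)
 define N where "N = max N1 N2"
 have uN: "moderate u N" and vN: "moderate v N" using N by (auto intro: moderate_mono simp: N_def)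
 have "AE x in gm. u x - v x = 0"
 proof (rule group_AE_zero)
  show "(%x. u x - v x) \<in> Borel" by measurable
  have "integrable gm (%x. cmod (u x) / growth \<Gamma> x ^ N + cmod (v x) / growth \<Gamma> x ^ N)"
   using uN vN by (auto simp: moderate_def)
  then show "integrable gm (%x. cmod (u x - v x) / growth \<Gamma> x ^ N)"
  proof (rule integrable_bound)
   have "cmod (u x - v x) / growth \<Gamma> x ^ N <= cmod (u x) / growth \<Gamma> x ^ N + cmod (v x) / growth \<Gamma> x ^ N" for x
    unfolding add_divide_distrib[symmetric] by (intro divide_right_mono norm_triangle_ineq4) (simp add: add_nonneg_nonneg)
   then show "AE x in gm. norm (cmod (u x - v x) / growth \<Gamma> x ^ N) <= norm (cmod (u x) / growth \<Gamma> x ^ N + cmod (v x) / growth \<Gamma> x ^ N)"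
    by (auto simp: abs_of_nonneg add_nonneg_nonneg)
  qed measurable
  fix phi assume phi: "phi \<in> schwartz \<Gamma>"
  have "(LINT x|gm. u x * phi x) = (LINT x|gm. v x * phi x)"
   using fun_cong[OF eq, of phi] phi by (simp add: dist_of_eq m)
  then show "(LINT x|gm. (u x - v x) * phi x) = 0"
   using moderate_integrable(1)[OF uN phi] moderate_integrable(1)[OF vN phi] by (simp add: left_diff_distrib)
 qed
 then show ?thesis by simp
qed

section \<open>The Fourier transform of a distribution\<close>

lemma fourier_unique:
 assumes g: "is_fourier \<Gamma> T g" and h: "is_fourier \<Gamma> T h"
 shows "AE xi in dm. g xi = h xi"
proof -
 have gm [measurable]: "g \<in> Borel" "h \<in> Borel"
  and loc: "!!K. compact K ==> set_integrable dm K g" "!!K. compact K ==> set_integrable dm K h"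
  using g h by (auto simp: is_fourier_def L1_loc_dual_def)
 have i: "integrable dm (%xi. k xi * psi xi)" if "k = g \<or> k = h" "psi \<in> dual_test_functions" for k psi
 proof -
  note kpsi = that
  obtain B where B: "!!xi. psi xi ~= 0 ==> norm xi <= B"
   using kpsi(2) by (auto simp: dual_test_functions_def bounded_iff)
  have ml: "psi \<in> schwartz (%_. Line)" by (rule dual_test_schwartz[OF kpsi(2)])
  obtain C where C: "!!xi. cmod (psi xi) <= C" using schwartz_bound[OF ml, of 0 "[]"] by simp metis
  note [measurable] = schwartz_measurable[OF ml]
  have km [measurable]: "k \<in> Borel" using kpsi(1) gm by auto
  have "integrable dm (%xi. C *\<^sub>R (indicator (cball 0 B) xi *\<^sub>R k xi))"
   using loc[of "cball 0 B"] kpsi(1) by (intro integrable_scaleR_right) (auto simp: set_integrable_def)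
  then show ?thesis
  proof (rule integrable_bound)
   have "cmod (k xi * psi xi) <= norm (C *\<^sub>R (indicator (cball 0 B) xi *\<^sub>R k xi))" for xi
   proof (cases "psi xi = 0")
    case False
    have "cmod (k xi) * cmod (psi xi) <= cmod (k xi) * \<bar>C\<bar>" using C[of xi] by (intro mult_left_mono) auto
    then show ?thesis using B[OF False] by (simp add: norm_mult mult.commute)
   qed simp
   then show "AE xi in dm. cmod (k xi * psi xi) <= norm (C *\<^sub>R (indicator (cball 0 B) xi *\<^sub>R k xi))" by simp
  qed measurable
 qed
 have "AE xi in dm. g xi - h xi = 0"
 proof (rule dual_AE_zero)
  show "(%xi. g xi - h xi) \<in> Borel" by measurable
  show "set_integrable dm K (%xi. g xi - h xi)" if "compact K" for K
   using loc[OF that] by (rule set_integral_diff)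
  show "(LINT xi|dm. (g xi - h xi) * psi xi) = 0" if "psi \<in> dual_test_functions" for psi
   using i[OF _ that] g h that by (simp add: left_diff_distrib is_fourier_def)
 qed
 then show ?thesis by simp
qed

lemma fourier_fun:
 assumes "is_fourier \<Gamma> T g"
 shows "is_fourier \<Gamma> T (fourier_fun \<Gamma> T)" "AE xi in dm. fourier_fun \<Gamma> T xi = g xi"
proof -
 show 1: "is_fourier \<Gamma> T (fourier_fun \<Gamma> T)" unfolding fourier_fun_def by (rule someI[of "is_fourier \<Gamma> T", OF assms])
 show "AE xi in dm. fourier_fun \<Gamma> T xi = g xi" by (rule fourier_unique[OF 1 assms])
qed

lemma is_fourier_measurable: "is_fourier \<Gamma> T g ==> g \<in> Borel"
 by (simp add: is_fourier_def L1_loc_dual_def)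

text \<open>
 The choice made in \<open>fourier_fun\<close> is immaterial: membership and norm can be computed from any
 representative of the transform.
\<close>

lemma weighted_space_iff:
 assumes g: "is_fourier \<Gamma> T g" and w: "w \<in> Borel"
 shows "T \<in> weighted_space w F \<Gamma> \<longleftrightarrow> T \<in> dist_over F \<Gamma> \<and> integrable dm (\<lambda>xi. (w xi * cmod (g xi))\<^sup>2)"
  and "weighted_norm w \<Gamma> T = sqrt (LINT xi|dm. (w xi * cmod (g xi))\<^sup>2)"
proof -
 note [measurable] = w is_fourier_measurable[OF g] is_fourier_measurable[OF fourier_fun(1)[OF g]]
 have ae: "AE xi in dm. (w xi * cmod (fourier_fun \<Gamma> T xi))\<^sup>2 = (w xi * cmod (g xi))\<^sup>2"
  using fourier_fun(2)[OF g] by eventually_elim simp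
 have "integrable dm (%xi. (w xi * cmod (fourier_fun \<Gamma> T xi))\<^sup>2) \<longleftrightarrow> integrable dm (%xi. (w xi * cmod (g xi))\<^sup>2)"
  by (rule integrable_cong_AE) (use ae in auto)
 then show "T \<in> weighted_space w F \<Gamma> \<longleftrightarrow> T \<in> dist_over F \<Gamma> \<and> integrable dm (%xi. (w xi * cmod (g xi))\<^sup>2)"
  unfolding weighted_space_def using g by blast
 have "(LINT xi|dm. (w xi * cmod (fourier_fun \<Gamma> T xi))\<^sup>2) = (LINT xi|dm. (w xi * cmod (g xi))\<^sup>2)"
  by (rule integral_cong_AE) (use ae in auto)
 then show "weighted_norm w \<Gamma> T = sqrt (LINT xi|dm. (w xi * cmod (g xi))\<^sup>2)"
  by (simp add: weighted_norm_def)
qed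

lemma weighted_space_fourier:
 assumes "T \<in> weighted_space w F \<Gamma>"
 shows "is_fourier \<Gamma> T (fourier_fun \<Gamma> T)"
 using assms fourier_fun(1) by (auto simp: weighted_space_def)

lemma weighted_space_mono:
 assumes w: "w1 \<in> Borel" "w2 \<in> Borel"
  and C: "AE xi in dm. \<bar>w2 xi\<bar> <= C * \<bar>w1 xi\<bar>" "C >= 0"
  and T: "T \<in> weighted_space w1 F \<Gamma>"
 shows "T \<in> weighted_space w2 F \<Gamma>" and "weighted_norm w2 \<Gamma> T <= C * weighted_norm w1 \<Gamma> T"
proof -
 let ?g = "fourier_fun \<Gamma> T"
 note [measurable] = w is_fourier_measurable[OF weighted_space_fourier[OF T]]
 have i: "integrable dm (%xi. C\<^sup>2 * (w1 xi * cmod (?g xi))\<^sup>2)"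
  using T by (intro integrable_mult_right) (simp add: weighted_space_def)
 have ae: "AE xi in dm. (w2 xi * cmod (?g xi))\<^sup>2 <= C\<^sup>2 * (w1 xi * cmod (?g xi))\<^sup>2"
  using C(1)
 proof eventually_elim
  case (elim xi)
  have "\<bar>w2 xi\<bar> * cmod (?g xi) <= (C * \<bar>w1 xi\<bar>) * cmod (?g xi)" using elim by (rule mult_right_mono) simp
  then have "(\<bar>w2 xi\<bar> * cmod (?g xi))\<^sup>2 <= ((C * \<bar>w1 xi\<bar>) * cmod (?g xi))\<^sup>2" by (rule power_mono) simp
  then show ?case by (simp add: power_mult_distrib)
 qed
 have i2: "integrable dm (%xi. (w2 xi * cmod (?g xi))\<^sup>2)"
  by (rule integrable_bound[OF i]) (use ae in \<open>auto simp: abs_mult\<close>)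
 then show "T \<in> weighted_space w2 F \<Gamma>" using T by (simp add: weighted_space_def)
 have "(LINT xi|dm. (w2 xi * cmod (?g xi))\<^sup>2) <= (LINT xi|dm. C\<^sup>2 * (w1 xi * cmod (?g xi))\<^sup>2)"
  by (rule integral_mono_AE[OF i2 i ae])
 then have "weighted_norm w2 \<Gamma> T <= sqrt (C\<^sup>2 * (LINT xi|dm. (w1 xi * cmod (?g xi))\<^sup>2))"
  unfolding weighted_norm_def by (intro real_sqrt_le_mono) simp
 then show "weighted_norm w2 \<Gamma> T <= C * weighted_norm w1 \<Gamma> T"
  using C(2) by (simp add: real_sqrt_mult weighted_norm_def)
qed

lemma inv_fourier_tempered:
 assumes g: "integrable dm g"
 shows "inv_fourier g \<in> Borel" "periodic_on \<Gamma> (inv_fourier g)"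
  "\<exists>B. \<forall>x. cmod (inv_fourier g x) <= B" "range (inv_fourier g) \<subseteq> F ==> inv_fourier g \<in> tempered_functions F \<Gamma>"
proof -
 have gmeas: "g \<in> borel_measurable dm" using g by simp
 interpret D: sigma_finite_measure dm by (rule sigma_finite_dm)
 have m: "(%(x, xi). g xi * cis (2 * pi * (xi \<bullet> x))) \<in> borel_measurable (borel \<Otimes>\<^sub>M dm)"
 proof -
  have "(%(x, xi). cis (2 * pi * (xi \<bullet> x))) \<in> borel_measurable (borel \<Otimes>\<^sub>M dm :: ((real^'n) \<times> (real^'n)) measure)"
   by (rule continuous_pair_measurable) (auto simp: case_prod_beta' cis_conv_exp intro!: continuous_intros)
  then show ?thesis using gmeas by (simp add: case_prod_beta') measurable
 qed
 show 1: "inv_fourier g \<in> Borel"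
  unfolding inv_fourier_def[abs_def] osc_def
  using D.borel_measurable_lebesgue_integral[OF m] by measurable
 show 2: "periodic_on \<Gamma> (inv_fourier g)"
  using osc_periodic[of 1 g] by (simp add: periodic_on_def inv_fourier_def)
 have "cmod (inv_fourier g x) <= torus_volume \<Gamma> powr (- 1 / 2) * (LINT xi|dm. cmod (g xi))" for x
  using osc_dm_bounded[OF g, of "2 * pi" x] by (simp add: inv_fourier_def norm_mult mult_left_mono)
 then show 3: "\<exists>B. \<forall>x. cmod (inv_fourier g x) <= B" by blast
 then obtain B where B: "!!x. cmod (inv_fourier g x) <= B" by blast
 assume "range (inv_fourier g) \<subseteq> F"
 moreover have "moderate (inv_fourier g) (2 * CARD('n))"
  unfolding moderate_def
 proof (intro conjI 1 integrable_bound[OF integrable_mult_right[OF integrable_gm_weight_nat, of B]])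
  show "(%x. cmod (inv_fourier g x) / growth \<Gamma> x ^ (2 * CARD('n))) \<in> borel_measurable gm"
   using 1 by measurable
  have "cmod (inv_fourier g x) / growth \<Gamma> x ^ (2 * CARD('n)) <= B * (1 / growth \<Gamma> x ^ (2 * CARD('n)))" for x
   using divide_right_mono[OF B, of "growth \<Gamma> x ^ (2 * CARD('n))" x] by (simp add: add_nonneg_nonneg)
  then show "AE x in gm. norm (cmod (inv_fourier g x) / growth \<Gamma> x ^ (2 * CARD('n))) <= norm (B * (1 / growth \<Gamma> x ^ (2 * CARD('n))))"
   by (intro AE_I2) (simp add: abs_of_nonneg add_nonneg_nonneg abs_mult, smt (verit) divide_right_mono add_nonneg_nonneg real_part_norm_nonneg zero_le_power)
 qed
 ultimately show "inv_fourier g \<in> tempered_functions F \<Gamma>"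
  unfolding tempered_functions_iff using 1 2 by blast
qed

lemma is_fourier_inv_fourier:
 assumes g: "integrable dm g"
 shows "is_fourier \<Gamma> (dist_of \<Gamma> (inv_fourier g)) g"
 unfolding is_fourier_def L1_loc_dual_def
proof (intro conjI ballI CollectI allI impI)
 show "g \<in> Borel" using borel_measurable_integrable[OF g] by simp
 show "set_integrable dm K g" if "compact K" for K
  unfolding set_integrable_def using that g by (intro integrable_mult_indicator) (auto intro: borel_compact)
 fix psi :: "real ^ 'n => complex" assume "psi \<in> dual_test_functions"
 then have psi: "psi \<in> schwartz (%_. Line)" by (rule dual_test_schwartz)
 have "dist_of \<Gamma> (inv_fourier g) (fourier_transpose \<Gamma> psi) = (LINT x|gm. inv_fourier g x * fourier_transpose \<Gamma> psi x)"
  by (rule dist_of_eq[OF inv_fourier_tempered(1)[OF g] fourier_transpose_schwartz[OF psi]])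
 also have "... = (LINT xi|dm. g xi * psi xi)" by (rule multiplication_formula[OF g psi])
 finally show "fourier_dist \<Gamma> (dist_of \<Gamma> (inv_fourier g)) psi = (LINT xi|dm. g xi * psi xi)"
  by (simp add: fourier_dist_def)
qed

end

section \<open>A low frequency profile\<close>

context lca
begin

lemma lattice_gap: "\<exists>delta>0. \<forall>i L t. \<Gamma> i = Torus L \<longrightarrow> t \<in> lattice L \<longrightarrow> t ~= 0 \<longrightarrow> delta <= \<bar>t\<bar>"
proof -
 define D where "D i = (case \<Gamma> i of Line => 1 | Torus L => 1 / L)" for i
 define delta where "delta = Min (range D)"
 have Dpos: "D i > 0" for i using pos by (auto simp: D_def split: factor.split)
 have "delta > 0" unfolding delta_def using Dpos by (subst Min_gr_iff) auto
 moreover have "delta <= \<bar>t\<bar>" if "\<Gamma> i = Torus L" "t \<in> lattice L" "t ~= 0" for i L t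
 proof -
  have L: "L > 0" using pos that by simp
  have "t \<in> range (%m::int. of_int m / L)" using that(2) by (simp only: lattice_def)
  then obtain m :: int where m: "t = of_int m / L" by blast
  then have "\<bar>m\<bar> >= 1" using that(3) by auto
  then have "1 <= \<bar>real_of_int m\<bar>" by linarith
  then have "1 / L <= \<bar>t\<bar>" using L by (simp add: m divide_right_mono)
  moreover have "delta <= D i" unfolding delta_def by (rule Min_le) auto
  ultimately show ?thesis using that by (simp add: D_def)
 qed
 ultimately show ?thesis by blast
qed

text \<open>
 In a small ball only the lattice point zero occurs in the toroidal coordinates, and one real
 coordinate already contributes a factor of the order of the radius.
\<close>

lemma dm_ball_bounds:
 assumes R: "\<Gamma> i0 = Line"
  and gap: "!!i L t. \<Gamma> i = Torus L ==> t \<in> lattice L ==> t ~= 0 ==> r <= \<bar>t\<bar>"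
  and r: "0 < r" "r <= 1 / 2"
 shows "emeasure dm (ball 0 r) <= ennreal (2 * r)" and "0 < emeasure dm (ball 0 r)"
proof -
 have sing: "emeasure (dual_factor (Torus L)) {-q<..<q} = 1" if "\<Gamma> i = Torus L" "0 < q" "q <= r" for i L q
 proof -
  have "{-q<..<q} \<inter> lattice L = {0}"
  proof (intro equalityI subsetI)
   fix t assume t: "t \<in> {-q<..<q} \<inter> lattice L"
   then have "\<bar>t\<bar> < r" using that by auto
   then show "t \<in> {0}" using gap[OF that(1), of t] t by force
  next
   have "(0::real) \<in> lattice L" unfolding lattice_def by (auto intro: image_eqI[of _ _ 0])
   then show "t \<in> {0} ==> t \<in> {-q<..<q} \<inter> lattice L" for t using that by auto
  qed
  then show ?thesis by (simp add: emeasure_dual_torus emeasure_count_space del: factor_simps)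
 qed
 have fac: "emeasure (dual_factor (\<Gamma> i)) {-q<..<q} = (if \<Gamma> i = Line then ennreal (2 * q) else 1)"
  if "0 < q" "q <= r" for i q
  using sing[OF _ that, of i] that by (cases "\<Gamma> i") (auto simp del: factor_simps(5))
 have box: "emeasure dm {xi. \<forall>i. xi $ i \<in> {-q<..<q}} = (\<Prod>i\<in>UNIV. if \<Gamma> i = Line then ennreal (2 * q) else 1)"
  if "0 < q" "q <= r" for q
  unfolding dual_measure_eq by (subst D.emeasure_vprod) (simp_all add: fac[OF that])
 have sub: "ball 0 r \<subseteq> {xi::real^'n. \<forall>i. xi $ i \<in> {-r<..<r}}"
 proof
  fix xi :: "real^'n" assume "xi \<in> ball 0 r"
  then have "\<bar>xi $ i\<bar> < r" for i using component_le_norm_cart[of xi i] by (simp add: le_less_trans)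
  then show "xi \<in> {xi. \<forall>i. xi $ i \<in> {-r<..<r}}" by (auto simp: abs_less_iff) (metis minus_less_iff)
 qed
 have "emeasure dm (ball 0 r) <= emeasure dm {xi. \<forall>i. xi $ i \<in> {-r<..<r}}"
  by (rule emeasure_mono[OF sub]) (simp add: measurable_box)
 also have "... = ennreal (2 * r) * (\<Prod>i\<in>UNIV - {i0}. if \<Gamma> i = Line then ennreal (2 * r) else 1)"
  unfolding box[OF r(1) order_refl] by (subst prod.remove[of _ i0]) (auto simp: R)
 also have "(\<Prod>i\<in>UNIV - {i0}. if \<Gamma> i = Line then ennreal (2 * r) else 1) = (\<Prod>i\<in>UNIV - {i0}. ennreal (if \<Gamma> i = Line then 2 * r else 1))"
  by (intro prod.cong) auto
 also have "... = ennreal (\<Prod>i\<in>UNIV - {i0}. if \<Gamma> i = Line then 2 * r else 1)"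
  using r by (intro prod_ennreal) auto
 also have "ennreal (2 * r) * ... <= ennreal (2 * r) * 1"
  using r by (intro mult_left_mono) (auto simp: ennreal_le_1 intro!: prod_le_1)
 finally show "emeasure dm (ball 0 r) <= ennreal (2 * r)" by simp
 define q where "q = r / (2 * real CARD('n))"
 have "r / (2 * N) <= r" if "1 <= N" for N :: real using that r by (simp add: divide_le_eq)
 moreover have "1 <= real CARD('n)" by (simp add: Suc_leI)
 ultimately have q: "0 < q" "q <= r" using r unfolding q_def by (simp, blast)
 have "{xi::real^'n. \<forall>i. xi $ i \<in> {-q<..<q}} \<subseteq> ball 0 r"
 proof
  fix xi :: "real^'n" assume "xi \<in> {xi. \<forall>i. xi $ i \<in> {-q<..<q}}"
  then have c: "\<bar>xi $ i\<bar> <= q" for i by (auto simp: abs_le_iff less_imp_le) (metis less_imp_le minus_le_iff)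
  have "norm xi <= (\<Sum>i\<in>UNIV. \<bar>xi $ i\<bar>)" by (rule norm_le_l1_cart)
  also have "... <= (\<Sum>i\<in>(UNIV::'n set). q)" by (intro sum_mono c)
  also have "... = r / 2" by (simp add: q_def)
  finally show "xi \<in> ball 0 r" using r by simp
 qed
 then have "emeasure dm {xi. \<forall>i. xi $ i \<in> {-q<..<q}} <= emeasure dm (ball 0 r)"
  by (rule emeasure_mono) simp
 moreover have "0 < emeasure dm {xi. \<forall>i. xi $ i \<in> {-q<..<q}}"
  unfolding box[OF q] using q by (auto simp: zero_less_iff_neq_zero prod_zero_iff split: if_splits)
 ultimately show "0 < emeasure dm (ball 0 r)" by (rule order.strict_trans2[rotated])
qed

definition ball_bump :: "real => real ^ 'n => real" where
 "ball_bump r xi = flat (r\<^sup>2 - (norm xi)\<^sup>2)"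

lemma ball_bump_nonneg: "0 <= ball_bump r xi" and ball_bump_le_1: "ball_bump r xi <= 1"
 by (simp_all add: ball_bump_def flat_nonneg flat_le_1)

lemma ball_bump_nz: "r > 0 ==> ball_bump r xi ~= 0 \<longleftrightarrow> norm xi < r"
 unfolding ball_bump_def flat_pos_iff
 using power2_less_imp_less[of "norm xi" r] power_strict_mono[of "norm xi" r 2] by auto

lemma ball_bump_uminus: "ball_bump r (- xi) = ball_bump r xi"
 by (simp add: ball_bump_def)

lemma smooth_ball_bump: "smooth_fun (\<lambda>xi::real^'n. complex_of_real (ball_bump r (xi - a)))"
 unfolding ball_bump_def
proof (rule smooth_fun_flat)
 have "smooth_fun (%xi::real^'n. of_real (r\<^sup>2) + of_real (- 1) * (\<Sum>i\<in>UNIV. (of_real (xi $ i) + of_real (- (a $ i))) * (of_real (xi $ i) + of_real (- (a $ i)))))"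
  by (intro smooth_fun_add smooth_fun_mult smooth_fun_const smooth_fun_sum smooth_fun_nth finite)
 moreover have "complex_of_real (r\<^sup>2) + of_real (- 1) * (\<Sum>i\<in>UNIV. (of_real (xi $ i) + of_real (- (a $ i))) * (of_real (xi $ i) + of_real (- (a $ i))))
  = of_real (r\<^sup>2 - (norm (xi - a))\<^sup>2)" for xi :: "real^'n"
  by (simp add: power2_norm_eq_inner inner_vec_def)
 ultimately show "smooth_fun (%xi::real^'n. complex_of_real (r\<^sup>2 - (norm (xi - a))\<^sup>2))" by (simp only:)
qed

lemma ball_bump_measurable [measurable]: "ball_bump r \<in> Borel"
 unfolding ball_bump_def[abs_def] by measurable

text \<open>
 The bumps have disjoint supports and \<open>L\<^sup>2\<close> norm one, so \<open>g\<^sup>2\<close> has infinite integral, whereas the factor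
 \<open>norm xi\<close>, about \<open>2\<^sup>-\<^sup>j\<close> on the supports of index \<open>j\<close>, makes the series converge geometrically. The supports
 have measure \<open>O(4\<^sup>-\<^sup>j)\<close>, which gives integrability of \<open>g\<close>. The partial sums \<open>psi N\<close> are test functions
 that detect the divergence of the integral of \<open>g\<^sup>2\<close>.
\<close>

lemma low_frequency_example:
 fixes w :: "real ^ 'n"
 assumes w: "norm w = 1" "!!i L. \<Gamma> i = Torus L ==> w $ i = 0" and eps: "eps > 0"
 obtains g :: "real ^ 'n => real" and psi :: "nat => real ^ 'n => real"
 where "g \<in> Borel" "integrable dm g" "!!xi. 0 <= g xi" "!!xi. g (- xi) = g xi"
  "integrable dm (\<lambda>xi. (norm xi * g xi)\<^sup>2)"
  "!!xi. g xi ~= 0 ==> \<exists>t. t ~= 0 \<and> \<bar>t\<bar> <= 1 \<and> norm (xi - t *\<^sub>R w) <= eps * t\<^sup>2"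
  "!!N. (\<lambda>xi. complex_of_real (psi N xi)) \<in> dual_test_functions"
  "!!N xi. g xi * psi N xi = (psi N xi)\<^sup>2" "!!N xi. (psi N xi)\<^sup>2 <= (g xi)\<^sup>2"
  "!!N. real N <= (LINT xi|dm. (psi N xi)\<^sup>2)"
proof -
 obtain delta where delta: "delta > 0" "!!i L t. \<Gamma> i = Torus L ==> t \<in> lattice L ==> t ~= 0 ==> delta <= \<bar>t\<bar>"
  using lattice_gap by blast
 obtain i0 where i0: "\<Gamma> i0 = Line"
 proof -
  have "w ~= 0" using w(1) by auto
  then obtain i where "w $ i ~= 0" by (auto simp: vec_eq_iff)
  then show thesis using w(2) that by (cases "\<Gamma> i") auto
 qed
 (* at most the lattice gap, so that no small ball around zero contains a nonzero toroidal lattice coordinate *)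
 define kappa where "kappa = min (1 / 8) (min eps delta)"
 have kappa: "kappa > 0" "kappa <= 1 / 8" "kappa <= eps" "kappa <= delta" using eps delta by (auto simp: kappa_def)
 define tau where "tau j = (1 / 2 :: real) ^ j" for j
 have tau: "0 < tau j" "tau j <= 1" for j by (auto simp: tau_def power_le_one)
 define rho where "rho j = kappa * (tau j)\<^sup>2" for j
 have rhot: "rho j <= kappa * tau j" for j
  unfolding rho_def power2_eq_square using tau[of j] kappa by (intro mult_left_mono) (auto simp: mult_left_le)
 have rho: "0 < rho j" "rho j <= kappa" "rho j <= tau j / 8" for j
 proof -
  show "0 < rho j" using tau[of j] kappa by (simp add: rho_def)
  have "kappa * tau j <= kappa * 1" using tau[of j] kappa by (intro mult_left_mono) auto
  then show "rho j <= kappa" using rhot[of j] by simp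
  have "kappa * tau j <= (1 / 8) * tau j" using tau[of j] kappa by (intro mult_right_mono) auto
  then show "rho j <= tau j / 8" using rhot[of j] by simp
 qed
 let ?b = "%j. ball_bump (rho j)"
 have gaprho: "rho j <= \<bar>t\<bar>" if "\<Gamma> i = Torus L" "t \<in> lattice L" "t ~= 0" for i L t j
  using delta(2)[OF that] rho(2)[of j] kappa by linarith
 have rhohalf: "rho j <= 1 / 2" for j using rho(2)[of j] kappa by linarith
 have ball: "emeasure dm (ball 0 (rho j)) <= ennreal (2 * rho j)" "0 < emeasure dm (ball 0 (rho j))" for j
  using dm_ball_bounds[OF i0 gaprho rho(1)[of j] rhohalf[of j]] by auto
 have nz: "?b j xi ~= 0 \<longleftrightarrow> norm xi < rho j" for j xi using ball_bump_nz[OF rho(1)] .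
 have bi: "integrable dm (%xi. (?b j xi)\<^sup>2)" for j
 proof (rule integrable_dm_bounded_support[where B = 1 and R = "rho j"])
  show "norm ((?b j xi)\<^sup>2) <= 1" for xi using ball_bump_nonneg[of "rho j" xi] ball_bump_le_1[of "rho j" xi] by (simp add: power_le_one)
  show "(?b j xi)\<^sup>2 ~= 0 ==> norm xi <= rho j" for xi using nz[of j xi] by auto
 qed measurable
 define B where "B j = (LINT xi|dm. (?b j xi)\<^sup>2)" for j
 have B: "B j > 0" for j
 proof -
  have "B j >= 0" unfolding B_def by (rule integral_nonneg_AE) simp
  moreover have "B j ~= 0"
  proof
   assume "B j = 0"
   then have "AE xi in dm. (?b j xi)\<^sup>2 = 0"
    unfolding B_def by (subst (asm) integral_nonneg_eq_0_iff_AE[OF bi]) auto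
   then have "AE xi in dm. xi \<notin> ball 0 (rho j)"
    by eventually_elim (use nz in auto)
   then have "emeasure dm (ball 0 (rho j)) = 0"
    by (subst (asm) AE_iff_measurable[where N = "ball 0 (rho j)"]) auto
   then show False using ball(2)[of j] by simp
  qed
  ultimately show ?thesis by simp
 qed
 (* normalises the bump in L\<^sup>2 *)
 define c where "c j = 1 / sqrt (B j)" for j
 have c: "c j > 0" "(c j)\<^sup>2 * B j = 1" for j using B[of j] by (auto simp: c_def power_divide)
 define h where "h j a xi = c j * ?b j (xi - a *\<^sub>R w)" for j a xi
 have hm [measurable]: "h j a \<in> Borel" for j a
  unfolding h_def[abs_def] by measurable
 have h0: "0 <= h j a xi" for j a xi using c(1)[of j] ball_bump_nonneg by (simp add: h_def)
 have hnz: "h j a xi ~= 0 \<longleftrightarrow> norm (xi - a *\<^sub>R w) < rho j" for j a xi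
  using c(1)[of j] nz by (auto simp: h_def)
 have shift: "distr dm borel (%xi. xi + (- a) *\<^sub>R w) = dm" for a
 proof (rule dm_translate)
  fix i L assume "\<Gamma> i = Torus L"
  then have "((- a) *\<^sub>R w) $ i = of_int 0 / L" using w(2) by simp
  then show "((- a) *\<^sub>R w) $ i \<in> lattice L" unfolding lattice_def by blast
 qed
 have hsq: "integrable dm (%xi. (h j a xi)\<^sup>2)" "(LINT xi|dm. (h j a xi)\<^sup>2) = 1" for j a
 proof -
  have m: "(%xi. xi + (- a) *\<^sub>R w) \<in> dm \<rightarrow>\<^sub>M borel" by simp
  have m2: "(%xi. (?b j xi)\<^sup>2) \<in> Borel" by measurable
  have "integrable (distr dm borel (%xi. xi + (- a) *\<^sub>R w)) (%xi. (?b j xi)\<^sup>2)" unfolding shift by (rule bi)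
  then have 1: "integrable dm (%xi. (?b j (xi + (- a) *\<^sub>R w))\<^sup>2)" using integrable_distr_eq[OF m m2] by simp
  have 2: "(LINT xi|dm. (?b j (xi + (- a) *\<^sub>R w))\<^sup>2) = B j"
   using integral_distr[OF m m2] unfolding shift B_def by (rule sym)
  have eq: "(h j a xi)\<^sup>2 = (c j)\<^sup>2 * (?b j (xi + (- a) *\<^sub>R w))\<^sup>2" for xi
   by (simp add: h_def power_mult_distrib)
  show "integrable dm (%xi. (h j a xi)\<^sup>2)" "(LINT xi|dm. (h j a xi)\<^sup>2) = 1"
   unfolding eq using 1 2 c(2)[of j] by simp_all
 qed
 have balli: "integrable dm (indicator (ball (a *\<^sub>R w) (rho j)) :: real^'n => real)" "(LINT xi|dm. indicator (ball (a *\<^sub>R w) (rho j)) xi) <= 2 * rho j" for a j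
 proof -
  have m: "(%xi. xi + (- a) *\<^sub>R w) \<in> dm \<rightarrow>\<^sub>M borel" by simp
  have "emeasure dm (ball (a *\<^sub>R w) (rho j)) = emeasure (distr dm borel (%xi. xi + (- a) *\<^sub>R w)) (ball 0 (rho j))"
   by (subst emeasure_distr[OF m]) (auto intro!: arg_cong2[where f=emeasure] simp: dist_norm norm_minus_commute)
  also have "... <= ennreal (2 * rho j)" unfolding shift by (rule ball(1))
  finally have e: "emeasure dm (ball (a *\<^sub>R w) (rho j)) <= ennreal (2 * rho j)" .
  then have fin: "emeasure dm (ball (a *\<^sub>R w) (rho j)) < \<infinity>" by (simp add: order_le_less_trans)
  then show "integrable dm (indicator (ball (a *\<^sub>R w) (rho j)) :: real^'n => real)" by simp
  have "measure dm (ball (a *\<^sub>R w) (rho j)) <= 2 * rho j"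
   using e rho(1)[of j] unfolding measure_def by (simp add: enn2real_leI less_imp_le)
  then show "(LINT xi|dm. indicator (ball (a *\<^sub>R w) (rho j)) xi) <= 2 * rho j" by simp
 qed
 have hint: "integrable dm (h j a)" "(LINT xi|dm. h j a xi) <= tau j" for j a
 proof -
  let ?u = "%xi. (indicator (ball (a *\<^sub>R w) (rho j)) xi / tau j + tau j * (h j a xi)\<^sup>2) / 2"
  have ui: "integrable dm ?u" using balli(1) hsq(1) by auto
  have half: "2 * y <= z ==> y <= z / 2" for y z :: real by simp
  have le: "h j a xi <= ?u xi" for xi
  proof (cases "h j a xi = 0")
   case True
   then show ?thesis using tau(1)[of j] by (simp add: less_imp_le)
  next
   case False
   then have in_ball: "xi \<in> ball (a *\<^sub>R w) (rho j)" using hnz by (simp add: dist_norm norm_minus_commute)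
   have "0 <= (1 - tau j * h j a xi)\<^sup>2" by simp
   then have "2 * (tau j * h j a xi) <= 1 + (tau j * h j a xi)\<^sup>2" by (simp add: power2_diff)
   then have "(2 * (tau j * h j a xi)) / tau j <= (1 + (tau j * h j a xi)\<^sup>2) / tau j"
    using tau(1)[of j] by (intro divide_right_mono) auto
   then have "2 * h j a xi <= 1 / tau j + tau j * (h j a xi)\<^sup>2"
    using tau(1)[of j] by (simp add: add_divide_distrib power2_eq_square mult_ac)
   then have "h j a xi <= (1 / tau j + tau j * (h j a xi)\<^sup>2) / 2"
    by (rule half)
   then show ?thesis using in_ball by (simp only: indicator_simps)
  qed
  show i: "integrable dm (h j a)"
   by (rule integrable_bound[OF ui]) (use le h0 in \<open>auto intro!: AE_I2 order_trans[OF _ abs_ge_self]\<close>)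
  have "(LINT xi|dm. h j a xi) <= (LINT xi|dm. ?u xi)" by (intro integral_mono i ui le)
  also have "... = ((LINT xi|dm. indicator (ball (a *\<^sub>R w) (rho j)) xi) / tau j + tau j) / 2"
   using balli(1) hsq by simp
  also have "... <= (2 * rho j / tau j + tau j) / 2"
   using balli(2) tau(1)[of j] by (intro divide_right_mono add_mono) auto
  also have "2 * rho j / tau j <= tau j"
  proof -
   have "2 * rho j / tau j = 2 * kappa * tau j" using tau(1)[of j] by (simp add: rho_def power2_eq_square)
   also have "... <= 1 * tau j" using kappa tau(1)[of j] by (intro mult_right_mono) auto
   finally show ?thesis by simp
  qed
  finally show "(LINT xi|dm. h j a xi) <= tau j" by simp
 qed
 (* symmetric, so that the inverse transform is real *)
 define f where "f j xi = h j (tau j) xi + h j (- tau j) xi" for j xi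
 have fm [measurable]: "f j \<in> Borel" for j unfolding f_def[abs_def] by measurable
 have f0: "0 <= f j xi" for j xi by (simp add: f_def h0)
 have fsupp: "\<exists>t. \<bar>t\<bar> = tau j \<and> norm (xi - t *\<^sub>R w) < rho j" if nzf: "f j xi ~= 0" for j xi
 proof -
  have "h j (tau j) xi ~= 0 \<or> h j (- tau j) xi ~= 0" using nzf by (auto simp: f_def)
  then show ?thesis using hnz tau(1)[of j] by (metis abs_minus_cancel abs_of_pos)
 qed
 have fnorm: "7 / 8 * tau j < norm xi \<and> norm xi < 9 / 8 * tau j" if nzf: "f j xi ~= 0" for j xi
 proof -
  obtain t where t: "\<bar>t\<bar> = tau j" "norm (xi - t *\<^sub>R w) < rho j" using fsupp[OF nzf] by blast
  have "\<bar>norm xi - norm (t *\<^sub>R w)\<bar> <= norm (xi - t *\<^sub>R w)" by (rule norm_triangle_ineq3)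
  moreover have "norm (t *\<^sub>R w) = tau j" using t w by simp
  ultimately show ?thesis using t(2) rho(3)[of j] by (auto simp: abs_if split: if_splits)
 qed
 have disj: "f k xi = 0" if "f j xi ~= 0" "k ~= j" for j k xi
 proof (rule ccontr)
  assume nk: "f k xi ~= 0"
  have *: "9 / 8 * tau m <= 7 / 8 * tau l" if "l < m" for l m
  proof -
   have "tau m <= tau (Suc l)" unfolding tau_def using that by (intro power_decreasing) auto
   moreover have "tau (Suc l) = tau l / 2" by (simp add: tau_def)
   ultimately show ?thesis using tau(1)[of l] by linarith
  qed
  show False using fnorm[OF that(1)] fnorm[OF nk] *[of j k] *[of k j] that(2) by (cases "j < k") auto
 qed
 have pick: "\<exists>j. \<forall>k. k ~= j \<longrightarrow> f k xi = 0" for xi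
  using disj by (cases "\<exists>j. f j xi ~= 0") blast+
 define g where "g xi = (\<Sum>j. f j xi)" for xi
 define psi where "psi N xi = (\<Sum>j<N. f j xi)" for N xi
 have g_eq: "(!!k. k ~= j ==> f k xi = 0) ==> g xi = f j xi" for j xi
  unfolding g_def using suminf_finite[of "{j}" "%j. f j xi"] by simp
 have psi_eq: "(!!k. k ~= j ==> f k xi = 0) ==> psi N xi = (if j < N then f j xi else 0)" for j N xi
 proof -
  assume z: "!!k. k ~= j ==> f k xi = 0"
  have "psi N xi = (\<Sum>k<N. if k = j then f j xi else 0)" unfolding psi_def by (intro sum.cong) (use z in auto)
  then show ?thesis by simp
 qed
 have fint: "integrable dm (f j)" "(LINT xi|dm. f j xi) <= 2 * tau j" for j
  unfolding f_def[abs_def] using hint[of j "tau j"] hint[of j "- tau j"] by simp_all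
 have fsum: "summable (%j. f j xi)" for xi
 proof -
  obtain j where "!!k. k ~= j ==> f k xi = 0" using pick by blast
  then show ?thesis by (intro summable_finite[of "{j}"]) auto
 qed
 have stau: "summable tau" unfolding tau_def[abs_def] by (rule summable_geometric) simp
 have gi: "integrable dm g"
  unfolding g_def[abs_def]
 proof (rule integrable_suminf)
  show "integrable dm (f j)" for j by (rule fint)
  show "AE xi in dm. summable (%j. norm (f j xi))" using fsum f0 by simp
  show "summable (%j. LINT xi|dm. norm (f j xi))"
  proof (rule summable_comparison_test'[of "%j. 2 * tau j" 0])
   show "summable (%j. 2 * tau j)" using stau by (rule summable_mult)
   show "norm (LINT xi|dm. norm (f j xi)) <= 2 * tau j" for j
    using fint(2)[of j] f0 by (simp add: integral_nonneg_AE)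
  qed
 qed
 have fsq: "integrable dm (%xi. (f j xi)\<^sup>2)" "(LINT xi|dm. (f j xi)\<^sup>2) <= 4" "1 <= (LINT xi|dm. (f j xi)\<^sup>2)" for j
 proof -
  have le: "(f j xi)\<^sup>2 <= 2 * (h j (tau j) xi)\<^sup>2 + 2 * (h j (- tau j) xi)\<^sup>2" for xi
   using sum_squares_bound[of "h j (tau j) xi" "h j (- tau j) xi"] by (simp add: f_def power2_sum)
  have ge: "(h j (tau j) xi)\<^sup>2 <= (f j xi)\<^sup>2" for xi
   using h0 by (intro power_mono) (auto simp: f_def)
  have ui: "integrable dm (%xi. 2 * (h j (tau j) xi)\<^sup>2 + 2 * (h j (- tau j) xi)\<^sup>2)" using hsq(1) by simp
  show i: "integrable dm (%xi. (f j xi)\<^sup>2)"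
   by (rule integrable_bound[OF ui]) (use le in \<open>auto intro!: AE_I2\<close>)
  have "(LINT xi|dm. (f j xi)\<^sup>2) <= (LINT xi|dm. 2 * (h j (tau j) xi)\<^sup>2 + 2 * (h j (- tau j) xi)\<^sup>2)"
   by (intro integral_mono i ui le)
  then show "(LINT xi|dm. (f j xi)\<^sup>2) <= 4" using hsq by simp
  have "(LINT xi|dm. (h j (tau j) xi)\<^sup>2) <= (LINT xi|dm. (f j xi)\<^sup>2)"
   by (intro integral_mono i hsq ge)
  then show "1 <= (LINT xi|dm. (f j xi)\<^sup>2)" using hsq by simp
 qed
 show thesis
 proof (rule that[of g psi])
  show gm: "g \<in> Borel" using gi by auto
  show "integrable dm g" by (rule gi)
  show "0 <= g xi" for xi unfolding g_def by (intro suminf_nonneg fsum f0)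
  have he: "h j a (- xi) = h j (- a) xi" for j a xi
   using ball_bump_uminus[of "rho j" "xi + a *\<^sub>R w"] by (simp add: h_def)
  show "g (- xi) = g xi" for xi by (simp add: g_def f_def he add.commute)
  show "integrable dm (%xi. (norm xi * g xi)\<^sup>2)"
  proof -
   have eq: "(norm xi * g xi)\<^sup>2 = (\<Sum>j. (norm xi * f j xi)\<^sup>2)" for xi
   proof -
    obtain j where j: "!!k. k ~= j ==> f k xi = 0" using pick by blast
    have "(\<Sum>k. (norm xi * f k xi)\<^sup>2) = (norm xi * f j xi)\<^sup>2"
     using suminf_finite[of "{j}" "%k. (norm xi * f k xi)\<^sup>2"] j by simp
    then show ?thesis using g_eq[OF j] by simp
   qed
   have le: "(norm xi * f j xi)\<^sup>2 <= (4 * tau j) * (f j xi)\<^sup>2" for j xi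
   proof (cases "f j xi = 0")
    case False
    have "norm xi <= 2 * tau j" using fnorm[OF False] tau(1)[of j] by linarith
    then have "(norm xi)\<^sup>2 <= (2 * tau j)\<^sup>2" by (intro power_mono) auto
    also have "... = 4 * (tau j * tau j)" by (simp add: power2_eq_square)
    also have "... <= 4 * (tau j * 1)" using tau[of j] by (intro mult_left_mono) auto
    finally show ?thesis unfolding power_mult_distrib by (intro mult_right_mono) auto
   qed simp
   have ii: "integrable dm (%xi. (norm xi * f j xi)\<^sup>2)" for j
    by (rule integrable_bound[OF integrable_mult_right[OF fsq(1), of "4 * tau j"]])
     (use le tau(1)[of j] in \<open>auto intro!: AE_I2 order_trans[OF _ abs_ge_self]\<close>)
   show ?thesis unfolding eq
   proof (rule integrable_suminf[OF ii])
    show "AE xi in dm. summable (%j. norm ((norm xi * f j xi)\<^sup>2))"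
    proof (rule AE_I2)
     fix xi obtain j where "!!k. k ~= j ==> f k xi = 0" using pick by blast
     then show "summable (%j. norm ((norm xi * f j xi)\<^sup>2))" by (intro summable_finite[of "{j}"]) auto
    qed
    show "summable (%j. LINT xi|dm. norm ((norm xi * f j xi)\<^sup>2))"
    proof (rule summable_comparison_test'[of "%j. 16 * tau j" 0])
     show "summable (%j. 16 * tau j)" using stau by (rule summable_mult)
     fix j
     have "(LINT xi|dm. (norm xi * f j xi)\<^sup>2) <= (LINT xi|dm. (4 * tau j) * (f j xi)\<^sup>2)"
      by (intro integral_mono ii integrable_mult_right fsq le)
     also have "... <= (4 * tau j) * 4" using fsq(2)[of j] tau(1)[of j] by simp
     finally show "norm (LINT xi|dm. norm ((norm xi * f j xi)\<^sup>2)) <= 16 * tau j"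
      by (simp add: integral_nonneg_AE)
    qed
   qed
  qed
  show "\<exists>t. t ~= 0 \<and> \<bar>t\<bar> <= 1 \<and> norm (xi - t *\<^sub>R w) <= eps * t\<^sup>2" if gnz: "g xi ~= 0" for xi
  proof -
   obtain j where j: "!!k. k ~= j ==> f k xi = 0" using pick by blast
   have "f j xi ~= 0" using gnz g_eq[OF j] by simp
   then obtain t where t: "\<bar>t\<bar> = tau j" "norm (xi - t *\<^sub>R w) < rho j" using fsupp by blast
   have "t\<^sup>2 = (tau j)\<^sup>2" using t(1) by (metis power2_abs)
   moreover have "kappa * (tau j)\<^sup>2 <= eps * (tau j)\<^sup>2" using kappa by (intro mult_right_mono) auto
   ultimately have "norm (xi - t *\<^sub>R w) <= eps * t\<^sup>2"
    using t(2) unfolding rho_def by (metis less_imp_le order_trans)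
   then show ?thesis using t tau[of j] by (intro exI[of _ t]) auto
  qed
  show "(%xi. complex_of_real (psi N xi)) \<in> dual_test_functions" for N
   unfolding dual_test_functions_def
  proof (intro CollectI conjI)
   have "smooth_fun (%xi. \<Sum>j<N. of_real (c j) * complex_of_real (?b j (xi - tau j *\<^sub>R w)) + of_real (c j) * complex_of_real (?b j (xi - (- tau j) *\<^sub>R w)))"
    by (intro smooth_fun_sum smooth_fun_add smooth_fun_mult smooth_fun_const smooth_ball_bump finite_lessThan)
   then show "smooth_fun (%xi. complex_of_real (psi N xi))" by (simp add: psi_def f_def h_def)
   have "norm xi <= 2" if nzpsi: "psi N xi ~= 0" for xi
   proof -
    obtain j where "f j xi ~= 0" using nzpsi unfolding psi_def by (metis (no_types, lifting) sum.neutral)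
    from fnorm[OF this] show ?thesis using tau(2)[of j] by linarith
   qed
   then show "bounded {xi. complex_of_real (psi N xi) ~= 0}" by (auto simp: bounded_iff)
  qed
  show "g xi * psi N xi = (psi N xi)\<^sup>2" "(psi N xi)\<^sup>2 <= (g xi)\<^sup>2" for N xi
  proof -
   obtain j where j: "!!k. k ~= j ==> f k xi = 0" using pick by blast
   have 1: "g xi = f j xi" by (rule g_eq[OF j])
   have 2: "psi N xi = (if j < N then f j xi else 0)" by (rule psi_eq[OF j])
   show "g xi * psi N xi = (psi N xi)\<^sup>2" "(psi N xi)\<^sup>2 <= (g xi)\<^sup>2"
    unfolding 1 2 by (simp_all add: power2_eq_square)
  qed
  show "real N <= (LINT xi|dm. (psi N xi)\<^sup>2)" for N
  proof -
   have "(psi N xi)\<^sup>2 = (\<Sum>j<N. (f j xi)\<^sup>2)" for xi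
   proof -
    obtain j where j: "!!k. k ~= j ==> f k xi = 0" using pick by blast
    have "(\<Sum>k<N. (f k xi)\<^sup>2) = (\<Sum>k<N. if k = j then (f j xi)\<^sup>2 else 0)" by (intro sum.cong) (use j in auto)
    moreover have "psi N xi = (if j < N then f j xi else 0)" by (rule psi_eq[OF j])
    ultimately show ?thesis by simp
   qed
   then have "(LINT xi|dm. (psi N xi)\<^sup>2) = (\<Sum>j<N. LINT xi|dm. (f j xi)\<^sup>2)"
    using fsq(1) by simp
   also have "... >= (\<Sum>j<N. 1)" by (intro sum_mono fsq(3))
   finally show ?thesis by simp
  qed
 qed
qed

end

section \<open>The weights\<close>

lemma bracket_measurable [measurable]: "(bracket :: real ^ 'n::finite => real) \<in> Borel"
 unfolding bracket_def[abs_def] by measurable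

lemma mu_measurable [measurable]: "(mu :: real ^ 'n::{finite,linorder} => real) \<in> Borel"
 unfolding mu_def[abs_def] by measurable

lemma bracket_sqrt: "bracket xi = sqrt (1 + (norm xi)\<^sup>2)"
 unfolding bracket_def by (rule powr_half_sqrt) simp

lemma bracket_ge_1: "1 <= bracket xi" and bracket_ge_norm: "norm xi <= bracket xi"
 and bracket_le: "bracket xi <= 1 + norm xi"
 unfolding bracket_sqrt
 by (auto intro!: real_le_rsqrt real_le_lsqrt simp: power2_sum)

lemma mu_nonneg: "0 <= mu xi" by (simp add: mu_def)

lemma mu_ge_norm: "norm xi <= mu xi" by (simp add: mu_def)

lemma mu_le: "mu xi <= 2 * bracket xi"
proof (cases "xi = 0")
 case False
 have "\<bar>xi $ first_index\<bar> / norm xi <= 1"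
  using component_le_norm_cart[of xi first_index] False by (simp add: divide_le_eq)
 moreover have "mu xi = \<bar>xi $ first_index\<bar> / norm xi + norm xi" using False by (simp add: mu_def)
 ultimately show ?thesis using bracket_ge_1[of xi] bracket_ge_norm[of xi] by linarith
qed (use bracket_ge_1[of xi] in \<open>simp add: mu_def\<close>)

lemma bracket_powr_split: "bracket xi powr s = bracket xi * bracket xi powr (s - 1)"
 using bracket_ge_1[of xi] by (simp add: powr_diff)

locale lca_ord = lca \<Gamma> for \<Gamma> :: "'n::{finite,linorder} => factor"
begin

abbreviation wX :: "real => real ^ ('n::{finite,linorder}) => real" where "wX s \<equiv> (\<lambda>xi. mu xi * bracket xi powr (s - 1))"
abbreviation wH :: "real => real ^ ('n::{finite,linorder}) => real" where "wH s \<equiv> (\<lambda>xi. bracket xi powr s)"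

lemma weights_measurable: "wX s \<in> Borel" "wH s \<in> Borel"
 by measurable

lemma wX_le_wH: "\<bar>wX s xi\<bar> <= 2 * \<bar>wH s xi\<bar>"
proof -
 have "mu xi * bracket xi powr (s - 1) <= (2 * bracket xi) * bracket xi powr (s - 1)"
  by (intro mult_right_mono mu_le) simp
 then show ?thesis
  using mu_nonneg[of xi] bracket_ge_1[of xi] by (simp add: bracket_powr_split[of xi s] abs_mult mult.assoc)
qed

lemma H_space_subset_X_space: "H_space s F \<Gamma> \<subseteq> X_space s F \<Gamma>"
 unfolding H_space_def X_space_def
 using weighted_space_mono(1)[OF weights_measurable(2,1) AE_I2[OF wX_le_wH]] by force

lemma norm_weight_comparison:
 assumes "AE xi in dm. bracket xi <= C * mu xi" "C > 0"
 shows "X_space s F \<Gamma> = H_space s F \<Gamma>"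
  and "f \<in> X_space s F \<Gamma> ==> (1 / C) * H_norm s \<Gamma> f <= X_norm s \<Gamma> f"
  and "f \<in> X_space s F \<Gamma> ==> X_norm s \<Gamma> f <= 2 * H_norm s \<Gamma> f"
proof -
 have ae: "AE xi in dm. \<bar>wH s xi\<bar> <= C * \<bar>wX s xi\<bar>"
  using assms(1)
 proof eventually_elim
  case (elim xi)
  have "bracket xi * bracket xi powr (s - 1) <= (C * mu xi) * bracket xi powr (s - 1)"
   using elim by (rule mult_right_mono) simp
  then show ?case using mu_nonneg[of xi] bracket_ge_1[of xi] by (simp add: bracket_powr_split[of xi s] abs_mult)
 qed
 note le = weighted_space_mono[OF weights_measurable(1,2) ae less_imp_le[OF assms(2)]]
 show eq: "X_space s F \<Gamma> = H_space s F \<Gamma>"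
  using le(1) H_space_subset_X_space[of s F] unfolding H_space_def X_space_def by blast
 show "f \<in> X_space s F \<Gamma> ==> (1 / C) * H_norm s \<Gamma> f <= X_norm s \<Gamma> f"
  using le(2)[of f F] assms(2) unfolding H_norm_def X_norm_def X_space_def by (simp add: field_simps)
 show "f \<in> X_space s F \<Gamma> ==> X_norm s \<Gamma> f <= 2 * H_norm s \<Gamma> f"
  using weighted_space_mono(2)[OF weights_measurable(2,1) AE_I2[OF wX_le_wH], where T = f and F = F] eq
  unfolding H_norm_def X_norm_def X_space_def H_space_def by simp
qed

text \<open>
 A frequency with a nonzero toroidal coordinate is bounded away from zero. Otherwise it is a multiple
 of the first basis vector, where \<open>|xi\<^sub>1| / |xi| = 1\<close>.
\<close>

lemma bracket_le_mu:
 assumes R: "real_coords \<Gamma> = {} \<or> real_coords \<Gamma> = {first_index}"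
 shows "\<exists>C>0. AE xi in dm. bracket xi <= C * mu xi"
proof -
 obtain delta where delta: "delta > 0" "!!i L t. \<Gamma> i = Torus L ==> t \<in> lattice L ==> t ~= 0 ==> delta <= \<bar>t\<bar>"
  using lattice_gap by blast
 have line: "\<Gamma> i = Line ==> i = first_index" for i using R by (auto simp: real_coords_def)
 define C where "C = 1 + 1 / delta"
 have C: "C > 0" "1 <= C" using delta by (auto simp: C_def add_pos_pos)
 have "bracket xi <= C * mu xi" if xi: "xi \<in> dual_lattice" for xi
 proof (cases "\<exists>i L. \<Gamma> i = Torus L \<and> xi $ i ~= 0")
  case True
  then obtain i L where i: "\<Gamma> i = Torus L" "xi $ i ~= 0" by blast
  have "delta <= \<bar>xi $ i\<bar>" using xi i by (intro delta(2)[of i L]) (auto simp: dual_lattice_def)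
  also have "... <= norm xi" by (rule component_le_norm_cart)
  finally have "1 <= norm xi / delta" using delta by (simp add: le_divide_eq)
  then have "1 + norm xi <= C * norm xi" by (simp add: C_def distrib_right)
  also have "... <= C * mu xi" using C by (intro mult_left_mono mu_ge_norm) auto
  finally show ?thesis using bracket_le[of xi] by linarith
 next
  case False
  then have z: "i ~= first_index ==> xi $ i = 0" for i using line[of i] by (cases "\<Gamma> i") auto
  have "bracket xi <= mu xi"
  proof (cases "xi = 0")
   case True
   then show ?thesis by (simp add: mu_def bracket_def)
  next
   case nz: False
   have "norm xi <= (\<Sum>i\<in>UNIV. \<bar>xi $ i\<bar>)" by (rule norm_le_l1_cart)
   also have "... = \<bar>xi $ first_index\<bar>"
    using z by (subst sum.remove[of _ first_index]) (auto intro!: sum.neutral)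
   finally have "1 <= \<bar>xi $ first_index\<bar> / norm xi" using nz by (simp add: le_divide_eq)
   moreover have "mu xi = \<bar>xi $ first_index\<bar> / norm xi + norm xi" using nz by (simp add: mu_def)
   ultimately show ?thesis using bracket_le[of xi] by linarith
  qed
  also have "... <= C * mu xi" using C mu_nonneg[of xi] by (simp add: mult_le_cancel_right1)
  finally show ?thesis .
 qed
 then have "AE xi in dm. bracket xi <= C * mu xi" using AE_dual_lattice by (auto elim: AE_mp)
 then show ?thesis using C by blast
qed

text \<open>
 If \<open>xi\<^sub>1\<close> does not vanish it is bounded away from zero, being a lattice point, so \<open>|xi\<^sub>1| / |xi| <= 1\<close> is
 absorbed by \<open>|xi|\<close>. The exceptional value of \<open>mu\<close> at zero does not count, since the dual group has a
 real coordinate and zero is a null set.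
\<close>

lemma X_norm_homogeneous:
 assumes R: "first_index \<notin> real_coords \<Gamma>" "real_coords \<Gamma> ~= {}"
 shows "\<exists>c>0. \<exists>C>0. \<forall>f\<in>X_space s F \<Gamma>.
  integrable dm (\<lambda>xi. (norm xi)\<^sup>2 * bracket xi powr (2 * (s - 1)) * (cmod (fourier_fun \<Gamma> f xi))\<^sup>2) \<and>
  c * (LINT xi|dm. (norm xi)\<^sup>2 * bracket xi powr (2 * (s - 1)) * (cmod (fourier_fun \<Gamma> f xi))\<^sup>2) <= (X_norm s \<Gamma> f)\<^sup>2 \<and>
  (X_norm s \<Gamma> f)\<^sup>2 <= C * (LINT xi|dm. (norm xi)\<^sup>2 * bracket xi powr (2 * (s - 1)) * (cmod (fourier_fun \<Gamma> f xi))\<^sup>2)"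
proof -
 obtain delta where delta: "delta > 0" "!!i L t. \<Gamma> i = Torus L ==> t \<in> lattice L ==> t ~= 0 ==> delta <= \<bar>t\<bar>"
  using lattice_gap by blast
 obtain i0 where i0: "\<Gamma> i0 = Line" using R by (auto simp: real_coords_def)
 obtain L where L: "\<Gamma> first_index = Torus L" using R by (cases "\<Gamma> first_index") (auto simp: real_coords_def)
 define v where "v xi = norm xi * bracket xi powr (s - 1)" for xi :: "real^('n::{finite,linorder})"
 have vm: "v \<in> Borel" unfolding v_def[abs_def] by measurable
 define C where "C = 1 + 1 / delta"
 have C: "C > 0" using delta by (auto simp: C_def add_pos_pos)
 have ae0: "AE xi in dm. xi $ i0 ~= 0"
  unfolding dual_measure_eq
  by (rule D.AE_vprod_component) (unfold i0 factor_simps, rule AE_lborel_singleton)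
 have ae: "AE xi in dm. \<bar>wX s xi\<bar> <= C * \<bar>v xi\<bar>"
  using AE_dual_lattice ae0
 proof eventually_elim
  case (elim xi)
  have nz: "xi ~= 0" using elim(2) by auto
  have "mu xi <= C * norm xi"
  proof (cases "xi $ first_index = 0")
   case True
   then show ?thesis using nz delta by (simp add: mu_def C_def distrib_right)
  next
   case False
   have "delta <= \<bar>xi $ first_index\<bar>"
    using elim(1) L False by (intro delta(2)[OF L]) (auto simp: dual_lattice_def)
   also have "... <= norm xi" by (rule component_le_norm_cart)
   finally have "1 <= norm xi / delta" using delta by (simp add: le_divide_eq)
   moreover have "\<bar>xi $ first_index\<bar> / norm xi <= 1"
    using component_le_norm_cart[of xi first_index] nz by (simp add: divide_le_eq)
   moreover have "mu xi = \<bar>xi $ first_index\<bar> / norm xi + norm xi" using nz by (simp add: mu_def)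
   moreover have "C * norm xi = norm xi + norm xi / delta" by (simp add: C_def distrib_right)
   ultimately show ?thesis by linarith
  qed
  then have "mu xi * bracket xi powr (s - 1) <= (C * norm xi) * bracket xi powr (s - 1)"
   by (rule mult_right_mono) simp
  then show ?case using mu_nonneg[of xi] by (simp add: v_def abs_mult)
 qed
 have le: "\<bar>v xi\<bar> <= 1 * \<bar>wX s xi\<bar>" for xi
  using mult_right_mono[OF mu_ge_norm[of xi], of "bracket xi powr (s - 1)"] mu_nonneg[of xi]
  by (simp add: v_def abs_mult)
 have sq: "(norm xi)\<^sup>2 * bracket xi powr (2 * (s - 1)) * (cmod z)\<^sup>2 = (v xi * cmod z)\<^sup>2" for xi z
 proof -
  have "bracket xi powr (2 * (s - 1)) = (bracket xi powr (s - 1))\<^sup>2"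
   by (simp add: powr_powr mult.commute power2_eq_square powr_add[symmetric])
  then show ?thesis by (simp add: v_def power_mult_distrib)
 qed
 show ?thesis
 proof (rule exI[of _ 1], rule conjI[OF zero_less_one], rule exI[of _ "C\<^sup>2"], intro conjI ballI)
  show "0 < C\<^sup>2" using C by simp
  fix f assume f: "f \<in> X_space s F \<Gamma>"
  then have f': "f \<in> weighted_space (wX s) F \<Gamma>" by (simp add: X_space_def)
  note 1 = weighted_space_mono[OF weights_measurable(1) vm AE_I2[OF le] zero_le_one f']
  note 2 = weighted_space_mono(2)[OF vm weights_measurable(1) ae less_imp_le[OF C] 1(1)]
  have i: "integrable dm (%xi. (v xi * cmod (fourier_fun \<Gamma> f xi))\<^sup>2)" using 1(1) by (simp add: weighted_space_def)
  then show "integrable dm (%xi. (norm xi)\<^sup>2 * bracket xi powr (2 * (s - 1)) * (cmod (fourier_fun \<Gamma> f xi))\<^sup>2)"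
   by (simp only: sq)
  have I: "(weighted_norm v \<Gamma> f)\<^sup>2 = (LINT xi|dm. (norm xi)\<^sup>2 * bracket xi powr (2 * (s - 1)) * (cmod (fourier_fun \<Gamma> f xi))\<^sup>2)"
   unfolding sq weighted_norm_def by (simp add: integral_nonneg_AE)
  have n0: "0 <= weighted_norm v \<Gamma> f" "0 <= X_norm s \<Gamma> f"
   by (auto simp: weighted_norm_def X_norm_def integral_nonneg_AE)
  show "1 * (LINT xi|dm. (norm xi)\<^sup>2 * bracket xi powr (2 * (s - 1)) * (cmod (fourier_fun \<Gamma> f xi))\<^sup>2) <= (X_norm s \<Gamma> f)\<^sup>2"
   using power_mono[of "weighted_norm v \<Gamma> f" "X_norm s \<Gamma> f" 2] 1(2) n0 by (simp add: I X_norm_def)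
  show "(X_norm s \<Gamma> f)\<^sup>2 <= C\<^sup>2 * (LINT xi|dm. (norm xi)\<^sup>2 * bracket xi powr (2 * (s - 1)) * (cmod (fourier_fun \<Gamma> f xi))\<^sup>2)"
   using power_mono[of "X_norm s \<Gamma> f" "C * weighted_norm v \<Gamma> f" 2] 2 n0
   unfolding I[symmetric] by (simp add: X_norm_def power_mult_distrib)
 qed
qed

end

section \<open>Functions in the space that are not square integrable\<close>

context lca
begin

lemma cnj_osc: "cnj (osc dm c g x) = osc dm (- c) (\<lambda>xi. cnj (g xi)) x"
proof -
 have "cnj (osc dm c g x) = (LINT xi|dm. cnj (g xi * cis (c * (xi \<bullet> x))))"
  unfolding osc_def
  by (rule integral_bounded_linear'[OF bounded_linear_cnj bounded_linear_cnj, symmetric]) simp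
 then show ?thesis by (simp add: osc_def cis_cnj)
qed

lemma plancherel_test:
 assumes psi: "psi \<in> schwartz (\<lambda>_::'n. Line)"
 shows "(LINT x|gm. (cmod (fourier_transpose \<Gamma> psi x))\<^sup>2) = (LINT xi|dm. (cmod (psi xi))\<^sup>2)"
  and "integrable gm (\<lambda>x. (cmod (fourier_transpose \<Gamma> psi x))\<^sup>2)"
proof -
 let ?F = "fourier_transpose \<Gamma> psi"
 have F: "?F \<in> schwartz \<Gamma>" by (rule fourier_transpose_schwartz[OF psi])
 have c: "inv_fourier (%xi. cnj (psi xi)) x = cnj (?F x)" for x
  by (simp add: inv_fourier_def fourier_transpose_eq cnj_osc)
 have "(LINT x|gm. cnj (?F x) * ?F x) = (LINT xi|dm. cnj (psi xi) * psi xi)"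
  using multiplication_formula[OF _ psi, of "%xi. cnj (psi xi)"] rapid_integrable[OF rapid_dm[OF psi]] by (simp add: c)
 then have "(LINT x|gm. complex_of_real ((cmod (?F x))\<^sup>2)) = (LINT xi|dm. complex_of_real ((cmod (psi xi))\<^sup>2))"
  by (simp add: complex_norm_square mult.commute del: of_real_power)
 then show "(LINT x|gm. (cmod (?F x))\<^sup>2) = (LINT xi|dm. (cmod (psi xi))\<^sup>2)"
  by (simp del: of_real_power)
 obtain B where B: "!!x. cmod (?F x) <= B" using schwartz_bound[OF F, of 0 "[]"] by simp metis
 have i: "integrable gm (%x. B * cmod (?F x))"
  by (intro integrable_mult_right integrable_norm rapid_integrable rapid_gm F)
 show "integrable gm (%x. (cmod (?F x))\<^sup>2)"
 proof (rule integrable_bound[OF i])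
  show "(%x. (cmod (?F x))\<^sup>2) \<in> borel_measurable gm"
   using schwartz_measurable[OF F] by measurable
  have "cmod (?F x) * cmod (?F x) <= B * cmod (?F x)" for x by (intro mult_right_mono B) simp
  then show "AE x in gm. norm ((cmod (?F x))\<^sup>2) <= norm (B * cmod (?F x))"
   by (intro AE_I2) (simp add: power2_eq_square, metis abs_ge_self order_trans)
 qed
qed

text \<open>
 For a square integrable function, the pairing with the transform of \<open>psi N\<close> and the Plancherel identity
 for \<open>psi N\<close> would bound the integrals of \<open>|psi N|\<^sup>2\<close> uniformly in \<open>N\<close>.
\<close>

lemma not_L2_if_unbounded:
 assumes g: "integrable dm g"
  and psi: "!!N. psi N \<in> dual_test_functions" "!!N xi. g xi * psi N xi = of_real ((cmod (psi N xi))\<^sup>2)"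
  and unb: "!!N. real N <= (LINT xi|dm. (cmod (psi N xi))\<^sup>2)"
 shows "dist_of \<Gamma> (inv_fourier g) \<notin> L2_space F \<Gamma>"
proof
 assume "dist_of \<Gamma> (inv_fourier g) \<in> L2_space F \<Gamma>"
 then obtain v where eq: "dist_of \<Gamma> (inv_fourier g) = dist_of \<Gamma> v" and v [measurable]: "v \<in> Borel"
  and v2: "integrable (group_measure \<Gamma>) (%x. (cmod (v x))\<^sup>2)" by (auto simp: L2_space_def)
 have "(%x. (cmod (v x))\<^sup>2) \<in> Borel" by measurable
 then have vi: "integrable gm (%x. (cmod (v x))\<^sup>2)" using v2 integrable_group by blast
 define V where "V = (LINT x|gm. (cmod (v x))\<^sup>2)"
 have "real N <= V" for N
 proof -
  have s: "psi N \<in> schwartz (%_. Line)" by (rule dual_test_schwartz[OF psi(1)])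
  let ?F = "fourier_transpose \<Gamma> (psi N)"
  define A where "A = (LINT xi|dm. (cmod (psi N xi))\<^sup>2)"
  have F: "?F \<in> schwartz \<Gamma>" by (rule fourier_transpose_schwartz[OF s])
  note [measurable] = schwartz_measurable[OF F]
  have "(LINT x|gm. v x * ?F x) = (LINT x|gm. inv_fourier g x * ?F x)"
   using fun_cong[OF eq, of ?F] by (simp add: dist_of_eq v F inv_fourier_tempered(1)[OF g])
  also have "... = (LINT xi|dm. g xi * psi N xi)" by (rule multiplication_formula[OF g s])
  also have "... = of_real A" unfolding A_def psi(2) by (rule integral_complex_of_real)
  finally have e: "(LINT x|gm. v x * ?F x) = of_real A" .
  have A0: "0 <= A" unfolding A_def by (rule integral_nonneg_AE) simp
  have bi: "integrable gm (%x. ((cmod (v x))\<^sup>2 + (cmod (?F x))\<^sup>2) / 2)"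
   using vi plancherel_test(2)[OF s] by simp
  have bound: "cmod (v x * ?F x) <= ((cmod (v x))\<^sup>2 + (cmod (?F x))\<^sup>2) / 2" for x
   using sum_squares_bound[of "cmod (v x)" "cmod (?F x)"] by (simp add: norm_mult)
  have "integrable gm (%x. v x * ?F x)"
   by (rule integrable_bound[OF bi]) (use bound in \<open>auto intro!: AE_I2\<close>)
  then have "cmod (LINT x|gm. v x * ?F x) <= (LINT x|gm. ((cmod (v x))\<^sup>2 + (cmod (?F x))\<^sup>2) / 2)"
   by (rule integral_norm_bound_integral_AE[OF _ bi]) (use bound in auto)
  also have "... = (V + A) / 2"
   using vi plancherel_test[OF s] by (simp add: V_def A_def)
  finally have "A <= V" using A0 by (simp add: e)
  then show ?thesis using unb[of N] by (simp add: A_def)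
 qed
 then show False using reals_Archimedean2[of V] by (meson not_less)
qed

lemma inv_fourier_real:
 assumes m: "g \<in> Borel" and even: "!!xi. g (- xi) = g xi"
 shows "inv_fourier (\<lambda>xi. complex_of_real (g xi)) x \<in> \<real>"
proof -
 let ?g = "%xi. complex_of_real (g xi)"
 have m2: "(%xi. ?g xi * cis (2 * pi * (xi \<bullet> x))) \<in> Borel"
  using m cis_measurable_osc[of "2 * pi" x] by measurable
 have "osc dm (2 * pi) ?g x = (LINT xi|distr dm borel uminus. ?g xi * cis (2 * pi * (xi \<bullet> x)))"
  by (simp add: osc_def dm_reflect)
 also have "... = (LINT xi|dm. ?g (- xi) * cis (2 * pi * ((- xi) \<bullet> x)))"
  by (rule integral_distr[OF _ m2]) simp
 also have "... = osc dm (- (2 * pi)) ?g x" by (simp add: osc_def even)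
 finally have "cnj (osc dm (2 * pi) ?g x) = osc dm (2 * pi) ?g x" by (simp add: cnj_osc)
 then show ?thesis unfolding inv_fourier_def by (intro Reals_mult) (auto simp: Reals_cnj_iff)
qed

lemma inv_fourier_compose_orthogonal:
 assumes A: "orthogonal_transformation A" and inv: "distr dm borel A = dm" and g: "integrable dm g"
 shows "inv_fourier g \<circ> A = inv_fourier (g \<circ> A)" and "integrable dm (g \<circ> A)"
proof -
 have Am: "A \<in> dm \<rightarrow>\<^sub>M borel" using orthogonal_measurable[OF A] by simp
 have gm: "g \<in> Borel" using borel_measurable_integrable[OF g] by simp
 show "integrable dm (g \<circ> A)"
  using integrable_distr_eq[OF Am gm] g by (simp add: inv comp_def)
 show "inv_fourier g \<circ> A = inv_fourier (g \<circ> A)"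
 proof
  fix x
  have m2: "(%xi. g xi * cis (2 * pi * (xi \<bullet> A x))) \<in> Borel"
   using gm cis_measurable_osc[of "2 * pi" "A x"] by measurable
  have "osc dm (2 * pi) g (A x) = (LINT xi|distr dm borel A. g xi * cis (2 * pi * (xi \<bullet> A x)))"
   by (simp add: osc_def inv)
  also have "... = (LINT xi|dm. g (A xi) * cis (2 * pi * (A xi \<bullet> A x)))"
   by (rule integral_distr[OF Am m2])
  also have "... = osc dm (2 * pi) (g \<circ> A) x"
   using A by (simp add: osc_def orthogonal_transformation_def)
  finally show "(inv_fourier g \<circ> A) x = inv_fourier (g \<circ> A) x" by (simp add: inv_fourier_def)
 qed
qed

end

section \<open>The action on the real coordinates\<close>

lemma strict_mono_range_unique:
 fixes f g :: "'k::{finite,linorder} => 'n::{finite,linorder}"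
 assumes f: "strict_mono f" and g: "strict_mono g" and eq: "range f = range g"
 shows "f = g"
proof -
 let ?xs = "sorted_list_of_set (UNIV :: 'k set)"
 have xs: "sorted_wrt (<) ?xs" "set ?xs = UNIV" by simp_all
 have s: "sorted_wrt (<) (map h ?xs)" if "strict_mono h" for h :: "'k => 'n"
  unfolding sorted_wrt_map
  by (rule sorted_wrt_mono_rel[OF _ xs(1)]) (use that in \<open>auto simp: strict_mono_def\<close>)
 have "map f ?xs = map g ?xs"
  by (rule strict_sorted_equal[OF s[OF g] s[OF f]]) (use eq xs(2) in simp)
 then show ?thesis using xs(2) by (auto simp: fun_eq_iff)
qed

lemma strict_mono_enum_exists:
 fixes R :: "'n::{finite,linorder} set"
 assumes "CARD('k::{finite,linorder}) = card R"
 shows "\<exists>e :: 'k => 'n. strict_mono e \<and> range e = R"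
proof -
 let ?ys = "sorted_list_of_set R"
 have ys: "sorted_wrt (<) ?ys" "set ?ys = R" "length ?ys = card R" by simp_all
 define e :: "'k => 'n" where "e k = ?ys ! card {..<k}" for k
 have lt: "card {..<k} < card R" for k :: 'k
 proof -
  have "card {..<k} < CARD('k)" by (rule psubset_card_mono) auto
  then show ?thesis using assms by simp
 qed
 have mono: "strict_mono e"
 proof (rule strict_monoI)
  fix j k :: 'k assume "j < k"
  then have "card {..<j} < card {..<k}" by (intro psubset_card_mono) auto
  then show "e j < e k" unfolding e_def using ys lt[of k] by (intro sorted_wrt_nth_less[OF ys(1)]) simp_all
 qed
 have "e k \<in> set ?ys" for k unfolding e_def by (rule nth_mem) (simp add: lt)
 then have sub: "range e \<subseteq> R" using ys(2) by blast
 have "card (range e) = card R"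
  using strict_mono_imp_inj_on[OF mono] assms by (simp add: card_image)
 then have "range e = R" using sub by (intro card_subset_eq) auto
 then show ?thesis using mono by blast
qed

lemma enum_real_coords_props:
 fixes \<Gamma> :: "'n::{finite,linorder} => factor"
 assumes "CARD('k::{finite,linorder}) = card (real_coords \<Gamma>)"
 shows "strict_mono (enum_real_coords \<Gamma> :: 'k => 'n)" "range (enum_real_coords \<Gamma> :: 'k => 'n) = real_coords \<Gamma>"
proof -
 have "\<exists>!e :: 'k => 'n. strict_mono e \<and> range e = real_coords \<Gamma>"
 proof (rule ex_ex1I[OF strict_mono_enum_exists[OF assms]])
  fix e e' :: "'k => 'n" assume "strict_mono e \<and> range e = real_coords \<Gamma>" "strict_mono e' \<and> range e' = real_coords \<Gamma>"
  then show "e = e'" by (intro strict_mono_range_unique) simp_all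
 qed
 from theI'[OF this] show "strict_mono (enum_real_coords \<Gamma> :: 'k => 'n)" "range (enum_real_coords \<Gamma> :: 'k => 'n) = real_coords \<Gamma>"
  unfolding enum_real_coords_def by auto
qed

context lca_ord
begin

text \<open>
 Commutation with the rounding makes the map preserve the dual measure. The enumeration starts with
 the first coordinate when that one is real, so the hypothesis on \<open>Q\<close> is one about the image of the
 first basis vector under the action.
\<close>

lemma act_real_props:
 fixes Q :: "real ^ ('k::{finite,linorder}) ^ ('k::{finite,linorder})"
 assumes card: "CARD('k) = card (real_coords \<Gamma>)" and Q: "orthogonal_matrix Q"
 shows "orthogonal_transformation (act_real \<Gamma> Q)"
  and "!!x i. \<Gamma> i ~= Line ==> act_real \<Gamma> Q x $ i = x $ i"
  and "!!x. act_real \<Gamma> Q (round_vec x) = round_vec (act_real \<Gamma> Q x)"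
  and "first_index \<in> real_coords \<Gamma> ==>
   act_real \<Gamma> Q (axis first_index 1) \<bullet> axis first_index 1 = (Q *v axis first_index 1) \<bullet> axis first_index 1"
proof -
 let ?E = "enum_real_coords \<Gamma> :: 'k => 'n" and ?R = "real_coords \<Gamma>" and ?A = "act_real \<Gamma> Q"
 note E = enum_real_coords_props[OF card]
 have inj: "inj ?E" using strict_mono_imp_inj_on[OF E(1)] .
 define P where "P x = (\<chi> a. x $ ?E a)" for x :: "real ^ ('n::{finite,linorder})"
 have A_E: "?A x $ ?E a = (Q *v P x) $ a" for x a
  using E(2) inj by (auto simp: act_real_def P_def inv_f_f)
 have A_nR: "i \<notin> ?R ==> ?A x $ i = x $ i" for x i by (simp add: act_real_def)
 show "!!x i. \<Gamma> i ~= Line ==> ?A x $ i = x $ i" by (rule A_nR) (simp add: real_coords_def)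
 have vec_eqI: "x = y" if "!!a. x $ ?E a = y $ ?E a" "!!i. i \<notin> ?R ==> x $ i = y $ i" for x y :: "real ^ ('n::{finite,linorder})"
  using that E(2) by (auto simp: vec_eq_iff) (metis rangeE)
 have P_add: "P (x + y) = P x + P y" and P_scale: "P (c *\<^sub>R x) = c *\<^sub>R P x" for x y c
  by (simp_all add: P_def vec_eq_iff)
 have lin: "linear ?A"
 proof (rule linearI)
  show "?A (x + y) = ?A x + ?A y" for x y
   by (rule vec_eqI) (simp_all add: A_E A_nR P_add matrix_vector_right_distrib)
  show "?A (c *\<^sub>R x) = c *\<^sub>R ?A x" for c x
   by (rule vec_eqI) (simp_all add: A_E A_nR P_scale matrix_vector_mult_scaleR)
 qed
 have inner: "x \<bullet> y = P x \<bullet> P y + (\<Sum>i\<in>- ?R. x $ i * y $ i)" for x y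
 proof -
  have "x \<bullet> y = (\<Sum>i\<in>?R. x $ i * y $ i) + (\<Sum>i\<in>- ?R. x $ i * y $ i)"
   unfolding inner_vec_def by (simp add: sum.union_disjoint[symmetric] Compl_disjoint)
  also have "(\<Sum>i\<in>?R. x $ i * y $ i) = P x \<bullet> P y"
   unfolding E(2)[symmetric] by (simp add: sum.reindex[OF inj] inner_vec_def P_def)
  finally show ?thesis .
 qed
 have PA: "P (?A x) = Q *v P x" for x using A_E by (simp add: P_def vec_eq_iff)
 have "orthogonal_transformation ((*v) Q)" using Q by (simp add: orthogonal_transformation_matrix)
 then have "?A x \<bullet> ?A y = x \<bullet> y" for x y
  unfolding inner[of "?A x"] inner[of x] PA by (simp add: orthogonal_transformation_def A_nR)
 then show "orthogonal_transformation ?A" using lin by (simp add: orthogonal_transformation_def)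
 have EL: "\<Gamma> (?E a) = Line" for a using E(2) by (auto simp: real_coords_def)
 have Pr: "P (round_vec x) = P x" for x by (simp add: P_def round_vec_def EL vec_eq_iff)
 show "!!x. ?A (round_vec x) = round_vec (?A x)"
  by (rule vec_eqI) (simp_all add: A_E A_nR Pr, simp_all add: round_vec_def EL A_E A_nR)
 assume f: "first_index \<in> ?R"
 then have "first_index \<in> range ?E" by (simp only: E(2))
 then obtain a where a: "?E a = first_index" by (metis rangeE)
 have least: "first_index <= z" for z :: "'z::{finite,linorder}" unfolding first_index_def by (rule Min_le) auto
 have "?E first_index <= ?E a" using least strict_mono_less_eq[OF E(1)] by blast
 then have Ef: "?E first_index = first_index" using a least antisym by metis
 have "P (axis first_index 1) = axis first_index 1"
  using inj Ef by (auto simp: P_def vec_eq_iff axis_def inj_eq) (metis inj_eq)+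
 then have "?A (axis first_index 1) $ ?E first_index = (Q *v axis first_index 1) $ first_index"
  by (simp only: A_E)
 then show "?A (axis first_index 1) \<bullet> axis first_index 1 = (Q *v axis first_index 1) \<bullet> axis first_index 1"
  by (simp add: Ef inner_axis)
qed

section \<open>Strict inclusion and failure of rotation invariance\<close>

text \<open>
 On the support of the profile \<open>xi\<close> is within \<open>O(t\<^sup>2)\<close> of \<open>t w\<close> and \<open>w\<close> has first coordinate zero, so
 \<open>|xi\<^sub>1| / |xi|\<close> is \<open>O(|xi|)\<close> and the weight of \<open>X\<close> is \<open>O(|xi|)\<close>. Symmetry of the profile makes its inverse
 transform real.
\<close>

lemma low_frequency_function:
 fixes w :: "real ^ ('n::{finite,linorder})"
 assumes F: "F = \<real> \<or> F = UNIV" and s: "s >= 0"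
  and w: "norm w = 1" "!!i L. \<Gamma> i = Torus L ==> w $ i = 0" "w $ first_index = 0" and eps: "eps > 0"
 obtains g where "inv_fourier (\<lambda>xi. complex_of_real (g xi)) \<in> tempered_functions F \<Gamma>"
  "dist_of \<Gamma> (inv_fourier (\<lambda>xi. complex_of_real (g xi))) \<in> X_space s F \<Gamma>"
  "dist_of \<Gamma> (inv_fourier (\<lambda>xi. complex_of_real (g xi))) \<notin> L2_space F \<Gamma>"
  "dist_of \<Gamma> (inv_fourier (\<lambda>xi. complex_of_real (g xi))) \<notin> H_space s F \<Gamma>"
  "integrable dm (\<lambda>xi. complex_of_real (g xi))" "\<not> integrable dm (\<lambda>xi. (g xi)\<^sup>2)"
  "!!xi. g xi ~= 0 ==> \<exists>t. t ~= 0 \<and> \<bar>t\<bar> <= 1 \<and> norm (xi - t *\<^sub>R w) <= eps * t\<^sup>2"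
proof -
 define eps' where "eps' = min eps (1 / 2)"
 have eps': "eps' > 0" "eps' <= eps" "eps' <= 1 / 2" using eps by (auto simp: eps'_def)
 obtain g psi where gm [measurable]: "g \<in> Borel" and gi: "integrable dm g" and g0: "!!xi. 0 <= g xi"
  and even: "!!xi. g (- xi) = g xi" and gn: "integrable dm (%xi. (norm xi * g xi)\<^sup>2)"
  and supp: "!!xi. g xi ~= 0 ==> \<exists>t. t ~= 0 \<and> \<bar>t\<bar> <= 1 \<and> norm (xi - t *\<^sub>R w) <= eps' * t\<^sup>2"
  and psi: "!!N. (%xi. complex_of_real (psi N xi)) \<in> dual_test_functions"
   "!!N xi. g xi * psi N xi = (psi N xi)\<^sup>2" "!!N xi. (psi N xi)\<^sup>2 <= (g xi)\<^sup>2"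
   "!!N. real N <= (LINT xi|dm. (psi N xi)\<^sup>2)"
  by (rule low_frequency_example[OF w(1) _ eps'(1)]) (erule w(2), rule that)
 let ?g = "%xi. complex_of_real (g xi)"
 let ?u = "inv_fourier ?g"
 have ci: "integrable dm ?g" using gi by simp
 have nsq: "\<not> integrable dm (%xi. (g xi)\<^sup>2)"
 proof
  assume i: "integrable dm (%xi. (g xi)\<^sup>2)"
  have "real N <= (LINT xi|dm. (g xi)\<^sup>2)" for N
  proof -
   have "Re \<circ> (%xi. complex_of_real (psi N xi)) \<in> Borel"
    using schwartz_measurable[OF dual_test_schwartz[OF psi(1)[of N]]] by (intro measurable_comp[of _ borel borel]) auto
   then have [measurable]: "psi N \<in> Borel" by (simp add: comp_def)
   have "integrable dm (%xi. (psi N xi)\<^sup>2)"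
    by (rule integrable_bound[OF i]) (use psi(3) in auto)
   then have "(LINT xi|dm. (psi N xi)\<^sup>2) <= (LINT xi|dm. (g xi)\<^sup>2)" using i psi(3) by (intro integral_mono)
   then show ?thesis using psi(4)[of N] by linarith
  qed
  then show False using reals_Archimedean2 by (meson not_less)
 qed
 have four: "is_fourier \<Gamma> (dist_of \<Gamma> ?u) ?g" by (rule is_fourier_inv_fourier[OF ci])
 have u: "?u \<in> tempered_functions F \<Gamma>"
 proof (rule inv_fourier_tempered(4)[OF ci])
  show "range ?u \<subseteq> F" using F inv_fourier_real[OF gm even] by auto
 qed
 have ov: "dist_of \<Gamma> ?u \<in> dist_over F \<Gamma>" by (rule dist_of_over[OF u])
 show thesis
 proof (rule that[of g])
  show "?u \<in> tempered_functions F \<Gamma>" by (rule u)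
  show "integrable dm ?g" by (rule ci)
  show "\<not> integrable dm (%xi. (g xi)\<^sup>2)" by (rule nsq)
  show "\<exists>t. t ~= 0 \<and> \<bar>t\<bar> <= 1 \<and> norm (xi - t *\<^sub>R w) <= eps * t\<^sup>2" if "g xi ~= 0" for xi
  proof -
   obtain t where t: "t ~= 0" "\<bar>t\<bar> <= 1" "norm (xi - t *\<^sub>R w) <= eps' * t\<^sup>2" using supp[OF \<open>g xi ~= 0\<close>] by blast
   have "eps' * t\<^sup>2 <= eps * t\<^sup>2" using eps' by (intro mult_right_mono) auto
   then show ?thesis using t by (meson order_trans)
  qed
  show "dist_of \<Gamma> ?u \<notin> L2_space F \<Gamma>"
  proof (rule not_L2_if_unbounded[OF ci psi(1)])
   show "?g xi * complex_of_real (psi N xi) = complex_of_real ((cmod (complex_of_real (psi N xi)))\<^sup>2)" for N xi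
    using psi(2)[of xi N] by (simp add: of_real_mult[symmetric] del: of_real_mult of_real_power)
   show "real N <= (LINT xi|dm. (cmod (complex_of_real (psi N xi)))\<^sup>2)" for N
    using psi(4)[of N] by simp
  qed
  show "dist_of \<Gamma> ?u \<notin> H_space s F \<Gamma>"
  proof
   assume "dist_of \<Gamma> ?u \<in> H_space s F \<Gamma>"
   then have i: "integrable dm (%xi. (wH s xi * cmod (?g xi))\<^sup>2)"
    unfolding H_space_def weighted_space_iff[OF four weights_measurable(2)] by simp
   have "integrable dm (%xi. (g xi)\<^sup>2)"
   proof (rule integrable_bound[OF i])
    have "(g xi)\<^sup>2 <= (wH s xi * g xi)\<^sup>2" for xi
    proof (rule power_mono)
     have "1 <= wH s xi" using bracket_ge_1[of xi] s by (rule ge_one_powr_ge_zero)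
     then show "g xi <= wH s xi * g xi" using g0[of xi] by (simp add: mult_le_cancel_right1)
    qed (rule g0)
    then show "AE xi in dm. norm ((g xi)\<^sup>2) <= norm ((wH s xi * cmod (?g xi))\<^sup>2)" using g0 by simp
   qed measurable
   then show False using nsq by simp
  qed
  have b: "mu xi * bracket xi powr (s - 1) <= (3 * 3 powr \<bar>s - 1\<bar>) * norm xi" if "g xi ~= 0" for xi
  proof -
   obtain t where t: "t ~= 0" "\<bar>t\<bar> <= 1" "norm (xi - t *\<^sub>R w) <= eps' * t\<^sup>2" using supp[OF \<open>g xi ~= 0\<close>] by blast
   have "eps' * t\<^sup>2 <= (1 / 2) * t\<^sup>2" using eps' by (intro mult_right_mono) auto
   also have "(1 / 2) * t\<^sup>2 = \<bar>t\<bar> * \<bar>t\<bar> / 2" by (simp add: power2_eq_square)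
   finally have "eps' * t\<^sup>2 <= \<bar>t\<bar> * \<bar>t\<bar> / 2" .
   with t(3) have d: "norm (xi - t *\<^sub>R w) <= \<bar>t\<bar> * \<bar>t\<bar> / 2" by (rule order_trans)
   have tt: "\<bar>t\<bar> * \<bar>t\<bar> <= \<bar>t\<bar> * 1" using t(2) by (intro mult_left_mono) auto
   have "\<bar>norm xi - norm (t *\<^sub>R w)\<bar> <= norm (xi - t *\<^sub>R w)" by (rule norm_triangle_ineq3)
   then have n: "\<bar>t\<bar> / 2 <= norm xi" "norm xi <= 2" using d tt t(2) w(1) by auto
   have nz: "xi ~= 0" using n(1) t(1) by auto
   have "\<bar>xi $ first_index\<bar> = \<bar>(xi - t *\<^sub>R w) $ first_index\<bar>" using w(3) by simp
   also have "... <= \<bar>t\<bar> * \<bar>t\<bar> / 2" using d component_le_norm_cart order_trans by blast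
   also have "... = \<bar>t\<bar> * (\<bar>t\<bar> / 2)" by simp
   also have "... <= (2 * norm xi) * norm xi" using n(1) by (intro mult_mono) auto
   finally have "\<bar>xi $ first_index\<bar> / norm xi <= 2 * norm xi" using nz by (simp add: divide_le_eq)
   then have mu3: "mu xi <= 3 * norm xi" using nz by (simp add: mu_def)
   have "bracket xi powr (s - 1) <= bracket xi powr \<bar>s - 1\<bar>" using bracket_ge_1[of xi] by (intro powr_mono) auto
   also have "... <= 3 powr \<bar>s - 1\<bar>" using bracket_le[of xi] n(2) bracket_ge_1[of xi] by (intro powr_mono2) auto
   finally have "mu xi * bracket xi powr (s - 1) <= (3 * norm xi) * 3 powr \<bar>s - 1\<bar>"
    using mu3 mu_nonneg[of xi] by (intro mult_mono) auto
   then show ?thesis by (simp add: mult_ac)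
  qed
  have "integrable dm (%xi. (wX s xi * cmod (?g xi))\<^sup>2)"
  proof (rule integrable_bound[OF integrable_mult_right[OF gn, of "(3 * 3 powr \<bar>s - 1\<bar>)\<^sup>2"]])
   have "(wX s xi * g xi)\<^sup>2 <= (3 * 3 powr \<bar>s - 1\<bar>)\<^sup>2 * (norm xi * g xi)\<^sup>2" for xi
   proof (cases "g xi = 0")
    case False
    have "wX s xi * g xi <= ((3 * 3 powr \<bar>s - 1\<bar>) * norm xi) * g xi" using b[OF False] g0 by (rule mult_right_mono)
    then have "(wX s xi * g xi)\<^sup>2 <= (((3 * 3 powr \<bar>s - 1\<bar>) * norm xi) * g xi)\<^sup>2"
     using g0[of xi] mu_nonneg[of xi] by (intro power_mono) auto
    then show ?thesis by (simp only: power_mult_distrib mult.assoc)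
   qed simp
   then show "AE xi in dm. norm ((wX s xi * cmod (?g xi))\<^sup>2) <= norm ((3 * 3 powr \<bar>s - 1\<bar>)\<^sup>2 * (norm xi * g xi)\<^sup>2)"
    using g0 by (simp add: abs_mult power_mult_distrib)
  qed measurable
  then show "dist_of \<Gamma> ?u \<in> X_space s F \<Gamma>"
   unfolding X_space_def weighted_space_iff(1)[OF four weights_measurable(1)] using ov by blast
 qed
qed

lemma H_space_psubset_X_space:
 assumes F: "F = \<real> \<or> F = UNIV" and s: "s >= 0" and r: "r \<in> real_coords \<Gamma>" "r ~= first_index"
 shows "H_space s F \<Gamma> \<subset> X_space s F \<Gamma>"
proof -
 let ?w = "axis r 1 :: real ^ ('n::{finite,linorder})"
 have w: "norm ?w = 1" by (simp add: norm_eq_sqrt_inner inner_axis_axis)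
 have w2: "!!i L. \<Gamma> i = Torus L ==> ?w $ i = 0" and w3: "?w $ first_index = 0"
  using r by (auto simp: real_coords_def axis_def)
 obtain g where "dist_of \<Gamma> (inv_fourier (%xi. complex_of_real (g xi))) \<in> X_space s F \<Gamma>"
  "dist_of \<Gamma> (inv_fourier (%xi. complex_of_real (g xi))) \<notin> H_space s F \<Gamma>"
  by (rule low_frequency_function[OF F s w _ w3 zero_less_one]) (erule w2, rule that)
 then show ?thesis using H_space_subset_X_space[of s F] by blast
qed

text \<open>
 The direction \<open>w\<close> of the profile is the normalised component of \<open>Q e\<close> orthogonal to the first basis
 vector \<open>e\<close>. The transform of the rotated function lives near the line through the preimage of \<open>w\<close>,
 whose first coordinate is \<open>w \<bullet> Q e > 0\<close>. There the weight of \<open>X\<close> is bounded below, and the profile is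
 not square integrable.
\<close>

lemma rotation_example:
 fixes Q :: "real ^ ('k::{finite,linorder}) ^ ('k::{finite,linorder})"
 assumes F: "F = \<real> \<or> F = UNIV" and s: "s >= 0" and fi: "first_index \<in> real_coords \<Gamma>"
  and card: "CARD('k) = card (real_coords \<Gamma>)" and Q: "orthogonal_matrix Q"
  and Q1: "\<bar>(Q *v axis first_index 1) \<bullet> axis first_index 1\<bar> < 1"
 shows "\<exists>u\<in>tempered_functions F \<Gamma>. dist_of \<Gamma> u \<in> X_space s F \<Gamma> - L2_space F \<Gamma> \<and>
  dist_of \<Gamma> (u \<circ> act_real \<Gamma> Q) \<notin> X_space s F \<Gamma>"
proof -
 let ?A = "act_real \<Gamma> Q"
 let ?e = "axis first_index 1 :: real ^ ('n::{finite,linorder})"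
 note A = act_real_props[OF card Q]
 have lin: "linear ?A" and inn: "?A x \<bullet> ?A y = x \<bullet> y" for x y
  using A(1) by (auto simp: orthogonal_transformation_def)
 have inv: "distr dm borel ?A = dm" by (rule dm_orthogonal[OF A(1,3)])
 have nA: "norm (?A x) = norm x" for x by (rule orthogonal_transformation_norm[OF A(1)])
 have e1: "?e \<bullet> ?e = 1" by (simp add: inner_axis_axis)
 define a where "a = ?A ?e \<bullet> ?e"
 have a: "\<bar>a\<bar> < 1" using Q1 A(4)[OF fi] by (simp add: a_def)
 then have a2: "a\<^sup>2 < 1" by (simp add: abs_square_less_1)
 (* the component of ?A ?e orthogonal to ?e *)
 define w0 where "w0 = ?A ?e - a *\<^sub>R ?e"
 have w0e: "w0 \<bullet> ?e = 0" unfolding w0_def inner_diff_left inner_scaleR_left e1 by (simp only: a_def mult_1_right diff_self)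
 have w0A: "w0 \<bullet> ?A ?e = 1 - a\<^sup>2"
 proof -
  have 1: "?A ?e \<bullet> ?A ?e = 1" by (simp only: inn e1)
  have 2: "?e \<bullet> ?A ?e = a" unfolding a_def by (rule inner_commute)
  show ?thesis unfolding w0_def inner_diff_left inner_scaleR_left 1 2 by (simp only: power2_eq_square)
 qed
 have "w0 \<bullet> w0 = w0 \<bullet> ?A ?e - a * (w0 \<bullet> ?e)" by (simp only: w0_def inner_diff_right inner_scaleR_right)
 then have ww: "w0 \<bullet> w0 = 1 - a\<^sup>2" by (simp add: w0A w0e)
 define \<beta> where "\<beta> = sqrt (1 - a\<^sup>2)"
 have \<beta>: "\<beta> > 0" using a2 by (simp add: \<beta>_def)
 have nw0: "norm w0 = \<beta>" by (simp add: norm_eq_sqrt_inner ww \<beta>_def)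
 define w where "w = (1 / \<beta>) *\<^sub>R w0"
 have wA: "w \<bullet> ?A ?e = \<beta>"
 proof -
  have "w \<bullet> ?A ?e = (1 - a\<^sup>2) / \<beta>" by (simp add: w_def w0A)
  also have "1 - a\<^sup>2 = \<beta> * \<beta>" using a2 by (simp add: \<beta>_def)
  finally show ?thesis using \<beta> by simp
 qed
 have w: "norm w = 1" "!!i L. \<Gamma> i = Torus L ==> w $ i = 0" "w $ first_index = 0"
 proof -
  show "norm w = 1" using \<beta> by (simp add: w_def nw0)
  show "w $ first_index = 0" using w0e by (simp add: w_def inner_axis)
  show "w $ i = 0" if "\<Gamma> i = Torus L" for i L
  proof -
   have "i ~= first_index" using fi that by (auto simp: real_coords_def)
   then have "?e $ i = 0" by (simp add: axis_def)
   then show ?thesis using A(2)[of i ?e] that by (simp add: w_def w0_def)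
  qed
 qed
 define eps where "eps = min (1 / 2) (\<beta> / 2)"
 have eps: "eps > 0" "eps <= 1 / 2" "eps <= \<beta> / 2" using \<beta> by (auto simp: eps_def)
 obtain g where u: "inv_fourier (%xi. complex_of_real (g xi)) \<in> tempered_functions F \<Gamma>"
  and X: "dist_of \<Gamma> (inv_fourier (%xi. complex_of_real (g xi))) \<in> X_space s F \<Gamma>"
  and L2: "dist_of \<Gamma> (inv_fourier (%xi. complex_of_real (g xi))) \<notin> L2_space F \<Gamma>"
  and "dist_of \<Gamma> (inv_fourier (%xi. complex_of_real (g xi))) \<notin> H_space s F \<Gamma>"
  and gi: "integrable dm (%xi. complex_of_real (g xi))" and nsq: "\<not> integrable dm (%xi. (g xi)\<^sup>2)"
  and supp: "!!xi. g xi ~= 0 ==> \<exists>t. t ~= 0 \<and> \<bar>t\<bar> <= 1 \<and> norm (xi - t *\<^sub>R w) <= eps * t\<^sup>2"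
  by (rule low_frequency_function[OF F s w(1) _ w(3) eps(1)]) (erule w(2), rule that)
 let ?g = "%xi. complex_of_real (g xi)"
 let ?u = "inv_fourier ?g"
 have comp: "?u \<circ> ?A = inv_fourier (?g \<circ> ?A)" and gAi: "integrable dm (?g \<circ> ?A)"
  by (rule inv_fourier_compose_orthogonal[OF A(1) inv gi])+
 have four: "is_fourier \<Gamma> (dist_of \<Gamma> (?u \<circ> ?A)) (?g \<circ> ?A)"
  unfolding comp by (rule is_fourier_inv_fourier[OF gAi])
 have gm: "g \<in> Borel"
  using measurable_compose[OF borel_measurable_integrable[OF gi] borel_measurable_Re]
  unfolding measurable_cong_sets[OF sets_dm refl] by simp
 have Am: "?A \<in> borel \<rightarrow>\<^sub>M borel" by (rule orthogonal_measurable[OF A(1)])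
 define delta where "delta = \<beta> / 4 * 3 powr (- \<bar>s - 1\<bar>)"
 have delta: "delta > 0" using \<beta> by (simp add: delta_def)
 have lower: "delta <= wX s eta" if gA: "g (?A eta) ~= 0" for eta
 proof -
  define xi where "xi = ?A eta"
  obtain t where t: "t ~= 0" "\<bar>t\<bar> <= 1" "norm (xi - t *\<^sub>R w) <= eps * t\<^sup>2" using supp[OF gA] unfolding xi_def by blast
  have "eps * t\<^sup>2 = (eps * \<bar>t\<bar>) * \<bar>t\<bar>" by (simp add: power2_eq_square mult.assoc)
  also have "... <= (eps * 1) * \<bar>t\<bar>" using t(2) eps by (intro mult_right_mono mult_left_mono) auto
  finally have d: "norm (xi - t *\<^sub>R w) <= eps * \<bar>t\<bar>" using t(3) by simp
  have d1: "norm (xi - t *\<^sub>R w) <= \<bar>t\<bar> / 2" and d2: "norm (xi - t *\<^sub>R w) <= \<beta> * \<bar>t\<bar> / 2"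
   using d mult_right_mono[OF eps(2), of "\<bar>t\<bar>"] mult_right_mono[OF eps(3), of "\<bar>t\<bar>"] by simp_all
  have "\<bar>norm xi - norm (t *\<^sub>R w)\<bar> <= norm (xi - t *\<^sub>R w)" by (rule norm_triangle_ineq3)
  then have n: "\<bar>t\<bar> / 2 <= norm xi" "norm xi <= 2 * \<bar>t\<bar>" using d1 w(1) by auto
  have nz: "eta ~= 0" using n(1) t(1) nA[of eta] by (auto simp: xi_def)
  have "eta $ first_index = xi \<bullet> ?A ?e" unfolding xi_def inn by (simp add: inner_axis)
  also have "... = t * \<beta> + (xi - t *\<^sub>R w) \<bullet> ?A ?e" by (simp add: inner_diff_left wA)
  finally have f: "eta $ first_index = t * \<beta> + (xi - t *\<^sub>R w) \<bullet> ?A ?e" .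
  have "norm ?e = 1" by (simp add: norm_eq_sqrt_inner e1)
  then have "\<bar>(xi - t *\<^sub>R w) \<bullet> ?A ?e\<bar> <= \<beta> * \<bar>t\<bar> / 2"
   using Cauchy_Schwarz_ineq2[of "xi - t *\<^sub>R w" "?A ?e"] d2 by (simp add: nA)
  moreover have "\<bar>t * \<beta>\<bar> = \<beta> * \<bar>t\<bar>" using \<beta> by (simp add: abs_mult)
  ultimately have "\<beta> * \<bar>t\<bar> / 2 <= \<bar>eta $ first_index\<bar>" unfolding f by linarith
  then have "\<beta> * \<bar>t\<bar> / 2 / (2 * \<bar>t\<bar>) <= \<bar>eta $ first_index\<bar> / norm eta"
   using n(2) nz nA[of eta] \<beta> by (intro frac_le) (auto simp: xi_def)
  then have "\<beta> / 4 <= \<bar>eta $ first_index\<bar> / norm eta" using t(1) by simp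
  also have "... <= mu eta" using nz by (simp add: mu_def)
  finally have m: "\<beta> / 4 <= mu eta" .
  have "norm eta <= 2" using n(2) t(2) nA[of eta] by (simp add: xi_def)
  then have b3: "bracket eta <= 3" using bracket_le[of eta] by simp
  have "3 powr (- \<bar>s - 1\<bar>) <= bracket eta powr (- \<bar>s - 1\<bar>)"
   using b3 bracket_ge_1[of eta] by (intro powr_mono2') auto
  also have "... <= bracket eta powr (s - 1)" using bracket_ge_1[of eta] by (intro powr_mono) auto
  finally show ?thesis unfolding delta_def using m \<beta> mu_nonneg[of eta] by (intro mult_mono) auto
 qed
 have "dist_of \<Gamma> (?u \<circ> ?A) \<notin> X_space s F \<Gamma>"
 proof
  assume "dist_of \<Gamma> (?u \<circ> ?A) \<in> X_space s F \<Gamma>"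
  then have i: "integrable dm (%xi. (wX s xi * cmod ((?g \<circ> ?A) xi))\<^sup>2)"
   unfolding X_space_def weighted_space_iff(1)[OF four weights_measurable(1)] by simp
  have m: "(%xi. (g xi)\<^sup>2) \<in> Borel" using gm by measurable
  have "integrable dm (%eta. (g (?A eta))\<^sup>2)"
  proof (rule integrable_bound[OF integrable_mult_right[OF i, of "1 / delta\<^sup>2"]])
   show "(%eta. (g (?A eta))\<^sup>2) \<in> borel_measurable dm"
    using measurable_compose[OF Am m] by simp
   have "(g (?A eta))\<^sup>2 <= 1 / delta\<^sup>2 * (wX s eta * \<bar>g (?A eta)\<bar>)\<^sup>2" for eta
   proof (cases "g (?A eta) = 0")
    case False
    have "delta * \<bar>g (?A eta)\<bar> <= wX s eta * \<bar>g (?A eta)\<bar>" by (rule mult_right_mono[OF lower[OF False]]) simp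
    then have "(delta * \<bar>g (?A eta)\<bar>)\<^sup>2 <= (wX s eta * \<bar>g (?A eta)\<bar>)\<^sup>2" using delta by (intro power_mono) auto
    moreover have "(delta * \<bar>g (?A eta)\<bar>)\<^sup>2 = delta\<^sup>2 * (g (?A eta))\<^sup>2" by (simp add: power_mult_distrib)
    ultimately have "delta\<^sup>2 * (g (?A eta))\<^sup>2 <= (wX s eta * \<bar>g (?A eta)\<bar>)\<^sup>2" by simp
    then have "(g (?A eta))\<^sup>2 <= (wX s eta * \<bar>g (?A eta)\<bar>)\<^sup>2 / delta\<^sup>2"
     using delta by (subst pos_le_divide_eq) (simp_all add: mult.commute)
    then show ?thesis by simp
   qed simp
   then show "AE eta in dm. norm ((g (?A eta))\<^sup>2) <= norm (1 / delta\<^sup>2 * (wX s eta * cmod ((?g \<circ> ?A) eta))\<^sup>2)"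
    by (intro AE_I2) (simp only: real_norm_def abs_power2 abs_mult abs_divide abs_one comp_def norm_of_real)
  qed
  then have "integrable (distr dm borel ?A) (%xi. (g xi)\<^sup>2)"
   using Am m by (subst integrable_distr_eq) auto
  then show False using nsq by (simp add: inv)
 qed
 then show ?thesis using u X L2 by blast
qed

end

section \<open>Summability kernels with compactly supported transform\<close>

definition bump :: "real => real" where
 "bump t = exp 1 * flat (1 - t\<^sup>2)"

lemma bump_0 [simp]: "bump 0 = 1"
 by (simp add: bump_def flat_simps mult_exp_exp)

lemma bump_eq_0: "\<bar>t\<bar> >= 1 ==> bump t = 0"
 by (simp add: bump_def flat_simps one_le_power abs_le_square_iff[of 1 t, simplified])

lemma bump_measurable [measurable]: "bump \<in> Borel"
 unfolding bump_def by measurable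

lemma bump_bounds: "0 <= bump t" "bump t <= exp 1"
 using flat_nonneg flat_le_1 by (simp_all add: bump_def)

lemma smooth_fun_bump:
 "smooth_fun (\<lambda>x::real^'n::finite. complex_of_real (bump (a * (x $ i) + b)))"
proof -
 have "(%x::real^'n. complex_of_real (1 - (a * (x $ i) + b)\<^sup>2)) =
  (%x. 1 + (-1) * ((of_real a * of_real (x $ i) + of_real b) * (of_real a * of_real (x $ i) + of_real b)))"
  by (simp add: power2_eq_square fun_eq_iff)
 moreover have "smooth_fun ..."
  by (intro smooth_fun_add smooth_fun_mult smooth_fun_const smooth_fun_nth)
 ultimately have "smooth_fun (%x::real^'n. complex_of_real (1 - (a * (x $ i) + b)\<^sup>2))" by simp
 from smooth_fun_mult[OF smooth_fun_const smooth_fun_flat[OF this]]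
 show ?thesis unfolding bump_def of_real_mult .
qed

lemma integrable_bump: "integrable lborel (\<lambda>u. complex_of_real (bump u) * cis (c * u))"
proof (rule integrable_bound)
 show "integrable lborel (%u::real. indicator {-1..1} u * exp 1 :: real)" by simp
 show "AE u in lborel. norm (complex_of_real (bump u) * cis (c * u)) <= norm (indicator {-1..1} u * exp 1 :: real)"
  using bump_bounds bump_eq_0 by (auto simp: norm_mult indicator_def)
qed measurable

definition bump_kernel :: "real => complex" where
 "bump_kernel t = (LINT u|lborel. complex_of_real (bump u) * cis (2 * pi * u * t))"

lemma bump_kernel_minus: "bump_kernel (- t) = bump_kernel t"
 unfolding bump_kernel_def
 by (subst lborel_integral_real_affine[where c = "-1" and t = 0]) (simp_all add: bump_def)

text \<open>
 All this is read off from the theory for the group that consists of one line: decay because the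
 transform is a Schwartz function, the integral from the inversion formula at zero.
\<close>

lemma bump_kernel_decay:
 shows "\<exists>B. \<forall>t. (1 + \<bar>t\<bar>) ^ N * cmod (bump_kernel t) <= B"
  and "bump_kernel \<in> Borel"
  and "(LINT t|lborel. bump_kernel t) = 1"
proof -
 interpret lca "%_::1. Line" by unfold_locales simp
 let ?psi = "%xi::real^1. complex_of_real (bump (xi $ 1))"
 have sm: "smooth_fun ?psi" using smooth_fun_bump[of 1 1 0] by simp
 have "bounded {xi. ?psi xi ~= 0}"
 proof (rule boundedI)
  fix xi :: "real^1" assume "xi \<in> {xi. ?psi xi ~= 0}"
  then have "\<bar>xi $ 1\<bar> <= 1" using bump_eq_0[of "xi $ 1"] by fastforce
  then show "norm xi <= 1" using norm_le_l1_cart[of xi] by (simp add: sum_1)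
 qed
 then have psi: "?psi \<in> schwartz (%_. Line)" using sm by (intro dual_test_schwartz) (simp add: dual_test_functions_def)
 have osc: "osc dm (2 * pi * of_int (-1)) ?psi x = bump_kernel (x $ 1)" for x :: "real^1"
 proof -
  have e: "?psi xi * cis (2 * pi * of_int (-1) * (xi \<bullet> x)) = (\<Prod>i\<in>UNIV. complex_of_real (bump (xi $ i)) * cis ((- 2 * pi * x $ 1) * xi $ i))" for xi :: "real^1"
   by (simp add: inner_vec_def sum_1 UNIV_1 mult_ac)
  have i: "integrable (dual_factor Line) (%u. complex_of_real (bump u) * cis ((- 2 * pi * x $ 1) * u))" for i :: 1
   using integrable_bump[of "- 2 * pi * x $ 1"] by simp
  have "osc dm (2 * pi * of_int (-1)) ?psi x = (\<Prod>i\<in>(UNIV::1 set). LINT u|dual_factor Line. complex_of_real (bump u) * cis ((- 2 * pi * x $ 1) * u))"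
   unfolding osc_def e dual_measure_eq by (rule D.integral_vprod_prod[OF i])
  also have "... = bump_kernel (- (x $ 1))"
   by (simp add: UNIV_1 bump_kernel_def mult_ac)
  finally show ?thesis by (simp add: bump_kernel_minus)
 qed
 have S: "osc dm (2 * pi * of_int (-1)) ?psi \<in> schwartz (%_. Line)" by (rule schwartz_osc_dm[OF psi]) simp
 have vec: "vec t $ 1 = t" for t :: real by simp
 have nv: "norm (vec t :: real^1) = \<bar>t\<bar>" for t :: real by (simp add: norm_vec_def L2_set_def sum_1 UNIV_1)
 obtain B where "!!x. growth (%_. Line) x ^ N * cmod (iter_partial [] (osc dm (2 * pi * of_int (-1)) ?psi) x) <= B"
  by (rule schwartz_bound[OF S]) (rule that)
 then have "(1 + \<bar>t\<bar>) ^ N * cmod (bump_kernel t) <= B" for t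
  unfolding real_part_norm_lines iter_partial.simps osc by (metis nv vec)
 then show "\<exists>B. \<forall>t. (1 + \<bar>t\<bar>) ^ N * cmod (bump_kernel t) <= B" by blast
 have vm: "(vec :: real => real^1) \<in> borel \<rightarrow>\<^sub>M borel"
  by (intro borel_measurable_continuous_onI continuous_at_imp_continuous_on ballI linear_continuous_at linear_conv_bounded_linear[THEN iffD1] linearI) (simp_all add: vec_eq_iff)
 from measurable_compose[OF vm schwartz_measurable[OF S]]
 show km: "bump_kernel \<in> Borel" unfolding osc vec .
 have gm1: "gm = distr lborel borel (vec :: real => real^1)"
  unfolding gm_def
 proof (rule G.vprod_eqI[symmetric])
  fix A :: "1 => real set" assume A: "!!i. A i \<in> sets borel"
  have "{x::real^1. \<forall>i. x $ i \<in> A i} \<in> sets borel" using A by measurable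
  then show "emeasure (distr lborel borel (vec :: real => real^1)) {x. \<forall>i. x $ i \<in> A i} = (\<Prod>i\<in>UNIV. emeasure (group_factor Line) (A i))"
   by (subst emeasure_distr) (use vm in \<open>auto simp: UNIV_1 vimage_def\<close>)
 qed simp
 have "0 \<in> dual_lattice" by (simp add: dual_lattice_def)
 from dual_inversion[OF psi this]
 have "(LINT x|gm. bump_kernel (x $ 1)) = 1" unfolding osc by (simp add: torus_volume_def)
 moreover have "(LINT x|gm. bump_kernel (x $ 1)) = (LINT t|lborel. bump_kernel ((vec t :: real^1) $ 1))"
  unfolding gm1 by (rule integral_distr) (use vm km in measurable)
 ultimately show "(LINT t|lborel. bump_kernel t) = 1" by simp
qed

lemma bump_kernel_integrable: "integrable lborel (\<lambda>t. cmod (bump_kernel t) * (1 + \<bar>t\<bar>) ^ N)"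
proof -
 obtain B where B: "!!t. (1 + \<bar>t\<bar>) ^ (N + 2) * cmod (bump_kernel t) <= B" using bump_kernel_decay(1)[of "N + 2"] by blast
 note [measurable] = bump_kernel_decay(2)
 show ?thesis
 proof (rule integrable_bound)
  show "integrable lborel (%t::real. B * (1 + t\<^sup>2) powr (- 1))"
   by (intro integrable_mult_right integrable_weight_lborel) simp
  have "norm (cmod (bump_kernel t) * (1 + \<bar>t\<bar>) ^ N) <= norm (B * (1 + t\<^sup>2) powr (- 1))" for t
  proof -
   have p: "(0::real) < 1 + t\<^sup>2" by (simp add: add_pos_nonneg)
   have "(cmod (bump_kernel t) * (1 + \<bar>t\<bar>) ^ N) * (1 + t\<^sup>2) <= (cmod (bump_kernel t) * (1 + \<bar>t\<bar>) ^ N) * (1 + \<bar>t\<bar>)\<^sup>2"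
    by (intro mult_left_mono) (simp_all add: power2_eq_square algebra_simps)
   also have "... <= B" using B[of t] by (simp only: power_add mult_ac)
   finally have "cmod (bump_kernel t) * (1 + \<bar>t\<bar>) ^ N <= B / (1 + t\<^sup>2)" using p by (simp add: pos_le_divide_eq)
   moreover have "(1 + t\<^sup>2) powr (- 1) = 1 / (1 + t\<^sup>2)" using p by (simp add: powr_minus_divide)
   ultimately have "cmod (bump_kernel t) * (1 + \<bar>t\<bar>) ^ N <= B * (1 + t\<^sup>2) powr (- 1)" by simp
   then show ?thesis using abs_ge_self order_trans by fastforce
  qed
  then show "AE t in lborel. norm (cmod (bump_kernel t) * (1 + \<bar>t\<bar>) ^ N) <= norm (B * (1 + t\<^sup>2) powr (- 1))" by simp
 qed measurable
qed

definition kernel_weight :: "factor => nat => real => real" where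
 "kernel_weight f N t = (case f of Line => (1 + \<bar>t\<bar>) ^ N | Torus L => 1)"

definition kernel_dist :: "factor => real => real" where
 "kernel_dist f t = (case f of Line => \<bar>t\<bar> | Torus L => \<bar>sin (pi * t / L)\<bar>)"

definition factor_volume :: "factor => real" where
 "factor_volume f = (case f of Line => 1 | Torus L => L)"

text \<open>
 The real function \<open>q\<close> is a compactly supported multiplier on the dual factor and \<open>p\<close> is its
 inverse transform.
\<close>

definition multiplier_kernel :: "factor => 'n::finite => nat => real => real => (real => real) => (real => complex) => bool" where
 "multiplier_kernel f i N W eps q p \<longleftrightarrow>
  smooth_fun (\<lambda>x::real^'n. complex_of_real (q (x $ i))) \<and> (\<exists>R. \<forall>u. q u ~= 0 \<longrightarrow> \<bar>u\<bar> <= R) \<and>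
  (\<forall>t. integrable (dual_factor f) (\<lambda>u. complex_of_real (q u) * cis (2 * pi * u * t))) \<and>
  (\<forall>t. p t = (LINT u|dual_factor f. complex_of_real (q u) * cis (2 * pi * u * t))) \<and>
  integrable (group_factor f) p \<and> (LINT t|group_factor f. p t) = of_real (factor_volume f) \<and>
  integrable (group_factor f) (\<lambda>t. cmod (p t) * kernel_weight f N t) \<and>
  (LINT t|group_factor f. cmod (p t) * kernel_weight f N t) <= W \<and>
  integrable (group_factor f) (\<lambda>t. cmod (p t) * (kernel_weight f N t * kernel_dist f t)) \<and>
  (LINT t|group_factor f. cmod (p t) * (kernel_weight f N t * kernel_dist f t)) <= eps"

lemma line_multiplier_kernel:
 fixes i :: "'n::finite"
 shows "\<exists>W\<ge>0. \<forall>eps>0. \<exists>q p. multiplier_kernel Line i N W eps q p"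
proof -
 let ?w = "%t::real. (1 + \<bar>t\<bar>) ^ N"
 define W where "W = (LINT t|lborel. cmod (bump_kernel t) * ?w t)"
 define V where "V = (LINT t|lborel. cmod (bump_kernel t) * (?w t * \<bar>t\<bar>))"
 note [measurable] = bump_kernel_decay(2)
 have iW: "integrable lborel (%t. cmod (bump_kernel t) * ?w t)" by (rule bump_kernel_integrable)
 have iV: "integrable lborel (%t. cmod (bump_kernel t) * (?w t * \<bar>t\<bar>))"
 proof (rule integrable_bound[OF bump_kernel_integrable[of "Suc N"]])
  have "?w t * \<bar>t\<bar> <= (1 + \<bar>t\<bar>) ^ Suc N" for t :: real by (simp add: distrib_right)
  then have "cmod (bump_kernel t) * (?w t * \<bar>t\<bar>) <= cmod (bump_kernel t) * (1 + \<bar>t\<bar>) ^ Suc N" for t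
   by (intro mult_left_mono) auto
  then show "AE t in lborel. norm (cmod (bump_kernel t) * (?w t * \<bar>t\<bar>)) <= norm (cmod (bump_kernel t) * (1 + \<bar>t\<bar>) ^ Suc N)"
   by (simp add: abs_mult)
 qed measurable
 have ik: "integrable lborel bump_kernel"
  using bump_kernel_integrable[of 0] by (simp add: integrable_norm_iff)
 have "\<exists>q p. multiplier_kernel Line i N W eps q p" if eps: "eps > 0" for eps
 proof -
  define m where "m = 1 + V / eps"
  have V0: "V >= 0" unfolding V_def by simp
  have m: "m >= 1" "m > 0" using V0 eps by (simp_all add: m_def add_pos_nonneg)
  have Vm: "V / m <= eps"
  proof -
   have "V = (V / eps) * eps" using eps by simp
   also have "... <= m * eps" using eps by (intro mult_right_mono) (simp_all add: m_def)
   finally show ?thesis using m by (simp add: divide_le_eq mult.commute)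
  qed
  define q where "q u = bump (u / m)" for u
  define p where "p t = of_real m * bump_kernel (m * t)" for t
  have aff: "integrable lborel (%t. f (m * t))" "(LINT t|lborel. f (m * t)) = (LINT t|lborel. f t) / m"
   if "integrable lborel f" for f :: "real => real"
   using lborel_integrable_real_affine[OF that, of m 0] lborel_integral_real_affine[of m f 0] m by simp_all
  have mono: "?w t <= ?w (m * t)" for t
  proof -
   have "1 * \<bar>t\<bar> <= m * \<bar>t\<bar>" using m by (intro mult_right_mono) auto
   then show ?thesis using m by (intro power_mono) (auto simp: abs_mult)
  qed
  have b1: "cmod (p t) * ?w t <= m * (cmod (bump_kernel (m * t)) * ?w (m * t))" for t
   using m mono[of t] by (simp add: p_def norm_mult mult_left_mono mult.assoc)
  have b2: "cmod (p t) * (?w t * \<bar>t\<bar>) <= cmod (bump_kernel (m * t)) * (?w (m * t) * \<bar>m * t\<bar>)" for t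
  proof -
   have "cmod (p t) * (?w t * \<bar>t\<bar>) = cmod (bump_kernel (m * t)) * (?w t * \<bar>m * t\<bar>)"
    using m by (simp add: p_def norm_mult abs_mult mult_ac)
   also have "... <= cmod (bump_kernel (m * t)) * (?w (m * t) * \<bar>m * t\<bar>)"
    using mono[of t] by (intro mult_left_mono mult_right_mono) auto
   finally show ?thesis .
  qed
  have pm [measurable]: "p \<in> Borel" unfolding p_def by measurable
  have i1: "integrable lborel (%t. cmod (p t) * ?w t)"
   by (rule integrable_bound[OF integrable_mult_right[OF aff(1)[OF iW], of m]]) (use b1 m in \<open>auto simp: abs_mult\<close>)
  have i2: "integrable lborel (%t. cmod (p t) * (?w t * \<bar>t\<bar>))"
   by (rule integrable_bound[OF aff(1)[OF iV]]) (use b2 in \<open>auto simp: abs_mult\<close>)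
  have "(LINT t|lborel. cmod (p t) * ?w t) <= (LINT t|lborel. m * (cmod (bump_kernel (m * t)) * ?w (m * t)))"
   by (rule integral_mono[OF i1 integrable_mult_right[OF aff(1)[OF iW]] b1])
  also have "... = W" using aff(2)[OF iW] m by (simp add: W_def)
  finally have c1: "(LINT t|lborel. cmod (p t) * ?w t) <= W" .
  have "(LINT t|lborel. cmod (p t) * (?w t * \<bar>t\<bar>)) <= (LINT t|lborel. cmod (bump_kernel (m * t)) * (?w (m * t) * \<bar>m * t\<bar>))"
   by (rule integral_mono[OF i2 aff(1)[OF iV] b2])
  also have "... = V / m" using aff(2)[OF iV] by (simp add: V_def)
  finally have c2: "(LINT t|lborel. cmod (p t) * (?w t * \<bar>t\<bar>)) <= eps" using Vm by linarith
  have ip: "integrable lborel p" unfolding p_def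
   using lborel_integrable_real_affine[OF ik, of m 0] m by (intro integrable_mult_right) simp
  have "(LINT t|lborel. p t) = (LINT t|lborel. bump_kernel t)"
   using lborel_integral_real_affine[of m bump_kernel 0] m by (simp add: p_def scaleR_conv_of_real)
  then have lp: "(LINT t|lborel. p t) = 1" by (simp add: bump_kernel_decay(3))
  have sm: "smooth_fun (%x::real^'n. complex_of_real (q (x $ i)))"
   using smooth_fun_bump[of "1 / m" i 0] by (simp add: q_def)
  have R: "\<bar>u\<bar> <= m" if "q u ~= 0" for u
   using that bump_eq_0[of "u / m"] m by (cases "\<bar>u\<bar> <= m") (auto simp: q_def field_simps)
  have iq: "integrable lborel (%u. complex_of_real (q u) * cis (2 * pi * u * t))" for t
   using lborel_integrable_real_affine[OF integrable_bump[of "2 * pi * m * t"], of "1 / m" 0] m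
   by (simp add: q_def mult_ac)
  have pe: "p t = (LINT u|lborel. complex_of_real (q u) * cis (2 * pi * u * t))" for t
   using lborel_integral_real_affine[of m "%u. complex_of_real (q u) * cis (2 * pi * u * t)" 0] m
   by (simp add: p_def bump_kernel_def q_def scaleR_conv_of_real mult_ac)
  show ?thesis
   unfolding multiplier_kernel_def kernel_weight_def kernel_dist_def factor_volume_def factor.case factor_simps
   by (intro exI[of _ q] exI[of _ p] conjI allI sm iq pe ip i1 c1 i2 c2 exI[of _ m] impI R) (simp_all add: lp)
 qed
 moreover have "W >= 0" unfolding W_def by simp
 ultimately show ?thesis by blast
qed

lemma central_binomial_Suc:
 "real (2 * Suc m choose Suc m) * (real m + 1) = 2 * (2 * real m + 1) * real (2 * m choose m)"
proof -
 have a: "(2 * Suc m choose Suc m) * Suc m = Suc (Suc (2 * m)) * (Suc (2 * m) choose m)"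
  using Suc_times_binomial_eq[of "Suc (2 * m)" m] by simp
 have b: "(Suc (2 * m) choose Suc m) * Suc m = Suc (2 * m) * (2 * m choose m)"
  using Suc_times_binomial_eq[of "2 * m" m] by simp
 have c: "Suc (2 * m) choose m = Suc (2 * m) choose Suc m"
  using binomial_symmetric[of m "Suc (2 * m)"] by (simp add: Suc_diff_le)
 have "(2 * Suc m choose Suc m) * Suc m = (2 * (Suc (2 * m) choose Suc m)) * Suc m" unfolding a c by simp
 then have "(2 * Suc m choose Suc m) * Suc m = 2 * (Suc (2 * m) * (2 * m choose m))" unfolding b[symmetric] by simp
 then have "real ((2 * Suc m choose Suc m) * Suc m) = real (2 * (Suc (2 * m) * (2 * m choose m)))" by (rule arg_cong)
 then show ?thesis by (simp only: of_nat_mult of_nat_Suc of_nat_numeral) (simp add: algebra_simps)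
qed

text \<open>
 The factor makes the mean over a period equal to one: the constant Fourier coefficient of
 \<open>cos\<^sup>2\<^sup>m\<close> is \<open>(2 m choose m) / 4\<^sup>m\<close>.
\<close>

definition cos_kernel :: "real => nat => real => real" where
 "cos_kernel L m t = 4 ^ m / real (2 * m choose m) * cos (pi * t / L) ^ (2 * m)"

definition cos_kernel_coeff :: "nat => nat => real" where
 "cos_kernel_coeff m j = real (2 * m choose j) / real (2 * m choose m)"

lemma cos_kernel_expand:
 assumes L: "L > 0"
 shows "complex_of_real (cos_kernel L m t) = (\<Sum>j\<le>2 * m. of_real (cos_kernel_coeff m j) * cis (2 * pi * ((real j - real m) / L) * t))"
proof -
 let ?theta = "pi * t / L"
 have e: "2 * complex_of_real (cos ?theta) = cis ?theta + cis (- ?theta)" by (simp add: complex_eq_iff)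
 have "4 ^ m * complex_of_real (cos ?theta) ^ (2 * m) = (2 * complex_of_real (cos ?theta)) ^ (2 * m)"
  by (simp add: power_mult_distrib power_mult)
 also have "... = (cis ?theta + cis (- ?theta)) ^ (2 * m)" unfolding e ..
 also have "... = (\<Sum>j\<le>2 * m. of_nat (2 * m choose j) * cis ?theta ^ j * cis (- ?theta) ^ (2 * m - j))" by (rule binomial_ring)
 also have "... = (\<Sum>j\<le>2 * m. of_nat (2 * m choose j) * cis (2 * pi * ((real j - real m) / L) * t))"
 proof (rule sum.cong[OF refl])
  fix j assume "j \<in> {..2 * m}"
  then have "real j * ?theta + real (2 * m - j) * (- ?theta) = 2 * pi * ((real j - real m) / L) * t"
   using L by (simp add: field_simps of_nat_diff)
  then show "of_nat (2 * m choose j) * cis ?theta ^ j * cis (- ?theta) ^ (2 * m - j) = of_nat (2 * m choose j) * cis (2 * pi * ((real j - real m) / L) * t)"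
   unfolding Complex.DeMoivre mult.assoc cis_mult by simp
 qed
 finally have "complex_of_real (cos_kernel L m t) = (\<Sum>j\<le>2 * m. of_nat (2 * m choose j) * cis (2 * pi * ((real j - real m) / L) * t)) / of_nat (2 * m choose m)"
  by (simp add: cos_kernel_def)
 also have "... = (\<Sum>j\<le>2 * m. of_real (cos_kernel_coeff m j) * cis (2 * pi * ((real j - real m) / L) * t))"
  by (simp add: sum_divide_distrib cos_kernel_coeff_def)
 finally show ?thesis .
qed

lemma integrable_torus_bounded:
 fixes f :: "real => 'b::{banach,second_countable_topology}"
 assumes f [measurable]: "f \<in> Borel" and B: "!!t. norm (f t) <= B"
 shows "integrable (group_factor (Torus L)) f"
proof -
 interpret finite_measure "group_factor (Torus L)"
  by (rule finite_measureI) (cases "0 <= L"; simp add: emeasure_density)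
 show ?thesis by (rule integrable_const_bound[of _ B]) (use B in auto)
qed

lemma cos_kernel_integral:
 assumes L: "L > 0"
 shows "integrable (group_factor (Torus L)) (cos_kernel L m)" "(LINT t|group_factor (Torus L). cos_kernel L m t) = L"
proof -
 have b: "\<bar>cos_kernel L m t\<bar> <= 4 ^ m / real (2 * m choose m)" for t
  unfolding cos_kernel_def abs_mult by (rule mult_right_le_one_le[THEN order_trans]) (auto simp: power_abs intro!: power_le_one)
 have [measurable]: "cos_kernel L m \<in> Borel" unfolding cos_kernel_def by measurable
 show "integrable (group_factor (Torus L)) (cos_kernel L m)" by (rule integrable_torus_bounded) (use b in auto)
 have ic: "integrable (group_factor (Torus L)) (%t. cis (a * t))" for a
  by (rule integrable_torus_bounded[where B = 1]) auto
 have lat: "(real j - real m) / L \<in> lattice L" "0 \<in> lattice L" for j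
  unfolding lattice_def by (rule range_eqI[of _ _ "int j - int m"], simp, rule range_eqI[of _ _ 0], simp)
 have "complex_of_real (LINT t|group_factor (Torus L). cos_kernel L m t) = (LINT t|group_factor (Torus L). complex_of_real (cos_kernel L m t))"
  by simp
 also have "... = (\<Sum>j\<le>2 * m. of_real (cos_kernel_coeff m j) * (LINT t|group_factor (Torus L). cis (2 * pi * ((real j - real m) / L) * t)))"
  unfolding cos_kernel_expand[OF L] Bochner_Integration.integral_sum[OF integrable_mult_right[OF ic]] by (simp del: factor_simps)
 also have "... = (\<Sum>j\<le>2 * m. if j = m then of_real L else 0)"
 proof (rule sum.cong[OF refl])
  fix j
  have "(LINT t|group_factor (Torus L). cis (2 * pi * ((real j - real m) / L) * t)) = (if (real j - real m) / L = 0 then of_real L else 0)"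
   using torus_character_integral[OF L lat(1)[of j] lat(2)] by simp
  then show "of_real (cos_kernel_coeff m j) * (LINT t|group_factor (Torus L). cis (2 * pi * ((real j - real m) / L) * t)) = (if j = m then of_real L else 0)"
   using L by (simp add: cos_kernel_coeff_def)
 qed
 also have "... = of_real L" by simp
 finally show "(LINT t|group_factor (Torus L). cos_kernel L m t) = L" by (simp only: of_real_eq_iff)
qed

text \<open>
 Since \<open>cos\<^sup>2 = 1 - sin\<^sup>2\<close>, the integral of \<open>sin\<^sup>2\<close> against the kernel is a ratio of consecutive
 normalising factors and equals \<open>L / (2 m + 2)\<close>. The kernel is a trigonometric polynomial, so
 its coefficients are interpolated by finitely many bumps, each of which vanishes at all lattice points but one.
\<close>

lemma torus_multiplier_kernel:
 fixes i :: "'n::finite"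
 assumes L: "L > 0"
 shows "\<exists>W\<ge>0. \<forall>eps>0. \<exists>q p. multiplier_kernel (Torus L) i N W eps q p"
proof -
 let ?G = "group_factor (Torus L)"
 have "\<exists>q p. multiplier_kernel (Torus L) i N L eps q p" if eps: "eps > 0" for eps
 proof -
  define delta where "delta = eps / (2 * L)"
  have delta: "delta > 0" using eps L by (simp add: delta_def)
  obtain m :: nat where m: "L / delta * (2 / eps) < real m" using reals_Archimedean2 by blast
  have m2: "L / (2 * real m + 2) / delta <= eps / 2"
  proof -
   have "L / delta = eps / 2 * (L / delta * (2 / eps))" using eps by simp
   also have "... <= eps / 2 * real m" using m eps by (intro mult_left_mono) auto
   finally have "L / delta <= eps / 2 * real m" .
   also have "... <= eps / 2 * (2 * real m + 2)" using eps by (intro mult_left_mono) auto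
   finally have "L / delta / (2 * real m + 2) <= eps / 2" by (subst pos_divide_le_eq) auto
   then show ?thesis by (simp add: mult.commute)
  qed
  let ?P = "cos_kernel L m"
  let ?s = "%t. \<bar>sin (pi * t / L)\<bar>"
  have P0: "?P t >= 0" for t by (simp add: cos_kernel_def power_mult)
  have iP: "integrable ?G (cos_kernel L k)" for k by (rule cos_kernel_integral(1)[OF L])
  let ?a = "(2 * real m + 1) / (2 * real m + 2)"
  have rec: "?P t * (?s t)\<^sup>2 = ?P t - ?a * cos_kernel L (Suc m) t" for t
  proof -
   let ?c = "cos (pi * t / L)"
   have b: "real (2 * Suc m choose Suc m) = 2 * (2 * real m + 1) * real (2 * m choose m) / (real m + 1)"
    using central_binomial_Suc[of m] by (simp add: eq_divide_eq)
   have "?a * cos_kernel L (Suc m) t = ?a * (4 * 4 ^ m / real (2 * Suc m choose Suc m) * (?c ^ (2 * m) * ?c\<^sup>2))"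
    by (simp add: cos_kernel_def power_add[symmetric])
   also have "... = ?P t * ?c\<^sup>2"
    unfolding b cos_kernel_def by (simp add: divide_simps) (simp add: algebra_simps)
   finally have e: "?a * cos_kernel L (Suc m) t = ?P t * ?c\<^sup>2" .
   show ?thesis unfolding e by (simp add: sin_squared_eq right_diff_distrib)
  qed
  have i2: "integrable ?G (%t. ?P t * (?s t)\<^sup>2)" and l2: "(LINT t|?G. ?P t * (?s t)\<^sup>2) = L / (2 * real m + 2)"
  proof -
   show "integrable ?G (%t. ?P t * (?s t)\<^sup>2)" unfolding rec
    by (intro Bochner_Integration.integrable_diff integrable_mult_right iP)
   have "(LINT t|?G. ?P t * (?s t)\<^sup>2) = L - ?a * L" unfolding rec
    by (subst Bochner_Integration.integral_diff) (use iP cos_kernel_integral(2)[OF L] in simp_all)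
   also have "... = L / (2 * real m + 2)" by (simp add: divide_simps) (simp add: algebra_simps)
   finally show "(LINT t|?G. ?P t * (?s t)\<^sup>2) = L / (2 * real m + 2)" .
  qed
  have [measurable]: "?P \<in> Borel" unfolding cos_kernel_def by measurable
  have bd: "?P t * ?s t <= delta * ?P t + ?P t * (?s t)\<^sup>2 / delta" for t
  proof -
   (* this trades the first absolute moment for the second moment, with delta balancing the two terms *)
   have bnd: "r <= delta + r\<^sup>2 / delta" if "r >= 0" for r
   proof -
    have "r * delta <= delta\<^sup>2 + r\<^sup>2" using sum_squares_bound[of r delta] mult_nonneg_nonneg[OF that less_imp_le[OF delta]] by linarith
    then show ?thesis using delta by (simp add: power2_eq_square divide_simps)
   qed
   have "?s t <= delta + (?s t)\<^sup>2 / delta" by (rule bnd[OF abs_ge_zero])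
   from mult_left_mono[OF this P0[of t]] show ?thesis by (simp add: algebra_simps)
  qed
  have iB: "integrable ?G (%t. delta * ?P t + ?P t * (?s t)\<^sup>2 / delta)"
   by (intro Bochner_Integration.integrable_add integrable_mult_right iP integrable_divide_zero i2)
  have i1: "integrable ?G (%t. ?P t * ?s t)"
   by (rule integrable_bound[OF iB]) (use bd P0 delta in \<open>auto simp: abs_mult intro!: order_trans[OF bd abs_ge_self]\<close>)
  have "(LINT t|?G. ?P t * ?s t) <= (LINT t|?G. delta * ?P t + ?P t * (?s t)\<^sup>2 / delta)" by (rule integral_mono[OF i1 iB bd])
  also have "... = delta * L + L / (2 * real m + 2) / delta"
   using iP i2 by (subst Bochner_Integration.integral_add) (simp_all add: cos_kernel_integral(2)[OF L] l2[unfolded power2_abs] del: factor_simps)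
  also have "... <= eps" using m2 L by (simp add: delta_def)
  finally have c2: "(LINT t|?G. ?P t * ?s t) <= eps" .
  define q where "q u = (\<Sum>j\<le>2 * m. cos_kernel_coeff m j * bump (L * u + (real m - real j)))" for u
  have qm [measurable]: "q \<in> Borel" unfolding q_def by measurable
  have sm: "smooth_fun (%x::real^'n. complex_of_real (q (x $ i)))"
   unfolding q_def of_real_sum of_real_mult
   by (intro smooth_fun_sum smooth_fun_mult smooth_fun_const smooth_fun_bump) simp
  have R: "\<bar>u\<bar> <= (3 * real m + 1) / L" if "q u ~= 0" for u
  proof -
   from that obtain j where j: "j <= 2 * m" "bump (L * u + (real m - real j)) ~= 0"
    unfolding q_def by (metis (mono_tags, lifting) atMost_iff mult_zero_right sum.neutral)
   then have "\<bar>L * u + (real m - real j)\<bar> <= 1" using bump_eq_0 by (meson linorder_le_cases)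
   moreover have "\<bar>real m - real j\<bar> <= 3 * real m" using j(1) by linarith
   ultimately have "\<bar>L * u\<bar> <= 3 * real m + 1" by linarith
   then show ?thesis using L by (simp add: abs_mult pos_le_divide_eq mult.commute)
  qed
  have ql: "q (of_int k / L) = (\<Sum>j\<le>2 * m. if int j = k + int m then cos_kernel_coeff m j else 0)" for k
   unfolding q_def
  proof (rule sum.cong[OF refl])
   fix j
   show "cos_kernel_coeff m j * bump (L * (of_int k / L) + (real m - real j)) = (if int j = k + int m then cos_kernel_coeff m j else 0)"
   proof (cases "int j = k + int m")
    case True
    then have "real j = real_of_int k + real m" by (metis of_int_add of_int_of_nat_eq)
    then have "L * (of_int k / L) + (real m - real j) = 0" using L by simp
    then show ?thesis using True by (simp only: bump_0 if_True simp_thms mult_1_right)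
   next
    case False
    then have "1 <= \<bar>k + int m - int j\<bar>" by linarith
    then have "1 <= \<bar>real_of_int (k + int m - int j)\<bar>" by linarith
    then have "1 <= \<bar>L * (of_int k / L) + (real m - real j)\<bar>" using L by (simp add: algebra_simps)
    then show ?thesis using False bump_eq_0 by simp
   qed
  qed
  let ?x = "%j::nat. (real j - real m) / L"
  have xl: "?x j = of_int (int j - int m) / L" for j by simp
  let ?S = "?x ` {..2 * m}"
  have S: "finite ?S" "?S \<subseteq> lattice L" by (auto simp: lattice_def xl simp del: of_int_diff)
  have inj: "inj_on ?x {..2 * m}" using L by (auto intro!: inj_onI)
  have qS: "q (?x j) = cos_kernel_coeff m j" if "j <= 2 * m" for j
   unfolding xl ql using that by (simp add: sum.delta)
  have qz: "q u = 0" if u: "u \<in> lattice L" "u \<notin> ?S" for u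
  proof -
   obtain k where k: "u = of_int k / L" using u(1) by (auto simp: lattice_def)
   have "int j ~= k + int m" if "j <= 2 * m" for j
   proof
    assume "int j = k + int m"
    then have "u = ?x j" unfolding k xl by simp
    then show False using u(2) that by auto
   qed
   then show ?thesis unfolding k ql by (intro sum.neutral) auto
  qed
  have fin: "integrable (dual_factor (Torus L)) (%u. complex_of_real (q u) * cis (2 * pi * u * t))"
   "(LINT u|dual_factor (Torus L). complex_of_real (q u) * cis (2 * pi * u * t)) = (\<Sum>u\<in>?S. complex_of_real (q u) * cis (2 * pi * u * t))" for t
   by (rule integral_dual_torus_finite[OF _ S]; use qz in simp)+
  have pe: "complex_of_real (?P t) = (LINT u|dual_factor (Torus L). complex_of_real (q u) * cis (2 * pi * u * t))" for t
   unfolding fin(2) cos_kernel_expand[OF L] sum.reindex[OF inj] by (rule sum.cong[OF refl]) (simp add: qS)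
  have "multiplier_kernel (Torus L) i N L eps q (%t. complex_of_real (?P t))"
   unfolding multiplier_kernel_def kernel_weight_def kernel_dist_def factor_volume_def factor.case
   using iP i1 c2 P0 cos_kernel_integral(2)[OF L]
   by (intro conjI allI sm fin(1) pe exI[of _ "(3 * real m + 1) / L"] impI R) (simp_all add: abs_of_nonneg)
  then show ?thesis by blast
 qed
 then show ?thesis using L less_imp_le by blast
qed

lemma multiplier_kernel_exists:
 fixes i :: "'n::finite"
 assumes "!!L. f = Torus L ==> L > 0"
 shows "\<exists>W\<ge>0. \<forall>eps>0. \<exists>q p. multiplier_kernel f i N W eps q p"
 using assms line_multiplier_kernel torus_multiplier_kernel by (cases f) auto

section \<open>Density of the transforms of test functions\<close>

lemma multiplier_kernelD:
 assumes "multiplier_kernel f (i :: 'n::finite) N W eps q p"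
 shows "smooth_fun (\<lambda>x::real^'n. complex_of_real (q (x $ i)))" "\<exists>R. \<forall>u. q u ~= 0 \<longrightarrow> \<bar>u\<bar> <= R"
  "integrable (dual_factor f) (\<lambda>u. complex_of_real (q u) * cis (2 * pi * u * t))"
  "(LINT u|dual_factor f. complex_of_real (q u) * cis (2 * pi * u * t)) = p t"
  "integrable (group_factor f) p" "(LINT t|group_factor f. p t) = of_real (factor_volume f)"
  "integrable (group_factor f) (\<lambda>t. cmod (p t) * kernel_weight f N t)"
  "(LINT t|group_factor f. cmod (p t) * kernel_weight f N t) <= W"
  "integrable (group_factor f) (\<lambda>t. cmod (p t) * (kernel_weight f N t * kernel_dist f t))"
  "(LINT t|group_factor f. cmod (p t) * (kernel_weight f N t * kernel_dist f t)) <= eps"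
 by (insert assms, unfold multiplier_kernel_def, (elim conjE, (assumption | erule spec | (rule sym, erule spec)))+)

context lca
begin

lemma periodic_translate:
 assumes "periodic_on \<Gamma> h"
 shows "periodic_on \<Gamma> (\<lambda>z. h (z + a))"
 unfolding periodic_on_def
proof (intro allI impI)
 fix i L x assume "\<Gamma> i = Torus L"
 then have "h ((x + a) + axis i L) = h (x + a)" using assms unfolding periodic_on_def by blast
 moreover have "(x + a) + axis i L = x + axis i L + a" by (simp only: add_ac)
 ultimately show "h (x + axis i L + a) = h (x + a)" by (simp only:)
qed

lemma gm_translate_axis:
 fixes h :: "real ^ 'n => complex"
 assumes h [measurable]: "h \<in> Borel" and per: "periodic_on \<Gamma> h"
 shows "(LINT z|gm. h (z + t *\<^sub>R axis j 1)) = (LINT z|gm. h z)"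
proof -
 have m [measurable]: "(%z. h (z + a)) \<in> Borel" for a by measurable
 have p: "periodic_on \<Gamma> (%z. h (z + a))" for a by (rule periodic_translate[OF per])
 show ?thesis
 proof (cases "\<Gamma> j")
  case Line
  then have l: "!!L. \<Gamma> j = Torus L ==> r < L" for r :: real by simp
  consider "t > 0" | "t = 0" | "- t > 0" by linarith
  then show ?thesis
  proof cases
   case 1
   then show ?thesis using gm_translate[OF h per _ l] by simp
  next
   case 3
   have "(LINT z|gm. h (z + (- t) *\<^sub>R axis j 1 + t *\<^sub>R axis j 1)) = (LINT z|gm. h (z + t *\<^sub>R axis j 1))"
    by (rule gm_translate[OF m p 3 l])
   then show ?thesis by simp
  qed simp
 next
  case (Torus L)
  have L: "L > 0" by (rule pos[OF Torus])
  define k where "k = \<lfloor>t / L\<rfloor>"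
  define r where "r = t - of_int k * L"
  have r: "0 <= r" "r < L"
   using floor_divide_lower[OF L, of t] floor_divide_upper[OF L, of t] by (simp_all add: r_def k_def algebra_simps)
  have "h (z + t *\<^sub>R axis j 1) = h (z + r *\<^sub>R axis j 1)" for z
  proof -
   have e: "(z + t *\<^sub>R axis j 1) = (z + r *\<^sub>R axis j 1) + (\<chi> i. case \<Gamma> i of Line => 0 | Torus L => of_int (if i = j then k else 0) * L)"
    using Torus by (auto simp: vec_eq_iff axis_def r_def algebra_simps split: factor.split)
   show ?thesis unfolding e by (rule periodic_shift_multi[OF per])
  qed
  then have e: "(LINT z|gm. h (z + t *\<^sub>R axis j 1)) = (LINT z|gm. h (z + r *\<^sub>R axis j 1))" by simp
  show ?thesis
  proof (cases "r = 0")
   case False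
   then have "0 < r" using r by simp
   then show ?thesis unfolding e by (rule gm_translate[OF h per]) (use Torus r in simp)
  qed (use e in simp)
 qed
qed

lemma gm_translate_vec:
 fixes h :: "real ^ 'n => complex"
 assumes h: "h \<in> Borel" and per: "periodic_on \<Gamma> h"
 shows "(LINT z|gm. h (z + x)) = (LINT z|gm. h z)"
proof -
 have m: "(%z. h (z + a)) \<in> Borel" for a using h by measurable
 have p: "periodic_on \<Gamma> (%z. h (z + a))" for a by (rule periodic_translate[OF per])
 have "(LINT z|gm. h (z + (\<Sum>i\<in>I. (x $ i) *\<^sub>R (axis i 1 :: real ^ 'n)))) = (LINT z|gm. h z)" if "finite I" for I
  using that
 proof (induction I rule: finite_induct)
  case (insert i I)
  have "(LINT z|gm. h (z + (x $ i) *\<^sub>R axis i 1 + (\<Sum>i\<in>I. (x $ i) *\<^sub>R axis i 1))) = (LINT z|gm. h (z + (\<Sum>i\<in>I. (x $ i) *\<^sub>R axis i 1)))"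
   by (rule gm_translate_axis[OF m p])
  then show ?case using insert by (simp add: add.assoc)
 qed simp
 moreover have "(\<Sum>i\<in>UNIV. (x $ i) *\<^sub>R (axis i 1 :: real ^ 'n)) = x" by (simp add: vec_eq_iff axis_def if_distrib cong: if_cong)
 ultimately show ?thesis using finite_class.finite_UNIV by metis
qed

text \<open>Multiplying the transform of \<open>phi\<close> by a product multiplier amounts to averaging the translates of
 \<open>phi\<close> against the product of the kernels.\<close>

lemma multiplier_average:
 assumes phi: "phi \<in> schwartz \<Gamma>" and qp: "!!i. multiplier_kernel (\<Gamma> i) i N (W i) eps (q i) (p i)"
 shows "osc dm (2 * pi * of_int (-1)) (\<lambda>xi. of_real (\<Prod>i\<in>UNIV. q i (xi $ i)) * osc gm (2 * pi * of_int 1) phi xi) x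
  = (LINT z|gm. phi (z + x) * (\<Prod>i\<in>UNIV. p i (z $ i)))"
  and "integrable gm (\<lambda>z. phi (z + x) * (\<Prod>i\<in>UNIV. p i (z $ i)))"
proof -
 let ?X = "%xi::real^'n. complex_of_real (\<Prod>i\<in>UNIV. q i (xi $ i))"
 define K where "K z = (\<Prod>i\<in>UNIV. p i (z $ i))" for z :: "real ^ 'n"
 have iX: "integrable dm (%xi. ?X xi * cis (2 * pi * (xi \<bullet> z)))" and K: "osc dm (2 * pi * of_int 1) ?X z = K z" for z
 proof -
  have e: "?X xi * cis (2 * pi * (xi \<bullet> z)) = (\<Prod>i\<in>UNIV. complex_of_real (q i (xi $ i)) * cis (2 * pi * xi $ i * z $ i))" for xi
   by (simp add: cis_prod prod.distrib)
  have i: "integrable (dual_factor (\<Gamma> i)) (%u. complex_of_real (q i u) * cis (2 * pi * u * z $ i))" for i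
   by (rule multiplier_kernelD[OF qp])
  show "integrable dm (%xi. ?X xi * cis (2 * pi * (xi \<bullet> z)))"
   unfolding e dual_measure_eq by (rule D.integrable_vprod_prod[OF i])
  have "osc dm (2 * pi * of_int 1) ?X z = (\<Prod>i\<in>UNIV. LINT u|dual_factor (\<Gamma> i). complex_of_real (q i u) * cis (2 * pi * u * z $ i))"
   unfolding osc_def of_int_1 mult_1_right e dual_measure_eq by (rule D.integral_vprod_prod[OF i])
  also have "... = K z" unfolding K_def multiplier_kernelD(4)[OF qp] ..
  finally show "osc dm (2 * pi * of_int 1) ?X z = K z" .
 qed
 have iphi: "integrable gm phi" using integrable_gm_schwartz[OF phi, of 0] by simp
 have ib: "integrable dm (%xi. ?X xi * cis (2 * pi * of_int (-1) * (xi \<bullet> x)))"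
  using iX[of "- x"] by simp
 have km: "(%(z, xi). cis (2 * pi * (xi \<bullet> z))) \<in> borel_measurable (gm \<Otimes>\<^sub>M dm)"
  using cis_pair_measurable by measurable
 have shift: "(LINT xi|dm. (?X xi * cis (2 * pi * of_int (-1) * (xi \<bullet> x))) * cis (2 * pi * (xi \<bullet> z))) = K (z - x)" for z
  unfolding K[symmetric] osc_def by (simp add: inner_diff_right cis_mult mult.assoc algebra_simps)
 note fub = fubini_bounded_kernel[OF sigma_finite_gm sigma_finite_dm iphi ib km, of 1, simplified norm_cis, OF order_refl]
 have Km: "K \<in> Borel"
 proof -
  have "integrable (group_factor (\<Gamma> i)) (p i)" for i by (rule multiplier_kernelD[OF qp])
  from borel_measurable_integrable[OF this] have [measurable]: "p i \<in> Borel" for i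
   by (simp cong: measurable_cong_sets)
  show ?thesis unfolding K_def by measurable
 qed
 have Kp: "periodic_on \<Gamma> K" using osc_periodic[of 1 ?X] unfolding K .
 have per: "periodic_on \<Gamma> (%z. phi z * K (z - x))"
  using Kp schwartz_periodic[OF phi] by (simp add: periodic_on_def) (metis add_diff_eq diff_add_eq)
 note [measurable] = Km schwartz_measurable[OF phi]
 have "osc dm (2 * pi * of_int (-1)) (%xi. ?X xi * osc gm (2 * pi * of_int 1) phi xi) x
   = (LINT xi|dm. (?X xi * cis (2 * pi * of_int (-1) * (xi \<bullet> x))) * (LINT z|gm. phi z * cis (2 * pi * (xi \<bullet> z))))"
  unfolding osc_def by (simp add: mult_ac inner_commute)
 also have "... = (LINT z|gm. phi z * K (z - x))" using fub(1) unfolding shift by simp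
 also have "... = (LINT z|gm. phi (z + x) * K (z + x - x))"
  by (rule gm_translate_vec[OF _ per, symmetric]) measurable
 finally show "osc dm (2 * pi * of_int (-1)) (%xi. ?X xi * osc gm (2 * pi * of_int 1) phi xi) x
  = (LINT z|gm. phi (z + x) * (\<Prod>i\<in>UNIV. p i (z $ i)))" by (simp add: K_def)
 obtain B where B: "!!y. cmod (phi y) <= B" using schwartz_bound[OF phi, of 0 "[]"] by auto
 have iK: "integrable gm K"
  unfolding K_def gm_def by (rule G.integrable_vprod_prod) (rule multiplier_kernelD[OF qp])
 show "integrable gm (%z. phi (z + x) * (\<Prod>i\<in>UNIV. p i (z $ i)))"
  unfolding K_def[symmetric]
 proof (rule integrable_bound[OF integrable_mult_right[OF integrable_norm[OF iK], of B]])
  show "AE z in gm. norm (phi (z + x) * K z) <= norm (B * cmod (K z))"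
   using order_trans[OF B abs_ge_self] by (intro AE_I2) (simp add: norm_mult abs_mult mult_right_mono)
 qed measurable
qed

lemma sin_pi_ge:
 assumes r: "0 <= r" "r <= (1 / 2 :: real)"
 shows "r <= sin (pi * r)"
proof (cases "r <= 1 / 6")
 case True
 have "sin (pi * 0) - 0 <= sin (pi * r) - r"
 proof (rule DERIV_nonneg_imp_nondecreasing[OF r(1)])
  fix x assume x: "0 <= x" "x <= r"
  have "cos (pi / 3) <= cos (pi * x)" using x True by (intro cos_monotone_0_pi_le) auto
  then have "1 / 2 <= cos (pi * x)" by (simp add: cos_60)
  then have "pi * (1 / 2) <= pi * cos (pi * x)" by (intro mult_left_mono) auto
  then have "0 <= pi * cos (pi * x) - 1" using pi_gt3 by linarith
  moreover have "((%x. sin (pi * x) - x) has_real_derivative pi * cos (pi * x) - 1) (at x)"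
   by (auto intro!: derivative_eq_intros)
  ultimately show "\<exists>y. ((%x. sin (pi * x) - x) has_real_derivative y) (at x) \<and> 0 <= y" by blast
 qed
 then show ?thesis by simp
next
 case False
 have "sin (pi / 6) <= sin (pi * r)" using False r by (intro sin_monotone_2pi_le) auto
 then show ?thesis using r by (simp add: sin_30)
qed

text \<open>
 Subtraction of the nearest multiple of \<open>L\<close>.
\<close>

lemma wrap_torus:
 assumes L: "L > (0::real)"
 shows "\<bar>t - of_int \<lfloor>t / L + 1 / 2\<rfloor> * L\<bar> <= L * \<bar>sin (pi * t / L)\<bar>"
proof -
 define k where "k = \<lfloor>t / L + 1 / 2\<rfloor>"
 define r where "r = t / L - of_int k"
 have r: "\<bar>r\<bar> <= 1 / 2" unfolding r_def k_def by linarith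
 have rt: "t - of_int k * L = L * r" using L by (simp add: r_def right_diff_distrib)
 have "pi * t / L = pi * r + pi * of_int k" by (simp add: r_def algebra_simps)
 then have "\<bar>sin (pi * t / L)\<bar> = \<bar>sin (pi * r)\<bar>"
  by (simp add: sin_add abs_mult cos_npi_int)
 also have "... = sin (pi * \<bar>r\<bar>)"
 proof -
  have "0 <= sin (pi * \<bar>r\<bar>)" using r by (intro sin_ge_zero) (simp_all add: mult_le_cancel_left1)
  then show ?thesis by (cases "r >= 0") auto
 qed
 finally have 1: "\<bar>sin (pi * t / L)\<bar> = sin (pi * \<bar>r\<bar>)" .
 have "\<bar>r\<bar> <= sin (pi * \<bar>r\<bar>)" by (rule sin_pi_ge) (use r in auto)
 then show ?thesis unfolding k_def[symmetric] rt 1 using L by (simp add: abs_mult)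
qed

text \<open>The weighted mean value inequality on the group: distances on a torus are measured by the sine.\<close>

lemma schwartz_translate_bound:
 assumes phi: "phi \<in> schwartz \<Gamma>"
 shows "\<exists>B\<ge>0. \<forall>x z. growth \<Gamma> x ^ N * cmod (phi (z + x) - phi x)
  <= B * (\<Prod>i\<in>UNIV. kernel_weight (\<Gamma> i) N (z $ i)) * (\<Sum>i\<in>UNIV. kernel_dist (\<Gamma> i) (z $ i))"
proof -
 have "\<exists>B>0. \<forall>x. growth \<Gamma> x ^ N * cmod (partial_deriv i phi x) <= B" for i
  using schwartz_bound[OF phi, of N "[i]"] by simp metis
 then obtain b where b: "!!i. b i > 0" "!!i x. growth \<Gamma> x ^ N * cmod (partial_deriv i phi x) <= b i" by metis
 define C where "C = (\<Sum>i\<in>UNIV. b i)"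
 have C: "b i <= C" for i unfolding C_def using b(1) by (intro member_le_sum) (auto intro: less_imp_le)
 have C0: "0 <= C" using C b(1) less_imp_le order_trans by blast
 define \<Lambda> where "\<Lambda> = 1 + (\<Sum>i\<in>UNIV. \<bar>factor_volume (\<Gamma> i)\<bar>)"
 have "\<bar>factor_volume (\<Gamma> i)\<bar> <= (\<Sum>i\<in>UNIV. \<bar>factor_volume (\<Gamma> i)\<bar>)" for i by (rule member_le_sum) auto
 then have \<Lambda>: "\<bar>factor_volume (\<Gamma> i)\<bar> <= \<Lambda>" "1 <= \<Lambda>" for i
  unfolding \<Lambda>_def by (simp_all add: add_increasing sum_nonneg)
 have "growth \<Gamma> x ^ N * cmod (phi (z + x) - phi x)
  <= (C * \<Lambda>) * (\<Prod>i\<in>UNIV. kernel_weight (\<Gamma> i) N (z $ i)) * (\<Sum>i\<in>UNIV. kernel_dist (\<Gamma> i) (z $ i))" for x z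
 proof -
  (* v is z with its toroidal coordinates moved next to zero by periods *)
  define k where "k i = (case \<Gamma> i of Line => 0 | Torus L => - \<lfloor>z $ i / L + 1 / 2\<rfloor>)" for i
  define v where "v = z + (\<chi> i. case \<Gamma> i of Line => 0 | Torus L => of_int (k i) * L)"
  have phiv: "phi (z + x) = phi (x + v)"
   using periodic_shift_multi[OF schwartz_periodic[OF phi], of "z + x" k] by (simp add: v_def add_ac)
  have vd: "\<bar>v $ i\<bar> <= \<Lambda> * kernel_dist (\<Gamma> i) (z $ i)" for i
  proof (cases "\<Gamma> i")
   case Line
   then show ?thesis using \<Lambda>(2) by (simp add: v_def kernel_dist_def mult_le_cancel_right1)
  next
   case (Torus L)
   have "\<bar>v $ i\<bar> <= L * \<bar>sin (pi * z $ i / L)\<bar>" using wrap_torus[OF pos[OF Torus], of "z $ i"] Torus by (simp add: v_def k_def)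
   also have "... <= \<Lambda> * \<bar>sin (pi * z $ i / L)\<bar>" using \<Lambda>(1)[of i] Torus by (intro mult_right_mono) (auto simp: factor_volume_def)
   finally show ?thesis using Torus by (simp add: kernel_dist_def)
  qed
  let ?w = "\<Prod>i\<in>UNIV. kernel_weight (\<Gamma> i) N (z $ i)"
  have rw: "growth \<Gamma> v ^ N <= ?w"
  proof -
   let ?a = "%i. if \<Gamma> i = Line then \<bar>z $ i\<bar> else 0"
   have "real_part_norm \<Gamma> v <= (\<Sum>i\<in>UNIV. \<bar>(\<chi> i. if \<Gamma> i = Line then v $ i else 0) $ i\<bar>)"
    unfolding real_part_norm_def by (rule norm_le_l1_cart)
   also have "... = (\<Sum>i\<in>UNIV. ?a i)" by (intro sum.cong) (auto simp: v_def)
   finally have "1 + real_part_norm \<Gamma> v <= 1 + (\<Sum>i\<in>UNIV. ?a i)" by simp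
   also have "... <= (\<Prod>i\<in>UNIV. 1 + ?a i)"
   proof -
    have "1 + (\<Sum>i\<in>I. ?a i) <= (\<Prod>i\<in>I. 1 + ?a i)" if "finite I" for I using that
    proof (induction I rule: finite_induct)
     case (insert i I)
     have "1 <= (\<Prod>i\<in>I. 1 + ?a i)" by (rule prod_ge_1) simp
     then have "1 + (\<Sum>i\<in>I. ?a i) + ?a i * 1 <= (\<Prod>i\<in>I. 1 + ?a i) + ?a i * (\<Prod>i\<in>I. 1 + ?a i)"
      by (intro add_mono insert.IH mult_left_mono) auto
     then show ?case using insert.hyps by (simp add: distrib_right)
    qed simp
    then show ?thesis by simp
   qed
   finally have "growth \<Gamma> v ^ N <= (\<Prod>i\<in>UNIV. 1 + ?a i) ^ N" by (rule power_mono) simp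
   also have "... = ?w" unfolding prod_power_distrib by (intro prod.cong) (auto simp: kernel_weight_def split: factor.split)
   finally show ?thesis .
  qed
  let ?R = "growth \<Gamma> x ^ N"
  have R: "?R > 0" by (simp add: add_pos_nonneg)
  have "cmod (phi (x + v) - phi x) <= (C * ?w / ?R) * (\<Sum>i\<in>UNIV. \<bar>v $ i\<bar>)"
  proof (rule smooth_mvt[OF schwartz_smooth[OF phi]])
   fix theta :: real and i assume theta: "0 <= theta" "theta <= 1"
   let ?y = "x + theta *\<^sub>R v"
   have thetav: "real_part_norm \<Gamma> (theta *\<^sub>R v) <= real_part_norm \<Gamma> v"
    unfolding real_part_norm_def by (rule norm_le_componentwise_cart) (use theta in \<open>auto simp: abs_mult mult_left_le_one_le\<close>)
   have "real_part_norm \<Gamma> x <= real_part_norm \<Gamma> ?y + real_part_norm \<Gamma> v"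
    using real_part_norm_triangle[of \<Gamma> ?y "- (theta *\<^sub>R v)"] thetav by (simp add: real_part_norm_uminus)
   also have "1 + (real_part_norm \<Gamma> ?y + real_part_norm \<Gamma> v) <= (1 + real_part_norm \<Gamma> ?y) * (1 + real_part_norm \<Gamma> v)"
    by (simp add: algebra_simps)
   finally have "?R <= ((1 + real_part_norm \<Gamma> ?y) * (1 + real_part_norm \<Gamma> v)) ^ N" by (intro power_mono) auto
   then have "?R * cmod (partial_deriv i phi ?y) <= ((1 + real_part_norm \<Gamma> ?y) * (1 + real_part_norm \<Gamma> v)) ^ N * cmod (partial_deriv i phi ?y)"
    by (rule mult_right_mono) simp
   also have "... = growth \<Gamma> v ^ N * (growth \<Gamma> ?y ^ N * cmod (partial_deriv i phi ?y))"
    by (simp only: power_mult_distrib mult_ac)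
   also have "... <= ?w * C"
    using rw b(2)[of ?y i] C[of i] by (intro mult_mono) (auto intro: order_trans[OF _ rw] simp: add_nonneg_nonneg)
   finally show "cmod (partial_deriv i phi ?y) <= C * ?w / ?R" using R by (simp add: pos_le_divide_eq mult.commute)
  qed
  also have "(C * ?w / ?R) * (\<Sum>i\<in>UNIV. \<bar>v $ i\<bar>) <= (C * ?w / ?R) * (\<Lambda> * (\<Sum>i\<in>UNIV. kernel_dist (\<Gamma> i) (z $ i)))"
   unfolding sum_distrib_left[of \<Lambda>] using C0 R order_trans[OF zero_le_power rw] by (intro mult_left_mono sum_mono vd) simp
  finally have "cmod (phi (x + v) - phi x) <= (C * ?w / ?R) * (\<Lambda> * (\<Sum>i\<in>UNIV. kernel_dist (\<Gamma> i) (z $ i)))" .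
  then show ?thesis unfolding phiv using R by (simp add: field_simps)
 qed
 moreover have "0 <= C * \<Lambda>" using C0 \<Lambda>(2) by simp
 ultimately show ?thesis by blast
qed

lemma freq_monomial_osc_gm:
 assumes phi: "phi \<in> schwartz \<Gamma>" and xi: "xi \<in> dual_lattice"
 shows "freq_monomial (2 * pi * of_int (-1)) js xi * osc gm (2 * pi * of_int 1) phi xi
  = osc gm (2 * pi * of_int 1) (iter_partial js phi) xi"
proof (induction js)
 case (Cons j js)
 have "osc gm (2 * pi * of_int 1) (iter_partial (j # js) phi) xi
  = - (\<i> * of_real (2 * pi * of_int 1) * of_real (xi $ j)) * osc gm (2 * pi * of_int 1) (iter_partial js phi) xi"
  unfolding iter_partial.simps by (rule osc_gm_partial_deriv[OF schwartz_iter_partial[OF phi] xi])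
 then show ?case unfolding Cons.IH[symmetric] by (simp add: freq_monomial_def)
qed (simp add: freq_monomial_def)

text \<open>
 The approximants are the transforms of the compactly supported multiples of the transform of \<open>phi\<close>.
 Multipliers commute with derivatives, so by \<open>multiplier_average\<close> each derivative of an approximant is an
 average of translates of that derivative of \<open>phi\<close>, and the kernel estimate applies to each of the
 finitely many derivatives in a seminorm.
\<close>

lemma transform_density:
 assumes phi: "phi \<in> schwartz \<Gamma>" and delta: "delta > 0"
 shows "\<exists>psi\<in>dual_test_functions. schwartz_seminorm \<Gamma> N (\<lambda>x. fourier_transpose \<Gamma> psi x + (-1) * phi x) <= delta"
proof -
 have phis: "iter_partial js phi \<in> schwartz \<Gamma>" for js by (rule schwartz_iter_partial[OF phi])
 have "\<forall>i. \<exists>W\<ge>0. \<forall>eps>0. \<exists>q p. multiplier_kernel (\<Gamma> i) i N W eps q p"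
  using multiplier_kernel_exists pos by blast
 from choice[OF this] obtain W where W: "!!i. W i >= 0" "!!i eps. eps > 0 ==> \<exists>q p. multiplier_kernel (\<Gamma> i) i N (W i) eps q p" by blast
 have "\<forall>js. \<exists>B\<ge>0. \<forall>x z. growth \<Gamma> x ^ N * cmod (iter_partial js phi (z + x) - iter_partial js phi x)
  <= B * (\<Prod>i\<in>UNIV. kernel_weight (\<Gamma> i) N (z $ i)) * (\<Sum>i\<in>UNIV. kernel_dist (\<Gamma> i) (z $ i))"
  using schwartz_translate_bound[OF phis] by blast
 from choice[OF this] obtain B where B: "!!js. B js >= 0" "!!js x z. growth \<Gamma> x ^ N * cmod (iter_partial js phi (z + x) - iter_partial js phi x)
  <= B js * (\<Prod>i\<in>UNIV. kernel_weight (\<Gamma> i) N (z $ i)) * (\<Sum>i\<in>UNIV. kernel_dist (\<Gamma> i) (z $ i))" by blast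
 define Bm where "Bm = (\<Sum>js | length js <= N. B js)"
 have Bm: "B js <= Bm" if "length js <= N" for js
  unfolding Bm_def using finite_lists_length_le[of N] that B(1) by (intro member_le_sum) auto
 have Bm0: "0 <= Bm" unfolding Bm_def using B(1) by (simp add: sum_nonneg)
 let ?v = "torus_volume \<Gamma>"
 define S where "S = (\<Sum>i\<in>UNIV. \<Prod>j\<in>UNIV - {i}. W j)"
 have S0: "0 <= S" unfolding S_def using W(1) by (simp add: sum_nonneg prod_nonneg)
 (* the admissible first moment of each factor, after the constants of the final estimate *)
 define eps where "eps = delta * ?v / (1 + Bm * S)"
 have d0: "0 < 1 + Bm * S" using Bm0 S0 by (simp add: add_pos_nonneg)
 have eps: "eps > 0" using delta d0 torus_volume_pos by (simp add: eps_def)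
 have epsb: "Bm * (eps * S) <= ?v * delta"
 proof -
  have "Bm * (eps * S) <= (1 + Bm * S) * eps" using eps by (simp add: algebra_simps)
  also have "... = ?v * delta" using d0 by (simp add: eps_def)
  finally show ?thesis .
 qed
 have "\<forall>i. \<exists>qp. multiplier_kernel (\<Gamma> i) i N (W i) eps (fst qp) (snd qp)" using W(2)[OF eps] by simp
 from choice[OF this] obtain qp where qp0: "!!i. multiplier_kernel (\<Gamma> i) i N (W i) eps (fst (qp i)) (snd (qp i))" by blast
 define q p where "q i = fst (qp i)" and "p i = snd (qp i)" for i
 have qp: "multiplier_kernel (\<Gamma> i) i N (W i) eps (q i) (p i)" for i using qp0 by (simp add: q_def p_def)
 let ?c = "2 * pi * real_of_int (-1)"
 let ?g = "osc gm (2 * pi * real_of_int 1)"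
 let ?X = "%xi::real^'n. complex_of_real (\<Prod>i\<in>UNIV. q i (xi $ i))"
 define f where "f js xi = ?X xi * ?g (iter_partial js phi) xi" for js xi
 have ft: "f js \<in> dual_test_functions" for js
 proof -
  have "smooth_fun (%x::real^'n. complex_of_real (q i (x $ i)))" for i by (rule multiplier_kernelD[OF qp])
  then have "smooth_fun ?X" unfolding of_real_prod by (intro smooth_fun_prod) auto
  then have 1: "smooth_fun (f js)" unfolding f_def by (intro smooth_fun_mult smooth_fun_osc rapid_gm phis) auto
  have "\<forall>i. \<exists>R. \<forall>u. q i u ~= 0 \<longrightarrow> \<bar>u\<bar> <= R" using multiplier_kernelD(2)[OF qp] by blast
  from choice[OF this] obtain R where R: "!!i u. q i u ~= 0 ==> \<bar>u\<bar> <= R i" by blast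
  have "bounded {xi. f js xi ~= 0}"
  proof (rule boundedI)
   fix xi assume "xi \<in> {xi. f js xi ~= 0}"
   then have "\<bar>xi $ i\<bar> <= R i" for i using R by (auto simp: f_def)
   then show "norm xi <= (\<Sum>i\<in>UNIV. R i)" by (intro order_trans[OF norm_le_l1_cart] sum_mono)
  qed
  with 1 show ?thesis by (simp add: dual_test_functions_def)
 qed
 have fr: "rapid dm (f js)" for js by (rule rapid_dm[OF dual_test_schwartz[OF ft]])
 have fm: "f js \<in> Borel" for js by (rule schwartz_measurable[OF dual_test_schwartz[OF ft]])
 define psi where "psi xi = of_real (?v powr (- 1 / 2)) * f [] xi" for xi
 have psit: "psi \<in> dual_test_functions"
  using ft[of "[]"] unfolding dual_test_functions_def psi_def
  by (auto intro!: smooth_fun_mult smooth_fun_const elim!: bounded_subset)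
 have vv: "complex_of_real (?v powr (- 1 / 2)) * of_real (?v powr (- 1 / 2)) = 1 / of_real ?v"
  using volume_powr torus_volume_pos by (simp add: field_simps)
 have Fpsi: "fourier_transpose \<Gamma> psi x = 1 / of_real ?v * osc dm ?c (f []) x" for x
  unfolding fourier_transpose_eq vv[symmetric] by (simp add: osc_def psi_def mult.assoc)
 have osc_f: "iter_partial js (osc dm ?c (f [])) = osc dm ?c (f js)" for js
 proof -
  have [measurable]: "f js \<in> Borel" "(%xi. freq_monomial ?c js xi * f [] xi) \<in> Borel"
   using fm schwartz_measurable[OF schwartz_lines_freq_monomial[OF dual_test_schwartz[OF ft]]] by auto
  have "osc dm ?c (%xi. freq_monomial ?c js xi * f [] xi) = osc dm ?c (f js)"
  proof
   fix x
   show "osc dm ?c (%xi. freq_monomial ?c js xi * f [] xi) x = osc dm ?c (f js) x"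
    unfolding osc_def
   proof (rule integral_cong_AE)
    have e: "freq_monomial ?c js xi * f [] xi = f js xi" if "xi \<in> dual_lattice" for xi
     unfolding f_def freq_monomial_osc_gm[OF phi that, symmetric] iter_partial.simps by (simp only: mult_ac)
    show "AE xi in dm. freq_monomial ?c js xi * f [] xi * cis (?c * (xi \<bullet> x)) = f js xi * cis (?c * (xi \<bullet> x))"
     using AE_dual_lattice by eventually_elim (simp only: e)
   qed measurable
  qed
  then show ?thesis using iter_partial_osc[OF fr] by simp
 qed
 have "schwartz_seminorm \<Gamma> N (%x. fourier_transpose \<Gamma> psi x + (-1) * phi x) <= delta"
 proof (rule schwartz_seminorm_le)
  fix js :: "'n list" and x assume js: "length js <= N"
  let ?h = "iter_partial js phi"
  let ?R = "growth \<Gamma> x ^ N"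
  have R: "?R > 0" by (simp add: add_pos_nonneg)
  have sm: "smooth_fun (osc dm ?c (f []))" by (rule smooth_fun_osc[OF fr]) simp
  have d: "iter_partial js (%x. fourier_transpose \<Gamma> psi x + (-1) * phi x) x = 1 / of_real ?v * osc dm ?c (f js) x + (-1) * ?h x"
   unfolding Fpsi iter_partial_add[OF smooth_fun_mult[OF smooth_fun_const sm] smooth_fun_mult[OF smooth_fun_const schwartz_smooth[OF phi]]]
    iter_partial_scale[OF sm] iter_partial_scale[OF schwartz_smooth[OF phi]] osc_f ..
  note av = multiplier_average[OF phis qp, of js x]
  have k: "integrable (group_factor (\<Gamma> i)) (p i)" "(LINT t|group_factor (\<Gamma> i). p i t) = of_real (factor_volume (\<Gamma> i))"
   "integrable (group_factor (\<Gamma> i)) (%t. cmod (p i t) * kernel_weight (\<Gamma> i) N t)"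
   "integrable (group_factor (\<Gamma> i)) (%t. cmod (p i t) * (kernel_weight (\<Gamma> i) N t * kernel_dist (\<Gamma> i) t))"
   and kW: "(LINT t|group_factor (\<Gamma> i). cmod (p i t) * kernel_weight (\<Gamma> i) N t) <= W i"
   "(LINT t|group_factor (\<Gamma> i). cmod (p i t) * (kernel_weight (\<Gamma> i) N t * kernel_dist (\<Gamma> i) t)) <= eps" for i
   by (rule multiplier_kernelD[OF qp])+
  have w0: "0 <= kernel_weight (\<Gamma> i) N t" "0 <= kernel_dist (\<Gamma> i) t" for i t
   by (simp_all add: kernel_weight_def kernel_dist_def split: factor.split)
  have "cmod ((LINT z|vprod (%i. group_factor (\<Gamma> i)). ?h (z + x) * (\<Prod>i\<in>UNIV. p i (z $ i))) - ?h x * (\<Prod>i\<in>UNIV. of_real (factor_volume (\<Gamma> i))))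
   <= (B js / ?R) * (\<Sum>i\<in>UNIV. (LINT t|group_factor (\<Gamma> i). cmod (p i t) * (kernel_weight (\<Gamma> i) N t * kernel_dist (\<Gamma> i) t))
    * (\<Prod>j\<in>UNIV - {i}. LINT t|group_factor (\<Gamma> j). cmod (p j t) * kernel_weight (\<Gamma> j) N t))"
  proof (rule G.product_kernel_estimate[OF k(1,2,3) w0(1) k(4) w0(2) av(2)[unfolded gm_def]], intro AE_I2 mult_right_mono prod_nonneg)
   fix z
   have "?R * cmod (?h (z + x) - ?h x) <= B js * (\<Prod>i\<in>UNIV. kernel_weight (\<Gamma> i) N (z $ i)) * (\<Sum>i\<in>UNIV. kernel_dist (\<Gamma> i) (z $ i))"
    by (rule B(2))
   then show "cmod (?h (z + x) - ?h x) <= B js / ?R * (\<Prod>i\<in>UNIV. kernel_weight (\<Gamma> i) N (z $ i)) * (\<Sum>i\<in>UNIV. kernel_dist (\<Gamma> i) (z $ i))"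
    using R by (simp add: pos_le_divide_eq mult.commute)
  qed simp
  also have "... <= (Bm / ?R) * (\<Sum>i\<in>UNIV. eps * (\<Prod>j\<in>UNIV - {i}. W j))"
  proof (intro mult_mono divide_right_mono Bm[OF js] sum_mono prod_mono conjI kW)
   show "0 <= (LINT t|group_factor (\<Gamma> i). cmod (p i t) * kernel_weight (\<Gamma> i) N t)" for i
    using w0 by (intro Bochner_Integration.integral_nonneg) simp
   show "0 <= (\<Sum>i\<in>UNIV. (LINT t|group_factor (\<Gamma> i). cmod (p i t) * (kernel_weight (\<Gamma> i) N t * kernel_dist (\<Gamma> i) t))
    * (\<Prod>j\<in>UNIV - {i}. LINT t|group_factor (\<Gamma> j). cmod (p j t) * kernel_weight (\<Gamma> j) N t))"
    using w0 by (intro sum_nonneg mult_nonneg_nonneg prod_nonneg Bochner_Integration.integral_nonneg) simp_all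
   show "0 <= (\<Prod>j\<in>UNIV - {i}. LINT t|group_factor (\<Gamma> j). cmod (p j t) * kernel_weight (\<Gamma> j) N t)" for i
    using w0 by (intro prod_nonneg Bochner_Integration.integral_nonneg) simp_all
  qed (use R Bm0 eps in auto)
  also have "... = Bm * (eps * S) / ?R" by (simp add: S_def sum_distrib_left sum_divide_distrib)
  also have "... <= ?v * delta / ?R" using epsb R by (intro divide_right_mono) auto
  finally have est: "cmod ((LINT z|gm. ?h (z + x) * (\<Prod>i\<in>UNIV. p i (z $ i))) - ?h x * of_real ?v) <= ?v * delta / ?R"
   by (simp only: gm_def torus_volume_def factor_volume_def of_real_prod)
  have "iter_partial js (%x. fourier_transpose \<Gamma> psi x + (-1) * phi x) x
    = ((LINT z|gm. ?h (z + x) * (\<Prod>i\<in>UNIV. p i (z $ i))) - ?h x * of_real ?v) / of_real ?v"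
   unfolding d f_def av(1) using torus_volume_pos by (simp add: diff_divide_distrib)
  then have "cmod (iter_partial js (%x. fourier_transpose \<Gamma> psi x + (-1) * phi x) x) <= ?v * delta / ?R / ?v"
   using divide_right_mono[OF est, of ?v] torus_volume_pos by (simp add: norm_divide)
  also have "... = delta / ?R" using torus_volume_pos by simp
  finally show "?R * cmod (iter_partial js (%x. fourier_transpose \<Gamma> psi x + (-1) * phi x) x) <= delta"
   using R by (simp add: pos_le_divide_eq mult.commute)
 qed
 with psit show ?thesis by blast
qed

lemma schwartz_seminorm_mono:
 assumes "phi \<in> schwartz \<Gamma>" "N <= N'"
 shows "schwartz_seminorm \<Gamma> N phi <= schwartz_seminorm \<Gamma> N' phi"
proof (rule schwartz_seminorm_le)
 fix js :: "'n list" and x assume "length js <= N"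
 have "growth \<Gamma> x ^ N * cmod (iter_partial js phi x) <= growth \<Gamma> x ^ N' * cmod (iter_partial js phi x)"
  using assms(2) by (intro mult_right_mono power_increasing) auto
 also have "... <= schwartz_seminorm \<Gamma> N' phi" using \<open>length js <= N\<close> assms by (intro schwartz_seminorm_ge) auto
 finally show "growth \<Gamma> x ^ N * cmod (iter_partial js phi x) <= schwartz_seminorm \<Gamma> N' phi" .
qed

text \<open>
 Both functionals are continuous and agree on a dense set.
\<close>

lemma tempered_eq_if_fourier_eq:
 assumes S: "S \<in> tempered_distributions \<Gamma>" and T: "T \<in> tempered_distributions \<Gamma>"
  and eq: "!!psi. psi \<in> dual_test_functions ==> fourier_dist \<Gamma> S psi = fourier_dist \<Gamma> T psi"
 shows "S = T"
proof (rule extensionalityI)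
 show "S \<in> extensional (schwartz \<Gamma>)" "T \<in> extensional (schwartz \<Gamma>)" using S T by (auto simp: tempered_distributions_def)
 fix phi assume phi: "phi \<in> schwartz \<Gamma>"
 have bd: "\<exists>C\<ge>0. \<exists>N0. \<forall>N\<ge>N0. \<forall>psi\<in>schwartz \<Gamma>. cmod (U psi) <= C * schwartz_seminorm \<Gamma> N psi" if U: "U \<in> tempered_distributions \<Gamma>" for U
 proof -
  obtain N0 C where C: "!!psi. psi \<in> schwartz \<Gamma> ==> cmod (U psi) <= C * schwartz_seminorm \<Gamma> N0 psi"
   using U unfolding tempered_distributions_def by blast
  have "cmod (U psi) <= \<bar>C\<bar> * schwartz_seminorm \<Gamma> N psi" if "psi \<in> schwartz \<Gamma>" "N >= N0" for N psi
  proof -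
   have "0 <= growth \<Gamma> 0 ^ N0 * cmod (iter_partial [] psi 0)" by simp
   also have "... <= schwartz_seminorm \<Gamma> N0 psi" by (rule schwartz_seminorm_ge[OF that(1)]) simp
   finally have "C * schwartz_seminorm \<Gamma> N0 psi <= \<bar>C\<bar> * schwartz_seminorm \<Gamma> N0 psi" by (intro mult_right_mono) auto
   also have "... <= \<bar>C\<bar> * schwartz_seminorm \<Gamma> N psi" by (intro mult_left_mono schwartz_seminorm_mono that) auto
   finally show ?thesis using C[OF that(1)] by linarith
  qed
  then show ?thesis by (intro exI[of _ "\<bar>C\<bar>"] exI[of _ N0] conjI) auto
 qed
 obtain C1 N1 where C1: "C1 >= 0" "!!N psi. N >= N1 ==> psi \<in> schwartz \<Gamma> ==> cmod (S psi) <= C1 * schwartz_seminorm \<Gamma> N psi" using bd[OF S] by blast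
 obtain C2 N2 where C2: "C2 >= 0" "!!N psi. N >= N2 ==> psi \<in> schwartz \<Gamma> ==> cmod (T psi) <= C2 * schwartz_seminorm \<Gamma> N psi" using bd[OF T] by blast
 define N where "N = max N1 N2"
 have main: "cmod (S phi - T phi) <= (C1 + C2) * delta" if delta: "delta > 0" for delta
 proof -
  obtain psi where psi: "psi \<in> dual_test_functions" "schwartz_seminorm \<Gamma> N (%x. fourier_transpose \<Gamma> psi x + (-1) * phi x) <= delta"
   using transform_density[OF phi delta] by blast
  let ?F = "fourier_transpose \<Gamma> psi"
  let ?d = "%x. ?F x + (-1) * phi x"
  have F: "?F \<in> schwartz \<Gamma>" by (rule fourier_transpose_schwartz[OF dual_test_schwartz[OF psi(1)]])
  have m: "(%x. (-1) * phi x) \<in> schwartz \<Gamma>" by (rule schwartz_scale[OF phi])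
  have d: "?d \<in> schwartz \<Gamma>" by (rule schwartz_add[OF F m])
  have lin: "U ?d = U ?F + (-1) * U phi" if U: "U \<in> tempered_distributions \<Gamma>" for U
  proof -
   have "\<forall>phi\<in>schwartz \<Gamma>. \<forall>psi\<in>schwartz \<Gamma>. U (%x. phi x + psi x) = U phi + U psi"
    using U unfolding tempered_distributions_def by blast
   from this[rule_format, OF F m] have "U ?d = U ?F + U (%x. (-1) * phi x)" .
   also have "U (%x. (-1) * phi x) = (-1) * U phi" using U phi unfolding tempered_distributions_def by blast
   finally show ?thesis .
  qed
  have "S phi - T phi = T ?d - S ?d" using eq[OF psi(1)] unfolding lin[OF S] lin[OF T] fourier_dist_def by simp
  also have "cmod ... <= cmod (T ?d) + cmod (S ?d)" by (rule norm_triangle_ineq4)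
  also have "... <= C2 * schwartz_seminorm \<Gamma> N ?d + C1 * schwartz_seminorm \<Gamma> N ?d"
   by (intro add_mono C1(2) C2(2) d) (simp_all add: N_def)
  also have "... <= C2 * delta + C1 * delta" using psi(2) C1(1) C2(1) by (intro add_mono mult_left_mono)
  finally show ?thesis by (simp add: algebra_simps)
 qed
 have "cmod (S phi - T phi) <= 0 + eta" if "eta > 0" for eta
 proof -
  have p: "0 < 1 + C1 + C2" using C1(1) C2(1) by simp
  have "cmod (S phi - T phi) <= (C1 + C2) * (eta / (1 + C1 + C2))"
   by (rule main) (use that p in simp)
  also have "... <= (1 + C1 + C2) * (eta / (1 + C1 + C2))" using that p by (intro mult_right_mono) auto
  finally show ?thesis using p by simp
 qed
 then have "cmod (S phi - T phi) <= 0" by (rule field_le_epsilon)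
 then show "S phi = T phi" by simp
qed

lemma eq_dist_of_inv_fourier:
 assumes T: "T \<in> tempered_distributions \<Gamma>" and four: "is_fourier \<Gamma> T g" and g: "integrable dm g"
 shows "T = dist_of \<Gamma> (inv_fourier g)"
proof (rule tempered_eq_if_fourier_eq[OF T])
 have "inv_fourier g \<in> tempered_functions UNIV \<Gamma>" by (rule inv_fourier_tempered(4)[OF g]) simp
 then show "dist_of \<Gamma> (inv_fourier g) \<in> tempered_distributions \<Gamma>" by (rule dist_of_tempered)
 show "fourier_dist \<Gamma> T psi = fourier_dist \<Gamma> (dist_of \<Gamma> (inv_fourier g)) psi" if "psi \<in> dual_test_functions" for psi
  using four is_fourier_inv_fourier[OF g] that by (simp add: is_fourier_def)
qed

end

section \<open>The algebra property\<close>

abbreviation weighted_square :: "real => (real ^ 'n::finite => complex) => real ^ 'n => real" where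
 "weighted_square s g xi \<equiv> (bracket xi powr s * cmod (g xi))\<^sup>2"

lemma bracket_add_le:
 fixes a b :: "real ^ 'n::finite"
 shows "bracket (a + b) <= bracket a + bracket b"
proof (rule power2_le_imp_le)
 have sq: "(bracket c)\<^sup>2 = 1 + (norm c)\<^sup>2" for c :: "real ^ 'n" by (simp add: bracket_sqrt)
 have p: "0 <= bracket c" for c :: "real ^ 'n" using bracket_ge_1[of c] by linarith
 have "(norm (a + b))\<^sup>2 <= (norm a + norm b)\<^sup>2" by (intro power_mono norm_triangle_ineq) simp
 moreover have "norm a * norm b <= bracket a * bracket b" by (intro mult_mono bracket_ge_norm p) simp
 ultimately show "(bracket (a + b))\<^sup>2 <= (bracket a + bracket b)\<^sup>2"
  unfolding power2_sum sq by linarith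
 show "0 <= bracket a + bracket b" using p[of a] p[of b] by linarith
qed

lemma bracket_powr_add_le:
 assumes "s >= 0"
 shows "bracket (a + b) powr s <= 2 powr s * (bracket a powr s + bracket b powr s)"
proof -
 have p: "0 <= bracket a" "0 <= bracket b" "0 <= bracket (a + b)"
  using bracket_ge_1[of a] bracket_ge_1[of b] bracket_ge_1[of "a + b"] by linarith+
 have "bracket (a + b) powr s <= (2 * max (bracket a) (bracket b)) powr s"
  using bracket_add_le[of a b] p assms by (intro powr_mono2) auto
 also have "... = 2 powr s * max (bracket a) (bracket b) powr s" using p by (simp add: powr_mult)
 also have "... <= 2 powr s * (bracket a powr s + bracket b powr s)"
  by (intro mult_left_mono) (auto simp: max_def)
 finally show ?thesis .
qed

lemma inverse_bracket_powr_square: "(1 / bracket xi powr s)\<^sup>2 = (1 + (norm xi)\<^sup>2) powr (- s)"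
proof -
 have "(bracket xi powr s)\<^sup>2 = (1 + (norm xi)\<^sup>2) powr s"
  unfolding bracket_def powr_powr power2_eq_square powr_add[symmetric] by simp
 then show ?thesis by (simp add: power_divide powr_minus_divide)
qed

lemma integrable_if_nn_integral_le:
 fixes f :: "'a => real"
 assumes f: "f \<in> borel_measurable M" "!!x. 0 <= f x" and le: "(\<integral>\<^sup>+x. ennreal (f x) \<partial>M) <= ennreal c" and c: "0 <= c"
 shows "integrable M f" "integral\<^sup>L M f <= c"
proof -
 show i: "integrable M f"
  by (rule integrableI_nonneg) (use assms in \<open>auto intro: le_less_trans\<close>)
 have "ennreal (integral\<^sup>L M f) <= ennreal c" using nn_integral_eq_integral[OF i] f(2) le by simp
 then show "integral\<^sup>L M f <= c" using c by simp
qed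

context lca
begin

definition convolution :: "(real ^ 'n => complex) => (real ^ 'n => complex) => real ^ 'n => complex" where
 "convolution g h xi = (LINT eta|dm. h eta * g (xi - eta))"

lemma dm_distr_diff:
 assumes "xi \<in> dual_lattice"
 shows "distr dm borel (\<lambda>eta. xi - eta) = dm"
proof -
 have "distr dm borel (%eta. xi - eta) = distr (distr dm borel uminus) borel (%eta. eta + xi)"
  by (subst distr_distr) (simp_all add: comp_def)
 also have "... = dm" using assms by (simp add: dm_reflect dm_translate dual_lattice_def)
 finally show ?thesis .
qed

lemma dm_distr_minus:
 assumes "eta \<in> dual_lattice"
 shows "distr dm borel (\<lambda>xi. xi - eta) = dm"
proof -
 have "(- eta) $ i \<in> lattice L" if "\<Gamma> i = Torus L" for i L
  using assms that lattice_uminus by (simp add: dual_lattice_def)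
 from dm_translate[OF this] show ?thesis by simp
qed

lemma nn_integral_dm_diff:
 assumes "xi \<in> dual_lattice" "f \<in> Borel"
 shows "(\<integral>\<^sup>+eta. f (xi - eta) \<partial>dm) = (\<integral>\<^sup>+eta. f eta \<partial>dm)"
 using nn_integral_distr[of "%eta. xi - eta" dm borel f] assms dm_distr_diff[OF assms(1)] by simp

lemma nn_integral_dm_minus:
 assumes "eta \<in> dual_lattice" "f \<in> Borel"
 shows "(\<integral>\<^sup>+xi. f (xi - eta) \<partial>dm) = (\<integral>\<^sup>+xi. f xi \<partial>dm)"
 using nn_integral_distr[of "%xi. xi - eta" dm borel f] assms dm_distr_minus[OF assms(1)] by simp

lemma integral_dm_minus:
 fixes f :: "real ^ 'n => 'b::{banach,second_countable_topology}"
 assumes "eta \<in> dual_lattice" "f \<in> Borel"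
 shows "(LINT xi|dm. f (xi - eta)) = (LINT xi|dm. f xi)" "integrable dm (\<lambda>xi. f (xi - eta)) \<longleftrightarrow> integrable dm f"
 using integral_distr[of "%xi. xi - eta" dm borel f] integrable_distr_eq[of "%xi. xi - eta" dm borel f] assms
  dm_distr_minus[OF assms(1)] by simp_all

text \<open>
 The variable of the inner integral may be translated by \<open>eta\<close>, because almost every \<open>eta\<close> lies in the
 dual lattice.
\<close>

lemma
 assumes g: "integrable dm g" and h: "integrable dm h"
 shows integrable_convolution: "integrable dm (convolution g h)"
  and inv_fourier_mult: "inv_fourier g x * inv_fourier h x
   = inv_fourier (\<lambda>xi. of_real (torus_volume \<Gamma> powr (- 1 / 2)) * convolution g h xi) x"
proof -
 interpret dm: sigma_finite_measure dm by (rule sigma_finite_dm)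
 interpret P: pair_sigma_finite dm dm ..
 have gm [measurable]: "g \<in> Borel" "h \<in> Borel"
  using borel_measurable_integrable[OF g] borel_measurable_integrable[OF h] by simp_all
 let ?K = "%eta xi. h eta * g (xi - eta)"
 have K0: "(%(eta, xi). ?K eta xi) \<in> borel_measurable (borel \<Otimes>\<^sub>M borel)" by measurable
 have K: "(%(eta, xi). ?K eta xi) \<in> borel_measurable (dm \<Otimes>\<^sub>M dm)"
  using K0 by (simp add: sets_pair_measure_cong[OF sets_dm sets_dm] cong: measurable_cong_sets)
 have iK: "integrable (dm \<Otimes>\<^sub>M dm) (%(eta, xi). ?K eta xi)"
 proof (rule P.Fubini_integrable)
  show "(%(eta, xi). ?K eta xi) \<in> borel_measurable (dm \<Otimes>\<^sub>M dm)" by (rule K)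
  show "AE eta in dm. integrable dm (%xi. case (eta, xi) of (eta, xi) => ?K eta xi)"
   using AE_dual_lattice
  proof eventually_elim
   case (elim eta)
   show ?case using integral_dm_minus(2)[OF elim gm(1)] g by simp
  qed
  have "integrable dm (%eta. cmod (h eta) * (LINT xi|dm. cmod (g xi)))" using h by simp
  moreover have "AE eta in dm. (LINT xi|dm. norm (case (eta, xi) of (eta, xi) => ?K eta xi)) = cmod (h eta) * (LINT xi|dm. cmod (g xi))"
   using AE_dual_lattice
  proof eventually_elim
   case (elim eta)
   have "(%xi. cmod (g xi)) \<in> Borel" by measurable
   from integral_dm_minus(1)[OF elim this] show ?case by (simp add: norm_mult)
  qed
  moreover have "(%eta. LINT xi|dm. norm (case (eta, xi) of (eta, xi) => ?K eta xi)) \<in> borel_measurable dm"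
   by (rule dm.borel_measurable_lebesgue_integral) (use measurable_compose[OF K borel_measurable_norm] in \<open>simp add: case_prod_beta\<close>)
  ultimately show "integrable dm (%eta. LINT xi|dm. norm (case (eta, xi) of (eta, xi) => ?K eta xi))"
   by (subst integrable_cong_AE) auto
 qed
 have ci: "integrable (dm \<Otimes>\<^sub>M dm) (%(eta, xi). ?K eta xi * cis (2 * pi * (xi \<bullet> x)))" for x
 proof (rule integrable_bound[OF iK])
  have "(%(eta, xi). ?K eta xi * cis (2 * pi * (xi \<bullet> x))) \<in> borel_measurable (borel \<Otimes>\<^sub>M borel)" by measurable
  then show "(%(eta, xi). ?K eta xi * cis (2 * pi * (xi \<bullet> x))) \<in> borel_measurable (dm \<Otimes>\<^sub>M dm)"
   by (simp add: sets_pair_measure_cong[OF sets_dm sets_dm] cong: measurable_cong_sets)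
 qed (simp add: case_prod_beta norm_mult)
 show "integrable dm (convolution g h)"
  unfolding convolution_def[abs_def] by (rule P.integrable_snd[OF iK])
 let ?c = "complex_of_real (torus_volume \<Gamma> powr (- 1 / 2))"
 have "osc dm (2 * pi) (convolution g h) x = (LINT xi|dm. LINT eta|dm. ?K eta xi * cis (2 * pi * (xi \<bullet> x)))"
  unfolding osc_def convolution_def by simp
 also have "... = (LINT eta|dm. LINT xi|dm. ?K eta xi * cis (2 * pi * (xi \<bullet> x)))"
  by (rule P.Fubini_integral[OF ci])
 also have "... = (LINT eta|dm. h eta * cis (2 * pi * (eta \<bullet> x)) * osc dm (2 * pi) g x)"
 proof (rule integral_cong_AE)
  show "AE eta in dm. (LINT xi|dm. ?K eta xi * cis (2 * pi * (xi \<bullet> x))) = h eta * cis (2 * pi * (eta \<bullet> x)) * osc dm (2 * pi) g x"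
   using AE_dual_lattice
  proof eventually_elim
   case (elim eta)
   have m: "(%xi. h eta * cis (2 * pi * (eta \<bullet> x)) * (g xi * cis (2 * pi * (xi \<bullet> x)))) \<in> Borel" by measurable
   have E: "?K eta xi * cis (2 * pi * (xi \<bullet> x)) = h eta * cis (2 * pi * (eta \<bullet> x)) * (g (xi - eta) * cis (2 * pi * ((xi - eta) \<bullet> x)))" for xi
   proof -
    have "cis (2 * pi * (xi \<bullet> x)) = cis (2 * pi * (eta \<bullet> x)) * cis (2 * pi * ((xi - eta) \<bullet> x))"
     by (simp add: cis_mult inner_diff_left algebra_simps)
    then show ?thesis by (simp add: mult_ac)
   qed
   have "(LINT xi|dm. ?K eta xi * cis (2 * pi * (xi \<bullet> x))) = (LINT xi|dm. h eta * cis (2 * pi * (eta \<bullet> x)) * (g xi * cis (2 * pi * (xi \<bullet> x))))"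
    unfolding E by (rule integral_dm_minus(1)[OF elim m])
   then show ?case by (simp add: osc_def)
  qed
  show "(%eta. LINT xi|dm. ?K eta xi * cis (2 * pi * (xi \<bullet> x))) \<in> borel_measurable dm"
   by (rule dm.borel_measurable_lebesgue_integral) (use ci in simp)
 qed measurable
 also have "... = osc dm (2 * pi) h x * osc dm (2 * pi) g x" by (simp add: osc_def)
 finally have o: "osc dm (2 * pi) (convolution g h) x = osc dm (2 * pi) h x * osc dm (2 * pi) g x" .
 have oc: "osc dm (2 * pi) (%xi. ?c * convolution g h xi) x = ?c * osc dm (2 * pi) (convolution g h) x"
  by (simp add: osc_def mult.assoc)
 show "inv_fourier g x * inv_fourier h x = inv_fourier (%xi. ?c * convolution g h xi) x"
  unfolding inv_fourier_def oc o by (simp only: mult_ac)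
qed

text \<open>The weight at \<open>xi\<close> is at most \<open>2 powr s\<close> times the sum of the weights at \<open>xi - eta\<close> and \<open>eta\<close>, and the
 inverse square of the weight is integrable. The Cauchy-Schwarz inequality then bounds the weighted convolution pointwise by the
 square root of a convolution of integrable functions.\<close>

lemma weighted_convolution:
 assumes s: "2 * s > real CARD('n)"
 shows "\<exists>C\<ge>0. \<forall>g h. g \<in> Borel \<longrightarrow> h \<in> Borel \<longrightarrow>
  integrable dm (\<lambda>xi. weighted_square s g xi) \<longrightarrow> integrable dm (\<lambda>xi. weighted_square s h xi) \<longrightarrow>
  integrable dm (\<lambda>xi. (bracket xi powr s * cmod (convolution g h xi))\<^sup>2) \<and>
  (LINT xi|dm. (bracket xi powr s * cmod (convolution g h xi))\<^sup>2)
   <= C * ((LINT xi|dm. weighted_square s g xi) * (LINT xi|dm. weighted_square s h xi))"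
proof -
 interpret dm: sigma_finite_measure dm by (rule sigma_finite_dm)
 interpret P: pair_sigma_finite dm dm ..
 have s0: "s >= 0" using s order_trans[OF of_nat_0_le_iff less_imp_le[OF s]] by simp
 define w where "w xi = bracket xi powr s" for xi :: "real ^ 'n"
 have w: "w xi >= 1" "w xi > 0" for xi
  using ge_one_powr_ge_zero[OF bracket_ge_1 s0, of xi] by (auto simp: w_def intro: less_le_trans[OF zero_less_one])
 have wm [measurable]: "w \<in> Borel" unfolding w_def by measurable
 have w2: "(1 / w xi)\<^sup>2 = (1 + (norm xi)\<^sup>2) powr (- s)" for xi
  unfolding w_def by (rule inverse_bracket_powr_square)
 define K where "K = (LINT xi|dm. (1 / w xi)\<^sup>2)"
 have iK: "integrable dm (%xi. (1 / w xi)\<^sup>2)" unfolding w2 by (rule integrable_dm_weight[OF s])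
 have K0: "0 <= K" unfolding K_def by simp
 have nK: "(\<integral>\<^sup>+xi. ennreal ((1 / w xi)\<^sup>2) \<partial>dm) = ennreal K"
  unfolding K_def by (rule nn_integral_eq_integral[OF iK]) simp
 define C where "C = (2 powr s)\<^sup>2 * (4 * K)"
 have C0: "0 <= C" using K0 by (simp add: C_def)
 have main: "integrable dm (%xi. (w xi * cmod (convolution g h xi))\<^sup>2) \<and>
  (LINT xi|dm. (w xi * cmod (convolution g h xi))\<^sup>2) <= C * ((LINT xi|dm. (w xi * cmod (g xi))\<^sup>2) * (LINT xi|dm. (w xi * cmod (h xi))\<^sup>2))"
  if gm [measurable]: "g \<in> Borel" and hm [measurable]: "h \<in> Borel"
   and ig: "integrable dm (%xi. (w xi * cmod (g xi))\<^sup>2)" and ih: "integrable dm (%xi. (w xi * cmod (h xi))\<^sup>2)" for g h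
 proof -
  define G where "G xi = w xi * cmod (g xi)" for xi
  define H where "H xi = w xi * cmod (h xi)" for xi
  have GH [measurable]: "G \<in> Borel" "H \<in> Borel" unfolding G_def H_def by measurable
  have GH0: "0 <= G xi" "0 <= H xi" for xi using w(2)[of xi] by (simp_all add: G_def H_def)
  define a where "a = (LINT xi|dm. (G xi)\<^sup>2)"
  define b where "b = (LINT xi|dm. (H xi)\<^sup>2)"
  have na: "(\<integral>\<^sup>+xi. ennreal ((G xi)\<^sup>2) \<partial>dm) = ennreal a" and nb: "(\<integral>\<^sup>+xi. ennreal ((H xi)\<^sup>2) \<partial>dm) = ennreal b"
   unfolding a_def b_def by (rule nn_integral_eq_integral; use ig ih in \<open>simp add: G_def H_def\<close>)+
  have ab0: "0 <= a" "0 <= b" by (simp_all add: a_def b_def)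
  have pw: "ennreal ((w xi * cmod (convolution g h xi))\<^sup>2) <= ennreal C * (\<integral>\<^sup>+eta. ennreal ((G (xi - eta))\<^sup>2 * (H eta)\<^sup>2) \<partial>dm)"
   if xi: "xi \<in> dual_lattice" for xi
  proof -
   let ?A = "%eta. 2 powr s * (1 / w eta + 1 / w (xi - eta))"
   let ?B = "%eta. G (xi - eta) * H eta"
   have A0: "0 <= ?A eta" for eta using w(2) by (simp add: less_imp_le)
   have AB: "w xi * cmod (h eta * g (xi - eta)) <= ?A eta * ?B eta" for eta
   proof -
    have "w xi <= 2 powr s * (w (xi - eta) + w eta)" using bracket_powr_add_le[OF s0, of "xi - eta" eta] by (simp add: w_def)
    then have "w xi * cmod (h eta * g (xi - eta)) <= 2 powr s * (w (xi - eta) + w eta) * cmod (h eta * g (xi - eta))"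
     by (rule mult_right_mono) simp
    also have "... = ?A eta * ?B eta"
     using w(2)[of eta] w(2)[of "xi - eta"] by (simp add: G_def H_def norm_mult field_simps)
    finally show ?thesis .
   qed
   have cn: "ennreal (cmod (convolution g h xi)) <= (\<integral>\<^sup>+eta. ennreal (cmod (h eta * g (xi - eta))) \<partial>dm)"
    unfolding convolution_def
    by (cases "integrable dm (%eta. h eta * g (xi - eta))") (auto intro: integral_norm_bound_ennreal simp: not_integrable_integral_eq)
   have "ennreal (w xi * cmod (convolution g h xi)) <= ennreal (w xi) * (\<integral>\<^sup>+eta. ennreal (cmod (h eta * g (xi - eta))) \<partial>dm)"
    using cn w(2)[of xi] by (simp add: ennreal_mult less_imp_le mult_left_mono)
   also have "... = (\<integral>\<^sup>+eta. ennreal (w xi * cmod (h eta * g (xi - eta))) \<partial>dm)"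
    using w(2)[of xi] by (subst nn_integral_cmult[symmetric]) (auto simp: ennreal_mult less_imp_le)
   also have "... <= (\<integral>\<^sup>+eta. ennreal (?A eta) * ennreal (?B eta) \<partial>dm)"
    using AB A0 GH0 by (intro nn_integral_mono) (simp flip: ennreal_mult)
   finally have 1: "ennreal (w xi * cmod (convolution g h xi)) <= (\<integral>\<^sup>+eta. ennreal (?A eta) * ennreal (?B eta) \<partial>dm)" .
   have "ennreal ((w xi * cmod (convolution g h xi))\<^sup>2) = (ennreal (w xi * cmod (convolution g h xi)))\<^sup>2"
    using w(2)[of xi] by (simp add: ennreal_power)
   also have "... <= (\<integral>\<^sup>+eta. ennreal (?A eta) * ennreal (?B eta) \<partial>dm)\<^sup>2" by (rule power_mono[OF 1]) simp
   also have "... <= (\<integral>\<^sup>+eta. (ennreal (?A eta))\<^sup>2 \<partial>dm) * (\<integral>\<^sup>+eta. (ennreal (?B eta))\<^sup>2 \<partial>dm)"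
    by (rule Cauchy_Schwarz_nn_integral) measurable
   also have "(\<integral>\<^sup>+eta. (ennreal (?A eta))\<^sup>2 \<partial>dm) <= (\<integral>\<^sup>+eta. ennreal ((2 powr s)\<^sup>2 * 2) * (ennreal ((1 / w eta)\<^sup>2) + ennreal ((1 / w (xi - eta))\<^sup>2)) \<partial>dm)"
   proof (rule nn_integral_mono)
    fix eta
    have "(p + q)\<^sup>2 <= 2 * (p\<^sup>2 + q\<^sup>2)" for p q :: real
     using zero_le_power2[of "p - q"] by (simp add: power2_eq_square algebra_simps)
    from this[of "1 / w eta" "1 / w (xi - eta)"] have "(?A eta)\<^sup>2 <= (2 powr s)\<^sup>2 * 2 * ((1 / w eta)\<^sup>2 + (1 / w (xi - eta))\<^sup>2)"
     unfolding power_mult_distrib mult.assoc by (intro mult_left_mono) auto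
    then show "(ennreal (?A eta))\<^sup>2 <= ennreal ((2 powr s)\<^sup>2 * 2) * (ennreal ((1 / w eta)\<^sup>2) + ennreal ((1 / w (xi - eta))\<^sup>2))"
     using A0[of eta] by (simp only: ennreal_power ennreal_mult[symmetric] ennreal_plus[symmetric] zero_le_power2 add_nonneg_nonneg mult_nonneg_nonneg zero_le_numeral ennreal_leI)
   qed
   also have "... = ennreal C"
   proof -
    have "(%\<zeta>. ennreal ((1 / w \<zeta>)\<^sup>2)) \<in> Borel" by measurable
    note t = nn_integral_dm_diff[OF xi this]
    have "(\<integral>\<^sup>+eta. ennreal ((2 powr s)\<^sup>2 * 2) * (ennreal ((1 / w eta)\<^sup>2) + ennreal ((1 / w (xi - eta))\<^sup>2)) \<partial>dm)
     = ennreal ((2 powr s)\<^sup>2 * 2) * (ennreal K + ennreal K)"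
     unfolding nK[symmetric] by (subst nn_integral_cmult, measurable, subst nn_integral_add, measurable) (simp only: t)
    also have "... = ennreal C" using K0 by (simp add: C_def ennreal_mult[symmetric] ennreal_plus[symmetric] del: ennreal_plus)
    finally show ?thesis .
   qed
   also have "(\<integral>\<^sup>+eta. (ennreal (?B eta))\<^sup>2 \<partial>dm) = (\<integral>\<^sup>+eta. ennreal ((G (xi - eta))\<^sup>2 * (H eta)\<^sup>2) \<partial>dm)"
    using GH0 by (simp add: ennreal_power power_mult_distrib)
   finally show ?thesis by (simp add: mult_right_mono)
  qed
  have cm [measurable]: "convolution g h \<in> Borel"
  proof -
   have "(%(xi, eta). h eta * g (xi - eta)) \<in> borel_measurable (borel \<Otimes>\<^sub>M borel)" by measurable
   then have "(%(xi, eta). h eta * g (xi - eta)) \<in> borel_measurable (borel \<Otimes>\<^sub>M dm)"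
    by (simp add: sets_pair_measure_cong[OF refl sets_dm] cong: measurable_cong_sets)
   then show ?thesis unfolding convolution_def[abs_def] by (rule dm.borel_measurable_lebesgue_integral)
  qed
  have pm: "(%(xi, eta). ennreal ((G (xi - eta))\<^sup>2 * (H eta)\<^sup>2)) \<in> borel_measurable (dm \<Otimes>\<^sub>M dm)"
  proof -
   have "(%(xi, eta). ennreal ((G (xi - eta))\<^sup>2 * (H eta)\<^sup>2)) \<in> borel_measurable (borel \<Otimes>\<^sub>M borel)" by measurable
   then show ?thesis by (simp add: sets_pair_measure_cong[OF sets_dm sets_dm] cong: measurable_cong_sets)
  qed
  have "(\<integral>\<^sup>+xi. ennreal ((w xi * cmod (convolution g h xi))\<^sup>2) \<partial>dm)
    <= (\<integral>\<^sup>+xi. ennreal C * (\<integral>\<^sup>+eta. ennreal ((G (xi - eta))\<^sup>2 * (H eta)\<^sup>2) \<partial>dm) \<partial>dm)"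
   by (rule nn_integral_mono_AE, rule AE_mp[OF AE_dual_lattice AE_I2]) (use pw in blast)
  also have "... = ennreal C * (\<integral>\<^sup>+xi. \<integral>\<^sup>+eta. ennreal ((G (xi - eta))\<^sup>2 * (H eta)\<^sup>2) \<partial>dm \<partial>dm)"
   by (rule nn_integral_cmult) (use dm.borel_measurable_nn_integral_fst[OF pm] in simp)
  also have "(\<integral>\<^sup>+xi. \<integral>\<^sup>+eta. ennreal ((G (xi - eta))\<^sup>2 * (H eta)\<^sup>2) \<partial>dm \<partial>dm) = (\<integral>\<^sup>+eta. \<integral>\<^sup>+xi. ennreal ((G (xi - eta))\<^sup>2 * (H eta)\<^sup>2) \<partial>dm \<partial>dm)"
   using P.Fubini[OF pm] by simp
  also have "... = (\<integral>\<^sup>+eta. ennreal a * ennreal ((H eta)\<^sup>2) \<partial>dm)"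
  proof (rule nn_integral_cong_AE)
   show "AE eta in dm. (\<integral>\<^sup>+xi. ennreal ((G (xi - eta))\<^sup>2 * (H eta)\<^sup>2) \<partial>dm) = ennreal a * ennreal ((H eta)\<^sup>2)"
    using AE_dual_lattice
   proof eventually_elim
    case (elim eta)
    have m: "(%\<zeta>. ennreal ((G \<zeta>)\<^sup>2)) \<in> Borel" by measurable
    have "(\<integral>\<^sup>+xi. ennreal ((G (xi - eta))\<^sup>2 * (H eta)\<^sup>2) \<partial>dm) = (\<integral>\<^sup>+xi. ennreal ((G (xi - eta))\<^sup>2) * ennreal ((H eta)\<^sup>2) \<partial>dm)"
     by (simp add: ennreal_mult)
    also have "... = (\<integral>\<^sup>+xi. ennreal ((G (xi - eta))\<^sup>2) \<partial>dm) * ennreal ((H eta)\<^sup>2)" by (rule nn_integral_multc) measurable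
    finally show ?case unfolding nn_integral_dm_minus[OF elim m] na .
   qed
  qed
  also have "... = ennreal a * ennreal b" unfolding nb[symmetric] by (rule nn_integral_cmult) measurable
  finally have "(\<integral>\<^sup>+xi. ennreal ((w xi * cmod (convolution g h xi))\<^sup>2) \<partial>dm) <= ennreal (C * (a * b))"
   using C0 ab0 by (simp add: ennreal_mult)
  from integrable_if_nn_integral_le[OF _ _ this] show ?thesis
   using C0 ab0 unfolding a_def b_def G_def H_def by simp
 qed
 show ?thesis
  unfolding w_def[symmetric] using main C0 by (intro exI[of _ C]) blast
qed

text \<open>
 The inverse square of the weight is integrable, so this is the arithmetic-geometric mean inequality.
\<close>

lemma integrable_if_weighted_square_integrable:
 fixes g :: "real ^ 'n => complex"
 assumes s: "2 * s > real CARD('n)" and g [measurable]: "g \<in> Borel"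
  and i: "integrable dm (\<lambda>xi. weighted_square s g xi)"
 shows "integrable dm g"
proof (rule integrable_bound)
 show "integrable dm (%xi. (1 + (norm xi)\<^sup>2) powr (- s) + weighted_square s g xi)"
  by (intro Bochner_Integration.integrable_add i integrable_dm_weight s)
 have "cmod (g xi) <= (1 + (norm xi)\<^sup>2) powr (- s) + weighted_square s g xi" for xi
 proof -
  have w: "bracket xi powr s > 0" using bracket_ge_1[of xi] by simp
  have "2 * (1 / bracket xi powr s) * (bracket xi powr s * cmod (g xi)) <= (1 / bracket xi powr s)\<^sup>2 + weighted_square s g xi"
   by (rule sum_squares_bound)
  moreover have "2 * (1 / bracket xi powr s) * (bracket xi powr s * cmod (g xi)) = 2 * cmod (g xi)" using w by simp
  ultimately show ?thesis unfolding inverse_bracket_powr_square[symmetric] using norm_ge_zero[of "g xi"] by linarith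
 qed
 then show "AE xi in dm. norm (g xi) <= norm ((1 + (norm xi)\<^sup>2) powr (- s) + weighted_square s g xi)"
  by (intro AE_I2 order_trans[OF _ abs_ge_self]) simp
qed measurable

lemma H_space_fourier:
 assumes s: "2 * s > real CARD('n)" and T: "T \<in> H_space s F \<Gamma>"
 shows "integrable dm (fourier_fun \<Gamma> T)" "T = dist_of \<Gamma> (inv_fourier (fourier_fun \<Gamma> T))"
  "integrable dm (\<lambda>xi. (bracket xi powr s * cmod (fourier_fun \<Gamma> T xi))\<^sup>2)"
proof -
 note T' = T[unfolded H_space_def]
 have four: "is_fourier \<Gamma> T (fourier_fun \<Gamma> T)" by (rule weighted_space_fourier[OF T'])
 show i: "integrable dm (%xi. (bracket xi powr s * cmod (fourier_fun \<Gamma> T xi))\<^sup>2)" using T' by (simp add: weighted_space_def)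
 show 1: "integrable dm (fourier_fun \<Gamma> T)"
  by (rule integrable_if_weighted_square_integrable[OF s is_fourier_measurable[OF four] i])
 show "T = dist_of \<Gamma> (inv_fourier (fourier_fun \<Gamma> T))"
  by (rule eq_dist_of_inv_fourier[OF _ four 1]) (use T' in \<open>simp add: weighted_space_def dist_over_def\<close>)
qed

text \<open>
 For real scalars the inverse transform is real only almost everywhere; its real part represents the
 same distribution.
\<close>

lemma H_space_functions:
 assumes F: "F = \<real> \<or> F = UNIV" and s: "2 * s > real CARD('n)"
 shows "H_space s F \<Gamma> \<subseteq> dist_of \<Gamma> ` tempered_functions F \<Gamma>"
proof
 fix T assume T: "T \<in> H_space s F \<Gamma>"
 let ?u = "inv_fourier (fourier_fun \<Gamma> T)"
 note four = H_space_fourier[OF s T]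
 have u: "?u \<in> tempered_functions UNIV \<Gamma>" by (rule inv_fourier_tempered(4)[OF four(1)]) simp
 then have um [measurable]: "?u \<in> Borel" by (simp add: tempered_functions_iff)
 show "T \<in> dist_of \<Gamma> ` tempered_functions F \<Gamma>"
 proof (cases "F = UNIV")
  case True
  then show ?thesis using u four(2) by blast
 next
  case False
  then have R: "F = \<real>" using F by blast
  let ?c = "%x. cnj (?u x)" and ?r = "%x. complex_of_real (Re (?u x))"
  have m: "?r \<in> Borel" by measurable
  have cm: "?c \<in> Borel"
   by (rule measurable_compose[OF um]) (intro borel_measurable_continuous_onI continuous_intros)
  obtain N where N: "moderate ?u N" and per: "periodic_on \<Gamma> ?u" using u by (auto simp: tempered_functions_iff)
  have mr: "moderate v N" if "v \<in> Borel" "!!x. cmod (v x) <= cmod (?u x)" for v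
   unfolding moderate_def
  proof (intro conjI that(1))
   show "integrable gm (%x. cmod (v x) / growth \<Gamma> x ^ N)"
   proof (rule integrable_bound)
    show "integrable gm (%x. cmod (?u x) / growth \<Gamma> x ^ N)" using N by (simp add: moderate_def)
    show "(%x. cmod (v x) / growth \<Gamma> x ^ N) \<in> borel_measurable gm"
     using that(1) real_part_norm_measurable by measurable
    show "AE x in gm. norm (cmod (v x) / growth \<Gamma> x ^ N) <= norm (cmod (?u x) / growth \<Gamma> x ^ N)"
     using that(2) by (intro AE_I2) (simp add: divide_right_mono)
   qed
  qed
  have c: "?c \<in> tempered_functions UNIV \<Gamma>"
   using mr[of ?c] cm per by (auto simp: tempered_functions_iff periodic_on_def)
  have r: "?r \<in> tempered_functions F \<Gamma>"
   using mr[OF m] m per abs_Re_le_cmod by (auto simp: tempered_functions_iff periodic_on_def R)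
  have "conj_dist \<Gamma> T = T" using T R by (simp add: H_space_def weighted_space_def dist_over_def)
  then have "dist_of \<Gamma> ?c = dist_of \<Gamma> ?u" using four(2) conj_dist_of[OF um] by metis
  from dist_of_inj[OF c u this] have "AE x in gm. ?u x = ?r x"
   by eventually_elim (simp add: complex_eq_iff)
  from dist_of_cong_AE[OF um m this] have "T = dist_of \<Gamma> ?r" using four(2) by metis
  then show ?thesis using r by blast
 qed
qed

lemma H_space_algebra:
 assumes F: "F = \<real> \<or> F = UNIV" and s: "2 * s > real CARD('n)"
 shows "pointwise_algebra F \<Gamma> (H_space s F \<Gamma>) (H_norm s \<Gamma>)"
proof -
 obtain C where C: "C >= 0" "!!g h. [|g \<in> Borel; h \<in> Borel;
  integrable dm (%xi. weighted_square s g xi); integrable dm (%xi. weighted_square s h xi)|] ==>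
  integrable dm (%xi. (bracket xi powr s * cmod (convolution g h xi))\<^sup>2) \<and>
  (LINT xi|dm. (bracket xi powr s * cmod (convolution g h xi))\<^sup>2)
   <= C * ((LINT xi|dm. weighted_square s g xi) * (LINT xi|dm. weighted_square s h xi))"
  using weighted_convolution[OF s] by blast
 let ?v = "torus_volume \<Gamma> powr (- 1 / 2)"
 have wm: "(%xi::real^'n. bracket xi powr s) \<in> Borel" by measurable
 have "(%x. u x * v x) \<in> tempered_functions F \<Gamma> \<and> dist_of \<Gamma> (%x. u x * v x) \<in> H_space s F \<Gamma> \<and>
   H_norm s \<Gamma> (dist_of \<Gamma> (%x. u x * v x)) <= (?v * sqrt C) * H_norm s \<Gamma> (dist_of \<Gamma> u) * H_norm s \<Gamma> (dist_of \<Gamma> v)"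
  if u: "u \<in> tempered_functions F \<Gamma>" and v: "v \<in> tempered_functions F \<Gamma>"
   and uH: "dist_of \<Gamma> u \<in> H_space s F \<Gamma>" and vH: "dist_of \<Gamma> v \<in> H_space s F \<Gamma>" for u v
 proof -
  let ?g = "fourier_fun \<Gamma> (dist_of \<Gamma> u)" and ?h = "fourier_fun \<Gamma> (dist_of \<Gamma> v)"
  note fg = H_space_fourier[OF s uH] and fh = H_space_fourier[OF s vH]
  have ae: "AE x in gm. y x = inv_fourier (fourier_fun \<Gamma> (dist_of \<Gamma> y)) x" "integrable dm (fourier_fun \<Gamma> (dist_of \<Gamma> y))"
   if y: "y \<in> tempered_functions F \<Gamma>" "dist_of \<Gamma> y \<in> H_space s F \<Gamma>" for y
  proof -
   note f = H_space_fourier[OF s y(2)]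
   show "integrable dm (fourier_fun \<Gamma> (dist_of \<Gamma> y))" by (rule f(1))
   have "inv_fourier (fourier_fun \<Gamma> (dist_of \<Gamma> y)) \<in> tempered_functions UNIV \<Gamma>"
    by (rule inv_fourier_tempered(4)[OF f(1)]) simp
   from dist_of_inj[OF y(1) this f(2)] show "AE x in gm. y x = inv_fourier (fourier_fun \<Gamma> (dist_of \<Gamma> y)) x" .
  qed
  have um [measurable]: "u \<in> Borel" "v \<in> Borel" using u v by (auto simp: tempered_functions_iff)
  have hm: "?g \<in> Borel" "?h \<in> Borel"
   using borel_measurable_integrable[OF fg(1)] borel_measurable_integrable[OF fh(1)] by simp_all
  let ?k = "%xi. of_real ?v * convolution ?g ?h xi"
  have ki: "integrable dm ?k" using integrable_convolution[OF fg(1) fh(1)] by simp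
  have pm: "(%x. u x * v x) \<in> Borel" by measurable
  have aek: "AE x in gm. u x * v x = inv_fourier ?k x"
   using ae(1)[OF u uH] ae(1)[OF v vH] by eventually_elim (simp only: inv_fourier_mult[OF fg(1) fh(1)])
  have d: "dist_of \<Gamma> (%x. u x * v x) = dist_of \<Gamma> (inv_fourier ?k)"
   by (rule dist_of_cong_AE[OF pm inv_fourier_tempered(1)[OF ki] aek])
  have uv: "(%x. u x * v x) \<in> tempered_functions F \<Gamma>"
  proof -
   have "u x * v x \<in> F" for x
   proof -
    have "u x \<in> F" "v x \<in> F" using u v by (auto simp: tempered_functions_iff)
    then show ?thesis using F by (auto intro: Reals_mult)
   qed
   moreover have "periodic_on \<Gamma> (%x. u x * v x)" using u v by (simp add: tempered_functions_iff periodic_on_def)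
   moreover have "\<exists>N. moderate (%x. u x * v x) N"
   proof -
    obtain N where N: "moderate u N" using u by (auto simp: tempered_functions_iff)
    obtain B where B: "!!x. cmod (inv_fourier ?h x) <= B" using inv_fourier_tempered(3)[OF fh(1)] by blast
    have B0: "0 <= B" using B norm_ge_zero order_trans by blast
    have "integrable gm (%x. cmod (u x * v x) / growth \<Gamma> x ^ N)"
    proof (rule integrable_bound)
     show "integrable gm (%x. B * (cmod (u x) / growth \<Gamma> x ^ N))"
      by (rule integrable_mult_right) (use N in \<open>simp add: moderate_def\<close>)
     show "(%x. cmod (u x * v x) / growth \<Gamma> x ^ N) \<in> borel_measurable gm"
      using real_part_norm_measurable by measurable
     show "AE x in gm. norm (cmod (u x * v x) / growth \<Gamma> x ^ N) <= norm (B * (cmod (u x) / growth \<Gamma> x ^ N))"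
      using ae(1)[OF v vH]
     proof eventually_elim
      case (elim x)
      have "cmod (v x) <= B" using B[of x] elim by simp
      from mult_left_mono[OF this, of "cmod (u x)"] have "cmod (u x) * cmod (v x) <= B * cmod (u x)"
       by (simp add: mult.commute)
      then show ?case using B0 by (simp add: norm_mult divide_right_mono)
     qed
    qed
    then show ?thesis unfolding moderate_def using pm by blast
   qed
   ultimately show ?thesis using pm by (auto simp: tempered_functions_iff)
  qed
  have four: "is_fourier \<Gamma> (dist_of \<Gamma> (%x. u x * v x)) ?k" unfolding d by (rule is_fourier_inv_fourier[OF ki])
  note c = C(2)[OF hm fg(3) fh(3)]
  have sq: "(bracket xi powr s * cmod (?k xi))\<^sup>2 = ?v\<^sup>2 * (bracket xi powr s * cmod (convolution ?g ?h xi))\<^sup>2" for xi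
   by (simp add: norm_mult power_mult_distrib)
  have "integrable dm (%xi. (bracket xi powr s * cmod (?k xi))\<^sup>2)" unfolding sq using c by simp
  then have mem: "dist_of \<Gamma> (%x. u x * v x) \<in> H_space s F \<Gamma>"
   unfolding H_space_def weighted_space_iff(1)[OF four wm] using dist_of_over[OF uv] by blast
  have "H_norm s \<Gamma> (dist_of \<Gamma> (%x. u x * v x)) = sqrt (?v\<^sup>2 * (LINT xi|dm. (bracket xi powr s * cmod (convolution ?g ?h xi))\<^sup>2))"
   unfolding H_norm_def weighted_space_iff(2)[OF four wm] sq by simp
  also have "... <= sqrt (?v\<^sup>2 * (C * ((LINT xi|dm. (bracket xi powr s * cmod (?g xi))\<^sup>2) * (LINT xi|dm. (bracket xi powr s * cmod (?h xi))\<^sup>2))))"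
   using c by (intro real_sqrt_le_mono mult_left_mono) auto
  also have "... = (?v * sqrt C) * H_norm s \<Gamma> (dist_of \<Gamma> u) * H_norm s \<Gamma> (dist_of \<Gamma> v)"
   by (simp add: H_norm_def weighted_norm_def real_sqrt_mult mult.assoc)
  finally show ?thesis using uv mem by blast
 qed
 then show ?thesis unfolding pointwise_algebra_def using H_space_functions[OF F s] by blast
qed

end

section \<open>The comparison of the two scales of spaces\<close>

context lca_ord
begin

lemma X_space_algebra:
 assumes F: "F = \<real> \<or> F = UNIV" and s: "s > real CARD('n::{finite,linorder}) / 2"
  and R: "real_coords \<Gamma> = {} \<or> real_coords \<Gamma> = {first_index}"
 shows "pointwise_algebra F \<Gamma> (X_space s F \<Gamma>) (X_norm s \<Gamma>)"
proof -
 have s2: "2 * s > real CARD('n::{finite,linorder})" using s by simp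
 obtain C where C: "C > 0" "AE xi in dm. bracket xi <= C * mu xi" using bracket_le_mu[OF R] by blast
 note eq = norm_weight_comparison(1)[OF C(2,1), of s F]
 note le = norm_weight_comparison(2,3)[OF C(2,1), of _ s F]
 have alg: "pointwise_algebra F \<Gamma> (H_space s F \<Gamma>) (H_norm s \<Gamma>)" by (rule H_space_algebra[OF F s2])
 obtain K where K: "!!u v. [|u \<in> tempered_functions F \<Gamma>; v \<in> tempered_functions F \<Gamma>; dist_of \<Gamma> u \<in> H_space s F \<Gamma>; dist_of \<Gamma> v \<in> H_space s F \<Gamma>|]
   ==> (%x. u x * v x) \<in> tempered_functions F \<Gamma> \<and> dist_of \<Gamma> (%x. u x * v x) \<in> H_space s F \<Gamma> \<and>
    H_norm s \<Gamma> (dist_of \<Gamma> (%x. u x * v x)) <= K * H_norm s \<Gamma> (dist_of \<Gamma> u) * H_norm s \<Gamma> (dist_of \<Gamma> v)"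
  using alg unfolding pointwise_algebra_def by blast
 have H0: "0 <= H_norm s \<Gamma> T" for T by (simp add: H_norm_def weighted_norm_def integral_nonneg_AE)
 have HX: "H_norm s \<Gamma> T <= C * X_norm s \<Gamma> T" if "T \<in> X_space s F \<Gamma>" for T
  using le(1)[OF that] C(1) by (simp add: field_simps)
 have "(%x. u x * v x) \<in> tempered_functions F \<Gamma> \<and> dist_of \<Gamma> (%x. u x * v x) \<in> X_space s F \<Gamma> \<and>
   X_norm s \<Gamma> (dist_of \<Gamma> (%x. u x * v x)) <= (2 * \<bar>K\<bar> * C * C) * X_norm s \<Gamma> (dist_of \<Gamma> u) * X_norm s \<Gamma> (dist_of \<Gamma> v)"
  if u: "u \<in> tempered_functions F \<Gamma>" "v \<in> tempered_functions F \<Gamma>" "dist_of \<Gamma> u \<in> X_space s F \<Gamma>" "dist_of \<Gamma> v \<in> X_space s F \<Gamma>" for u v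
 proof -
  note k = K[OF u(1,2) u(3,4)[unfolded eq]]
  let ?T = "dist_of \<Gamma> (%x. u x * v x)"
  have X: "?T \<in> X_space s F \<Gamma>" using k eq by simp
  have "X_norm s \<Gamma> ?T <= 2 * H_norm s \<Gamma> ?T" by (rule le(2)[OF X])
  also have "... <= 2 * (\<bar>K\<bar> * H_norm s \<Gamma> (dist_of \<Gamma> u) * H_norm s \<Gamma> (dist_of \<Gamma> v))"
   using k H0 by (intro mult_left_mono order_trans[OF conjunct2[OF conjunct2[OF k]]] mult_right_mono) auto
  also have "... <= 2 * (\<bar>K\<bar> * (C * X_norm s \<Gamma> (dist_of \<Gamma> u)) * (C * X_norm s \<Gamma> (dist_of \<Gamma> v)))"
   using HX[OF u(3)] HX[OF u(4)] H0 by (intro mult_left_mono mult_mono mult_nonneg_nonneg order_trans[OF H0 HX[OF u(3)]]) auto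
  finally show ?thesis using k X by (simp add: mult_ac)
 qed
 then show ?thesis unfolding pointwise_algebra_def using alg[unfolded pointwise_algebra_def] eq by blast
qed

end

theorem lemma2p2:
  fixes \<Gamma> :: "'n::{finite,linorder} \<Rightarrow> factor" and s :: real and F :: "complex set"
  assumes s: "s \<ge> 0"
    and F: "F = \<real> \<or> F = UNIV"
    and \<Gamma>: "\<And>i L. \<Gamma> i = Torus L \<Longrightarrow> L > 0"
  shows
    "(real_coords \<Gamma> = {} \<or> real_coords \<Gamma> = {first_index} \<longrightarrow>
        X_space s F \<Gamma> = H_space s F \<Gamma> \<and>
        (\<exists>c>0. \<exists>C>0. \<forall>f\<in>X_space s F \<Gamma>.
           c * H_norm s \<Gamma> f \<le> X_norm s \<Gamma> f \<and> X_norm s \<Gamma> f \<le> C * H_norm s \<Gamma> f) \<and>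
        (s > real CARD('n) / 2 \<longrightarrow> pointwise_algebra F \<Gamma> (X_space s F \<Gamma>) (X_norm s \<Gamma>)))
     \<and>
     (first_index \<in> real_coords \<Gamma> \<and> card (real_coords \<Gamma>) \<ge> 2 \<longrightarrow>
        (\<forall>Q :: real ^ ('k::{finite,linorder}) ^ ('k::{finite,linorder}).
           CARD('k) = card (real_coords \<Gamma>) \<and> orthogonal_matrix Q \<and>
           \<bar>(Q *v axis first_index 1) \<bullet> axis first_index 1\<bar> < 1 \<longrightarrow>
           (\<exists>u\<in>tempered_functions F \<Gamma>.
              dist_of \<Gamma> u \<in> X_space s F \<Gamma> - L2_space F \<Gamma> \<and>
              dist_of \<Gamma> (u \<circ> act_real \<Gamma> Q) \<notin> X_space s F \<Gamma>)) \<and>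
        H_space s F \<Gamma> \<subset> X_space s F \<Gamma>)
     \<and>
     (first_index \<notin> real_coords \<Gamma> \<and> real_coords \<Gamma> \<noteq> {} \<longrightarrow>
        H_space s F \<Gamma> \<subset> X_space s F \<Gamma> \<and>
        (\<exists>c>0. \<exists>C>0. \<forall>f\<in>X_space s F \<Gamma>.
           integrable (dual_measure \<Gamma>)
             (\<lambda>\<xi>. (norm \<xi>)\<^sup>2 * bracket \<xi> powr (2 * (s - 1)) * (cmod (fourier_fun \<Gamma> f \<xi>))\<^sup>2) \<and>
           c * (LINT \<xi>|dual_measure \<Gamma>.
                  (norm \<xi>)\<^sup>2 * bracket \<xi> powr (2 * (s - 1)) * (cmod (fourier_fun \<Gamma> f \<xi>))\<^sup>2)
             \<le> (X_norm s \<Gamma> f)\<^sup>2 \<and>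
           (X_norm s \<Gamma> f)\<^sup>2
             \<le> C * (LINT \<xi>|dual_measure \<Gamma>.
                  (norm \<xi>)\<^sup>2 * bracket \<xi> powr (2 * (s - 1)) * (cmod (fourier_fun \<Gamma> f \<xi>))\<^sup>2)))"
proof -
 interpret lca_ord \<Gamma> by unfold_locales (rule \<Gamma>)
 have 1: "X_space s F \<Gamma> = H_space s F \<Gamma> \<and>
    (\<exists>c>0. \<exists>C>0. \<forall>f\<in>X_space s F \<Gamma>.
     c * H_norm s \<Gamma> f <= X_norm s \<Gamma> f \<and> X_norm s \<Gamma> f <= C * H_norm s \<Gamma> f) \<and>
    (s > real CARD('n) / 2 \<longrightarrow> pointwise_algebra F \<Gamma> (X_space s F \<Gamma>) (X_norm s \<Gamma>))"
  if R: "real_coords \<Gamma> = {} \<or> real_coords \<Gamma> = {first_index}"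
 proof -
  obtain C where C: "C > 0" "AE xi in dm. bracket xi <= C * mu xi" using bracket_le_mu[OF R] by blast
  note cmp = norm_weight_comparison[OF C(2,1)]
  have "\<exists>c>0. \<exists>C>0. \<forall>f\<in>X_space s F \<Gamma>. c * H_norm s \<Gamma> f <= X_norm s \<Gamma> f \<and> X_norm s \<Gamma> f <= C * H_norm s \<Gamma> f"
   by (rule exI[of _ "1 / C"], rule conjI, use C(1) in simp, rule exI[of _ 2]) (use cmp(2,3) in auto)
  then show ?thesis using cmp(1) X_space_algebra[OF F _ R] by blast
 qed
 have 2: "H_space s F \<Gamma> \<subset> X_space s F \<Gamma>" if "card (real_coords \<Gamma>) >= 2"
 proof -
  have "\<not> real_coords \<Gamma> \<subseteq> {first_index}"
  proof
   assume "real_coords \<Gamma> \<subseteq> {first_index}"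
   then have "card (real_coords \<Gamma>) <= card {first_index :: 'n}" by (rule card_mono[rotated]) simp
   then show False using that by simp
  qed
  then show ?thesis using H_space_psubset_X_space[OF F s] by blast
 qed
 have 3: "H_space s F \<Gamma> \<subset> X_space s F \<Gamma>" if "first_index \<notin> real_coords \<Gamma>" "real_coords \<Gamma> ~= {}"
  using H_space_psubset_X_space[OF F s] that by blast
 show ?thesis
  by (intro conjI impI allI 1 2 3 rotation_example[OF F s] X_norm_homogeneous) auto
qed

end
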